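(* Let $d\ge2$, $\gamma>0$, and $0\le F^\circ\in L^1(\mathbb T^d\times\mathbb S^{d-1})$ with $$\int_{\mathbb T^d\times\mathbb S^{d-1}}F^\circ|\log F^\circ|\,dx\,d\omega<\infty.$$ Then there exists a nonnegative mild solution $F\in C([0,\infty);L^1(\mathbb T^d\times\mathbb S^{d-1}))$ of $$\partial_t F+\gamma\,\omega\cdot\nabla_x F=\rho_F M_{J_F}-F,\qquad F(0)=F^\circ,$$ whose total mass $\int F(t)\,dx\,d\omega$ is constant in time, and there exist $c,C>0$ such that for all $t\ge0$ $$\int_{\mathbb T^d\times\mathbb S^{d-1}}F(t,x,\omega)|\log F(t,x,\omega)|\,dx\,d\omega\le C(1+e^{ct}).$$
   Context: $\mathbb T^d$ flat torus, $\mathbb S^{d-1}$ unit sphere with surface measure $d\omega$. $\rho_F=\int_{\mathbb S^{d-1}}F\,d\omega$, $J_F=\int_{\mathbb S^{d-1}}\omega F\,d\omega$, $M_J(\omega)=e^{\omega\cdot J}/Z(J)$ with $Z(J)=\int_{\mathbb S^{d-1}}e^{\omega\cdot J}d\omega$. A mild solution is a function $F$ with $\rho_FM_{J_F}\in L^\infty_{loc}([0,\infty);L^1)$ satisfying for all $t\ge0$, a.e. $(x,\omega)$: $F(t,x,\omega)=e^{-t}F^\circ(x-\gamma\omega t,\omega)+\int_0^te^{s-t}(\rho_FM_{J_F})(s,x-\gamma\omega(t-s),\omega)\,ds$. *)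

theory Defs
  imports "HOL-Analysis.Analysis"
begin

text \<open>Surface measure on the unit sphere S^{d-1}, defined by the cone construction:
  sigma(A) = d * Lebesgue measure of {r w : 0 < r <= 1, w in A}.\<close>
definition sphere_measure :: "(real ^ 'n) measure" where
  "sphere_measure =
     measure_of (sphere 0 1) (sets (restrict_space lborel (sphere (0::real^'n) 1)))
       (\<lambda>A. ennreal (real CARD('n)) *
              emeasure lborel {x :: real^'n. x \<noteq> 0 \<and> norm x \<le> 1 \<and> sgn x \<in> A})"

text \<open>Fundamental domain of the flat torus T^d = R^d / Z^d.\<close>
definition unit_cube :: "(real ^ 'n) set" where
  "unit_cube = {x. \<forall>i. 0 \<le> x $ i \<and> x $ i \<le> 1}"

text \<open>Measure on the phase space T^d x S^{d-1} (functions on T^d are Z^d-periodic functions on R^d).\<close>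
definition phase_measure :: "((real ^ 'n) \<times> (real ^ 'n)) measure" where
  "phase_measure = restrict_space lborel unit_cube \<Otimes>\<^sub>M sphere_measure"

definition lattice_periodic :: "(real ^ 'n \<Rightarrow> 'b) \<Rightarrow> bool" where
  "lattice_periodic f \<longleftrightarrow> (\<forall>x k. (\<forall>i. k $ i \<in> \<int>) \<longrightarrow> f (x + k) = f x)"

definition rho :: "(real ^ 'n \<Rightarrow> real) \<Rightarrow> real" where
  "rho f = (\<integral>w. f w \<partial>sphere_measure)"

definition Jf :: "(real ^ 'n \<Rightarrow> real) \<Rightarrow> real ^ 'n" where
  "Jf f = (\<integral>w. f w *\<^sub>R w \<partial>sphere_measure)"

definition Zf :: "real ^ 'n \<Rightarrow> real" where
  "Zf J = (\<integral>w. exp (w \<bullet> J) \<partial>sphere_measure)"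

definition vonMises :: "real ^ 'n \<Rightarrow> real ^ 'n \<Rightarrow> real" where
  "vonMises J w = exp (w \<bullet> J) / Zf J"

definition gain :: "(real \<Rightarrow> real ^ 'n \<Rightarrow> real ^ 'n \<Rightarrow> real) \<Rightarrow> real \<Rightarrow> real ^ 'n \<Rightarrow> real ^ 'n \<Rightarrow> real" where
  "gain F t x w = rho (F t x) * vonMises (Jf (F t x)) w"

definition mild_solution ::
  "real \<Rightarrow> (real ^ 'n \<Rightarrow> real ^ 'n \<Rightarrow> real) \<Rightarrow> (real \<Rightarrow> real ^ 'n \<Rightarrow> real ^ 'n \<Rightarrow> real) \<Rightarrow> bool" where
  "mild_solution \<gamma> F0 F \<longleftrightarrow>
     \<comment> \<open>F(t) is a function on the torus\<close>
     (\<forall>t w. lattice_periodic (\<lambda>x. F t x w)) \<and>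
     \<comment> \<open>rho_F M_{J_F} in L^infty_loc([0,infty); L^1)\<close>
     (\<lambda>(t, x, w). gain F t x w) \<in> borel_measurable (restrict_space lborel {0..} \<Otimes>\<^sub>M phase_measure) \<and>
     (\<forall>t\<ge>0. integrable phase_measure (\<lambda>(x, w). gain F t x w)) \<and>
     (\<forall>T\<ge>0. \<exists>B. \<forall>t\<in>{0..T}. (\<integral>(x, w). \<bar>gain F t x w\<bar> \<partial>phase_measure) \<le> B) \<and>
     \<comment> \<open>Duhamel formula, for all t >= 0 and a.e. (x,w)\<close>
     (\<forall>t\<ge>0. AE (x, w) in phase_measure.
        set_integrable lborel {0..t} (\<lambda>s. exp (s - t) * gain F s (x - (\<gamma> * (t - s)) *\<^sub>R w) w) \<and>
        F t x w = exp (- t) * F0 (x - (\<gamma> * t) *\<^sub>R w) w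
                  + (LINT s:{0..t}|lborel. exp (s - t) * gain F s (x - (\<gamma> * (t - s)) *\<^sub>R w) w))"

end

theory Submission
  imports Defs "HOL-Library.Diagonal_Subsequence"
begin

text \<open>Approximate solutions are obtained by iterating the Duhamel formula with a truncated gain that
  acts with a small delay, so that on a bounded time interval the iteration becomes stationary. Since
  \<open>M\<^sub>J\<close> is bounded by a power of \<open>1 + |J|\<close> and \<open>|J| \<le> \<rho>\<close>, Young's inequality gives a bound on
  \<open>\<integral> F ln (1 + F)\<close> that grows at most exponentially in time, uniformly in the approximation.

  The moments \<open>\<rho>\<close> and \<open>J\<close> are compact in the mean by velocity averaging: after truncating the gain, which
  costs little because of the entropy bound, two applications of duality reduce the question to pairs
  of characteristics that meet. The joint law of their endpoints is absolutely continuous, because a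
  random multiple of a random chord \<open>w - w'\<close> of the sphere has a density; this is where \<open>d \<ge> 2\<close> enters.
  Against an integrable kernel a bounded sequence is totally bounded.

  Along a subsequence the moments converge almost everywhere, hence so does the gain, and the entropy
  bound upgrades this to convergence in the mean. The limit is a mild solution and inherits the
  entropy bound by Fatou's lemma; its mass could only drop, which the Duhamel formula excludes.\<close>

text \<open>The gain is nonlinear in \<open>J\<close>, so weak convergence of the approximations
  would not pass to the limit in it; hence the strong compactness of \<open>\<rho>\<close> and
  \<open>J\<close>.

  One application of duality is not enough. It couples \<open>(a, x)\<close> with
  \<open>(a', x - \<gamma> (a - a') w)\<close>, and for fixed times the second point runs over a
  sphere, a null set. The second application adds another velocity \<open>w'\<close> and a free
  meeting time; these are d parameters, and the coupling acquires a density. No rate is extracted: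
  compactness of integrable kernels is purely qualitative.

  The exponential rate \<open>d + 1\<close> comes from
  \<open>\<rho> M_J \<le> C (1 + \<rho>)^(d + 1)\<close>, which bounds the logarithm of the gain by
  \<open>d + 1\<close> logarithms of \<open>1 + \<rho>\<close>, up to a constant.

  Compactness is carried out on the whole half-line at once, with the measure
  \<open>exp (- t) dt\<close> and moments damped by \<open>exp (- (rate * t))\<close>, so that one
  subsequence serves all times. The limit is then defined by the Duhamel formula with the limit
  gain, hence at every time and point, and only afterwards is that gain recognised as its
  own.\<close>

section \<open>Total boundedness as finite colouring\<close>

text \<open>With \<open>R m n\<close> meaning closer than \<epsilon>, such a colouring is a finite
  cover of the sequence by small sets, so this encodes total boundedness. Keeping only a relation
  allows smallness to be measured by quadratic forms that are not norms, and comparison of two such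
  measurements is mere monotonicity.\<close>

definition finitely_colourable :: "(nat \<Rightarrow> nat \<Rightarrow> bool) \<Rightarrow> bool" where
  "finitely_colourable R \<longleftrightarrow> (\<exists>c::nat \<Rightarrow> nat. finite (range c) \<and> (\<forall>m n. c m = c n \<longrightarrow> R m n))"

lemma finitely_colourable_mono:
  "finitely_colourable R \<Longrightarrow> (\<And>m n. R m n \<Longrightarrow> S m n) \<Longrightarrow> finitely_colourable S"
  unfolding finitely_colourable_def by blast

text \<open>The product colouring works; \<open>prod_encode\<close> turns the pair of colours back
  into a natural number.\<close>

lemma finitely_colourable_conj:
  assumes "finitely_colourable R" "finitely_colourable S"
  shows "finitely_colourable (\<lambda>m n. R m n \<and> S m n)"
proof -
  obtain c d :: "nat \<Rightarrow> nat" where c: "finite (range c)" "\<And>m n. c m = c n \<Longrightarrow> R m n"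
    and d: "finite (range d)" "\<And>m n. d m = d n \<Longrightarrow> S m n"
    using assms unfolding finitely_colourable_def by metis
  have "range (\<lambda>n. prod_encode (c n, d n)) \<subseteq> prod_encode ` (range c \<times> range d)"
    by auto
  then have "finite (range (\<lambda>n. prod_encode (c n, d n)))"
    using c(1) d(1) by (meson finite_SigmaI finite_imageI finite_subset)
  then show ?thesis
    unfolding finitely_colourable_def using c(2) d(2)
    by (intro exI[of _ "\<lambda>n. prod_encode (c n, d n)"]) auto
qed

text \<open>The colour of \<open>n\<close> is the cell of the grid of width \<epsilon> that contains
  \<open>a n\<close>; boundedness leaves finitely many cells.\<close>

lemma finitely_colourable_bounded_seq:
  fixes a :: "nat \<Rightarrow> real"
  assumes "\<And>n. \<bar>a n\<bar> \<le> B" "\<epsilon> > 0"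
  shows "finitely_colourable (\<lambda>m n. \<bar>a m - a n\<bar> < \<epsilon>)"
proof -
  have bd: "- B \<le> a n" "a n \<le> B" for n using assms(1)[of n] by linarith+
  have "range (\<lambda>n. to_nat \<lfloor>a n / \<epsilon>\<rfloor>) \<subseteq> to_nat ` {\<lfloor>- B / \<epsilon>\<rfloor>..\<lfloor>B / \<epsilon>\<rfloor>}"
  proof (safe intro!: imageI)
    fix n
    show "\<lfloor>a n / \<epsilon>\<rfloor> \<in> {\<lfloor>- B / \<epsilon>\<rfloor>..\<lfloor>B / \<epsilon>\<rfloor>}"
      using assms(2) divide_right_mono[OF bd(1)[of n], of \<epsilon>] divide_right_mono[OF bd(2)[of n], of \<epsilon>]
      by (auto intro!: floor_mono)
  qed
  then have "finite (range (\<lambda>n. to_nat \<lfloor>a n / \<epsilon>\<rfloor>))"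
    by (meson finite_atLeastAtMost_int finite_imageI finite_subset)
  moreover have "\<bar>a m - a n\<bar> < \<epsilon>" if "\<lfloor>a m / \<epsilon>\<rfloor> = \<lfloor>a n / \<epsilon>\<rfloor>" for m n
  proof -
    have "\<bar>a m / \<epsilon> - a n / \<epsilon>\<bar> < 1" using that by linarith
    then have "\<bar>(a m - a n) / \<epsilon>\<bar> < 1" by (simp add: diff_divide_distrib)
    then show ?thesis using assms(2) by (simp add: field_simps)
  qed
  ultimately show ?thesis
    unfolding finitely_colourable_def by (intro exI[of _ "\<lambda>n. to_nat \<lfloor>a n / \<epsilon>\<rfloor>"]) auto
qed

text \<open>Pigeonhole on the colours makes \<open>R k\<close> hold on all pairs of a subsequence,
  and a diagonal sequence handles all \<open>k\<close> together. When \<open>R k\<close> says that a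
  distance is below the k-th term of a null sequence, this extracts a Cauchy subsequence.\<close>

lemma finitely_colourable_subseq:
  assumes "\<And>k. finitely_colourable (R k)"
  shows "\<exists>r::nat \<Rightarrow> nat. strict_mono r \<and> (\<forall>k. \<forall>m\<ge>k. \<forall>n\<ge>k. R k (r m) (r n))"
proof -
  interpret subseqs "\<lambda>k s. \<forall>m n. R k (s m) (s n)"
  proof
    fix k and s :: "nat \<Rightarrow> nat"
    obtain c :: "nat \<Rightarrow> nat" where c: "finite (range c)" "\<And>m n. c m = c n \<Longrightarrow> R k m n"
      using assms[of k] unfolding finitely_colourable_def by blast
    have "finite (range (\<lambda>n. c (s n)))" using c(1) by (rule finite_subset[rotated]) auto
    then obtain a where a: "infinite {n. c (s n) = c (s a)}"
      using pigeonhole_infinite[of UNIV "\<lambda>n. c (s n)"] by auto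
    have "c (s (enumerate {n. c (s n) = c (s a)} m)) = c (s a)" for m
      using enumerate_in_set[OF a, of m] by simp
    then have R: "R k (s (enumerate {n. c (s n) = c (s a)} m)) (s (enumerate {n. c (s n) = c (s a)} n))" for m n
      by (intro c(2)) simp
    show "\<exists>r'::nat \<Rightarrow> nat. strict_mono r' \<and> (\<forall>m n. R k ((s \<circ> r') m) ((s \<circ> r') n))"
    proof (intro exI conjI allI)
      show "strict_mono (enumerate {n. c (s n) = c (s a)})" by (rule strict_mono_enumerate[OF a])
    qed (simp add: R)
  qed
  have "\<forall>m n. R k ((diagseq \<circ> ((+) (Suc k))) m) ((diagseq \<circ> ((+) (Suc k))) n)" for k
    by (rule diagseq_holds) auto
  then have *: "R k (diagseq (Suc k + m)) (diagseq (Suc k + n))" for k m n by auto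
  \<comment> \<open>The diagonal sequence respects \<open>R k\<close> only from index
    \<open>Suc k\<close> on; passing to \<open>diagseq (Suc n)\<close> moves the start to
    \<open>k\<close>.\<close>
  have "R k (diagseq (Suc m)) (diagseq (Suc n))" if "k \<le> m" "k \<le> n" for k m n
    using *[of k "m - k" "n - k"] that by simp
  then show ?thesis
    using subseq_diagseq by (intro exI[of _ "\<lambda>n. diagseq (Suc n)"]) (auto simp: strict_mono_def)
qed

text \<open>A bounded sequence is totally bounded for the quadratic form given by an integrable kernel:
  for the indicator of a rectangle the form is a product of two real numbers, and the kernels with
  this property are closed under linear combinations and limits in the mean.\<close>

lemma finitely_colourable_kernel:
  fixes U :: "nat \<Rightarrow> 'a \<Rightarrow> real" and l :: "'a \<times> 'a \<Rightarrow> real"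
  assumes "finite_measure Z" and U[measurable]: "\<And>n. U n \<in> borel_measurable Z"
    and Ub: "\<And>n z. \<bar>U n z\<bar> \<le> 1"
    and l: "integrable (Z \<Otimes>\<^sub>M Z) l" and "\<epsilon> > 0"
  shows "finitely_colourable (\<lambda>m n.
    \<bar>\<integral>p. l p * ((U m (fst p) - U n (fst p)) * (U m (snd p) - U n (snd p))) \<partial>(Z \<Otimes>\<^sub>M Z)\<bar> < \<epsilon>)"
proof -
  interpret Z: finite_measure Z by fact
  interpret ZZ: pair_sigma_finite Z Z ..
  interpret P: finite_measure "Z \<Otimes>\<^sub>M Z" using assms(1) by (simp add: finite_measure_pair_measure)
  define D where "D m n p = (U m (fst p) - U n (fst p)) * (U m (snd p) - U n (snd p))" for m n p
  have D[measurable]: "D m n \<in> borel_measurable (Z \<Otimes>\<^sub>M Z)" for m n unfolding D_def by measurable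
  have D1: "\<bar>U m z - U n z\<bar> \<le> 2" for m n z using Ub[of m z] Ub[of n z] by linarith
  have Db: "\<bar>D m n p\<bar> \<le> 4" for m n p
    unfolding D_def abs_mult using mult_mono[OF D1[of m "fst p" n] D1[of m "snd p" n]] by simp
  have int: "integrable (Z \<Otimes>\<^sub>M Z) (\<lambda>p. f p * D m n p)" if "integrable (Z \<Otimes>\<^sub>M Z) f" for f m n
  proof (rule Bochner_Integration.integrable_bound[of _ "\<lambda>p. 4 * f p"])
    show "AE p in Z \<Otimes>\<^sub>M Z. norm (f p * D m n p) \<le> norm (4 * f p)"
      using Db mult_right_mono[OF Db abs_ge_zero] by (auto simp: abs_mult mult.commute)
  qed (use that in auto)
  define Q where "Q f \<longleftrightarrow> (\<forall>\<epsilon>>0. finitely_colourable (\<lambda>m n. \<bar>\<integral>p. f p * D m n p \<partial>(Z \<Otimes>\<^sub>M Z)\<bar> < \<epsilon>))"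
    for f :: "'a \<times> 'a \<Rightarrow> real"
  have Q_add: "Q (\<lambda>p. f p + g p)"
    if f: "integrable (Z \<Otimes>\<^sub>M Z) f" "Q f" and g: "integrable (Z \<Otimes>\<^sub>M Z) g" "Q g" for f g
    unfolding Q_def
  proof safe
    fix e :: real assume "e > 0"
    then have "finitely_colourable (\<lambda>m n. \<bar>\<integral>p. f p * D m n p \<partial>(Z \<Otimes>\<^sub>M Z)\<bar> < e/2 \<and>
        \<bar>\<integral>p. g p * D m n p \<partial>(Z \<Otimes>\<^sub>M Z)\<bar> < e/2)"
      using f(2) g(2) unfolding Q_def by (intro finitely_colourable_conj) (meson half_gt_zero)+
    then show "finitely_colourable (\<lambda>m n. \<bar>\<integral>p. (f p + g p) * D m n p \<partial>(Z \<Otimes>\<^sub>M Z)\<bar> < e)"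
      by (rule finitely_colourable_mono)
        (simp only: distrib_right Bochner_Integration.integral_add[OF int[OF f(1)] int[OF g(1)]], linarith)
  qed
  have Q_scale: "Q (\<lambda>p. c * f p)" if "Q f" for f c
    unfolding Q_def
  proof safe
    fix e :: real assume "e > 0"
    then have "finitely_colourable (\<lambda>m n. \<bar>\<integral>p. f p * D m n p \<partial>(Z \<Otimes>\<^sub>M Z)\<bar> < e / (\<bar>c\<bar> + 1))"
      using that unfolding Q_def by (auto simp: add_nonneg_pos)
    then show "finitely_colourable (\<lambda>m n. \<bar>\<integral>p. (c * f p) * D m n p \<partial>(Z \<Otimes>\<^sub>M Z)\<bar> < e)"
    proof (rule finitely_colourable_mono)
      fix m n
      let ?I = "\<bar>\<integral>p. f p * D m n p \<partial>(Z \<Otimes>\<^sub>M Z)\<bar>"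
      assume "?I < e / (\<bar>c\<bar> + 1)"
      then have "(\<bar>c\<bar> + 1) * ?I < e" by (subst (asm) pos_less_divide_eq) (auto simp: mult.commute)
      then have "\<bar>c\<bar> * ?I < e" by (smt (verit) mult_right_mono abs_ge_zero)
      then show "\<bar>\<integral>p. (c * f p) * D m n p \<partial>(Z \<Otimes>\<^sub>M Z)\<bar> < e"
        by (simp add: mult.assoc abs_mult)
    qed
  qed
  have Q_lim: "Q f"
    if f: "integrable (Z \<Otimes>\<^sub>M Z) f" and s: "\<And>i. integrable (Z \<Otimes>\<^sub>M Z) (s i)" "\<And>i. Q (s i)"
      and lim: "(\<lambda>i. \<integral>p. \<bar>s i p - f p\<bar> \<partial>(Z \<Otimes>\<^sub>M Z)) \<longlonglongrightarrow> 0" for f and s :: "nat \<Rightarrow> _"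
    unfolding Q_def
  proof safe
    fix e :: real assume "e > 0"
    \<comment> \<open>The bound \<open>4\<close> on \<open>D\<close> turns an error of
      \<open>e / 8\<close> in the kernel into one of \<open>e / 2\<close> in the form.\<close>
    then have "\<forall>\<^sub>F i in sequentially. (\<integral>p. \<bar>s i p - f p\<bar> \<partial>(Z \<Otimes>\<^sub>M Z)) < e / 8"
      using order_tendstoD(2)[OF lim, of "e/8"] by simp
    then obtain i where i: "(\<integral>p. \<bar>s i p - f p\<bar> \<partial>(Z \<Otimes>\<^sub>M Z)) < e / 8"
      by (auto simp: eventually_sequentially)
    have "finitely_colourable (\<lambda>m n. \<bar>\<integral>p. s i p * D m n p \<partial>(Z \<Otimes>\<^sub>M Z)\<bar> < e/2)"
      using s(2)[of i] \<open>e > 0\<close> unfolding Q_def by (meson half_gt_zero)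
    then show "finitely_colourable (\<lambda>m n. \<bar>\<integral>p. f p * D m n p \<partial>(Z \<Otimes>\<^sub>M Z)\<bar> < e)"
    proof (rule finitely_colourable_mono)
      fix m n
      assume a: "\<bar>\<integral>p. s i p * D m n p \<partial>(Z \<Otimes>\<^sub>M Z)\<bar> < e/2"
      have d: "integrable (Z \<Otimes>\<^sub>M Z) (\<lambda>p. f p - s i p)" using f s by auto
      have "\<bar>\<integral>p. (f p - s i p) * D m n p \<partial>(Z \<Otimes>\<^sub>M Z)\<bar> \<le> (\<integral>p. \<bar>(f p - s i p) * D m n p\<bar> \<partial>(Z \<Otimes>\<^sub>M Z))"
        by (rule integral_abs_bound)
      also have "\<dots> \<le> (\<integral>p. 4 * \<bar>s i p - f p\<bar> \<partial>(Z \<Otimes>\<^sub>M Z))"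
      proof (rule integral_mono)
        show "\<bar>(f p - s i p) * D m n p\<bar> \<le> 4 * \<bar>s i p - f p\<bar>" for p
          using mult_right_mono[OF Db[of m n p] abs_ge_zero[of "f p - s i p"]]
          by (simp add: abs_mult mult.commute abs_minus_commute)
      qed (use int[OF d] f s in auto)
      also have "\<dots> < e / 2" using i by simp
      finally have b: "\<bar>\<integral>p. (f p - s i p) * D m n p \<partial>(Z \<Otimes>\<^sub>M Z)\<bar> < e / 2" .
      have "(\<integral>p. f p * D m n p \<partial>(Z \<Otimes>\<^sub>M Z)) =
          (\<integral>p. s i p * D m n p + (f p - s i p) * D m n p \<partial>(Z \<Otimes>\<^sub>M Z))"
        by (simp add: algebra_simps)
      also have "\<dots> = (\<integral>p. s i p * D m n p \<partial>(Z \<Otimes>\<^sub>M Z)) + (\<integral>p. (f p - s i p) * D m n p \<partial>(Z \<Otimes>\<^sub>M Z))"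
        using int[OF d] int[OF s(1)] by (rule Bochner_Integration.integral_add[rotated])
      finally show "\<bar>\<integral>p. f p * D m n p \<partial>(Z \<Otimes>\<^sub>M Z)\<bar> < e" using a b by linarith
    qed
  qed
  have Q_rect: "Q (indicator (A \<times> B))" if [measurable]: "A \<in> sets Z" "B \<in> sets Z" for A B
    unfolding Q_def
  proof safe
    fix e :: real assume "e > 0"
    let ?\<mu> = "measure Z (space Z)"
    define a where "a n = (\<integral>z. indicator A z * U n z \<partial>Z)" for n
    define b where "b n = (\<integral>z. indicator B z * U n z \<partial>Z)" for n
    have iA: "integrable Z (\<lambda>z. indicator S z * U n z)" if [measurable]: "S \<in> sets Z" for n S
      by (rule Z.integrable_const_bound[of _ 1]) (use Ub in \<open>auto split: split_indicator\<close>)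
    have bd: "\<bar>\<integral>z. indicator S z * U n z \<partial>Z\<bar> \<le> ?\<mu>" if [measurable]: "S \<in> sets Z" for n S
    proof -
      have "\<bar>\<integral>z. indicator S z * U n z \<partial>Z\<bar> \<le> (\<integral>z. \<bar>indicator S z * U n z\<bar> \<partial>Z)"
        by (rule integral_abs_bound)
      also have "\<dots> \<le> (\<integral>z. 1 \<partial>Z)"
        by (rule integral_mono) (use iA Ub in \<open>auto split: split_indicator\<close>)
      finally show ?thesis by simp
    qed
    have eq: "(\<integral>p. indicator (A \<times> B) p * D m n p \<partial>(Z \<Otimes>\<^sub>M Z)) = (a m - a n) * (b m - b n)" for m n
    proof -
      have "(\<integral>p. indicator (A \<times> B) p * D m n p \<partial>(Z \<Otimes>\<^sub>M Z)) =
        (\<integral>p. (indicator A (fst p) * U m (fst p) - indicator A (fst p) * U n (fst p)) *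
               (indicator B (snd p) * U m (snd p) - indicator B (snd p) * U n (snd p)) \<partial>(Z \<Otimes>\<^sub>M Z))"
        by (intro Bochner_Integration.integral_cong) (auto simp: D_def split: split_indicator)
      also have "\<dots> = (a m - a n) * (b m - b n)"
      proof (subst ZZ.integral_fst'[symmetric])
        have *: "\<bar>indicator S z * U m z - indicator S z * U n z\<bar> \<le> 2" for S z
          using D1[of m z n] by (auto split: split_indicator)
        show "integrable (Z \<Otimes>\<^sub>M Z) (\<lambda>p.
           (indicator A (fst p) * U m (fst p) - indicator A (fst p) * U n (fst p)) *
           (indicator B (snd p) * U m (snd p) - indicator B (snd p) * U n (snd p)))"
          by (rule P.integrable_const_bound[of _ 4])
            (use mult_mono[OF * *] in \<open>auto simp: abs_mult\<close>)
        show "(\<integral>x. \<integral>y. (indicator A (fst (x, y)) * U m (fst (x, y)) - indicator A (fst (x, y)) * U n (fst (x, y))) *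
           (indicator B (snd (x, y)) * U m (snd (x, y)) - indicator B (snd (x, y)) * U n (snd (x, y))) \<partial>Z \<partial>Z)
           = (a m - a n) * (b m - b n)"
          using iA[of A] iA[of B] by (simp add: a_def b_def)
      qed
      finally show ?thesis .
    qed
    \<comment> \<open>It is enough to make one of the two factors small, because the other is at
      most \<open>2 * ?\<mu> + 1\<close>; the \<open>+ 1\<close> keeps the quotient positive for a
      null measure.\<close>
    have "finitely_colourable (\<lambda>m n. \<bar>a m - a n\<bar> < e / (2 * ?\<mu> + 1))"
      using bd[of A] \<open>e > 0\<close> unfolding a_def
      by (intro finitely_colourable_bounded_seq[of _ ?\<mu>]) (auto simp: add_nonneg_pos)
    then show "finitely_colourable (\<lambda>m n. \<bar>\<integral>p. indicator (A \<times> B) p * D m n p \<partial>(Z \<Otimes>\<^sub>M Z)\<bar> < e)"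
    proof (rule finitely_colourable_mono)
      fix m n
      assume h: "\<bar>a m - a n\<bar> < e / (2 * ?\<mu> + 1)"
      have "\<bar>b m - b n\<bar> \<le> 2 * ?\<mu> + 1" using bd[of B m] bd[of B n] unfolding b_def by simp
      then have "\<bar>a m - a n\<bar> * \<bar>b m - b n\<bar> \<le> \<bar>a m - a n\<bar> * (2 * ?\<mu> + 1)"
        by (intro mult_left_mono) auto
      also have "\<dots> < e" using h by (subst (asm) pos_less_divide_eq) (simp_all add: add_nonneg_pos)
      finally show "\<bar>\<integral>p. indicator (A \<times> B) p * D m n p \<partial>(Z \<Otimes>\<^sub>M Z)\<bar> < e"
        unfolding eq abs_mult .
    qed
  qed
  \<comment> \<open>The bound by \<open>2 * \<bar>f p\<bar>\<close> is the one that
    \<open>integrable_induct\<close> supplies with its approximating sequence.\<close>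
  have dom: "(\<lambda>i. \<integral>p. \<bar>s i p - f p\<bar> \<partial>(Z \<Otimes>\<^sub>M Z)) \<longlonglongrightarrow> 0"
    if [measurable]: "integrable (Z \<Otimes>\<^sub>M Z) f" "\<And>i. integrable (Z \<Otimes>\<^sub>M Z) (s i)"
      and lim: "\<And>p. p \<in> space (Z \<Otimes>\<^sub>M Z) \<Longrightarrow> (\<lambda>i. s i p) \<longlonglongrightarrow> f p"
      and bd: "\<And>i p. p \<in> space (Z \<Otimes>\<^sub>M Z) \<Longrightarrow> \<bar>s i p\<bar> \<le> 2 * \<bar>f p\<bar>"
    for f and s :: "nat \<Rightarrow> 'a \<times> 'a \<Rightarrow> real"
  proof -
    have "(\<lambda>i. \<integral>p. \<bar>s i p - f p\<bar> \<partial>(Z \<Otimes>\<^sub>M Z)) \<longlonglongrightarrow> (\<integral>p. 0 \<partial>(Z \<Otimes>\<^sub>M Z))"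
    proof (rule integral_dominated_convergence[where w="\<lambda>p. 3 * \<bar>f p\<bar>"])
      show "AE p in Z \<Otimes>\<^sub>M Z. (\<lambda>i. \<bar>s i p - f p\<bar>) \<longlonglongrightarrow> 0"
        using lim by (auto intro!: AE_I2 tendsto_rabs_zero simp: LIM_zero_iff)
      show "AE p in Z \<Otimes>\<^sub>M Z. norm \<bar>s i p - f p\<bar> \<le> 3 * \<bar>f p\<bar>" for i
        using bd by (intro AE_I2) (smt (verit) real_norm_def)
    qed (use that in auto)
    then show ?thesis by simp
  qed
  \<comment> \<open>Rectangles are stable under intersection, so a Dynkin argument reaches every set
    of the product; disjoint unions enter through finite sums and \<open>Q_lim\<close>.\<close>
  have Q_ind: "Q (indicator A)" if A: "A \<in> sets (Z \<Otimes>\<^sub>M Z)" for A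
  proof -
    let ?G = "{a \<times> b | a b. a \<in> sets Z \<and> b \<in> sets Z}"
    have sg: "sets (Z \<Otimes>\<^sub>M Z) = sigma_sets (space Z \<times> space Z) ?G" by (rule sets_pair_measure)
    have "?G \<subseteq> Pow (space Z \<times> space Z)" "A \<in> sigma_sets (space Z \<times> space Z) ?G"
      using A sg by (auto dest: sets.sets_into_space)
    from Int_stable_pair_measure_generator[of Z Z] this show ?thesis
    proof (induction A rule: sigma_sets_induct_disjoint)
      case (basic A)
      then show ?case using Q_rect by auto
    next
      case empty
      show ?case using Q_rect[of "{}" "{}"] by (simp only: Sigma_empty1 sets.empty_sets)
    next
      case (compl A)
      then have A: "A \<in> sets (Z \<Otimes>\<^sub>M Z)" using sg by simp
      have \<Omega>: "space Z \<times> space Z \<in> sets (Z \<Otimes>\<^sub>M Z)" by auto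
      have "Q (\<lambda>p. indicator (space Z \<times> space Z) p + (-1) * indicator A p)"
        using compl Q_rect A \<Omega> by (intro Q_add Q_scale) (auto simp: P.emeasure_eq_measure)
      moreover have "(\<lambda>p. indicator (space Z \<times> space Z) p + (-1) * indicator A p) =
          (indicator (space Z \<times> space Z - A) :: _ \<Rightarrow> real)"
        using sets.sets_into_space[OF A] by (auto simp: fun_eq_iff space_pair_measure split: split_indicator)
      ultimately show ?case by simp
    next
      case (union A)
      then have A[measurable]: "A i \<in> sets (Z \<Otimes>\<^sub>M Z)" for i using sg by auto
      have Qn: "Q (indicator (\<Union>i<n. A i))" for n
      proof (induction n)
        case 0 show ?case
          using Q_rect[of "{}" "{}"] by (simp only: Sigma_empty1 sets.empty_sets lessThan_0 UN_empty)
      next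
        case (Suc n)
        have "Q (\<lambda>p. indicator (\<Union>i<n. A i) p + indicator (A n) p)"
          using Suc union by (intro Q_add) (auto simp: P.emeasure_eq_measure)
        moreover have "(\<lambda>p. indicator (\<Union>i<n. A i) p + indicator (A n) p) = (indicator (\<Union>i<Suc n. A i) :: _ \<Rightarrow> real)"
          using union(1) by (auto simp: fun_eq_iff disjoint_family_on_def lessThan_Suc split: split_indicator) (metis IntI empty_iff nat_neq_iff)
        ultimately show ?case by simp
      qed
      show ?case
      proof (rule Q_lim[of _ "\<lambda>n. indicator (\<Union>i<n. A i)"])
        show "(\<lambda>n. \<integral>p. \<bar>(indicator (\<Union>i<n. A i) p :: real) - indicator (\<Union> (range A)) p\<bar> \<partial>(Z \<Otimes>\<^sub>M Z)) \<longlonglongrightarrow> 0"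
        proof (rule dom)
          fix p :: "'a \<times> 'a"
          show "(\<lambda>n. indicator (\<Union>i<n. A i) p :: real) \<longlonglongrightarrow> indicator (\<Union> (range A)) p"
            using LIMSEQ_indicator_UN[of A p] by simp
        qed (auto simp: P.emeasure_eq_measure split: split_indicator)
      qed (use Qn in \<open>auto simp: P.emeasure_eq_measure\<close>)
    qed
  qed
  have "Q l" using l
  proof (induction l rule: integrable_induct)
    case (base A c)
    then show ?case using Q_scale[OF Q_ind[OF base(1)], of c] by (simp add: mult.commute)
  next
    case (add f g) then show ?case by (intro Q_add)
  next
    case (lim f s) then show ?case by (intro Q_lim[of f s] dom) auto
  qed
  then show ?thesis using \<open>\<epsilon> > 0\<close> unfolding Q_def D_def by auto
qed

text \<open>The Radon-Nikodym density of the finite measure \<open>L\<close> is integrable, so it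
  can serve as the kernel in \<open>finitely_colourable_kernel\<close>.\<close>

lemma finitely_colourable_absolutely_continuous:
  fixes U :: "nat \<Rightarrow> 'a \<Rightarrow> real"
  assumes Z: "finite_measure Z" and U[measurable]: "\<And>n. U n \<in> borel_measurable Z"
    and Ub: "\<And>n z. \<bar>U n z\<bar> \<le> 1"
    and L: "finite_measure L" "sets L = sets (Z \<Otimes>\<^sub>M Z)" "absolutely_continuous (Z \<Otimes>\<^sub>M Z) L"
    and "\<epsilon> > 0"
  shows "finitely_colourable (\<lambda>m n.
    \<bar>\<integral>p. (U m (fst p) - U n (fst p)) * (U m (snd p) - U n (snd p)) \<partial>L\<bar> < \<epsilon>)"
proof -
  interpret P: finite_measure "Z \<Otimes>\<^sub>M Z" using Z by (simp add: finite_measure_pair_measure)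
  interpret L: finite_measure L by fact
  obtain D :: "'a \<times> 'a \<Rightarrow> real" where D: "D \<in> borel_measurable (Z \<Otimes>\<^sub>M Z)"
      "AE x in Z \<Otimes>\<^sub>M Z. RN_deriv (Z \<Otimes>\<^sub>M Z) L x = ennreal (D x)" "\<And>x. 0 \<le> D x"
    using P.real_RN_deriv[OF L(1) L(3) L(2)] by metis
  have "L = density (Z \<Otimes>\<^sub>M Z) (RN_deriv (Z \<Otimes>\<^sub>M Z) L)"
    using P.density_RN_deriv[OF L(3) L(2)] by simp
  also have "\<dots> = density (Z \<Otimes>\<^sub>M Z) (\<lambda>x. ennreal (D x))"
    using D by (intro density_cong) auto
  finally have Ld: "L = density (Z \<Otimes>\<^sub>M Z) (\<lambda>x. ennreal (D x))" .
  have "emeasure L (space L) = (\<integral>\<^sup>+x. ennreal (D x) \<partial>(Z \<Otimes>\<^sub>M Z))"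
    by (subst (1) Ld) (use D in \<open>simp add: emeasure_density sets_eq_imp_space_eq[OF L(2)] cong: nn_integral_cong\<close>)
  then have "integrable (Z \<Otimes>\<^sub>M Z) D"
    using D L.emeasure_finite[of "space L"] by (auto simp: integrable_iff_bounded less_top)
  from finitely_colourable_kernel[OF Z U Ub this \<open>\<epsilon> > 0\<close>]
  have k: "finitely_colourable (\<lambda>m n. \<bar>\<integral>p. D p * ((U m (fst p) - U n (fst p)) * (U m (snd p) - U n (snd p)))
      \<partial>(Z \<Otimes>\<^sub>M Z)\<bar> < \<epsilon>)" .
  have "(\<integral>p. (U m (fst p) - U n (fst p)) * (U m (snd p) - U n (snd p)) \<partial>L) =
    (\<integral>p. D p * ((U m (fst p) - U n (fst p)) * (U m (snd p) - U n (snd p))) \<partial>(Z \<Otimes>\<^sub>M Z))" for m n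
    by (subst Ld, subst integral_density) (use D in auto)
  with k show ?thesis by simp
qed

subsection \<open>The torus and the sphere\<close>

text \<open>Pushing the restricted measure forward to the full Borel space keeps
  \<open>restrict_space\<close> out of the later measurability goals; periodic functions live on all
  of \<open>real ^ 'n\<close> anyway.\<close>

definition torus_measure :: "(real ^ 'n) measure" where
  "torus_measure = distr (restrict_space lborel unit_cube) borel (\<lambda>x. x)"

definition sphere_borel :: "(real ^ 'n) measure" where
  "sphere_borel = distr sphere_measure borel (\<lambda>x. x)"

text \<open>The representative modulo the integer lattice in the half-open cube. Composition with it
  makes any function periodic.\<close>

definition fracv :: "real ^ 'n \<Rightarrow> real ^ 'n" where
  "fracv x = (\<chi> i. frac (x $ i))"

lemma unit_cube_eq: "unit_cube = cbox (0::real^'n) (\<chi> i. 1)"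
  by (auto simp: unit_cube_def mem_box_cart)

lemma unit_cube_borel[measurable]: "unit_cube \<in> sets borel"
  by (simp add: unit_cube_eq)

lemma fracv_mem: "fracv x \<in> unit_cube"
  by (auto simp: fracv_def unit_cube_def less_imp_le[OF frac_lt_1])

lemma borel_measurable_vec_nth[measurable]: "(\<lambda>x::real^'n. x $ i) \<in> borel_measurable borel"
  by (simp add: borel_measurable_continuous_onI continuous_on_component)

lemma punctured_cball_borel[measurable]: "cball 0 1 - {0::'a::euclidean_space} \<in> sets borel"
  by auto

lemma fracv_measurable[measurable]: "(fracv :: real^'n \<Rightarrow> real^'n) \<in> borel_measurable borel"
proof -
  have "frac \<in> borel_measurable (borel :: real measure)"
    unfolding frac_def[abs_def] by measurable
  note [measurable] = this
  have "(\<lambda>x::real^'n. \<Sum>i\<in>UNIV. frac (x $ i) *\<^sub>R axis i (1::real)) \<in> borel_measurable borel"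
    by measurable
  moreover have "(\<lambda>x::real^'n. \<Sum>i\<in>UNIV. frac (x $ i) *\<^sub>R axis i (1::real)) = fracv"
    by (simp add: fun_eq_iff fracv_def vec_eq_iff axis_def if_distrib sum.delta cong: if_cong)
  ultimately show ?thesis by (simp only:)
qed

lemma lattice_periodic_fracv: "lattice_periodic f \<Longrightarrow> f (fracv x) = f x"
proof -
  assume f: "lattice_periodic f"
  have "fracv x + (\<chi> i. of_int \<lfloor>x $ i\<rfloor>) = x"
    by (simp add: vec_eq_iff fracv_def frac_def)
  with f show "f (fracv x) = f x"
    unfolding lattice_periodic_def by (metis Ints_of_int vec_lambda_beta)
qed

lemma sets_torus_measure[measurable_cong, simp]: "sets torus_measure = sets borel"
  by (simp add: torus_measure_def)

lemma space_torus_measure[simp]: "space torus_measure = UNIV"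
  by (simp add: torus_measure_def)

lemma sets_sphere_borel[measurable_cong, simp]: "sets sphere_borel = sets borel"
  by (simp add: sphere_borel_def)

lemma space_sphere_borel[simp]: "space sphere_borel = UNIV"
  by (simp add: sphere_borel_def)

lemma sets_sphere_measure: "sets sphere_measure = sets (restrict_space borel (sphere (0::real^'n) 1))"
proof -
  have "sets (restrict_space lborel (sphere (0::real^'n) 1)) \<subseteq> Pow (sphere 0 1)"
    using sets.sets_into_space[of _ "restrict_space lborel (sphere (0::real^'n) 1)"]
    by (auto simp: space_restrict_space)
  moreover have "sigma_sets (sphere 0 1) (sets (restrict_space lborel (sphere (0::real^'n) 1)))
     = sets (restrict_space lborel (sphere (0::real^'n) 1))"
    using sets.sigma_sets_eq[of "restrict_space lborel (sphere (0::real^'n) 1)"]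
    by (simp add: space_restrict_space)
  ultimately have "sets sphere_measure = sets (restrict_space lborel (sphere (0::real^'n) 1))"
    unfolding sphere_measure_def by (subst sets_measure_of) auto
  also have "\<dots> = sets (restrict_space borel (sphere (0::real^'n) 1))"
    by (rule sets_restrict_space_cong) simp
  finally show ?thesis .
qed

lemma space_sphere_measure: "space (sphere_measure :: (real^'n) measure) = sphere 0 1"
  using sets_eq_imp_space_eq[OF sets_sphere_measure] by (simp add: space_restrict_space)

lemma id_measurable_sphere_measure: "(\<lambda>x. x) \<in> borel_measurable sphere_measure"
  by (subst measurable_cong_sets[OF sets_sphere_measure refl]) (simp add: measurable_restrict_space1)

text \<open>The cone construction says that the surface measure is the image under
  \<open>sgn\<close> of \<open>CARD('n)\<close> times Lebesgue measure on the punctured ball.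
  Integrals and null sets on the sphere thereby become questions about Lebesgue measure.\<close>

lemma sphere_borel_eq:
  "(sphere_borel :: (real^'n) measure) =
     distr (density lborel (\<lambda>x. ennreal (real CARD('n)) * indicator (cball 0 1 - {0}) x)) borel sgn"
  (is "_ = ?N")
proof (rule measure_eqI)
  fix A :: "(real^'n) set"
  assume "A \<in> sets sphere_borel"
  then have A[measurable]: "A \<in> sets borel" by simp
  have N: "emeasure ?N B = ennreal (real CARD('n)) *
      emeasure lborel {x :: real^'n. x \<noteq> 0 \<and> norm x \<le> 1 \<and> sgn x \<in> B}" if [measurable]: "B \<in> sets borel" for B
  proof -
    have [measurable]: "sgn -` B \<in> sets borel"
      using measurable_sets[OF borel_measurable_sgn that] by simp
    have "emeasure ?N B = (\<integral>\<^sup>+x. ennreal (real CARD('n)) * indicator ((cball 0 1 - {0}) \<inter> sgn -` B) x \<partial>lborel)"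
      by (subst emeasure_distr, simp, simp, subst emeasure_density)
        (auto intro!: nn_integral_cong split: split_indicator)
    also have "\<dots> = ennreal (real CARD('n)) * emeasure lborel ((cball 0 1 - {0}) \<inter> sgn -` B)"
      by (subst nn_integral_cmult_indicator) auto
    also have "(cball 0 1 - {0}) \<inter> sgn -` B = {x :: real^'n. x \<noteq> 0 \<and> norm x \<le> 1 \<and> sgn x \<in> B}"
      by auto
    finally show ?thesis .
  qed
  have sB: "B \<in> sets borel" if "B \<in> sets sphere_measure" for B :: "(real^'n) set"
    using that by (subst (asm) sets_sphere_measure, subst (asm) sets_restrict_space_iff) auto
  have em: "emeasure sphere_measure B = emeasure ?N B" if "B \<in> sets sphere_measure" for B
  proof -
    have "emeasure (sphere_measure :: (real^'n) measure) B = ennreal (real CARD('n)) *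
      emeasure lborel {x :: real^'n. x \<noteq> 0 \<and> norm x \<le> 1 \<and> sgn x \<in> B}"
    proof (rule emeasure_measure_of[OF sphere_measure_def[where 'n='n] _ _ _ that])
      show "sets (restrict_space lborel (sphere 0 1)) \<subseteq> Pow (sphere (0::real^'n) 1)"
        using sets.sets_into_space[of _ "restrict_space lborel (sphere (0::real^'n) 1)"]
        by (auto simp: space_restrict_space)
      show "positive (sets sphere_measure) (\<lambda>A. ennreal (real CARD('n)) *
              emeasure lborel {x :: real^'n. x \<noteq> 0 \<and> norm x \<le> 1 \<and> sgn x \<in> A})"
        by (simp add: positive_def)
      \<comment> \<open>\<open>emeasure_measure_of\<close> asks for countable additivity of the
        defining set function. It is inherited from the image measure \<open>?N\<close>, which has
        the same values on Borel sets.\<close>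
      show "countably_additive (sets sphere_measure) (\<lambda>A. ennreal (real CARD('n)) *
              emeasure lborel {x :: real^'n. x \<noteq> 0 \<and> norm x \<le> 1 \<and> sgn x \<in> A})"
      proof (rule countably_additiveI)
        fix B :: "nat \<Rightarrow> (real^'n) set"
        assume B: "range B \<subseteq> sets sphere_measure" "disjoint_family B" "\<Union> (range B) \<in> sets sphere_measure"
        have b: "B i \<in> sets borel" for i using B(1) sB by auto
        have "(\<Sum>i. emeasure ?N (B i)) = emeasure ?N (\<Union> (range B))"
          using b B(2) by (intro suminf_emeasure) auto
        then show "(\<Sum>i. ennreal (real CARD('n)) * emeasure lborel {x. x \<noteq> 0 \<and> norm x \<le> 1 \<and> sgn x \<in> B i})
           = ennreal (real CARD('n)) * emeasure lborel {x. x \<noteq> 0 \<and> norm x \<le> 1 \<and> sgn x \<in> \<Union> (range B)}"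
          using N[OF b] N[OF sB[OF B(3)]] by simp
      qed
    qed
    then show ?thesis using N[OF sB[OF that]] by simp
  qed
  have AS: "A \<inter> sphere 0 1 \<in> sets sphere_measure"
    by (subst sets_sphere_measure, subst sets_restrict_space_iff) auto
  have "emeasure sphere_borel A = emeasure sphere_measure (A \<inter> sphere 0 1)"
    unfolding sphere_borel_def
    by (subst emeasure_distr) (auto simp: space_sphere_measure id_measurable_sphere_measure)
  also have "\<dots> = emeasure ?N A"
    unfolding em[OF AS] N[OF sB[OF AS]] N[OF A] by (simp add: norm_sgn cong: conj_cong)
  finally show "emeasure sphere_borel A = emeasure ?N A" .
qed simp

lemma nn_integral_sphere_borel:
  fixes f :: "real^'n \<Rightarrow> ennreal"
  assumes [measurable]: "f \<in> borel_measurable borel"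
  shows "(\<integral>\<^sup>+w. f w \<partial>sphere_borel) =
    (\<integral>\<^sup>+x. ennreal (real CARD('n)) * indicator (cball 0 1 - {0}) x * f (sgn x) \<partial>lborel)"
  unfolding sphere_borel_eq
  by (subst nn_integral_distr, simp, simp, subst nn_integral_density, simp, measurable)

lemma AE_sphere_borelI:
  fixes P :: "real^'n \<Rightarrow> bool"
  assumes [measurable]: "Measurable.pred borel P" and P: "AE x in lborel. x \<noteq> 0 \<longrightarrow> P (sgn x)"
  shows "AE w in sphere_borel. P w"
  unfolding sphere_borel_eq
  by (subst AE_distr_iff, simp, simp, subst AE_density) (use P in \<open>auto split: split_indicator\<close>)

lemma finite_measure_torus_measure: "finite_measure (torus_measure :: (real^'n) measure)"
proof
  have "emeasure (torus_measure :: (real^'n) measure) (space torus_measure) = emeasure lborel (unit_cube :: (real^'n) set)"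
    unfolding torus_measure_def
    by (subst emeasure_distr) (auto simp: space_restrict_space emeasure_restrict_space measurable_restrict_space1)
  then show "emeasure (torus_measure :: (real^'n) measure) (space torus_measure) \<noteq> \<infinity>"
    unfolding unit_cube_eq using emeasure_lborel_cbox_finite[of "0::real^'n" "\<chi> i. 1"] by auto
qed

lemma finite_measure_sphere_borel: "finite_measure (sphere_borel :: (real^'n) measure)"
proof
  have "emeasure (sphere_borel :: (real^'n) measure) (space sphere_borel) =
      (\<integral>\<^sup>+x. ennreal (real CARD('n)) * indicator (cball 0 1 - {0}) (x::real^'n) \<partial>lborel)"
    using nn_integral_sphere_borel[of "\<lambda>x::real^'n. 1"] by simp
  also have "\<dots> \<le> (\<integral>\<^sup>+x. ennreal (real CARD('n)) * indicator (cball (0::real^'n) 1) x \<partial>lborel)"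
    by (intro nn_integral_mono) (auto split: split_indicator)
  also have "\<dots> < \<infinity>"
    by (subst nn_integral_cmult_indicator)
      (use emeasure_bounded_finite[OF bounded_cball, of "0::real^'n" 1] in \<open>auto simp: ennreal_mult_less_top\<close>)
  finally show "emeasure (sphere_borel :: (real^'n) measure) (space sphere_borel) \<noteq> \<infinity>" by simp
qed

interpretation torus: finite_measure torus_measure by (rule finite_measure_torus_measure)
interpretation sph: finite_measure sphere_borel by (rule finite_measure_sphere_borel)

text \<open>The analysis takes place on this copy of \<open>phase_measure\<close> over the full
  Borel space; \<open>phase_eq_distr\<close> links the two.\<close>

definition phase :: "((real^'n) \<times> (real^'n)) measure" where
  "phase = torus_measure \<Otimes>\<^sub>M sphere_borel"

lemma sets_phase[measurable_cong, simp]: "sets phase = sets (borel \<Otimes>\<^sub>M borel)"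
  unfolding phase_def by (intro sets_pair_measure_cong) simp_all

lemma space_phase[simp]: "space phase = UNIV"
  by (simp add: phase_def space_pair_measure)

interpretation phase: finite_measure phase
  unfolding phase_def by (intro finite_measure_pair_measure finite_measure_torus_measure finite_measure_sphere_borel)

interpretation phase_pair: pair_sigma_finite torus_measure sphere_borel ..

lemma AE_sphere_borel_norm: "AE w in sphere_borel. norm (w::real^'n) = 1"
  by (rule AE_sphere_borelI) (auto simp: norm_sgn)

lemma phase_eq_distr: "phase = distr phase_measure (borel \<Otimes>\<^sub>M borel) (\<lambda>p. p)"
proof -
  have s: "sigma_finite_measure (distr sphere_measure borel (\<lambda>x::real^'n. x))"
    using finite_measure_sphere_borel[unfolded sphere_borel_def] finite_measure.axioms(1) by blast
  have r: "(\<lambda>x::real^'n. x) \<in> measurable (restrict_space lborel unit_cube) borel"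
    by (simp add: measurable_restrict_space1)
  show ?thesis
    unfolding phase_def torus_measure_def sphere_borel_def phase_measure_def
      pair_measure_distr[OF r id_measurable_sphere_measure s] by (simp add: case_prod_beta')
qed

lemma id_measurable_phase_measure: "(\<lambda>p. p) \<in> measurable phase_measure (borel \<Otimes>\<^sub>M borel)"
proof -
  have "(\<lambda>p. (fst p, snd p)) \<in> measurable (restrict_space lborel unit_cube \<Otimes>\<^sub>M sphere_measure) (borel \<Otimes>\<^sub>M borel)"
    by (intro measurable_Pair measurable_compose[OF measurable_fst] measurable_compose[OF measurable_snd]
      id_measurable_sphere_measure measurable_restrict_space1) simp
  then show ?thesis by (simp add: phase_measure_def)
qed

subsection \<open>Translation invariance\<close>

text \<open>Unfolding: every point has exactly one integer translate in the half-open cube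
  \<open>Q\<close>, so the constant \<open>1\<close> can be written as a sum over the lattice.
  Exchanging sum and integral lets the shift by \<open>v\<close> be absorbed by that same
  count.\<close>

lemma lborel_integer_tiling:
  fixes f :: "real^'n \<Rightarrow> ennreal"
  assumes [measurable]: "f \<in> borel_measurable borel" and per: "lattice_periodic f"
  defines "Q \<equiv> {x::real^'n. \<forall>i. 0 \<le> x $ i \<and> x $ i < 1}"
  shows "(\<integral>\<^sup>+x. indicator Q x * f (x + v) \<partial>lborel) = (\<integral>\<^sup>+x. indicator Q x * f x \<partial>lborel)"
proof -
  let ?k = "\<lambda>k::int^'n. (\<chi> i. of_int (k $ i)) :: real^'n"
  have Q_eq: "Q = (\<Inter>i\<in>UNIV. {x. 0 \<le> x $ i \<and> x $ i < 1})" unfolding Q_def by auto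
  have Q[measurable]: "Q \<in> sets borel"
    unfolding Q_eq by (intro sets.finite_INT) (auto, measurable)
  have one: "(\<integral>\<^sup>+k. indicator Q (y + ?k k) \<partial>count_space UNIV) = (1::ennreal)" for y :: "real^'n"
  proof -
    have "y + ?k k \<in> Q \<longleftrightarrow> k = (\<chi> i. - \<lfloor>y $ i\<rfloor>)" for k
    proof
      assume "y + ?k k \<in> Q"
      then have "0 \<le> y $ i + of_int (k $ i) \<and> y $ i + of_int (k $ i) < 1" for i
        unfolding Q_def by auto
      then have "\<lfloor>y $ i\<rfloor> = - (k $ i)" for i by (smt (verit) floor_unique of_int_minus)
      then show "k = (\<chi> i. - \<lfloor>y $ i\<rfloor>)" by (simp add: vec_eq_iff)
    next
      assume "k = (\<chi> i. - \<lfloor>y $ i\<rfloor>)"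
      then show "y + ?k k \<in> Q"
        using frac_lt_1[of "y $ _", unfolded frac_def] by (auto simp: Q_def)
    qed
    then have "(\<lambda>k. indicator Q (y + ?k k) :: ennreal) = indicator {\<chi> i. - \<lfloor>y $ i\<rfloor>}"
      by (simp only: indicator_def fun_eq_iff singleton_iff) simp
    then show ?thesis by simp
  qed
  have shift: "(\<integral>\<^sup>+x. g x \<partial>lborel) = (\<integral>\<^sup>+x. g (x + c) \<partial>lborel)"
    if [measurable]: "g \<in> borel_measurable borel" for g :: "real^'n \<Rightarrow> ennreal" and c
  proof -
    have "(\<integral>\<^sup>+x. g x \<partial>lborel) = (\<integral>\<^sup>+x. g x \<partial>(distr lborel borel ((+) c)))"
      by (simp add: lborel_distr_plus)
    also have "\<dots> = (\<integral>\<^sup>+x. g (x + c) \<partial>lborel)"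
      by (subst nn_integral_distr) (auto simp: add.commute)
    finally show ?thesis .
  qed
  have fk: "f (x + ?k k) = f x" for x k
    using per unfolding lattice_periodic_def by auto
  have kk: "?k (- k) = - ?k k" for k by (simp add: vec_eq_iff)
  have "(\<integral>\<^sup>+x. indicator Q x * f (x + v) \<partial>lborel) = (\<integral>\<^sup>+x. indicator Q (x - v) * f x \<partial>lborel)"
    by (subst shift[of "\<lambda>x. indicator Q (x - v) * f x" v]) auto
  also have "\<dots> = (\<integral>\<^sup>+x. (\<integral>\<^sup>+k. indicator Q (x + ?k k) * (indicator Q (x - v) * f x) \<partial>count_space UNIV) \<partial>lborel)"
    by (subst nn_integral_multc) (auto simp: one)
  also have "\<dots> = (\<integral>\<^sup>+k. (\<integral>\<^sup>+x. indicator Q (x + ?k k) * (indicator Q (x - v) * f x) \<partial>lborel) \<partial>count_space UNIV)"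
    by (rule nn_integral_count_space_nn_integral) auto
  \<comment> \<open>Substituting \<open>x - k\<close> for \<open>x\<close> exchanges the roles of
    the two cubes: \<open>Q\<close> itself is now fixed, and its translate by \<open>v\<close> is
    the one that runs over the lattice.\<close>
  also have "\<dots> = (\<integral>\<^sup>+k. (\<integral>\<^sup>+x. indicator Q ((x - v) + ?k (- k)) * (indicator Q x * f x) \<partial>lborel) \<partial>count_space UNIV)"
  proof (rule nn_integral_cong)
    fix k
    have "(\<integral>\<^sup>+x. indicator Q (x + ?k k) * (indicator Q (x - v) * f x) \<partial>lborel) =
      (\<integral>\<^sup>+x. indicator Q (x + ?k (-k) + ?k k) * (indicator Q (x + ?k (-k) - v) * f (x + ?k (-k))) \<partial>lborel)"
      by (rule shift) measurable
    also have "\<dots> = (\<integral>\<^sup>+x. indicator Q ((x - v) + ?k (- k)) * (indicator Q x * f x) \<partial>lborel)"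
    proof (rule nn_integral_cong)
      fix x :: "real^'n"
      have "x + ?k (- k) + ?k k = x" "x + ?k (- k) - v = (x - v) + ?k (- k)"
        by (simp_all only: kk) simp_all
      then show "indicator Q (x + ?k (-k) + ?k k) * (indicator Q (x + ?k (-k) - v) * f (x + ?k (-k))) =
        indicator Q ((x - v) + ?k (- k)) * (indicator Q x * f x)"
        unfolding fk by (simp only: mult.left_commute)
    qed
    finally show "(\<integral>\<^sup>+x. indicator Q (x + ?k k) * (indicator Q (x - v) * f x) \<partial>lborel) = \<dots>" .
  qed
  also have "\<dots> = (\<integral>\<^sup>+x. (\<integral>\<^sup>+k. indicator Q ((x - v) + ?k (- k)) * (indicator Q x * f x) \<partial>count_space UNIV) \<partial>lborel)"
    by (rule nn_integral_count_space_nn_integral[symmetric]) auto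
  also have "\<dots> = (\<integral>\<^sup>+x. indicator Q x * f x \<partial>lborel)"
  proof (rule nn_integral_cong)
    fix x :: "real^'n"
    have "(\<integral>\<^sup>+k. indicator Q ((x - v) + ?k (- k)) \<partial>count_space UNIV) =
       (\<integral>\<^sup>+k. indicator Q ((x - v) + ?k k) \<partial>count_space UNIV :: ennreal)"
      by (rule nn_integral_bij_count_space) (auto intro!: bij_betwI[of _ _ _ uminus])
    then show "(\<integral>\<^sup>+k. indicator Q ((x - v) + ?k (- k)) * (indicator Q x * f x) \<partial>count_space UNIV) = indicator Q x * f x"
      by (subst nn_integral_multc) (auto simp: one)
  qed
  finally show ?thesis .
qed

text \<open>The closed cube \<open>unit_cube\<close> exceeds the half-open one by pieces of the
  hyperplanes \<open>x $ i = 1\<close>, which are null; only the half-open cube tiles the space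
  without overlap.\<close>

lemma nn_integral_torus:
  fixes f :: "real^'n \<Rightarrow> ennreal"
  assumes [measurable]: "f \<in> borel_measurable borel"
  shows "(\<integral>\<^sup>+x. f x \<partial>torus_measure) = (\<integral>\<^sup>+x. indicator {x. \<forall>i. 0 \<le> x $ i \<and> x $ i < 1} x * f x \<partial>lborel)"
proof -
  have "(\<integral>\<^sup>+x. f x \<partial>torus_measure) = (\<integral>\<^sup>+x. indicator unit_cube x * f x \<partial>lborel)"
    unfolding torus_measure_def
    by (subst nn_integral_distr) (auto simp: nn_integral_restrict_space measurable_restrict_space1 mult.commute)
  also have "\<dots> = (\<integral>\<^sup>+x. indicator {x. \<forall>i. 0 \<le> x $ i \<and> x $ i < 1} x * f x \<partial>lborel)"
  proof (rule nn_integral_cong_AE)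
    have "AE x::real^'n in lborel. x $ i \<noteq> 1" for i :: 'n
    proof -
      have "negligible {x::real^'n. x $ i = 1}"
        using negligible_standard_hyperplane[of "axis i (1::real)" 1]
        by (simp add: cart_eq_inner_axis axis_in_Basis_iff)
      then show ?thesis
        using AE_not_in[of "{x::real^'n. x $ i = 1}" lebesgue]
        by (simp add: negligible_iff_null_sets AE_completion_iff)
    qed
    then have "AE x::real^'n in lborel. \<forall>i. x $ i \<noteq> 1" by (subst AE_all_countable) auto
    then show "AE x::real^'n in lborel. indicator unit_cube x * f x =
        indicator {x. \<forall>i. 0 \<le> x $ i \<and> x $ i < 1} x * f x"
      by eventually_elim (auto simp: unit_cube_def order_less_le split: split_indicator)
  qed
  finally show ?thesis .
qed

lemma lattice_periodic_compose_fracv: "lattice_periodic (\<lambda>x. f (fracv x))"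
proof -
  have "fracv (x + k) = fracv x" if "\<forall>i. k $ i \<in> \<int>" for x k :: "real^'n"
  proof -
    have "frac (x $ i + k $ i) = frac (x $ i)" for i
      using that[rule_format, of i] by (auto elim!: Ints_cases simp: frac_def)
    then show ?thesis by (simp add: fracv_def vec_eq_iff)
  qed
  then show ?thesis unfolding lattice_periodic_def by metis
qed

text \<open>Composing the indicator of a test set with \<open>fracv\<close> makes it periodic, so
  \<open>lborel_integer_tiling\<close> applies. The case \<open>v = 0\<close> says that
  \<open>fracv\<close> itself preserves the measure.\<close>

lemma distr_torus_translation: "distr torus_measure borel (\<lambda>x. fracv (x + v)) = (torus_measure :: (real^'n) measure)"
proof (rule measure_eqI)
  fix A :: "(real^'n) set"
  assume "A \<in> sets (distr torus_measure borel (\<lambda>x. fracv (x + v)))"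
  then have A[measurable]: "A \<in> sets borel" by simp
  let ?Q = "{x::real^'n. \<forall>i. 0 \<le> x $ i \<and> x $ i < 1}"
  have fQ: "fracv x = x" if "x \<in> ?Q" for x using that by (auto simp: fracv_def vec_eq_iff frac_eq)
  have "emeasure (distr torus_measure borel (\<lambda>x. fracv (x + v))) A = (\<integral>\<^sup>+x. indicator A (fracv (x + v)) \<partial>torus_measure)"
    by (subst nn_integral_indicator[symmetric], simp, subst nn_integral_distr) auto
  also have "\<dots> = (\<integral>\<^sup>+x. indicator ?Q x * indicator A (fracv (x + v)) \<partial>lborel)"
    by (rule nn_integral_torus) measurable
  also have "\<dots> = (\<integral>\<^sup>+x. indicator ?Q x * indicator A (fracv x) \<partial>lborel)"
    by (rule lborel_integer_tiling) (auto intro!: lattice_periodic_compose_fracv[of "indicator A"])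
  also have "\<dots> = (\<integral>\<^sup>+x. indicator ?Q x * indicator A x \<partial>lborel)"
    by (rule nn_integral_cong) (auto simp: fQ split: split_indicator)
  also have "\<dots> = (\<integral>\<^sup>+x. indicator A x \<partial>torus_measure)"
    by (rule nn_integral_torus[symmetric]) measurable
  also have "\<dots> = emeasure torus_measure A" by simp
  finally show "emeasure (distr torus_measure borel (\<lambda>x. fracv (x + v))) A = emeasure torus_measure A" .
qed simp

lemma nn_integral_torus_translation:
  fixes f :: "real^'n \<Rightarrow> ennreal"
  assumes [measurable]: "f \<in> borel_measurable borel" and "lattice_periodic f"
  shows "(\<integral>\<^sup>+x. f (x + v) \<partial>torus_measure) = (\<integral>\<^sup>+x. f x \<partial>torus_measure)"
proof -
  have "(\<integral>\<^sup>+x. f x \<partial>torus_measure) = (\<integral>\<^sup>+x. f x \<partial>distr torus_measure borel (\<lambda>x. fracv (x + v)))"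
    by (simp only: distr_torus_translation)
  also have "\<dots> = (\<integral>\<^sup>+x. f (x + v) \<partial>torus_measure)"
    by (subst nn_integral_distr) (auto simp: lattice_periodic_fracv[OF assms(2)])
  finally show ?thesis by simp
qed

lemma integral_torus_translation:
  fixes f :: "real^'n \<Rightarrow> real"
  assumes [measurable]: "f \<in> borel_measurable borel" and "lattice_periodic f"
  shows "(\<integral>x. f (x + v) \<partial>torus_measure) = (\<integral>x. f x \<partial>torus_measure)"
proof -
  have "(\<integral>x. f x \<partial>torus_measure) = (\<integral>x. f x \<partial>distr torus_measure borel (\<lambda>x. fracv (x + v)))"
    by (simp only: distr_torus_translation)
  also have "\<dots> = (\<integral>x. f (x + v) \<partial>torus_measure)"
    by (subst integral_distr) (auto simp: lattice_periodic_fracv[OF assms(2)])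
  finally show ?thesis by simp
qed

subsection \<open>Absolute continuity of chords of the sphere\<close>

lemma AE_lborel_notin_null:
  fixes N :: "'a::euclidean_space set"
  assumes "negligible N" shows "AE x in lborel. x \<notin> N"
  using AE_not_in[of N lebesgue] assms by (simp add: negligible_iff_null_sets AE_completion_iff)

lemma null_sets_imp_negligible:
  fixes N :: "'a::euclidean_space set"
  assumes "N \<in> null_sets lborel" shows "negligible N"
  using assms by (auto simp: negligible_iff_null_sets null_sets_completionI)

text \<open>The map \<open>x \<mapsto> x - |x| e\<close> has the explicit inverse \<open>y \<mapsto> y - (|y|^2 / (2 y \<bullet> e)) e\<close>, which is
  differentiable off the hyperplane orthogonal to \<open>e\<close>.\<close>

lemma AE_diff_norm_notin_null:
  fixes e :: "real^'n" and N :: "(real^'n) set"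
  assumes d: "CARD('n) \<ge> 2" and e: "norm e = 1" and N: "N \<in> null_sets lborel"
  shows "AE x in lborel. x - norm x *\<^sub>R e \<notin> N"
proof -
  let ?g = "\<lambda>y. y - ((y \<bullet> y) / (2 * (y \<bullet> e))) *\<^sub>R e"
  \<comment> \<open>The inverse is undefined where \<open>y\<close> is orthogonal to
    \<open>e\<close>; those points are treated separately.\<close>
  let ?N = "{y \<in> N. y \<bullet> e \<noteq> 0}"
  have ee: "e \<bullet> e = 1" using e by (simp add: norm_eq_1)
  have "negligible ?N"
    by (rule negligible_subset[OF null_sets_imp_negligible[OF N]]) auto
  moreover have "?g differentiable_on ?N"
    unfolding differentiable_on_def differentiable_def
  proof
    fix y assume "y \<in> ?N"
    then have "2 * (y \<bullet> e) \<noteq> 0" by simp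
    then show "\<exists>D. (?g has_derivative D) (at y within ?N)"
      by (intro exI) (rule has_derivative_diff[OF has_derivative_ident has_derivative_scaleR[OF
        has_derivative_divide[OF has_derivative_inner[OF has_derivative_ident has_derivative_ident]
          has_derivative_mult[OF has_derivative_const has_derivative_inner[OF has_derivative_ident has_derivative_const]]]
        has_derivative_const]])
  qed
  ultimately have 1: "negligible (?g ` ?N)"
    by (intro negligible_differentiable_image_negligible[OF order_refl])
  \<comment> \<open>A line is a null set only in dimension at least two.\<close>
  have "dim (span {e}) \<le> card {e}" by (simp add: dim_le_card')
  then have 2: "negligible (span {e})"
    using d by (intro negligible_lowdim) auto
  have "x \<in> ?g ` ?N \<union> span {e}" if xN: "x - norm x *\<^sub>R e \<in> N" for x
  proof (cases "(x - norm x *\<^sub>R e) \<bullet> e = 0")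
    case True
    \<comment> \<open>This is equality in the Cauchy-Schwarz inequality, so \<open>x\<close> lies on
      the ray through \<open>e\<close>.\<close>
    then have "x \<bullet> e = norm x * norm e" using ee e by (simp add: inner_diff_left)
    then have "norm x *\<^sub>R e = norm e *\<^sub>R x" by (simp only: norm_cauchy_schwarz_eq)
    then have "x = norm x *\<^sub>R e" using e by simp
    then have "x \<in> span {e}" by (metis insertI1 span_base span_mul)
    then show ?thesis by simp
  next
    case False
    let ?y = "x - norm x *\<^sub>R e"
    have ye: "?y \<bullet> e = x \<bullet> e - norm x" using ee by (simp add: inner_diff_left)
    have "?y \<bullet> ?y = x \<bullet> x - 2 * norm x * (x \<bullet> e) + norm x * norm x"
      using ee by (simp add: inner_diff_left inner_diff_right inner_commute)
    also have "\<dots> = - (2 * norm x * (?y \<bullet> e))"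
      unfolding ye using power2_norm_eq_inner[of x] by (simp add: algebra_simps power2_eq_square)
    finally have "(?y \<bullet> ?y) / (2 * (?y \<bullet> e)) = - norm x" using False by simp
    then have "?g ?y = x" by simp
    then show ?thesis using xN False by (metis (mono_tags, lifting) UnI1 image_eqI mem_Collect_eq)
  qed
  note * = this
  have "AE x in lborel. x \<notin> ?g ` ?N \<union> span {e}"
    by (intro AE_lborel_notin_null negligible_Un 1 2)
  then show ?thesis
  proof eventually_elim
    case (elim x)
    show ?case
    proof
      assume "x - norm x *\<^sub>R e \<in> N"
      from *[OF this] elim show False by contradiction
    qed
  qed
qed

text \<open>For fixed \<open>q \<noteq> 0\<close>, \<open>AE_diff_norm_notin_null\<close> applies to
  the dilated and shifted null set. Fubini then exchanges \<open>q\<close> and \<open>x\<close>, and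
  for each \<open>x\<close> the substitution of \<open>q / norm x\<close> for \<open>q\<close> turns
  \<open>x - norm x *\<^sub>R e\<close> into \<open>sgn x - e\<close>, which depends on the
  direction of \<open>x\<close> only.\<close>

lemma AE_sphere_chord_notin_null:
  fixes e b :: "real^'n" and N :: "(real^'n) set"
  assumes d: "CARD('n) \<ge> 2" and e: "norm e = 1" and N: "N \<in> null_sets lborel"
  shows "AE w in sphere_borel. AE q in lborel. q *\<^sub>R (w - e) + b \<notin> N"
proof -
  have Nb[measurable]: "N \<in> sets borel" using N by auto
  have sc: "AE x in lborel. q *\<^sub>R (x - norm x *\<^sub>R e) + b \<notin> N" if q: "q \<noteq> 0" for q
  proof -
    let ?N = "{y. q *\<^sub>R y + b \<in> N}"
    have "?N \<subseteq> (\<lambda>z. (1/q) *\<^sub>R (z - b)) ` N"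
    proof
      fix y assume "y \<in> ?N"
      then have "y = (1/q) *\<^sub>R ((q *\<^sub>R y + b) - b)" "q *\<^sub>R y + b \<in> N" using q by auto
      then show "y \<in> (\<lambda>z. (1/q) *\<^sub>R (z - b)) ` N" by blast
    qed
    moreover have "negligible ((\<lambda>z. (1/q) *\<^sub>R (z - b)) ` N)"
      by (rule negligible_differentiable_image_negligible[OF order_refl null_sets_imp_negligible[OF N]])
        (rule differentiable_on_scaleR differentiable_on_diff differentiable_on_const differentiable_on_ident)+
    ultimately have "negligible ?N" by (rule negligible_subset[rotated])
    moreover have "?N \<in> sets borel" by measurable
    ultimately have "?N \<in> null_sets lborel"
      by (simp add: negligible_iff_null_sets null_sets_completion_iff)
    from AE_diff_norm_notin_null[OF d e this] show ?thesis by simp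
  qed
  have "AE q::real in lborel. q \<noteq> 0" by (rule AE_lborel_singleton)
  then have "AE q::real in lborel. AE x in lborel. q *\<^sub>R (x - norm x *\<^sub>R e) + b \<notin> N"
    by eventually_elim (rule sc)
  then have "AE x in lborel. AE q::real in lborel. q *\<^sub>R (x - norm x *\<^sub>R e) + b \<notin> N"
    by (subst (asm) lborel_pair.AE_commute) measurable
  then have "AE x in lborel. x \<noteq> 0 \<longrightarrow> (AE q::real in lborel. q *\<^sub>R (sgn x - e) + b \<notin> N)"
  proof eventually_elim
    case (elim x)
    show ?case
    proof
      assume x: "x \<noteq> 0"
      have "AE q::real in lborel. (0 + (1 / norm x) * q) *\<^sub>R (x - norm x *\<^sub>R e) + b \<notin> N"
        by (rule AE_borel_affine[OF _ _ elim]) (use x in auto)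
      then show "AE q::real in lborel. q *\<^sub>R (sgn x - e) + b \<notin> N"
        by eventually_elim (use x in \<open>simp add: sgn_div_norm scaleR_diff_right field_simps\<close>)
    qed
  qed
  \<comment> \<open>Written as the vanishing of a measure, the inner statement is a measurable
    predicate of the direction, as \<open>AE_sphere_borelI\<close> requires.\<close>
  then have *: "AE x in lborel. x \<noteq> 0 \<longrightarrow> emeasure lborel {q::real. q *\<^sub>R (sgn x - e) + b \<in> N} = 0"
    by eventually_elim (simp add: AE_iff_measurable[OF _ refl])
  have "AE w in sphere_borel. emeasure lborel {q::real. q *\<^sub>R (w - e) + b \<in> N} = 0"
    using * by (intro AE_sphere_borelI) measurable
  then show ?thesis
    by eventually_elim (simp add: AE_iff_measurable[OF _ refl])
qed

text \<open>A property valid almost everywhere on the cube is copied to every lattice translate, and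
  countably many translates cover the space.\<close>

lemma torus_null_imp_lborel_null:
  fixes P :: "real^'n \<Rightarrow> bool"
  assumes [measurable]: "Measurable.pred borel P" and "AE x in torus_measure. P x"
  shows "{x. \<not> P (fracv x)} \<in> null_sets lborel"
proof -
  let ?k = "\<lambda>k::int^'n. (\<chi> i. of_int (k $ i)) :: real^'n"
  have per: "lattice_periodic (\<lambda>x. P (fracv x))" by (rule lattice_periodic_compose_fracv)
  have "AE x in distr torus_measure borel (\<lambda>x. fracv (x + 0)). P x"
    unfolding distr_torus_translation by fact
  then have "AE x in torus_measure. P (fracv x)" by (subst (asm) AE_distr_iff) auto
  then have "AE x in lborel. x \<in> unit_cube \<longrightarrow> P (fracv x)"
    unfolding torus_measure_def
    by (subst (asm) AE_distr_iff) (auto simp: AE_restrict_space_iff measurable_restrict_space1)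
  then have 0: "AE x in distr lborel borel ((+) c). x \<in> unit_cube \<longrightarrow> P (fracv x)" for c :: "real^'n"
    by (simp only: lborel_distr_plus)
  have "AE x in lborel. c + x \<in> unit_cube \<longrightarrow> P (fracv (c + x))" for c :: "real^'n"
    using 0[of c] by (subst (asm) AE_distr_iff) auto
  then have "AE x in lborel. \<forall>k. ?k k + x \<in> unit_cube \<longrightarrow> P (fracv (?k k + x))"
    by (subst AE_all_countable) auto
  then have "AE x in lborel. P (fracv x)"
  proof eventually_elim
    case (elim x)
    let ?m = "(\<chi> i. - \<lfloor>x $ i\<rfloor>) :: int^'n"
    have eq: "?k ?m + x = fracv x" by (simp add: vec_eq_iff fracv_def frac_def)
    have "P (fracv (fracv x))" using elim[THEN spec, of ?m] unfolding eq using fracv_mem[of x] by blast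
    then show ?case using lattice_periodic_fracv[OF per, of x] by simp
  qed
  then show ?thesis by (simp add: AE_iff_null_sets)
qed

subsection \<open>A duality estimate\<close>

lemma integrable_bounded_finite:
  fixes f :: "'a \<Rightarrow> real"
  assumes "finite_measure M" "f \<in> borel_measurable M" "\<And>x. \<bar>f x\<bar> \<le> c"
  shows "integrable M f"
  using finite_measure.integrable_const_bound[of M f c] assms by simp

lemma integral_abs_le_const:
  fixes f :: "'a \<Rightarrow> real"
  assumes "finite_measure M" "\<And>x. \<bar>f x\<bar> \<le> c"
  shows "\<bar>\<integral>x. f x \<partial>M\<bar> \<le> c * measure M (space M)"
proof (cases "integrable M f")
  case True
  interpret finite_measure M by fact
  have "\<bar>\<integral>x. f x \<partial>M\<bar> \<le> (\<integral>x. \<bar>f x\<bar> \<partial>M)" by (rule integral_abs_bound)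
  also have "\<dots> \<le> (\<integral>x. c \<partial>M)"
    using True assms(2) by (intro integral_mono) auto
  finally show ?thesis by (simp add: mult.commute)
next
  case False
  have "0 \<le> c" using assms(2) by (meson abs_ge_zero order_trans)
  then show ?thesis using False by (simp add: not_integrable_integral_eq)
qed

lemma integral_pair_bounded:
  fixes f :: "'a \<times> 'b \<Rightarrow> real"
  assumes "finite_measure M" "finite_measure N" "f \<in> borel_measurable (M \<Otimes>\<^sub>M N)" "\<And>p. \<bar>f p\<bar> \<le> c"
  shows "(\<integral>x. \<integral>y. f (x, y) \<partial>N \<partial>M) = (\<integral>p. f p \<partial>(M \<Otimes>\<^sub>M N))"
proof -
  interpret M: finite_measure M by fact
  interpret N: finite_measure N by fact
  interpret pair_sigma_finite M N ..
  have i: "integrable (M \<Otimes>\<^sub>M N) f"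
    by (rule integrable_bounded_finite[OF finite_measure_pair_measure[OF assms(2,1)] assms(3,4)])
  then show ?thesis by (rule integral_fst')
qed

lemma Fubini_bounded:
  fixes f :: "'a \<Rightarrow> 'b \<Rightarrow> real"
  assumes "finite_measure M" "finite_measure N" "(\<lambda>(x, y). f x y) \<in> borel_measurable (M \<Otimes>\<^sub>M N)"
    "\<And>x y. \<bar>f x y\<bar> \<le> c"
  shows "(\<integral>x. \<integral>y. f x y \<partial>N \<partial>M) = (\<integral>y. \<integral>x. f x y \<partial>M \<partial>N)"
proof -
  interpret M: finite_measure M by fact
  interpret N: finite_measure N by fact
  interpret pair_sigma_finite M N ..
  have "integrable (M \<Otimes>\<^sub>M N) (\<lambda>(x, y). f x y)"
    by (rule integrable_bounded_finite[OF finite_measure_pair_measure[OF assms(2,1)] assms(3)])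
      (use assms(4) in auto)
  then show ?thesis by (rule Fubini_integral[symmetric])
qed

text \<open>The integral of \<open>(f - t * g)\<^sup>2\<close> is a nonnegative quadratic polynomial
  in \<open>t\<close>; evaluating it at its minimum gives the inequality.\<close>

lemma Cauchy_Schwarz_bounded:
  fixes f g :: "'a \<Rightarrow> real"
  assumes fin: "finite_measure M" and f[measurable]: "f \<in> borel_measurable M" "\<And>x. \<bar>f x\<bar> \<le> c"
    and g[measurable]: "g \<in> borel_measurable M" "\<And>x. \<bar>g x\<bar> \<le> c'"
  shows "(\<integral>x. f x * g x \<partial>M)\<^sup>2 \<le> (\<integral>x. (f x)\<^sup>2 \<partial>M) * (\<integral>x. (g x)\<^sup>2 \<partial>M)"
proof -
  have c: "0 \<le> c" "0 \<le> c'" using f(2) g(2) by (meson abs_ge_zero order_trans)+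
  have fg: "integrable M (\<lambda>x. f x * g x)"
    using c by (intro integrable_bounded_finite[OF fin, of _ "c * c'"]) (auto simp: abs_mult intro!: mult_mono f g)
  have "\<bar>(f x)\<^sup>2\<bar> \<le> c * c" for x
    using mult_mono[OF f(2) f(2), of x x] c by (simp add: power2_eq_square abs_mult)
  then have ff: "integrable M (\<lambda>x. (f x)\<^sup>2)" by (intro integrable_bounded_finite[OF fin]) auto
  have "\<bar>(g x)\<^sup>2\<bar> \<le> c' * c'" for x
    using mult_mono[OF g(2) g(2), of x x] c by (simp add: power2_eq_square abs_mult)
  then have gg: "integrable M (\<lambda>x. (g x)\<^sup>2)" by (intro integrable_bounded_finite[OF fin]) auto
  let ?F = "\<integral>x. (f x)\<^sup>2 \<partial>M" and ?G = "\<integral>x. (g x)\<^sup>2 \<partial>M" and ?I = "\<integral>x. f x * g x \<partial>M"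
  have q: "0 \<le> ?F - 2 * t * ?I + t\<^sup>2 * ?G" for t
  proof -
    have "0 \<le> (\<integral>x. (f x - t * g x)\<^sup>2 \<partial>M)" by simp
    also have "\<dots> = (\<integral>x. (f x)\<^sup>2 - 2 * t * (f x * g x) + t\<^sup>2 * (g x)\<^sup>2 \<partial>M)"
      by (simp add: power2_eq_square algebra_simps)
    also have "\<dots> = ?F - 2 * t * ?I + t\<^sup>2 * ?G" using fg ff gg by simp
    finally show ?thesis .
  qed
  have G: "0 \<le> ?G" by simp
  show ?thesis
  proof (cases "?G = 0")
    case True
    have "?I = 0"
    proof (rule ccontr)
      assume "?I \<noteq> 0"
      \<comment> \<open>For \<open>?G = 0\<close> the polynomial is affine, and this
        \<open>t\<close> would give it the value \<open>-1\<close>.\<close>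
      with q[of "(?F + 1) / (2 * ?I)"] True show False by simp
    qed
    then show ?thesis using True by simp
  next
    case False
    have "0 \<le> (?F - 2 * (?I / ?G) * ?I + (?I / ?G)\<^sup>2 * ?G) * ?G"
      using q[of "?I / ?G"] G by (rule mult_nonneg_nonneg)
    also have "\<dots> = ?F * ?G - ?I\<^sup>2" using False by (simp add: field_simps power2_eq_square)
    finally show ?thesis by simp
  qed
qed

text \<open>The TT* method: a translation in \<open>x\<close> moves the averaging from
  \<open>H\<close> to \<open>u\<close>, Cauchy-Schwarz splits off the norm of \<open>H\<close>, and
  the norm of the transposed average of \<open>u\<close> is expanded over two copies
  \<open>a\<close>, \<open>a'\<close> of the averaging variable.\<close>

lemma torus_duality_square:
  fixes k :: "'a \<times> 'b \<Rightarrow> real" and v :: "'a \<times> 'b \<Rightarrow> real^'n"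
    and u :: "'a \<times> (real^'n) \<Rightarrow> real" and H :: "'b \<times> (real^'n) \<Rightarrow> real"
  assumes A: "finite_measure A" and B: "finite_measure B"
    and k[measurable]: "k \<in> borel_measurable (A \<Otimes>\<^sub>M B)" and v[measurable]: "v \<in> borel_measurable (A \<Otimes>\<^sub>M B)"
    and u[measurable]: "u \<in> borel_measurable (A \<Otimes>\<^sub>M borel)" and H[measurable]: "H \<in> borel_measurable (B \<Otimes>\<^sub>M borel)"
    and kb: "\<And>p. \<bar>k p\<bar> \<le> ck" and ub: "\<And>p. \<bar>u p\<bar> \<le> cu" and Hb: "\<And>p. \<bar>H p\<bar> \<le> cH"
    and up: "\<And>a. lattice_periodic (\<lambda>x. u (a, x))" and Hp: "\<And>b. lattice_periodic (\<lambda>x. H (b, x))"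
  shows "(\<integral>a. \<integral>x. u (a, x) * (\<integral>b. k (a, b) * H (b, x + v (a, b)) \<partial>B) \<partial>torus_measure \<partial>A)\<^sup>2
    \<le> (\<integral>b. \<integral>x. (H (b, x))\<^sup>2 \<partial>torus_measure \<partial>B) *
       (\<integral>b. \<integral>a. \<integral>a'. k (a, b) * k (a', b) *
          (\<integral>x. u (a, x) * u (a', x + v (a, b) - v (a', b)) \<partial>torus_measure) \<partial>A \<partial>A \<partial>B)"
proof -
  interpret A: finite_measure A by fact
  interpret B: finite_measure B by fact
  have AA: "finite_measure (A \<Otimes>\<^sub>M A)" and BT: "finite_measure (B \<Otimes>\<^sub>M (torus_measure :: (real^'n) measure))"
    by (intro finite_measure_pair_measure A B finite_measure_torus_measure)+
  have [measurable_cong]: "sets (B \<Otimes>\<^sub>M (torus_measure :: (real^'n) measure)) = sets (B \<Otimes>\<^sub>M borel)"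
     "sets (A \<Otimes>\<^sub>M (torus_measure :: (real^'n) measure)) = sets (A \<Otimes>\<^sub>M borel)"
    by (intro sets_pair_measure_cong; simp)+
  have T: "finite_measure (torus_measure :: (real^'n) measure)" by (rule finite_measure_torus_measure)
  have c: "0 \<le> ck" "0 \<le> cu" "0 \<le> cH" using kb ub Hb by (meson abs_ge_zero order_trans)+
  \<comment> \<open>The transpose of the averaging operator, applied to \<open>u\<close>.\<close>
  define W where "W p = (\<integral>a. k (a, fst p) * u (a, snd p - v (a, fst p)) \<partial>A)" for p
  have W[measurable]: "W \<in> borel_measurable (B \<Otimes>\<^sub>M borel)" unfolding W_def by measurable
  have kub: "\<bar>k p * u q\<bar> \<le> ck * cu" for p q unfolding abs_mult by (intro mult_mono kb ub c) auto
  have Wb: "\<bar>W p\<bar> \<le> ck * cu * measure A (space A)" for p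
    unfolding W_def by (intro integral_abs_le_const[OF A] kub)
  have Hper: "H (b, x + y - y) = H (b, x)" for b x y by simp
  have kuH: "\<bar>u q * (k p * H r)\<bar> \<le> cu * (ck * cH)" for p q r
    unfolding abs_mult by (intro mult_mono kb ub Hb c mult_nonneg_nonneg) auto
  have "(\<integral>a. \<integral>x. u (a, x) * (\<integral>b. k (a, b) * H (b, x + v (a, b)) \<partial>B) \<partial>torus_measure \<partial>A)
      = (\<integral>a. \<integral>x. \<integral>b. u (a, x) * (k (a, b) * H (b, x + v (a, b))) \<partial>B \<partial>torus_measure \<partial>A)"
    by (simp only: integral_mult_right_zero)
  also have "\<dots> = (\<integral>a. \<integral>b. \<integral>x. u (a, x) * (k (a, b) * H (b, x + v (a, b))) \<partial>torus_measure \<partial>B \<partial>A)"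
  proof (rule Bochner_Integration.integral_cong[OF refl])
    fix a assume [measurable]: "a \<in> space A"
    show "(\<integral>x. \<integral>b. u (a, x) * (k (a, b) * H (b, x + v (a, b))) \<partial>B \<partial>torus_measure) =
      (\<integral>b. \<integral>x. u (a, x) * (k (a, b) * H (b, x + v (a, b))) \<partial>torus_measure \<partial>B)"
      by (rule Fubini_bounded[OF T B _ kuH]) measurable
  qed
  also have "\<dots> = (\<integral>a. \<integral>b. \<integral>x. u (a, x - v (a, b)) * (k (a, b) * H (b, x)) \<partial>torus_measure \<partial>B \<partial>A)"
  proof (rule Bochner_Integration.integral_cong[OF refl], rule Bochner_Integration.integral_cong[OF refl])
    fix a b assume [measurable]: "a \<in> space A" "b \<in> space B"
    have "lattice_periodic (\<lambda>x. u (a, x - v (a, b)) * (k (a, b) * H (b, x)))"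
      using up[of a] Hp[of b] unfolding lattice_periodic_def by (metis add_diff_eq diff_add_eq)
    from integral_torus_translation[OF _ this, of "v (a, b)"]
    show "(\<integral>x. u (a, x) * (k (a, b) * H (b, x + v (a, b))) \<partial>torus_measure) =
       (\<integral>x. u (a, x - v (a, b)) * (k (a, b) * H (b, x)) \<partial>torus_measure)" by simp
  qed
  also have "\<dots> = (\<integral>b. \<integral>a. \<integral>x. u (a, x - v (a, b)) * (k (a, b) * H (b, x)) \<partial>torus_measure \<partial>A \<partial>B)"
    by (rule Fubini_bounded[OF A B _ integral_abs_le_const[OF T kuH]]) measurable
  also have "\<dots> = (\<integral>b. \<integral>x. \<integral>a. u (a, x - v (a, b)) * (k (a, b) * H (b, x)) \<partial>A \<partial>torus_measure \<partial>B)"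
  proof (rule Bochner_Integration.integral_cong[OF refl])
    fix b assume [measurable]: "b \<in> space B"
    show "(\<integral>a. \<integral>x. u (a, x - v (a, b)) * (k (a, b) * H (b, x)) \<partial>torus_measure \<partial>A) =
      (\<integral>x. \<integral>a. u (a, x - v (a, b)) * (k (a, b) * H (b, x)) \<partial>A \<partial>torus_measure)"
      by (rule Fubini_bounded[OF A T _ kuH]) measurable
  qed
  also have "\<dots> = (\<integral>b. \<integral>x. H (b, x) * W (b, x) \<partial>torus_measure \<partial>B)"
    by (simp add: W_def mult_ac flip: integral_mult_right_zero)
  also have "\<dots> = (\<integral>p. H p * W p \<partial>(B \<Otimes>\<^sub>M torus_measure))"
    using mult_mono[OF Hb Wb] c by (intro integral_pair_bounded[OF B T, of _ "cH * (ck * cu * measure A (space A))"]) (auto simp: abs_mult)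
  finally have 1: "(\<integral>a. \<integral>x. u (a, x) * (\<integral>b. k (a, b) * H (b, x + v (a, b)) \<partial>B) \<partial>torus_measure \<partial>A) =
      (\<integral>p. H p * W p \<partial>(B \<Otimes>\<^sub>M torus_measure))" .
  have sq: "\<bar>h\<^sup>2\<bar> \<le> c * c" if "\<bar>h\<bar> \<le> c" for h c :: real
  proof -
    have "\<bar>h\<^sup>2\<bar> = \<bar>h\<bar> * \<bar>h\<bar>" by (simp add: power2_eq_square)
    also have "\<dots> \<le> c * c" using that abs_ge_zero[of h] by (intro mult_mono) linarith+
    finally show ?thesis .
  qed
  have CS: "(\<integral>p. H p * W p \<partial>(B \<Otimes>\<^sub>M torus_measure))\<^sup>2 \<le>
      (\<integral>p. (H p)\<^sup>2 \<partial>(B \<Otimes>\<^sub>M torus_measure)) * (\<integral>p. (W p)\<^sup>2 \<partial>(B \<Otimes>\<^sub>M torus_measure))"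
    by (rule Cauchy_Schwarz_bounded[OF BT _ Hb _ Wb]) measurable
  have HH: "(\<integral>p. (H p)\<^sup>2 \<partial>(B \<Otimes>\<^sub>M torus_measure)) = (\<integral>b. \<integral>x. (H (b, x))\<^sup>2 \<partial>torus_measure \<partial>B)"
    using integral_pair_bounded[OF B T, of "\<lambda>p. (H p)\<^sup>2", OF _ sq[OF Hb]] by simp
  have WW: "(\<integral>p. (W p)\<^sup>2 \<partial>(B \<Otimes>\<^sub>M torus_measure)) = (\<integral>b. \<integral>x. (W (b, x))\<^sup>2 \<partial>torus_measure \<partial>B)"
    using integral_pair_bounded[OF B T, of "\<lambda>p. (W p)\<^sup>2", OF _ sq[OF Wb]] by simp
  have kk: "\<bar>(k p * u q) * (k p' * u q')\<bar> \<le> (ck * cu) * (ck * cu)" for p q p' q'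
    unfolding abs_mult[of "k p * u q"] by (intro mult_mono kub) (auto simp: c)
  have "(\<integral>x. (W (b, x))\<^sup>2 \<partial>torus_measure) =
      (\<integral>a. \<integral>a'. k (a, b) * k (a', b) *
          (\<integral>x. u (a, x) * u (a', x + v (a, b) - v (a', b)) \<partial>torus_measure) \<partial>A \<partial>A)"
    if [measurable]: "b \<in> space B" for b
  proof -
    have "(\<integral>x. (W (b, x))\<^sup>2 \<partial>torus_measure) = (\<integral>x. \<integral>a. \<integral>a'. (k (a, b) * u (a, x - v (a, b))) *
        (k (a', b) * u (a', x - v (a', b))) \<partial>A \<partial>A \<partial>torus_measure)"
      by (simp add: W_def power2_eq_square)
    also have "\<dots> = (\<integral>a. \<integral>x. \<integral>a'. (k (a, b) * u (a, x - v (a, b))) *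
        (k (a', b) * u (a', x - v (a', b))) \<partial>A \<partial>torus_measure \<partial>A)"
      by (rule Fubini_bounded[OF T A _ integral_abs_le_const[OF A kk]]) measurable
    also have "\<dots> = (\<integral>a. \<integral>a'. \<integral>x. (k (a, b) * u (a, x - v (a, b))) *
        (k (a', b) * u (a', x - v (a', b))) \<partial>torus_measure \<partial>A \<partial>A)"
    proof (rule Bochner_Integration.integral_cong[OF refl])
      fix a assume [measurable]: "a \<in> space A"
      show "(\<integral>x. \<integral>a'. (k (a, b) * u (a, x - v (a, b))) * (k (a', b) * u (a', x - v (a', b))) \<partial>A \<partial>torus_measure)
       = (\<integral>a'. \<integral>x. (k (a, b) * u (a, x - v (a, b))) * (k (a', b) * u (a', x - v (a', b))) \<partial>torus_measure \<partial>A)"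
        by (rule Fubini_bounded[OF T A _ kk]) measurable
    qed
    also have "\<dots> = (\<integral>a. \<integral>a'. k (a, b) * k (a', b) *
          (\<integral>x. u (a, x) * u (a', x + v (a, b) - v (a', b)) \<partial>torus_measure) \<partial>A \<partial>A)"
    proof (intro Bochner_Integration.integral_cong[OF refl])
      fix a a' assume [measurable]: "a \<in> space A" "a' \<in> space A"
      have "lattice_periodic (\<lambda>x. u (a, x - v (a, b)) * u (a', x - v (a', b)))"
        using up[of a] up[of a'] unfolding lattice_periodic_def by (metis add_diff_eq diff_add_eq)
      \<comment> \<open>Translating by \<open>v (a, b)\<close> puts the first factor at
        \<open>x\<close>, so that only the difference of the two displacements remains.\<close>
      from integral_torus_translation[OF _ this, of "v (a, b)"]
      have "(\<integral>x. u (a, x - v (a, b)) * u (a', x - v (a', b)) \<partial>torus_measure) =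
        (\<integral>x. u (a, x) * u (a', x + v (a, b) - v (a', b)) \<partial>torus_measure)" by simp
      moreover have "(\<integral>x. (k (a, b) * u (a, x - v (a, b))) * (k (a', b) * u (a', x - v (a', b))) \<partial>torus_measure)
         = (\<integral>x. (k (a, b) * k (a', b)) * (u (a, x - v (a, b)) * u (a', x - v (a', b))) \<partial>torus_measure)"
        by (simp add: mult_ac)
      ultimately show "(\<integral>x. (k (a, b) * u (a, x - v (a, b))) * (k (a', b) * u (a', x - v (a', b))) \<partial>torus_measure)
         = k (a, b) * k (a', b) * (\<integral>x. u (a, x) * u (a', x + v (a, b) - v (a', b)) \<partial>torus_measure)" by simp
    qed
    finally show ?thesis .
  qed
  then have "(\<integral>b. \<integral>x. (W (b, x))\<^sup>2 \<partial>torus_measure \<partial>B) =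
      (\<integral>b. \<integral>a. \<integral>a'. k (a, b) * k (a', b) *
          (\<integral>x. u (a, x) * u (a', x + v (a, b) - v (a', b)) \<partial>torus_measure) \<partial>A \<partial>A \<partial>B)"
    by (intro Bochner_Integration.integral_cong[OF refl])
  then show ?thesis using CS unfolding 1 HH WW by simp
qed

subsection \<open>Velocity averaging\<close>

text \<open>A finite measure with the null sets of Lebesgue measure on the half-line: compactness is
  obtained for all times in one go, and statements for almost every \<open>t \<ge> 0\<close> can be
  read off.\<close>

definition time_measure :: "real measure" where
  "time_measure = density lborel (\<lambda>t. ennreal (exp (- t)) * indicator {0..} t)"

lemma sets_time_measure[measurable_cong, simp]: "sets time_measure = sets borel"
  by (simp add: time_measure_def)

lemma space_time_measure[simp]: "space time_measure = UNIV"
  by (simp add: time_measure_def)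

lemma finite_measure_time_measure: "finite_measure time_measure"
proof
  have "emeasure time_measure (space time_measure) = (\<integral>\<^sup>+t. ennreal (exp (- t)) * indicator {0..} t \<partial>lborel)"
    unfolding time_measure_def by (subst emeasure_density) auto
  also have "\<dots> = ennreal (0 - (- exp (- 0)))"
  proof (rule nn_integral_FTC_atLeast[where F="\<lambda>t. - exp (- t)"])
    show "((\<lambda>t::real. - exp (- t)) \<longlongrightarrow> 0) at_top"
      using tendsto_minus[OF filterlim_compose[OF exp_at_bot filterlim_uminus_at_bot_at_top]] by simp
  qed (auto intro!: derivative_eq_intros)
  finally show "emeasure time_measure (space time_measure) \<noteq> \<infinity>" by simp
qed

interpretation time: finite_measure time_measure by (rule finite_measure_time_measure)

lemma AE_time_measureI: "(AE t in lborel. P t) \<Longrightarrow> AE t in time_measure. P t"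
  unfolding time_measure_def by (subst AE_density) (auto elim: eventually_mono)

abbreviation velocity_time :: "(real \<times> (real^'n)) measure" where
  "velocity_time \<equiv> time_measure \<Otimes>\<^sub>M sphere_borel"

abbreviation space_time :: "(real \<times> (real^'n)) measure" where
  "space_time \<equiv> time_measure \<Otimes>\<^sub>M torus_measure"

lemma finite_measure_velocity_time: "finite_measure velocity_time"
  by (intro finite_measure_pair_measure finite_measure_time_measure finite_measure_sphere_borel)

lemma finite_measure_space_time: "finite_measure space_time"
  by (intro finite_measure_pair_measure finite_measure_time_measure finite_measure_torus_measure)

interpretation velocity_time: finite_measure velocity_time by (rule finite_measure_velocity_time)
interpretation space_time: finite_measure space_time by (rule finite_measure_space_time)

lemma sets_velocity_time[measurable_cong]: "sets velocity_time = sets (borel \<Otimes>\<^sub>M borel)"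
  by (intro sets_pair_measure_cong) simp_all

lemma sets_space_time[measurable_cong]: "sets space_time = sets (borel \<Otimes>\<^sub>M borel)"
  by (intro sets_pair_measure_cong) simp_all

text \<open>Here \<open>p = (t, x)\<close> and \<open>b = (s, w)\<close>: what arrives at
  \<open>x\<close> with velocity \<open>w\<close> was emitted at time \<open>s\<close> from
  \<open>x - \<gamma> (t - s) w\<close>. Adding a negated vector, instead of subtracting, matches
  the displacement \<open>v\<close> in \<open>torus_duality_square\<close>.\<close>

definition velocity_average ::
  "(real \<times> real \<Rightarrow> real) \<Rightarrow> real \<Rightarrow> ((real \<times> (real^'n)) \<times> (real^'n) \<Rightarrow> real) \<Rightarrow> real \<times> (real^'n) \<Rightarrow> real" where
  "velocity_average k \<gamma> H p =
     (\<integral>b. k (fst p, fst b) * H (b, snd p + - (\<gamma> * (fst p - fst b)) *\<^sub>R snd b) \<partial>velocity_time)"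

lemma velocity_average_measurable[measurable]:
  assumes [measurable]: "k \<in> borel_measurable (borel \<Otimes>\<^sub>M borel)" "H \<in> borel_measurable ((borel \<Otimes>\<^sub>M borel) \<Otimes>\<^sub>M borel)"
  shows "velocity_average k \<gamma> H \<in> borel_measurable (borel \<Otimes>\<^sub>M borel)"
  unfolding velocity_average_def[abs_def] by measurable

lemma velocity_average_bound:
  fixes \<gamma> :: real and H :: "(real \<times> (real^'n)) \<times> (real^'n) \<Rightarrow> real"
  assumes "\<And>p. \<bar>k p\<bar> \<le> 1" "\<And>p. \<bar>H p\<bar> \<le> c"
  shows "\<bar>velocity_average k \<gamma> H p\<bar> \<le> c * measure (velocity_time :: (real \<times> (real^'n)) measure) (space velocity_time)"
  unfolding velocity_average_def
proof (rule integral_abs_le_const[OF finite_measure_velocity_time])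
  show "\<bar>k (fst p, fst b) * H (b, snd p + - (\<gamma> * (fst p - fst b)) *\<^sub>R snd b)\<bar> \<le> c" for b
    using mult_mono[OF assms(1)[of "(fst p, fst b)"] assms(2)[of "(b, snd p + - (\<gamma> * (fst p - fst b)) *\<^sub>R snd b)"]]
    by (simp add: abs_mult)
qed

lemma velocity_average_periodic:
  assumes "\<And>b. lattice_periodic (\<lambda>x. H (b, x))"
  shows "lattice_periodic (\<lambda>x. velocity_average k \<gamma> H (t, x))"
  unfolding lattice_periodic_def
proof (intro allI impI)
  fix x l :: "real^'a" assume l: "\<forall>i. l $ i \<in> \<int>"
  have "H (b, x + l + v) = H (b, x + v)" for b v
    using assms[of b, unfolded lattice_periodic_def, rule_format, of l "x + v"] l by (simp add: algebra_simps)
  then show "velocity_average k \<gamma> H (t, x + l) = velocity_average k \<gamma> H (t, x)"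
    unfolding velocity_average_def by (simp only: fst_conv snd_conv)
qed

lemma velocity_average_diff:
  fixes H H' :: "(real \<times> (real^'n)) \<times> (real^'n) \<Rightarrow> real"
  assumes [measurable]: "k \<in> borel_measurable (borel \<Otimes>\<^sub>M borel)" and k: "\<And>p. \<bar>k p\<bar> \<le> 1"
    and H: "H \<in> borel_measurable ((borel \<Otimes>\<^sub>M borel) \<Otimes>\<^sub>M borel)" "\<And>p. \<bar>H p\<bar> \<le> c"
    and H': "H' \<in> borel_measurable ((borel \<Otimes>\<^sub>M borel) \<Otimes>\<^sub>M borel)" "\<And>p. \<bar>H' p\<bar> \<le> c"
  shows "velocity_average k \<gamma> H p - velocity_average k \<gamma> H' p = velocity_average k \<gamma> (\<lambda>q. H q - H' q) p"
proof -
  have "integrable velocity_time (\<lambda>b. k (fst p, fst b) * H (b, snd p + - (\<gamma> * (fst p - fst b)) *\<^sub>R snd b))"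
    if [measurable]: "H \<in> borel_measurable ((borel \<Otimes>\<^sub>M borel) \<Otimes>\<^sub>M borel)" and b: "\<And>p. \<bar>H p\<bar> \<le> c"
    for H :: "(real \<times> (real^'n)) \<times> (real^'n) \<Rightarrow> real"
  proof (rule integrable_bounded_finite[OF finite_measure_velocity_time])
    show "\<bar>k (fst p, fst b) * H (b, snd p + - (\<gamma> * (fst p - fst b)) *\<^sub>R snd b)\<bar> \<le> 1 * c" for b
      unfolding abs_mult by (intro mult_mono k b) auto
  qed measurable
  from this[OF H] this[OF H'] show ?thesis
    unfolding velocity_average_def by (simp add: right_diff_distrib flip: Bochner_Integration.integral_diff)
qed

text \<open>Applying the duality estimate twice bounds the fourth power of the square norm of a velocity
  average by an integral over pairs of characteristics that meet at a common time \<open>a\<close>.\<close>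

lemma velocity_average_double_duality:
  fixes \<gamma> :: real and H :: "(real \<times> (real^'n)) \<times> (real^'n) \<Rightarrow> real"
  assumes k[measurable]: "k \<in> borel_measurable (borel \<Otimes>\<^sub>M borel)" and kb: "\<And>p. \<bar>k p\<bar> \<le> 1"
    and H[measurable]: "H \<in> borel_measurable ((borel \<Otimes>\<^sub>M borel) \<Otimes>\<^sub>M borel)" and Hb: "\<And>p. \<bar>H p\<bar> \<le> 2"
    and per: "\<And>b. lattice_periodic (\<lambda>x. H (b, x))"
  defines "U \<equiv> velocity_average k \<gamma> H"
  defines "\<mu> \<equiv> measure (velocity_time :: (real \<times> (real^'n)) measure) (space velocity_time)"
  defines "\<nu> \<equiv> measure (space_time :: (real \<times> (real^'n)) measure) (space space_time)"
  defines "\<tau> \<equiv> measure (torus_measure :: (real^'n) measure) (space torus_measure)"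
  shows "(\<integral>p. (U p)\<^sup>2 \<partial>space_time) ^ 4 \<le> (4 * \<tau> * \<mu>)\<^sup>2 * ((2 * \<mu>)\<^sup>2 * \<nu>) *
    \<bar>\<integral>a. \<integral>p. \<integral>p'. (k (fst p, fst (snd p)) * k (a, fst (snd p))) * (k (fst p', fst (snd p')) * k (a, fst (snd p'))) *
      (\<integral>x. U (fst p, x) * U (fst p', x + - (\<gamma> * (fst p - a)) *\<^sub>R snd (snd p) - - (\<gamma> * (fst p' - a)) *\<^sub>R snd (snd p'))
       \<partial>torus_measure) \<partial>(time_measure \<Otimes>\<^sub>M velocity_time) \<partial>(time_measure \<Otimes>\<^sub>M velocity_time) \<partial>time_measure\<bar>"
proof -
  note fin = finite_measure_time_measure finite_measure_velocity_time finite_measure_space_time finite_measure_torus_measure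
  let ?T = "time_measure" and ?B = "velocity_time :: (real \<times> (real^'n)) measure"
  let ?v = "\<lambda>p::real \<times> real \<times> (real^'n). - (\<gamma> * (fst p - fst (snd p))) *\<^sub>R snd (snd p)"
  let ?w = "\<lambda>q::(real \<times> real \<times> (real^'n)) \<times> real. - (\<gamma> * (fst (fst q) - snd q)) *\<^sub>R snd (snd (fst q))"
  let ?kk = "\<lambda>q::(real \<times> real \<times> (real^'n)) \<times> real. k (fst (fst q), fst (snd (fst q))) * k (snd q, fst (snd (fst q)))"
  have U[measurable]: "U \<in> borel_measurable (borel \<Otimes>\<^sub>M borel)" unfolding U_def by measurable
  have Ub: "\<bar>U p\<bar> \<le> 2 * \<mu>" for p
    unfolding U_def \<mu>_def by (rule velocity_average_bound[OF kb Hb])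
  have Up: "lattice_periodic (\<lambda>x. U (t, x))" for t unfolding U_def by (rule velocity_average_periodic[OF per])
  have \<mu>: "0 \<le> \<mu>" and \<tau>: "0 \<le> \<tau>" and \<nu>: "0 \<le> \<nu>" unfolding \<mu>_def \<tau>_def \<nu>_def by auto
  have kkb: "\<bar>k p * k q\<bar> \<le> 1" for p q
    using mult_mono[OF kb[of p] kb[of q]] by (simp add: abs_mult)
  have UUb: "\<bar>U p * U q\<bar> \<le> 2 * \<mu> * (2 * \<mu>)" for p q
    unfolding abs_mult using \<mu> by (intro mult_mono Ub) auto
  define y where "y = (\<integral>p. (U p)\<^sup>2 \<partial>space_time)"
  define Q1 where "Q1 = (\<integral>b. \<integral>a. \<integral>a'. k (a, fst b) * k (a', fst b) *
     (\<integral>x. U (a, x) * U (a', x + ?v (a, b) - ?v (a', b)) \<partial>torus_measure) \<partial>?T \<partial>?T \<partial>?B)"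
  define Q2 where "Q2 = (\<integral>a. \<integral>p. \<integral>p'. ?kk (p, a) * ?kk (p', a) *
      (\<integral>x. U (fst p, x) * U (fst p', x + ?w (p, a) - ?w (p', a))
       \<partial>torus_measure) \<partial>(?T \<Otimes>\<^sub>M ?B) \<partial>(?T \<Otimes>\<^sub>M ?B) \<partial>?T)"
  have y_iter: "y = (\<integral>a. \<integral>x. U (a, x) * U (a, x) \<partial>torus_measure \<partial>?T)"
    unfolding y_def power2_eq_square
    by (rule integral_pair_bounded[OF fin(1,4) _ UUb, symmetric]) measurable
  have y0: "0 \<le> y" unfolding y_def by simp
  have yb: "y \<le> (2 * \<mu>)\<^sup>2 * \<nu>"
  proof -
    have "\<bar>y\<bar> \<le> (2 * \<mu> * (2 * \<mu>)) * \<nu>"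
      unfolding y_def \<nu>_def power2_eq_square by (rule integral_abs_le_const[OF fin(3) UUb])
    then show ?thesis by (simp add: power2_eq_square)
  qed
  have y_eq: "y = (\<integral>a. \<integral>x. U (a, x) * (\<integral>b. k (a, fst b) * H (b, x + ?v (a, b)) \<partial>?B) \<partial>torus_measure \<partial>?T)"
    unfolding y_iter by (simp add: U_def velocity_average_def)
  \<comment> \<open>First duality, with \<open>A\<close> the times and \<open>B\<close> the pairs of
    emission time and velocity. \<open>H\<close> is estimated by its bound, and \<open>Q1\<close>
    involves only \<open>U\<close> and the kernel.\<close>
  have y2: "y\<^sup>2 \<le> (\<integral>b. \<integral>x. (H (b, x))\<^sup>2 \<partial>torus_measure \<partial>?B) * Q1"
    unfolding y_eq Q1_def
    using torus_duality_square[OF fin(1,2), where k="\<lambda>p. k (fst p, fst (snd p))" and v="?v" and u=U and H=H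
      and ck=1 and cu="2*\<mu>" and cH=2, OF _ _ _ _ kb Ub Hb Up per] by simp
  have HH: "\<bar>\<integral>b. \<integral>x. (H (b, x))\<^sup>2 \<partial>torus_measure \<partial>?B\<bar> \<le> 4 * \<tau> * \<mu>"
    unfolding \<tau>_def \<mu>_def
  proof (intro integral_abs_le_const fin)
    show "\<bar>(H p)\<^sup>2\<bar> \<le> 4" for p using mult_mono[OF Hb Hb, of p p] by (simp add: power2_eq_square)
  qed
  \<comment> \<open>Both displacements belong to the same \<open>b\<close>, so the emission time
    cancels and \<open>- \<gamma> (a - a') w\<close> is left.\<close>
  have wv: "x + ?v (a, b) - ?v (a', b) = x + ?w ((a, b), a')" for x a a' b
    by (simp add: algebra_simps)
  \<comment> \<open>Read as a pairing of \<open>U\<close> with an average over \<open>a'\<close>,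
    \<open>Q1\<close> has again the shape required by \<open>torus_duality_square\<close>: the
    second copy of \<open>U\<close> takes the role of \<open>H\<close>, and \<open>a'\<close> that
    of \<open>b\<close>.\<close>
  have inner: "(\<integral>a'. k (a, fst b) * k (a', fst b) * (\<integral>x. U (a, x) * U (a', x + ?v (a, b) - ?v (a', b)) \<partial>torus_measure) \<partial>?T)
     = (\<integral>x. U (a, x) * (\<integral>a'. ?kk ((a, b), a') * U (a', x + ?w ((a, b), a')) \<partial>?T) \<partial>torus_measure)" for a b
  proof -
    have b1: "\<bar>(k (a, fst b) * k (a', fst b)) * (U (a, x) * U (a', x + ?w ((a, b), a')))\<bar> \<le> 1 * (2 * \<mu> * (2 * \<mu>))" for a' x
      unfolding abs_mult[of "k _ * k _"] by (intro mult_mono UUb kkb) auto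
    have "(\<integral>a'. k (a, fst b) * k (a', fst b) * (\<integral>x. U (a, x) * U (a', x + ?v (a, b) - ?v (a', b)) \<partial>torus_measure) \<partial>?T) =
      (\<integral>a'. \<integral>x. (k (a, fst b) * k (a', fst b)) * (U (a, x) * U (a', x + ?w ((a, b), a'))) \<partial>torus_measure \<partial>?T)"
      unfolding wv by (simp only: integral_mult_right_zero)
    also have "\<dots> = (\<integral>x. \<integral>a'. (k (a, fst b) * k (a', fst b)) * (U (a, x) * U (a', x + ?w ((a, b), a'))) \<partial>?T \<partial>torus_measure)"
      unfolding fst_conv snd_conv
      by (rule Fubini_bounded[OF fin(1,4) _ b1[unfolded fst_conv snd_conv]]) measurable
    also have "\<dots> = (\<integral>x. \<integral>a'. U (a, x) * (?kk ((a, b), a') * U (a', x + ?w ((a, b), a'))) \<partial>?T \<partial>torus_measure)"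
      by (simp only: mult_ac fst_conv snd_conv)
    also have "\<dots> = (\<integral>x. U (a, x) * (\<integral>a'. ?kk ((a, b), a') * U (a', x + ?w ((a, b), a')) \<partial>?T) \<partial>torus_measure)"
      by (simp only: integral_mult_right_zero)
    finally show ?thesis .
  qed
  define R where "R p = (\<integral>x. U (fst p, x) * (\<integral>a'. ?kk (p, a') * U (a', x + ?w (p, a')) \<partial>?T) \<partial>torus_measure)" for p
  have [measurable]: "R \<in> borel_measurable (borel \<Otimes>\<^sub>M (borel \<Otimes>\<^sub>M borel))" unfolding R_def by measurable
  have kU: "\<bar>?kk q * U q'\<bar> \<le> 1 * (2 * \<mu>)" for q q'
    unfolding abs_mult[of "k _ * k _"] by (intro mult_mono Ub kkb) auto
  have "\<bar>U q * (\<integral>a'. ?kk (p, a') * U (a', x + ?w (p, a')) \<partial>?T)\<bar> \<le> 2 * \<mu> * (1 * (2 * \<mu>) * measure ?T (space ?T))" for p q x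
    unfolding abs_mult[of "U q"]
    by (rule mult_mono[OF Ub integral_abs_le_const[OF fin(1) kU]]) (use \<mu> in auto)
  then have Rb: "\<bar>R p\<bar> \<le> 2 * \<mu> * (1 * (2 * \<mu>) * measure ?T (space ?T)) * \<tau>" for p
    unfolding R_def \<tau>_def by (rule integral_abs_le_const[OF fin(4)])
  have "Q1 = (\<integral>b. \<integral>a. R (a, b) \<partial>?T \<partial>?B)" unfolding Q1_def inner R_def by simp
  also have "\<dots> = (\<integral>a. \<integral>b. R (a, b) \<partial>?B \<partial>?T)" by (rule Fubini_bounded[OF fin(2,1) _ Rb]) measurable
  also have "\<dots> = (\<integral>p. R p \<partial>(?T \<Otimes>\<^sub>M ?B))" by (rule integral_pair_bounded[OF fin(1,2) _ Rb]) measurable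
  finally have Q1_eq: "Q1 = (\<integral>p. R p \<partial>(?T \<Otimes>\<^sub>M ?B))" .
  have Q1: "Q1\<^sup>2 \<le> y * Q2"
    unfolding y_iter Q2_def Q1_eq R_def
    using torus_duality_square[OF finite_measure_pair_measure[OF fin(2,1)] fin(1), where k="?kk" and v="?w"
      and u="\<lambda>q. U (fst (fst q), snd q)" and H=U and ck=1 and cu="2*\<mu>" and cH="2*\<mu>",
      OF _ _ _ _ kkb Ub Ub _ Up] Up by (simp add: power2_eq_square)
  have "y ^ 4 = (y\<^sup>2)\<^sup>2" by simp
  also have "\<dots> \<le> ((\<integral>b. \<integral>x. (H (b, x))\<^sup>2 \<partial>torus_measure \<partial>?B) * Q1)\<^sup>2"
    using y2 by (intro power_mono) auto
  also have "\<dots> = \<bar>\<integral>b. \<integral>x. (H (b, x))\<^sup>2 \<partial>torus_measure \<partial>?B\<bar>\<^sup>2 * Q1\<^sup>2" by (simp add: power_mult_distrib)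
  also have "\<dots> \<le> (4 * \<tau> * \<mu>)\<^sup>2 * ((2 * \<mu>)\<^sup>2 * \<nu> * \<bar>Q2\<bar>)"
  \<comment> \<open>The second duality leaves a factor \<open>y\<close> on the right, which is
    replaced by its trivial bound \<open>yb\<close>.\<close>
  proof (intro mult_mono power_mono HH)
    have "Q1\<^sup>2 \<le> y * \<bar>Q2\<bar>" using Q1 y0 by (meson abs_ge_self mult_left_mono order_trans)
    also have "\<dots> \<le> (2 * \<mu>)\<^sup>2 * \<nu> * \<bar>Q2\<bar>" using yb by (intro mult_right_mono) auto
    finally show "Q1\<^sup>2 \<le> (2 * \<mu>)\<^sup>2 * \<nu> * \<bar>Q2\<bar>" .
  qed auto
  finally show ?thesis unfolding y_def[symmetric] Q2_def by (simp add: mult.assoc)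
qed

section \<open>Pairs of characteristics that meet\<close>

text \<open>A point is \<open>(a, p, p', x)\<close> with \<open>p = (a1, s, w)\<close> and
  \<open>p' = (a2, s', w')\<close>. The two characteristics meet at time \<open>a\<close>; the
  emission times \<open>s\<close>, \<open>s'\<close> enter only through the weight.\<close>

definition pair_space :: "(real \<times> ((real \<times> real \<times> (real^'n)) \<times> ((real \<times> real \<times> (real^'n)) \<times> (real^'n)))) measure" where
  "pair_space = time_measure \<Otimes>\<^sub>M ((time_measure \<Otimes>\<^sub>M velocity_time) \<Otimes>\<^sub>M ((time_measure \<Otimes>\<^sub>M velocity_time) \<Otimes>\<^sub>M torus_measure))"

text \<open>The path starts at \<open>x\<close> at time \<open>fst p\<close>, follows the velocity
  of \<open>p\<close> to the meeting time \<open>a\<close>, and then that of \<open>p'\<close> to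
  the time \<open>fst p'\<close>. Reduction by \<open>fracv\<close> does not affect periodic
  functions and places the second point in the fundamental domain.\<close>

definition pair_endpoints ::
  "real \<Rightarrow> real \<times> ((real \<times> real \<times> (real^'n)) \<times> ((real \<times> real \<times> (real^'n)) \<times> (real^'n))) \<Rightarrow>
    (real \<times> (real^'n)) \<times> (real \<times> (real^'n))" where
  "pair_endpoints \<gamma> = (\<lambda>(a, p, p', x). ((fst p, x), (fst p',
     fracv (x + - (\<gamma> * (fst p - a)) *\<^sub>R snd (snd p) - - (\<gamma> * (fst p' - a)) *\<^sub>R snd (snd p')))))"

lemma finite_measure_pair_space: "finite_measure pair_space"
  unfolding pair_space_def
  by (intro finite_measure_pair_measure finite_measure_velocity_time finite_measure_torus_measure finite_measure_time_measure)

lemma sets_pair_space[measurable_cong]: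
  "sets pair_space = sets (borel \<Otimes>\<^sub>M ((borel \<Otimes>\<^sub>M (borel \<Otimes>\<^sub>M borel)) \<Otimes>\<^sub>M ((borel \<Otimes>\<^sub>M (borel \<Otimes>\<^sub>M borel)) \<Otimes>\<^sub>M borel)))"
  unfolding pair_space_def by (intro sets_pair_measure_cong sets_velocity_time) simp_all

lemma pair_endpoints_measurable[measurable]:
  "pair_endpoints \<gamma> \<in> measurable (borel \<Otimes>\<^sub>M ((borel \<Otimes>\<^sub>M (borel \<Otimes>\<^sub>M borel)) \<Otimes>\<^sub>M ((borel \<Otimes>\<^sub>M (borel \<Otimes>\<^sub>M borel)) \<Otimes>\<^sub>M borel)))
     ((borel \<Otimes>\<^sub>M borel) \<Otimes>\<^sub>M (borel \<Otimes>\<^sub>M borel))"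
  unfolding pair_endpoints_def by measurable

lemma nn_integral_zeroI:
  assumes "AE x in M. f x = 0" shows "(\<integral>\<^sup>+x. f x \<partial>M) = 0"
  using nn_integral_cong_AE[OF assms] by simp

lemma nn_integral_zeroD:
  assumes "(\<integral>\<^sup>+x. f x \<partial>M) = 0" "f \<in> borel_measurable M" shows "AE x in M. f x = 0"
  using assms by (simp add: nn_integral_0_iff_AE)

text \<open>Fubini with both times taken before both positions, the order in which the chord
  argument fixes its variables.\<close>

lemma sections_null:
  fixes E :: "((real \<times> (real^'n)) \<times> (real \<times> (real^'n))) set"
  assumes E: "E \<in> null_sets (space_time \<Otimes>\<^sub>M space_time)"
  shows "AE a in time_measure. AE a' in time_measure. AE x in torus_measure. AE y in torus_measure. ((a, x), (a', y)) \<notin> E"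
proof -
  have [measurable]: "E \<in> sets ((borel \<Otimes>\<^sub>M borel) \<Otimes>\<^sub>M (borel \<Otimes>\<^sub>M borel))"
    using E by (auto cong: sets_pair_measure_cong simp: sets_space_time)
  let ?f = "\<lambda>a x a' y. indicator E ((a, x), (a', y)) :: ennreal"
  interpret pair_sigma_finite torus_measure time_measure ..
  have "0 = (\<integral>\<^sup>+z. indicator E z \<partial>(space_time \<Otimes>\<^sub>M space_time))" using E by auto
  also have "\<dots> = (\<integral>\<^sup>+z. \<integral>\<^sup>+z'. indicator E (z, z') \<partial>space_time \<partial>space_time)"
    by (rule space_time.nn_integral_fst[symmetric]) measurable
  also have "\<dots> = (\<integral>\<^sup>+a. \<integral>\<^sup>+x. \<integral>\<^sup>+z'. indicator E ((a, x), z') \<partial>space_time \<partial>torus_measure \<partial>time_measure)"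
    by (rule torus.nn_integral_fst[symmetric]) measurable
  also have "\<dots> = (\<integral>\<^sup>+a. \<integral>\<^sup>+x. \<integral>\<^sup>+a'. \<integral>\<^sup>+y. ?f a x a' y \<partial>torus_measure \<partial>time_measure \<partial>torus_measure \<partial>time_measure)"
    by (intro nn_integral_cong torus.nn_integral_fst[symmetric]) measurable
  also have "\<dots> = (\<integral>\<^sup>+a. \<integral>\<^sup>+a'. \<integral>\<^sup>+x. \<integral>\<^sup>+y. ?f a x a' y \<partial>torus_measure \<partial>torus_measure \<partial>time_measure \<partial>time_measure)"
    by (intro nn_integral_cong Fubini'[symmetric]) measurable
  finally have "(\<integral>\<^sup>+a. \<integral>\<^sup>+a'. \<integral>\<^sup>+x. \<integral>\<^sup>+y. ?f a x a' y \<partial>torus_measure \<partial>torus_measure \<partial>time_measure \<partial>time_measure) = 0"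
    by simp
  then have "AE a in time_measure. (\<integral>\<^sup>+a'. \<integral>\<^sup>+x. \<integral>\<^sup>+y. ?f a x a' y \<partial>torus_measure \<partial>torus_measure \<partial>time_measure) = 0"
    by (rule nn_integral_zeroD) measurable
  then show ?thesis
  proof eventually_elim
    case (elim a)
    then have "AE a' in time_measure. (\<integral>\<^sup>+x. \<integral>\<^sup>+y. ?f a x a' y \<partial>torus_measure \<partial>torus_measure) = 0"
      by (rule nn_integral_zeroD) measurable
    then show ?case
    proof eventually_elim
      case (elim a')
      then have "AE x in torus_measure. (\<integral>\<^sup>+y. ?f a x a' y \<partial>torus_measure) = 0"
        by (rule nn_integral_zeroD) measurable
      then show ?case
      proof eventually_elim
        case (elim x)
        then have "AE y in torus_measure. ?f a x a' y = 0"
          by (rule nn_integral_zeroD) measurable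
        then show ?case by eventually_elim (simp split: split_indicator_asm)
      qed
    qed
  qed
qed

text \<open>With both end times, \<open>x\<close> and \<open>w\<close> fixed, the second endpoint is
  \<open>q (w' - w)\<close> plus a constant, where \<open>q = \<gamma> (a2 - a)\<close>. By
  \<open>AE_sphere_chord_notin_null\<close> the freedom in \<open>w'\<close> and in the meeting time
  \<open>a\<close> is enough to avoid a null set; this is why \<open>a\<close> is integrated
  innermost.\<close>

lemma pair_endpoints_absolutely_continuous:
  fixes E :: "((real \<times> (real^'n)) \<times> (real \<times> (real^'n))) set"
  assumes d: "CARD('n) \<ge> 2" and \<gamma>: "\<gamma> \<noteq> 0" and E: "E \<in> null_sets (space_time \<Otimes>\<^sub>M space_time)"
  shows "AE q in pair_space. pair_endpoints \<gamma> q \<notin> E"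
proof -
  have [measurable]: "E \<in> sets ((borel \<Otimes>\<^sub>M borel) \<Otimes>\<^sub>M (borel \<Otimes>\<^sub>M borel))"
    using E by (auto cong: sets_pair_measure_cong simp: sets_space_time)
  let ?T = "time_measure" and ?B = "velocity_time :: (real \<times> (real^'n)) measure" and ?S = "sphere_borel :: (real^'n) measure"
  let ?X = "torus_measure :: (real^'n) measure"
  define g where "g q = (indicator E (pair_endpoints \<gamma> q) :: ennreal)" for q
  have g[measurable]: "g \<in> borel_measurable (borel \<Otimes>\<^sub>M ((borel \<Otimes>\<^sub>M (borel \<Otimes>\<^sub>M borel)) \<Otimes>\<^sub>M ((borel \<Otimes>\<^sub>M (borel \<Otimes>\<^sub>M borel)) \<Otimes>\<^sub>M borel)))"
    unfolding g_def by measurable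
  have TB: "finite_measure (?T \<Otimes>\<^sub>M ?B)"
    by (intro finite_measure_pair_measure finite_measure_velocity_time finite_measure_time_measure)
  have TBX: "finite_measure ((?T \<Otimes>\<^sub>M ?B) \<Otimes>\<^sub>M ?X)" "finite_measure ((?T \<Otimes>\<^sub>M ?B) \<Otimes>\<^sub>M ((?T \<Otimes>\<^sub>M ?B) \<Otimes>\<^sub>M ?X))"
    by (intro finite_measure_pair_measure finite_measure_velocity_time finite_measure_time_measure finite_measure_torus_measure)+
  interpret TB: finite_measure "?T \<Otimes>\<^sub>M ?B" by fact
  interpret TBX: finite_measure "(?T \<Otimes>\<^sub>M ?B) \<Otimes>\<^sub>M ?X" by fact
  interpret TBX2: finite_measure "(?T \<Otimes>\<^sub>M ?B) \<Otimes>\<^sub>M ((?T \<Otimes>\<^sub>M ?B) \<Otimes>\<^sub>M ?X)" by fact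
  interpret sw: pair_sigma_finite ?T "(?T \<Otimes>\<^sub>M ?B) \<Otimes>\<^sub>M ((?T \<Otimes>\<^sub>M ?B) \<Otimes>\<^sub>M ?X)" ..
  interpret SX: pair_sigma_finite ?S ?X ..
  have last: "(\<integral>\<^sup>+w'. \<integral>\<^sup>+x. \<integral>\<^sup>+a. g (a, (a1, s, w), (a2, s', w'), x) \<partial>?T \<partial>?X \<partial>?S) = 0"
    if w: "norm w = 1" and ae: "AE x in ?X. AE y in ?X. ((a1, x), (a2, y)) \<notin> E" for a1 s w a2 s'
  proof -
    have "(\<integral>\<^sup>+w'. \<integral>\<^sup>+x. \<integral>\<^sup>+a. g (a, (a1, s, w), (a2, s', w'), x) \<partial>?T \<partial>?X \<partial>?S) =
        (\<integral>\<^sup>+x. \<integral>\<^sup>+w'. \<integral>\<^sup>+a. g (a, (a1, s, w), (a2, s', w'), x) \<partial>?T \<partial>?S \<partial>?X)"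
      by (rule SX.Fubini'[symmetric]) measurable
    also have "\<dots> = 0"
    proof (rule nn_integral_zeroI)
      from ae show "AE x in ?X. (\<integral>\<^sup>+w'. \<integral>\<^sup>+a. g (a, (a1, s, w), (a2, s', w'), x) \<partial>?T \<partial>?S) = 0"
      proof eventually_elim
        case (elim x)
        let ?N = "{y. \<not> ((a1, x), (a2, fracv y)) \<notin> E}"
        have N: "?N \<in> null_sets lborel"
          by (rule torus_null_imp_lborel_null[where P="\<lambda>y. ((a1, x), (a2, y)) \<notin> E"]) (measurable, fact)
        \<comment> \<open>What is left of the second endpoint when the multiple of
          \<open>w' - w\<close> is taken out.\<close>
        let ?b = "x + (\<gamma> * (a2 - a1)) *\<^sub>R w"
        from AE_sphere_chord_notin_null[OF d w N, of ?b]
        have "AE w' in ?S. (\<integral>\<^sup>+a. g (a, (a1, s, w), (a2, s', w'), x) \<partial>?T) = 0"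
        proof eventually_elim
          case (elim w')
          \<comment> \<open>The multiplier is an affine function of \<open>a\<close> with slope
            \<open>- \<gamma>\<close>, which is nonzero, so null sets of multipliers pull back to
            null sets of meeting times.\<close>
          have "AE a in lborel. (\<gamma> * a2 + (- \<gamma>) * a) *\<^sub>R (w' - w) + ?b \<notin> ?N"
            by (rule AE_borel_affine[OF _ _ elim]) (use \<gamma> in \<open>simp, measurable\<close>)
          then have "AE a in ?T. (\<gamma> * a2 + (- \<gamma>) * a) *\<^sub>R (w' - w) + ?b \<notin> ?N" by (rule AE_time_measureI)
          moreover have "(\<gamma> * a2 + (- \<gamma>) * a) *\<^sub>R (w' - w) + ?b =
             x + - (\<gamma> * (a1 - a)) *\<^sub>R w - - (\<gamma> * (a2 - a)) *\<^sub>R w'" for a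
            by (simp add: algebra_simps)
          ultimately have "AE a in ?T. x + - (\<gamma> * (a1 - a)) *\<^sub>R w - - (\<gamma> * (a2 - a)) *\<^sub>R w' \<notin> ?N"
            by (simp only:)
          then have "AE a in ?T. g (a, (a1, s, w), (a2, s', w'), x) = 0"
            by eventually_elim (simp add: g_def pair_endpoints_def)
          then show ?case by (rule nn_integral_zeroI)
        qed
        then show ?case by (rule nn_integral_zeroI)
      qed
    qed
    finally show ?thesis .
  qed
  have "(\<integral>\<^sup>+q. g q \<partial>pair_space) = (\<integral>\<^sup>+a. \<integral>\<^sup>+r. g (a, r) \<partial>((?T \<Otimes>\<^sub>M ?B) \<Otimes>\<^sub>M ((?T \<Otimes>\<^sub>M ?B) \<Otimes>\<^sub>M ?X)) \<partial>?T)"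
    unfolding pair_space_def by (rule TBX2.nn_integral_fst[symmetric]) measurable
  also have "\<dots> = (\<integral>\<^sup>+r. \<integral>\<^sup>+a. g (a, r) \<partial>?T \<partial>((?T \<Otimes>\<^sub>M ?B) \<Otimes>\<^sub>M ((?T \<Otimes>\<^sub>M ?B) \<Otimes>\<^sub>M ?X)))"
    by (rule sw.Fubini'[symmetric]) measurable
  also have "\<dots> = (\<integral>\<^sup>+p. \<integral>\<^sup>+p'x. \<integral>\<^sup>+a. g (a, p, p'x) \<partial>?T \<partial>((?T \<Otimes>\<^sub>M ?B) \<Otimes>\<^sub>M ?X) \<partial>(?T \<Otimes>\<^sub>M ?B))"
    by (rule TBX.nn_integral_fst[symmetric]) measurable
  also have "\<dots> = (\<integral>\<^sup>+p. \<integral>\<^sup>+p'. \<integral>\<^sup>+x. \<integral>\<^sup>+a. g (a, p, p', x) \<partial>?T \<partial>?X \<partial>(?T \<Otimes>\<^sub>M ?B) \<partial>(?T \<Otimes>\<^sub>M ?B))"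
  proof (rule nn_integral_cong)
    fix p :: "real \<times> real \<times> (real^'n)"
    have [measurable]: "p \<in> space (borel \<Otimes>\<^sub>M (borel \<Otimes>\<^sub>M borel))" by (simp add: space_pair_measure)
    show "(\<integral>\<^sup>+p'x. \<integral>\<^sup>+a. g (a, p, p'x) \<partial>?T \<partial>((?T \<Otimes>\<^sub>M ?B) \<Otimes>\<^sub>M ?X)) =
       (\<integral>\<^sup>+p'. \<integral>\<^sup>+x. \<integral>\<^sup>+a. g (a, p, p', x) \<partial>?T \<partial>?X \<partial>(?T \<Otimes>\<^sub>M ?B))"
      by (rule torus.nn_integral_fst[symmetric]) measurable
  qed
  also have "\<dots> = (\<integral>\<^sup>+a1. \<integral>\<^sup>+b. \<integral>\<^sup>+p'. \<integral>\<^sup>+x. \<integral>\<^sup>+a. g (a, (a1, b), p', x) \<partial>?T \<partial>?X \<partial>(?T \<Otimes>\<^sub>M ?B) \<partial>?B \<partial>?T)"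
    by (rule velocity_time.nn_integral_fst[symmetric]) measurable
  also have "\<dots> = (\<integral>\<^sup>+a1. \<integral>\<^sup>+s. \<integral>\<^sup>+w. \<integral>\<^sup>+p'. \<integral>\<^sup>+x. \<integral>\<^sup>+a. g (a, (a1, s, w), p', x) \<partial>?T \<partial>?X \<partial>(?T \<Otimes>\<^sub>M ?B) \<partial>?S \<partial>?T \<partial>?T)"
    by (intro nn_integral_cong sph.nn_integral_fst[symmetric]) measurable
  also have "\<dots> = 0"
  proof (rule nn_integral_zeroI)
    from sections_null[OF E]
    show "AE a1 in ?T. (\<integral>\<^sup>+s. \<integral>\<^sup>+w. \<integral>\<^sup>+p'. \<integral>\<^sup>+x. \<integral>\<^sup>+a. g (a, (a1, s, w), p', x) \<partial>?T \<partial>?X \<partial>(?T \<Otimes>\<^sub>M ?B) \<partial>?S \<partial>?T) = 0"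
    proof eventually_elim
      case (elim a1)
      note el = elim
      have "(\<integral>\<^sup>+w. \<integral>\<^sup>+p'. \<integral>\<^sup>+x. \<integral>\<^sup>+a. g (a, (a1, s, w), p', x) \<partial>?T \<partial>?X \<partial>(?T \<Otimes>\<^sub>M ?B) \<partial>?S) = 0" for s
      proof (rule nn_integral_zeroI)
        from AE_sphere_borel_norm
        show "AE w in ?S. (\<integral>\<^sup>+p'. \<integral>\<^sup>+x. \<integral>\<^sup>+a. g (a, (a1, s, w), p', x) \<partial>?T \<partial>?X \<partial>(?T \<Otimes>\<^sub>M ?B)) = 0"
        proof eventually_elim
          case (elim w)
          have "(\<integral>\<^sup>+p'. \<integral>\<^sup>+x. \<integral>\<^sup>+a. g (a, (a1, s, w), p', x) \<partial>?T \<partial>?X \<partial>(?T \<Otimes>\<^sub>M ?B)) =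
             (\<integral>\<^sup>+a2. \<integral>\<^sup>+b. \<integral>\<^sup>+x. \<integral>\<^sup>+a. g (a, (a1, s, w), (a2, b), x) \<partial>?T \<partial>?X \<partial>?B \<partial>?T)"
            by (rule velocity_time.nn_integral_fst[symmetric]) measurable
          also have "\<dots> = (\<integral>\<^sup>+a2. \<integral>\<^sup>+s'. \<integral>\<^sup>+w'. \<integral>\<^sup>+x. \<integral>\<^sup>+a. g (a, (a1, s, w), (a2, s', w'), x) \<partial>?T \<partial>?X \<partial>?S \<partial>?T \<partial>?T)"
            by (intro nn_integral_cong sph.nn_integral_fst[symmetric]) measurable
          also have "\<dots> = 0"
          proof (rule nn_integral_zeroI)
            from el show "AE a2 in ?T. (\<integral>\<^sup>+s'. \<integral>\<^sup>+w'. \<integral>\<^sup>+x. \<integral>\<^sup>+a. g (a, (a1, s, w), (a2, s', w'), x) \<partial>?T \<partial>?X \<partial>?S \<partial>?T) = 0"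
              by eventually_elim (simp add: last[OF elim])
          qed
          finally show ?case .
        qed
      qed
      then show ?case by simp
    qed
  qed
  finally have "AE q in pair_space. g q = 0"
    by (rule nn_integral_zeroD) measurable
  then show ?thesis by eventually_elim (simp add: g_def split: split_indicator_asm)
qed

definition pair_weight ::
  "(real \<times> real \<Rightarrow> real) \<Rightarrow> real \<times> ((real \<times> real \<times> (real^'n)) \<times> ((real \<times> real \<times> (real^'n)) \<times> (real^'n))) \<Rightarrow> real" where
  "pair_weight k = (\<lambda>(a, p, p', x). (k (fst p, fst (snd p)) * k (a, fst (snd p))) * (k (fst p', fst (snd p')) * k (a, fst (snd p'))))"

text \<open>The joint law of the two endpoints, weighted by the four kernel factors of the double
  duality. The iterated integral found there is the quadratic form of \<open>U\<close> against this
  measure.\<close>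

definition pair_coupling ::
  "(real \<times> real \<Rightarrow> real) \<Rightarrow> real \<Rightarrow> ((real \<times> (real^'n)) \<times> (real \<times> (real^'n))) measure" where
  "pair_coupling k \<gamma> = distr (density pair_space (\<lambda>q. ennreal (pair_weight k q))) (space_time \<Otimes>\<^sub>M space_time) (pair_endpoints \<gamma>)"

lemma pair_weight_measurable[measurable]:
  assumes [measurable]: "k \<in> borel_measurable (borel \<Otimes>\<^sub>M borel)"
  shows "pair_weight k \<in> borel_measurable (borel \<Otimes>\<^sub>M ((borel \<Otimes>\<^sub>M (borel \<Otimes>\<^sub>M borel)) \<Otimes>\<^sub>M ((borel \<Otimes>\<^sub>M (borel \<Otimes>\<^sub>M borel)) \<Otimes>\<^sub>M borel)))"
  unfolding pair_weight_def by measurable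

lemma pair_weight_bounds:
  assumes "\<And>p. 0 \<le> k p" "\<And>p. k p \<le> 1"
  shows "0 \<le> pair_weight k q" "pair_weight k q \<le> 1"
proof -
  have *: "k p * k p' \<le> 1" for p p' using mult_mono[OF assms(2)[of p] assms(2)[of p']] assms(1) by simp
  show "0 \<le> pair_weight k q" using assms by (auto simp: pair_weight_def split: prod.splits)
  obtain a p p' x where q: "q = (a, p, p', x)" by (metis surj_pair)
  show "pair_weight k q \<le> 1" unfolding q pair_weight_def
    using mult_mono[OF *[of "(fst p, fst (snd p))" "(a, fst (snd p))"] *[of "(fst p', fst (snd p'))" "(a, fst (snd p'))"]]
      assms(1) by simp
qed

lemma sets_pair_coupling: "sets (pair_coupling k \<gamma>) = sets (space_time \<Otimes>\<^sub>M space_time)"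
  by (simp add: pair_coupling_def)

lemma sets_space_time_pair[measurable_cong]:
  "sets (space_time \<Otimes>\<^sub>M space_time) = sets ((borel \<Otimes>\<^sub>M borel) \<Otimes>\<^sub>M (borel \<Otimes>\<^sub>M borel))"
  by (intro sets_pair_measure_cong sets_space_time)

lemma finite_measure_pair_coupling:
  fixes k :: "real \<times> real \<Rightarrow> real"
  assumes [measurable]: "k \<in> borel_measurable (borel \<Otimes>\<^sub>M borel)" and k: "\<And>p. 0 \<le> k p" "\<And>p. k p \<le> 1"
  shows "finite_measure (pair_coupling k \<gamma> :: ((real \<times> (real^'n)) \<times> (real \<times> (real^'n))) measure)"
proof -
  let ?P = "pair_space :: (real \<times> ((real \<times> real \<times> (real^'n)) \<times> ((real \<times> real \<times> (real^'n)) \<times> (real^'n)))) measure"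
  interpret finite_measure ?P by (rule finite_measure_pair_space)
  have "finite_measure (density ?P (\<lambda>q. ennreal (pair_weight k q)))"
  proof (rule finite_measureI)
    have "emeasure (density ?P (\<lambda>q. ennreal (pair_weight k q))) (space ?P) = (\<integral>\<^sup>+q. ennreal (pair_weight k q) * indicator (space ?P) q \<partial>?P)"
      by (rule emeasure_density) auto
    also have "\<dots> \<le> (\<integral>\<^sup>+q. 1 \<partial>?P)"
      by (intro nn_integral_mono) (use pair_weight_bounds[OF k] in \<open>auto split: split_indicator\<close>)
    also have "\<dots> < \<infinity>" using emeasure_finite[of "space ?P"] by (simp add: less_top[symmetric])
    finally show "emeasure (density ?P (\<lambda>q. ennreal (pair_weight k q))) (space (density ?P (\<lambda>q. ennreal (pair_weight k q)))) \<noteq> \<infinity>"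
      by simp
  qed
  then show ?thesis unfolding pair_coupling_def by (rule finite_measure.finite_measure_distr) measurable
qed

lemma pair_coupling_absolutely_continuous:
  fixes k :: "real \<times> real \<Rightarrow> real"
  assumes d: "CARD('n) \<ge> 2" and \<gamma>: "\<gamma> \<noteq> 0" and [measurable]: "k \<in> borel_measurable (borel \<Otimes>\<^sub>M borel)"
  shows "absolutely_continuous (space_time \<Otimes>\<^sub>M space_time) (pair_coupling k \<gamma> :: ((real \<times> (real^'n)) \<times> (real \<times> (real^'n))) measure)"
  unfolding absolutely_continuous_def
proof
  fix E :: "((real \<times> (real^'n)) \<times> (real \<times> (real^'n))) set"
  assume E: "E \<in> null_sets (space_time \<Otimes>\<^sub>M space_time)"
  then have [measurable]: "E \<in> sets (space_time \<Otimes>\<^sub>M space_time)" by auto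
  have "AE q in density pair_space (\<lambda>q. ennreal (pair_weight k q)). pair_endpoints \<gamma> q \<notin> E"
    using pair_endpoints_absolutely_continuous[OF d \<gamma> E] by (subst AE_density) auto
  then have "AE z in pair_coupling k \<gamma>. z \<notin> E"
    unfolding pair_coupling_def by (subst AE_distr_iff) measurable
  moreover have "E \<in> sets (pair_coupling k \<gamma>)" unfolding sets_pair_coupling by fact
  ultimately show "E \<in> null_sets (pair_coupling k \<gamma>)" by (simp add: AE_iff_null_sets)
qed

lemma integral_pair_coupling:
  fixes U :: "real \<times> (real^'n) \<Rightarrow> real" and k :: "real \<times> real \<Rightarrow> real"
  assumes k[measurable]: "k \<in> borel_measurable (borel \<Otimes>\<^sub>M borel)" and kb: "\<And>p. 0 \<le> k p" "\<And>p. k p \<le> 1"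
    and U[measurable]: "U \<in> borel_measurable (borel \<Otimes>\<^sub>M borel)" and Ub: "\<And>p. \<bar>U p\<bar> \<le> c"
    and per: "\<And>t. lattice_periodic (\<lambda>x. U (t, x))"
  shows "(\<integral>a. \<integral>p. \<integral>p'. (k (fst p, fst (snd p)) * k (a, fst (snd p))) * (k (fst p', fst (snd p')) * k (a, fst (snd p'))) *
      (\<integral>x. U (fst p, x) * U (fst p', x + - (\<gamma> * (fst p - a)) *\<^sub>R snd (snd p) - - (\<gamma> * (fst p' - a)) *\<^sub>R snd (snd p'))
       \<partial>torus_measure) \<partial>(time_measure \<Otimes>\<^sub>M velocity_time) \<partial>(time_measure \<Otimes>\<^sub>M velocity_time) \<partial>time_measure) =
    (\<integral>z. U (fst z) * U (snd z) \<partial>pair_coupling k \<gamma>)"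
proof -
  let ?T = "time_measure" and ?B = "velocity_time :: (real \<times> (real^'n)) measure" and ?X = "torus_measure :: (real^'n) measure"
  have TB: "finite_measure (?T \<Otimes>\<^sub>M ?B)"
    by (intro finite_measure_pair_measure finite_measure_velocity_time finite_measure_time_measure)
  have TBX: "finite_measure ((?T \<Otimes>\<^sub>M ?B) \<Otimes>\<^sub>M ?X)" "finite_measure ((?T \<Otimes>\<^sub>M ?B) \<Otimes>\<^sub>M ((?T \<Otimes>\<^sub>M ?B) \<Otimes>\<^sub>M ?X))"
    by (intro finite_measure_pair_measure finite_measure_velocity_time finite_measure_time_measure finite_measure_torus_measure)+
  define f where "f q = pair_weight k q * (U (fst (pair_endpoints \<gamma> q)) * U (snd (pair_endpoints \<gamma> q)))" for q
  have f[measurable]: "f \<in> borel_measurable (borel \<Otimes>\<^sub>M ((borel \<Otimes>\<^sub>M (borel \<Otimes>\<^sub>M borel)) \<Otimes>\<^sub>M ((borel \<Otimes>\<^sub>M (borel \<Otimes>\<^sub>M borel)) \<Otimes>\<^sub>M borel)))"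
    unfolding f_def by measurable
  have c: "0 \<le> c" using Ub by (meson abs_ge_zero order_trans)
  have fb: "\<bar>f q\<bar> \<le> 1 * (c * c)" for q
    unfolding f_def abs_mult using pair_weight_bounds[of k q, OF kb] c by (intro mult_mono Ub) auto
  have "(\<integral>z. U (fst z) * U (snd z) \<partial>pair_coupling k \<gamma>) =
      (\<integral>q. U (fst (pair_endpoints \<gamma> q)) * U (snd (pair_endpoints \<gamma> q)) \<partial>density pair_space (\<lambda>q. ennreal (pair_weight k q)))"
    unfolding pair_coupling_def by (rule integral_distr) measurable
  also have "\<dots> = (\<integral>q. f q \<partial>pair_space)"
    unfolding f_def by (subst integral_density) (auto simp: pair_weight_bounds(1)[of k, OF kb])
  also have "\<dots> = (\<integral>a. \<integral>r. f (a, r) \<partial>((?T \<Otimes>\<^sub>M ?B) \<Otimes>\<^sub>M ((?T \<Otimes>\<^sub>M ?B) \<Otimes>\<^sub>M ?X)) \<partial>?T)"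
    unfolding pair_space_def
    by (rule integral_pair_bounded[OF finite_measure_time_measure TBX(2) _ fb, symmetric]) measurable
  also have "\<dots> = (\<integral>a. \<integral>p. \<integral>r. f (a, p, r) \<partial>((?T \<Otimes>\<^sub>M ?B) \<Otimes>\<^sub>M ?X) \<partial>(?T \<Otimes>\<^sub>M ?B) \<partial>?T)"
    by (intro Bochner_Integration.integral_cong[OF refl] integral_pair_bounded[OF TB TBX(1) _ fb, symmetric]) measurable
  also have "\<dots> = (\<integral>a. \<integral>p. \<integral>p'. \<integral>x. f (a, p, p', x) \<partial>?X \<partial>(?T \<Otimes>\<^sub>M ?B) \<partial>(?T \<Otimes>\<^sub>M ?B) \<partial>?T)"
  proof (rule Bochner_Integration.integral_cong[OF refl], rule Bochner_Integration.integral_cong[OF refl])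
    fix a :: real and p :: "real \<times> real \<times> (real^'n)"
    have [measurable]: "p \<in> space (borel \<Otimes>\<^sub>M (borel \<Otimes>\<^sub>M borel))" by (simp add: space_pair_measure)
    show "(\<integral>r. f (a, p, r) \<partial>((?T \<Otimes>\<^sub>M ?B) \<Otimes>\<^sub>M ?X)) = (\<integral>p'. \<integral>x. f (a, p, p', x) \<partial>?X \<partial>(?T \<Otimes>\<^sub>M ?B))"
      by (rule integral_pair_bounded[OF TB finite_measure_torus_measure _ fb, symmetric]) measurable
  qed
  also have "\<dots> = (\<integral>a. \<integral>p. \<integral>p'. (k (fst p, fst (snd p)) * k (a, fst (snd p))) * (k (fst p', fst (snd p')) * k (a, fst (snd p'))) *
      (\<integral>x. U (fst p, x) * U (fst p', x + - (\<gamma> * (fst p - a)) *\<^sub>R snd (snd p) - - (\<gamma> * (fst p' - a)) *\<^sub>R snd (snd p'))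
       \<partial>torus_measure) \<partial>(time_measure \<Otimes>\<^sub>M velocity_time) \<partial>(time_measure \<Otimes>\<^sub>M velocity_time) \<partial>time_measure)"
    unfolding f_def pair_weight_def pair_endpoints_def prod.case fst_conv snd_conv
    by (simp only: lattice_periodic_fracv[OF per] integral_mult_right_zero)
  finally show ?thesis by simp
qed

text \<open>The double duality controls the distance of two averages in the mean by the quadratic
  form of their difference against \<open>pair_coupling\<close>. That form is finitely colourable
  because the coupling is absolutely continuous.\<close>

theorem velocity_average_compact:
  fixes H :: "nat \<Rightarrow> (real \<times> (real^'n)) \<times> (real^'n) \<Rightarrow> real" and k :: "real \<times> real \<Rightarrow> real"
  assumes d: "CARD('n) \<ge> 2" and \<gamma>: "\<gamma> \<noteq> 0"
    and k[measurable]: "k \<in> borel_measurable (borel \<Otimes>\<^sub>M borel)" and kb: "\<And>p. 0 \<le> k p" "\<And>p. k p \<le> 1"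
    and H[measurable]: "\<And>n. H n \<in> borel_measurable ((borel \<Otimes>\<^sub>M borel) \<Otimes>\<^sub>M borel)" and Hb: "\<And>n p. \<bar>H n p\<bar> \<le> 1"
    and per: "\<And>n b. lattice_periodic (\<lambda>x. H n (b, x))" and \<epsilon>: "\<epsilon> > 0"
  shows "finitely_colourable (\<lambda>m n.
    (\<integral>p. \<bar>velocity_average k \<gamma> (H m) p - velocity_average k \<gamma> (H n) p\<bar> \<partial>space_time) < \<epsilon>)"
proof -
  define U where "U n = velocity_average k \<gamma> (H n)" for n
  define \<mu> where "\<mu> = measure (velocity_time :: (real \<times> (real^'n)) measure) (space velocity_time)"
  define \<nu> where "\<nu> = measure (space_time :: (real \<times> (real^'n)) measure) (space space_time)"
  define \<tau> where "\<tau> = measure (torus_measure :: (real^'n) measure) (space torus_measure)"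
  define C where "C = (4 * \<tau> * \<mu>)\<^sup>2 * ((2 * \<mu>)\<^sup>2 * \<nu>)"
  \<comment> \<open>Rescaled to values in \<open>[-1, 1]\<close>, as the kernel lemma expects;
    \<open>\<mu> + 1\<close> is positive even if \<mu> is zero.\<close>
  define V where "V n p = U n p / (\<mu> + 1)" for n p
  have nn: "0 \<le> \<mu>" "0 \<le> \<nu>" "0 \<le> C" unfolding \<mu>_def \<nu>_def C_def by auto
  have kb': "\<bar>k p\<bar> \<le> 1" for p using kb[of p] by simp
  have U[measurable]: "U n \<in> borel_measurable (borel \<Otimes>\<^sub>M borel)" for n unfolding U_def by measurable
  have Ub: "\<bar>U n p\<bar> \<le> \<mu>" for n p
    using velocity_average_bound[OF kb' Hb[of n]] by (simp add: U_def \<mu>_def)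
  have V[measurable]: "V n \<in> borel_measurable (borel \<Otimes>\<^sub>M borel)" for n unfolding V_def by measurable
  have Vb: "\<bar>V n p\<bar> \<le> 1" for n p using Ub[of n p] nn by (simp add: V_def)
  let ?L = "pair_coupling k \<gamma> :: ((real \<times> (real^'n)) \<times> (real \<times> (real^'n))) measure"
  \<comment> \<open>The distance in the mean enters with the power \<open>8\<close>: squared by
    Cauchy-Schwarz against \<open>1\<close>, then raised to the fourth power by the double duality.
    \<open>K\<close> collects the constants, and its \<open>+ 1\<close> makes the last inequality
    strict.\<close>
  define K where "K = \<nu> ^ 4 * C * (\<mu> + 1)\<^sup>2 + 1"
  have K: "0 < K" unfolding K_def using nn by (intro add_nonneg_pos mult_nonneg_nonneg) auto
  have "finitely_colourable (\<lambda>m n. \<bar>\<integral>z. (V m (fst z) - V n (fst z)) * (V m (snd z) - V n (snd z)) \<partial>?L\<bar> < \<epsilon> ^ 8 / K)"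
    by (intro finitely_colourable_absolutely_continuous[OF finite_measure_space_time _ Vb
      finite_measure_pair_coupling[OF k kb] sets_pair_coupling pair_coupling_absolutely_continuous[OF d \<gamma> k]])
      (use K \<epsilon> in auto)
  then show ?thesis
  proof (rule finitely_colourable_mono)
    fix m n
    assume small: "\<bar>\<integral>z. (V m (fst z) - V n (fst z)) * (V m (snd z) - V n (snd z)) \<partial>?L\<bar> < \<epsilon> ^ 8 / K"
    define D where "D p = U m p - U n p" for p
    have D[measurable]: "D \<in> borel_measurable (borel \<Otimes>\<^sub>M borel)" unfolding D_def by measurable
    have Hd: "\<bar>H m p - H n p\<bar> \<le> 2" for p using Hb[of m p] Hb[of n p] by linarith
    have Hm: "(\<lambda>q. H m q - H n q) \<in> borel_measurable ((borel \<Otimes>\<^sub>M borel) \<Otimes>\<^sub>M borel)" by measurable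
    have perd: "lattice_periodic (\<lambda>x. H m (b, x) - H n (b, x))" for b
      using per unfolding lattice_periodic_def by metis
    have D_eq: "D = velocity_average k \<gamma> (\<lambda>q. H m q - H n q)"
      unfolding D_def U_def by (intro ext velocity_average_diff[OF k kb' H Hb H Hb])
    have Db: "\<bar>D p\<bar> \<le> 2 * \<mu>" for p unfolding D_def using Ub[of m p] Ub[of n p] by linarith
    have Dper: "lattice_periodic (\<lambda>x. D (t, x))" for t
      unfolding D_eq by (rule velocity_average_periodic[OF perd])
    have DV: "D p = (\<mu> + 1) * (V m p - V n p)" for p
      using nn by (simp add: D_def V_def right_diff_distrib)
    define y where "y = (\<integral>p. (D p)\<^sup>2 \<partial>space_time)"
    have "(\<integral>z. D (fst z) * D (snd z) \<partial>?L) =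
        (\<integral>z. (\<mu> + 1)\<^sup>2 * ((V m (fst z) - V n (fst z)) * (V m (snd z) - V n (snd z))) \<partial>?L)"
      by (simp add: DV power2_eq_square mult_ac)
    also have "\<dots> = (\<mu> + 1)\<^sup>2 * (\<integral>z. (V m (fst z) - V n (fst z)) * (V m (snd z) - V n (snd z)) \<partial>?L)" by simp
    finally have DL: "\<bar>\<integral>z. D (fst z) * D (snd z) \<partial>?L\<bar> \<le> (\<mu> + 1)\<^sup>2 * (\<epsilon> ^ 8 / K)"
      using mult_left_mono[OF less_imp_le[OF small], of "(\<mu> + 1)\<^sup>2"] by (simp only: abs_mult abs_power2 zero_le_power2)
    have "y ^ 4 \<le> C * \<bar>\<integral>z. D (fst z) * D (snd z) \<partial>?L\<bar>"
      using velocity_average_double_duality[OF k kb' Hm Hd perd, of \<gamma>, folded D_eq]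
      unfolding integral_pair_coupling[OF k kb D Db Dper] y_def C_def \<mu>_def \<nu>_def \<tau>_def .
    also have "\<dots> \<le> C * ((\<mu> + 1)\<^sup>2 * (\<epsilon> ^ 8 / K))" using DL nn by (intro mult_left_mono)
    finally have y4: "y ^ 4 \<le> C * ((\<mu> + 1)\<^sup>2 * (\<epsilon> ^ 8 / K))" .
    let ?I = "\<integral>p. \<bar>D p\<bar> \<partial>space_time"
    have "(\<integral>p. \<bar>D p\<bar> * 1 \<partial>space_time)\<^sup>2 \<le> (\<integral>p. \<bar>D p\<bar>\<^sup>2 \<partial>space_time) * (\<integral>p. 1\<^sup>2 \<partial>(space_time :: (real \<times> (real^'n)) measure))"
      by (intro Cauchy_Schwarz_bounded[OF finite_measure_space_time, of _ "2 * \<mu>" _ 1]) (use Db in auto)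
    then have "?I\<^sup>2 \<le> y * \<nu>" by (simp add: y_def \<nu>_def)
    then have "(?I\<^sup>2) ^ 4 \<le> (y * \<nu>) ^ 4" by (intro power_mono) auto
    also have "\<dots> = \<nu> ^ 4 * y ^ 4" by (simp add: power_mult_distrib mult.commute)
    also have "\<dots> \<le> \<nu> ^ 4 * (C * ((\<mu> + 1)\<^sup>2 * (\<epsilon> ^ 8 / K)))" using y4 by (intro mult_left_mono) auto
    also have "\<dots> = (K - 1) * (\<epsilon> ^ 8 / K)" by (simp add: K_def mult.assoc)
    also have "\<dots> < K * (\<epsilon> ^ 8 / K)" using K \<epsilon> by (intro mult_strict_right_mono) auto
    also have "\<dots> = (\<epsilon>\<^sup>2) ^ 4" using K by (simp flip: power_mult)
    finally have "?I < \<epsilon>" using \<epsilon> by (meson less_eq_real_def not_le power_less_imp_less_base power_mono zero_le_power2)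
    then show "(\<integral>p. \<bar>velocity_average k \<gamma> (H m) p - velocity_average k \<gamma> (H n) p\<bar> \<partial>space_time) < \<epsilon>"
      by (simp add: D_def U_def)
  qed
qed

subsection \<open>Moments and von Mises distributions\<close>

lemma integral_sphere_measure:
  fixes f :: "real^'n \<Rightarrow> 'b::{banach, second_countable_topology}"
  assumes "f \<in> borel_measurable borel"
  shows "(\<integral>w. f w \<partial>sphere_measure) = (\<integral>w. f w \<partial>sphere_borel)"
  unfolding sphere_borel_def using assms id_measurable_sphere_measure by (subst integral_distr) auto

lemma Zf_eq: "Zf J = (\<integral>w. exp (w \<bullet> J) \<partial>sphere_borel)"
  unfolding Zf_def by (rule integral_sphere_measure) measurable

lemma Zf_measurable[measurable]: "Zf \<in> borel_measurable borel"
  unfolding Zf_eq[abs_def] by measurable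

lemma vonMises_measurable[measurable]:
  assumes [measurable]: "f \<in> borel_measurable M" "g \<in> borel_measurable M"
  shows "(\<lambda>x. vonMises (f x) (g x)) \<in> borel_measurable M"
  unfolding vonMises_def by measurable

lemma exp_inner_sphere_integrable: "integrable sphere_borel (\<lambda>w. exp (w \<bullet> J))"
proof (rule sph.integrable_const_bound[of _ "exp (norm J)"])
  show "AE w in sphere_borel. norm (exp (w \<bullet> J)) \<le> exp (norm J)"
    using AE_sphere_borel_norm
  proof eventually_elim
    case (elim w)
    then show ?case using norm_cauchy_schwarz[of w J] by simp
  qed
qed measurable

text \<open>\<open>exp 1\<close> pays for the loss of \<open>1\<close> in the exponent,
  \<open>4 ^ CARD('n)\<close> for the radius \<open>1 / (4 * (1 + norm J))\<close> of the ball used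
  in \<open>Zf_lower_bound\<close>, and the denominator for its volume.\<close>

definition vonMises_const :: "'n::finite itself \<Rightarrow> real" where
  "vonMises_const _ = exp 1 * 4 ^ CARD('n) / measure lborel (ball (0::real^'n) 1)"

lemma unit_ball_content_pos: "0 < measure lborel (ball (0::real^'n) 1)"
  by (rule content_ball_pos) simp

lemma vonMises_const_pos: "0 < vonMises_const TYPE('n::finite)"
  unfolding vonMises_const_def using unit_ball_content_pos by (intro divide_pos_pos mult_pos_pos) auto

text \<open>Only the directions within \<open>1 / (1 + |J|)\<close> of \<open>J / |J|\<close> are kept, where the exponent
  exceeds \<open>|J| - 1\<close>.\<close>

lemma Zf_lower_bound:
  fixes J :: "real^'n"
  shows "exp (norm J) \<le> vonMises_const TYPE('n) * (1 + norm J) ^ CARD('n) * Zf J"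
proof -
  \<comment> \<open>For \<open>J = 0\<close> any unit vector will do as a direction.\<close>
  define e where "e = (if J = 0 then axis undefined 1 else sgn J)"
  have e: "norm e = 1" "J = norm J *\<^sub>R e" by (auto simp: e_def norm_sgn norm_axis_1 sgn_div_norm)
  define r where "r = 1 / (4 * (1 + norm J))"
  have p: "0 < 1 + norm J" by (simp add: add_pos_nonneg)
  have r1: "r * (4 * (1 + norm J)) = 1" unfolding r_def using p by simp
  have "0 < r" unfolding r_def using p by simp
  moreover have "r \<le> 1/4" unfolding r_def by (intro frac_le) auto
  moreover have "4 * r * norm J = 1 - 4 * r" using r1 by (simp add: algebra_simps)
  ultimately have r: "0 < r" "r \<le> 1/4" "4 * r * norm J \<le> 1" by auto
  \<comment> \<open>By the cone formula a set in the solid ball can stand for a set of directions.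
    Centred at \<open>e / 2\<close> with radius at most \<open>1/4\<close>, the ball stays away from
    the origin and inside the unit ball.\<close>
  let ?B = "ball ((1/2) *\<^sub>R e) r"
  have sub: "x \<in> cball 0 1 - {0}" "norm J - 1 \<le> sgn x \<bullet> J" if x: "x \<in> ?B" for x
  proof -
    have n: "norm ((1/2) *\<^sub>R e - x) < r" using x by (simp add: dist_norm)
    have h: "norm ((1/2) *\<^sub>R e) = 1/2" using e by simp
    have nx: "1/2 - r \<le> norm x" "norm x \<le> 1/2 + r"
      using norm_triangle_ineq2[of "(1/2) *\<^sub>R e" x] norm_triangle_ineq2[of x "(1/2) *\<^sub>R e"] n h
      by (auto simp: norm_minus_commute)
    then show "x \<in> cball 0 1 - {0}" using r by auto
    have "((1/2) *\<^sub>R e - x) \<bullet> e \<le> norm ((1/2) *\<^sub>R e - x) * norm e" by (rule norm_cauchy_schwarz)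
    then have "1/2 - x \<bullet> e \<le> r" using n e by (simp add: inner_diff_left dot_square_norm)
    then have xe: "1/2 - r \<le> x \<bullet> e" by simp
    have "0 < norm x" using nx r by linarith
    moreover have "(1 - 4 * r) * norm x \<le> (1 - 4 * r) * (1/2 + r)" using nx r by (intro mult_left_mono) auto
    moreover have "(1 - 4 * r) * (1/2 + r) \<le> 1/2 - r" using r by (simp add: algebra_simps)
    ultimately have "1 - 4 * r \<le> (x \<bullet> e) / norm x" using xe by (simp add: pos_le_divide_eq)
    then have "1 - 4 * r \<le> sgn x \<bullet> e" by (simp add: sgn_div_norm divide_inverse mult.commute)
    then have "norm J * (1 - 4 * r) \<le> norm J * (sgn x \<bullet> e)" by (intro mult_left_mono) auto
    also have "\<dots> = sgn x \<bullet> J" by (subst (2) e(2)) simp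
    finally show "norm J - 1 \<le> sgn x \<bullet> J" using r(3) by (simp add: algebra_simps)
  qed
  have "ennreal (exp (norm J - 1) * measure lborel ?B) = (\<integral>\<^sup>+x. ennreal (exp (norm J - 1)) * indicator ?B x \<partial>lborel)"
    using emeasure_bounded_finite[OF bounded_ball, of "(1/2) *\<^sub>R e" r]
    by (subst nn_integral_cmult_indicator) (auto simp: ennreal_mult emeasure_eq_ennreal_measure)
  also have "\<dots> \<le> (\<integral>\<^sup>+x. ennreal (real CARD('n)) * indicator (cball 0 1 - {0}) x * ennreal (exp (sgn x \<bullet> J)) \<partial>lborel)"
  proof (rule nn_integral_mono)
    fix x :: "real^'n"
    \<comment> \<open>The dimension factor of the cone formula is at least \<open>1\<close> and is
      dropped.\<close>
    have "1 * exp (norm J - 1) \<le> real CARD('n) * exp (sgn x \<bullet> J)" if "x \<in> ?B"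
      using sub(2)[OF that] by (intro mult_mono) (auto simp: Suc_leI)
    then show "ennreal (exp (norm J - 1)) * indicator ?B x \<le>
        ennreal (real CARD('n)) * indicator (cball 0 1 - {0}) x * ennreal (exp (sgn x \<bullet> J))"
      using sub(1)[of x] by (auto simp: ennreal_mult[symmetric] split: split_indicator)
  qed
  also have "\<dots> = (\<integral>\<^sup>+w. ennreal (exp (w \<bullet> J)) \<partial>sphere_borel)"
    by (rule nn_integral_sphere_borel[symmetric]) measurable
  also have "\<dots> = ennreal (Zf J)"
    unfolding Zf_eq by (rule nn_integral_eq_integral[OF exp_inner_sphere_integrable]) simp
  finally have "exp (norm J - 1) * measure lborel ?B \<le> Zf J"
    by (subst (asm) ennreal_le_iff) (simp add: Zf_eq)
  moreover have "measure lborel ?B = r ^ CARD('n) * measure lborel (ball (0::real^'n) 1)"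
    using content_ball_conv_unit_ball[of r "(1/2) *\<^sub>R e"] r by simp
  ultimately have Z: "exp (norm J - 1) * (r ^ CARD('n) * measure lborel (ball (0::real^'n) 1)) \<le> Zf J" by simp
  let ?\<kappa> = "measure lborel (ball (0::real^'n) 1)"
  have "exp (norm J) = (vonMises_const TYPE('n) * (1 + norm J) ^ CARD('n)) * (exp (norm J - 1) * (r ^ CARD('n) * ?\<kappa>))"
  proof -
    have "r ^ CARD('n) * 4 ^ CARD('n) * (1 + norm J) ^ CARD('n) = (r * 4 * (1 + norm J)) ^ CARD('n)"
      by (simp add: power_mult_distrib)
    also have "r * 4 * (1 + norm J) = 1"
      unfolding r_def using norm_ge_zero[of J] by (simp add: field_simps add_nonneg_eq_0_iff)
    finally have 1: "r ^ CARD('n) * 4 ^ CARD('n) * (1 + norm J) ^ CARD('n) = 1" by simp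
    have "(vonMises_const TYPE('n) * (1 + norm J) ^ CARD('n)) * (exp (norm J - 1) * (r ^ CARD('n) * ?\<kappa>)) =
       (exp 1 * exp (norm J - 1)) * (r ^ CARD('n) * 4 ^ CARD('n) * (1 + norm J) ^ CARD('n)) * (?\<kappa> / ?\<kappa>)"
      unfolding vonMises_const_def by (simp add: mult_ac)
    then show ?thesis using 1 unit_ball_content_pos[where 'n='n] by (simp flip: exp_add)
  qed
  also have "\<dots> \<le> (vonMises_const TYPE('n) * (1 + norm J) ^ CARD('n)) * Zf J"
    using Z vonMises_const_pos[where 'n='n] by (intro mult_left_mono) auto
  finally show ?thesis .
qed

lemma Zf_pos: "0 < Zf J"
proof -
  have "0 < exp (norm J)" by simp
  also note Zf_lower_bound[of J]
  finally have "0 < vonMises_const TYPE('a) * (1 + norm J) ^ CARD('a) * Zf J" .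
  moreover have "0 < vonMises_const TYPE('a) * (1 + norm J) ^ CARD('a)"
    using vonMises_const_pos[where 'n='a] by (intro mult_pos_pos zero_less_power) (auto simp: add_pos_nonneg)
  ultimately show ?thesis by (rule zero_less_mult_pos)
qed

lemma vonMises_nonneg: "0 \<le> vonMises J w"
  using Zf_pos[of J] by (simp add: vonMises_def)

lemma vonMises_le:
  fixes J w :: "real^'n"
  assumes "norm w \<le> 1"
  shows "vonMises J w \<le> vonMises_const TYPE('n) * (1 + norm J) ^ CARD('n)"
proof -
  have "w \<bullet> J \<le> norm w * norm J" by (rule norm_cauchy_schwarz)
  also have "\<dots> \<le> norm J" using assms by (simp add: mult_left_le_one_le)
  finally have "exp (w \<bullet> J) \<le> exp (norm J)" by simp
  also note Zf_lower_bound
  finally show ?thesis using Zf_pos[of J] by (simp add: vonMises_def pos_divide_le_eq)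
qed

lemma nn_integral_vonMises: "(\<integral>\<^sup>+w. ennreal (vonMises J w) \<partial>sphere_borel) = 1"
proof -
  have "(\<integral>\<^sup>+w. ennreal (vonMises J w) \<partial>sphere_borel) = ennreal (\<integral>w. vonMises J w \<partial>sphere_borel)"
    using exp_inner_sphere_integrable[of J] vonMises_nonneg
    by (intro nn_integral_eq_integral) (auto simp: vonMises_def)
  also have "(\<integral>w. vonMises J w \<partial>sphere_borel) = 1"
    using Zf_pos[of J] by (simp add: vonMises_def Zf_eq)
  finally show ?thesis by simp
qed

text \<open>A convergent sequence is bounded by some \<open>B\<close>, and on the unit sphere the
  integrands are then dominated by \<open>exp B\<close>.\<close>

lemma tendsto_Zf:
  assumes J: "J \<longlonglongrightarrow> (J0 :: real^'n)"
  shows "(\<lambda>n. Zf (J n)) \<longlonglongrightarrow> Zf J0"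
  unfolding Zf_eq
proof -
  obtain B where B: "\<And>n. norm (J n) \<le> B" using Bseq_def convergentI[OF J] convergent_imp_Bseq by blast
  show "(\<lambda>n. \<integral>w. exp (w \<bullet> J n) \<partial>sphere_borel) \<longlonglongrightarrow> (\<integral>w. exp (w \<bullet> J0) \<partial>sphere_borel)"
  proof (rule integral_dominated_convergence[where w="\<lambda>w. exp B"])
    show "AE w in sphere_borel. (\<lambda>n. exp (w \<bullet> J n)) \<longlonglongrightarrow> exp (w \<bullet> J0)"
      by (intro AE_I2 tendsto_intros J)
    show "AE w in sphere_borel. norm (exp (w \<bullet> J n)) \<le> exp B" for n
      using AE_sphere_borel_norm
    proof eventually_elim
      case (elim w)
      then show ?case using norm_cauchy_schwarz[of w "J n"] B[of n] by simp
    qed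
  qed auto
qed

lemma tendsto_vonMises:
  assumes "J \<longlonglongrightarrow> J0"
  shows "(\<lambda>n. vonMises (J n) w) \<longlonglongrightarrow> vonMises J0 w"
  unfolding vonMises_def using Zf_pos[of J0]
  by (intro tendsto_divide tendsto_exp tendsto_inner tendsto_const assms tendsto_Zf) auto

subsection \<open>The entropy functional\<close>

text \<open>Unlike \<open>u * \<bar>ln u\<bar>\<close>, this function is monotone for
  \<open>u \<ge> 0\<close> and satisfies the inequality \<open>log_Young\<close>. The two are
  comparable up to an additive \<open>1\<close> in one direction and \<open>u\<close> in the
  other.\<close>

definition entropy_density :: "real \<Rightarrow> real" where
  "entropy_density u = u * ln (1 + u)"

lemma entropy_density_measurable[measurable]: "entropy_density \<in> borel_measurable borel"
  unfolding entropy_density_def[abs_def] by measurable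

lemma entropy_density_nonneg: "0 \<le> u \<Longrightarrow> 0 \<le> entropy_density u"
  by (simp add: entropy_density_def)

lemma entropy_density_mono: "0 \<le> u \<Longrightarrow> u \<le> v \<Longrightarrow> entropy_density u \<le> entropy_density v"
  by (auto simp: entropy_density_def intro!: mult_mono)

text \<open>For \<open>b > a\<close> the inequality \<open>ln y \<le> y - 1\<close> bounds the
  excess by \<open>a (b - a) / (1 + a)\<close>, which is at most \<open>b\<close>. It serves to
  exchange a common factor \<open>ln (1 + b)\<close> for the entropy of \<open>a\<close>
  itself.\<close>

lemma log_Young:
  fixes a b :: real
  assumes "0 \<le> a" "0 \<le> b"
  shows "a * ln (1 + b) \<le> entropy_density a + b"
proof (cases "b \<le> a")
  case True
  then have "a * ln (1 + b) \<le> a * ln (1 + a)" using assms by (intro mult_left_mono) auto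
  then show ?thesis using assms by (simp add: entropy_density_def)
next
  case False
  have "ln (1 + b) - ln (1 + a) = ln ((1 + b) / (1 + a))" using assms by (simp add: ln_div)
  also have "\<dots> \<le> (1 + b) / (1 + a) - 1" using assms by (intro ln_le_minus_one divide_pos_pos) auto
  also have "\<dots> = (b - a) / (1 + a)" using assms by (simp add: field_simps)
  finally have "a * (ln (1 + b) - ln (1 + a)) \<le> a * ((b - a) / (1 + a))" using assms by (intro mult_left_mono)
  also have "\<dots> \<le> b" using assms False mult_nonneg_nonneg[OF assms(1) assms(1)]
    by (simp add: pos_divide_le_eq add_pos_nonneg algebra_simps)
  finally show ?thesis by (simp add: entropy_density_def algebra_simps)
qed

lemma abs_ln_le_entropy_density:
  assumes "0 \<le> u" shows "u * \<bar>ln u\<bar> \<le> entropy_density u + 1"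
proof (cases "1 \<le> u")
  case True
  then have "u * \<bar>ln u\<bar> \<le> u * ln (1 + u)" by (intro mult_left_mono) auto
  then show ?thesis by (simp add: entropy_density_def)
next
  case False
  show ?thesis
  proof (cases "u = 0")
    case False
    then have u: "0 < u" "u < 1" using assms \<open>\<not> 1 \<le> u\<close> by auto
    have "- ln u = ln (1 / u)" using u by (simp add: ln_div)
    also have "\<dots> \<le> 1 / u - 1" using u by (intro ln_le_minus_one) auto
    finally have "u * \<bar>ln u\<bar> \<le> u * (1 / u - 1)" using u by (intro mult_left_mono) auto
    also have "\<dots> \<le> 1" using u by (simp add: algebra_simps)
    finally show ?thesis using entropy_density_nonneg[OF assms] by simp
  qed (simp add: entropy_density_def)
qed

lemma entropy_density_le_abs_ln:
  assumes "0 \<le> u" shows "entropy_density u \<le> u * \<bar>ln u\<bar> + u"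
proof (cases "1 \<le> u")
  case True
  have "ln (1 + u) \<le> ln (2 * u)" using True by (subst ln_le_cancel_iff) auto
  also have "\<dots> = ln 2 + ln u" using True by (simp add: ln_mult)
  also have "\<dots> \<le> 1 + \<bar>ln u\<bar>" using ln_le_minus_one[of 2] by simp
  finally have "u * ln (1 + u) \<le> u * (1 + \<bar>ln u\<bar>)" using assms by (intro mult_left_mono)
  then show ?thesis by (simp add: entropy_density_def algebra_simps)
next
  case False
  have "ln (1 + u) \<le> u" using assms by (intro ln_add_one_self_le_self)
  then have "u * ln (1 + u) \<le> u * 1" using False assms by (intro mult_left_mono) auto
  then show ?thesis using assms by (simp add: entropy_density_def add_increasing)
qed

text \<open>Where \<open>u\<close> exceeds \<open>R\<close>, the logarithm in the entropy is at
  least \<open>ln (1 + R)\<close>. A bound on the entropy thus becomes uniform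
  integrability.\<close>

lemma tail_le_entropy_density:
  assumes "0 \<le> u" "0 < R"
  shows "u - min u R \<le> entropy_density u / ln (1 + R)"
proof (cases "u \<le> R")
  case True
  then show ?thesis using assms entropy_density_nonneg[of u] by simp
next
  case False
  have R: "0 < ln (1 + R)" using assms by simp
  have "(u - min u R) * ln (1 + R) \<le> u * ln (1 + u)" using False assms by (intro mult_mono) auto
  then show ?thesis using R by (simp add: pos_le_divide_eq entropy_density_def)
qed

subsection \<open>Totally bounded sequences in the mean\<close>

text \<open>The indices before \<open>N\<close> get a colour each, for which \<open>R n n\<close>
  suffices, and the tail shares the colour \<open>0\<close>.\<close>

lemma finitely_colourable_eventually:
  assumes "\<And>n. R n n" "\<And>m n. N \<le> m \<Longrightarrow> N \<le> n \<Longrightarrow> R m n"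
  shows "finitely_colourable R"
proof -
  let ?c = "\<lambda>n. if n < N then Suc n else 0"
  have "range ?c \<subseteq> {..N}" by auto
  then have "finite (range ?c)" by (rule finite_subset) simp
  moreover have "R m n" if "?c m = ?c n" for m n
    using that assms by (auto split: if_splits)
  ultimately show ?thesis unfolding finitely_colourable_def by blast
qed

lemma finitely_colourable_ball:
  assumes "finite I" "\<And>i. i \<in> I \<Longrightarrow> finitely_colourable (R i)"
  shows "finitely_colourable (\<lambda>m n. \<forall>i\<in>I. R i m n)"
  using assms
proof (induction I rule: finite_induct)
  case empty
  show ?case by (rule finitely_colourable_eventually[of _ 0]) auto
next
  case (insert i I)
  then have "finitely_colourable (\<lambda>m n. R i m n \<and> (\<forall>i\<in>I. R i m n))"
    by (intro finitely_colourable_conj) auto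
  then show ?case by (rule finitely_colourable_mono) auto
qed

definition totally_bounded_L1 :: "'a measure \<Rightarrow> (nat \<Rightarrow> 'a \<Rightarrow> real) \<Rightarrow> bool" where
  "totally_bounded_L1 M a \<longleftrightarrow> (\<forall>n. integrable M (a n)) \<and>
     (\<forall>\<epsilon>>0. finitely_colourable (\<lambda>m n. (\<integral>x. \<bar>a m x - a n x\<bar> \<partial>M) < \<epsilon>))"

lemma integral_abs_triangle:
  fixes f g h :: "'a \<Rightarrow> real"
  assumes "integrable M f" "integrable M g" "integrable M h"
  shows "(\<integral>x. \<bar>f x - h x\<bar> \<partial>M) \<le> (\<integral>x. \<bar>f x - g x\<bar> \<partial>M) + (\<integral>x. \<bar>g x - h x\<bar> \<partial>M)"
proof -
  have "(\<integral>x. \<bar>f x - h x\<bar> \<partial>M) \<le> (\<integral>x. \<bar>f x - g x\<bar> + \<bar>g x - h x\<bar> \<partial>M)"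
    using assms by (intro integral_mono) auto
  also have "\<dots> = (\<integral>x. \<bar>f x - g x\<bar> \<partial>M) + (\<integral>x. \<bar>g x - h x\<bar> \<partial>M)" using assms by simp
  finally show ?thesis .
qed

text \<open>The approximating sequence may change with \<epsilon> but has to be close uniformly in
  \<open>n\<close>; the usual splitting into thirds then applies.\<close>

lemma totally_bounded_L1_approx:
  assumes a: "\<And>n. integrable M (a n)"
    and b: "\<And>\<epsilon>. \<epsilon> > 0 \<Longrightarrow> \<exists>b. totally_bounded_L1 M b \<and> (\<forall>n. (\<integral>x. \<bar>a n x - b n x\<bar> \<partial>M) < \<epsilon>)"
  shows "totally_bounded_L1 M a"
  unfolding totally_bounded_L1_def
proof (intro conjI allI impI a)
  fix \<epsilon> :: real assume "\<epsilon> > 0"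
  then obtain b where b: "totally_bounded_L1 M b" "\<And>n. (\<integral>x. \<bar>a n x - b n x\<bar> \<partial>M) < \<epsilon> / 3"
    using b[of "\<epsilon>/3"] by auto
  then have bi: "integrable M (b n)" for n by (simp add: totally_bounded_L1_def)
  have "finitely_colourable (\<lambda>m n. (\<integral>x. \<bar>b m x - b n x\<bar> \<partial>M) < \<epsilon> / 3)"
    using b(1) \<open>\<epsilon> > 0\<close> unfolding totally_bounded_L1_def by (meson zero_less_divide_iff zero_less_numeral)
  then show "finitely_colourable (\<lambda>m n. (\<integral>x. \<bar>a m x - a n x\<bar> \<partial>M) < \<epsilon>)"
  proof (rule finitely_colourable_mono)
    fix m n assume "(\<integral>x. \<bar>b m x - b n x\<bar> \<partial>M) < \<epsilon> / 3"
    moreover have "(\<integral>x. \<bar>b n x - a n x\<bar> \<partial>M) < \<epsilon> / 3" using b(2)[of n] by (simp add: abs_minus_commute)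
    ultimately show "(\<integral>x. \<bar>a m x - a n x\<bar> \<partial>M) < \<epsilon>"
      using b(2)[of m] integral_abs_triangle[OF a[of m] bi[of m] a[of n]]
        integral_abs_triangle[OF bi[of m] bi[of n] a[of n]] by linarith
  qed
qed

lemma totally_bounded_L1_add:
  assumes "totally_bounded_L1 M a" "totally_bounded_L1 M b"
  shows "totally_bounded_L1 M (\<lambda>n x. a n x + b n x)"
  unfolding totally_bounded_L1_def
proof (intro conjI allI impI)
  have ab: "integrable M (a n)" "integrable M (b n)" for n using assms by (auto simp: totally_bounded_L1_def)
  then show "integrable M (\<lambda>x. a n x + b n x)" for n by auto
  fix \<epsilon> :: real assume "\<epsilon> > 0"
  then have "finitely_colourable (\<lambda>m n. (\<integral>x. \<bar>a m x - a n x\<bar> \<partial>M) < \<epsilon>/2 \<and> (\<integral>x. \<bar>b m x - b n x\<bar> \<partial>M) < \<epsilon>/2)"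
    using assms unfolding totally_bounded_L1_def by (intro finitely_colourable_conj) (meson half_gt_zero)+
  then show "finitely_colourable (\<lambda>m n. (\<integral>x. \<bar>a m x + b m x - (a n x + b n x)\<bar> \<partial>M) < \<epsilon>)"
  proof (rule finitely_colourable_mono)
    fix m n assume h: "(\<integral>x. \<bar>a m x - a n x\<bar> \<partial>M) < \<epsilon>/2 \<and> (\<integral>x. \<bar>b m x - b n x\<bar> \<partial>M) < \<epsilon>/2"
    have "(\<integral>x. \<bar>a m x + b m x - (a n x + b n x)\<bar> \<partial>M) \<le> (\<integral>x. \<bar>a m x - a n x\<bar> + \<bar>b m x - b n x\<bar> \<partial>M)"
      using ab by (intro integral_mono) auto
    also have "\<dots> = (\<integral>x. \<bar>a m x - a n x\<bar> \<partial>M) + (\<integral>x. \<bar>b m x - b n x\<bar> \<partial>M)" using ab by simp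
    finally show "(\<integral>x. \<bar>a m x + b m x - (a n x + b n x)\<bar> \<partial>M) < \<epsilon>" using h by linarith
  qed
qed

lemma totally_bounded_L1_scale:
  assumes "totally_bounded_L1 M a"
  shows "totally_bounded_L1 M (\<lambda>n x. c * a n x)"
  unfolding totally_bounded_L1_def
proof (intro conjI allI impI)
  show "integrable M (\<lambda>x. c * a n x)" for n using assms by (auto simp: totally_bounded_L1_def)
  fix \<epsilon> :: real assume e: "\<epsilon> > 0"
  have "\<epsilon> / (\<bar>c\<bar> + 1) > 0" using e by (intro divide_pos_pos) auto
  then have "finitely_colourable (\<lambda>m n. (\<integral>x. \<bar>a m x - a n x\<bar> \<partial>M) < \<epsilon> / (\<bar>c\<bar> + 1))"
    using assms unfolding totally_bounded_L1_def by blast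
  then show "finitely_colourable (\<lambda>m n. (\<integral>x. \<bar>c * a m x - c * a n x\<bar> \<partial>M) < \<epsilon>)"
  proof (rule finitely_colourable_mono)
    fix m n
    let ?I = "\<integral>x. \<bar>a m x - a n x\<bar> \<partial>M"
    assume "?I < \<epsilon> / (\<bar>c\<bar> + 1)"
    then have "?I * (\<bar>c\<bar> + 1) < \<epsilon>" by (simp add: pos_less_divide_eq add_nonneg_pos)
    moreover have "\<bar>c\<bar> * ?I \<le> ?I * (\<bar>c\<bar> + 1)"
      using mult_right_mono[of "\<bar>c\<bar>" "\<bar>c\<bar> + 1" ?I] by (simp add: mult.commute)
    ultimately have "\<bar>c\<bar> * ?I < \<epsilon>" by linarith
    moreover have "(\<integral>x. \<bar>c * a m x - c * a n x\<bar> \<partial>M) = \<bar>c\<bar> * ?I"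
      by (simp add: abs_mult flip: right_diff_distrib)
    ultimately show "(\<integral>x. \<bar>c * a m x - c * a n x\<bar> \<partial>M) < \<epsilon>" by simp
  qed
qed

subsection \<open>Free transport and Duhamel integrals\<close>

lemma nn_integral_phase:
  fixes f :: "(real^'n) \<times> (real^'n) \<Rightarrow> ennreal"
  assumes [measurable]: "f \<in> borel_measurable (borel \<Otimes>\<^sub>M borel)"
  shows "(\<integral>\<^sup>+p. f p \<partial>phase) = (\<integral>\<^sup>+w. \<integral>\<^sup>+x. f (x, w) \<partial>torus_measure \<partial>sphere_borel)"
    and "(\<integral>\<^sup>+p. f p \<partial>phase) = (\<integral>\<^sup>+x. \<integral>\<^sup>+w. f (x, w) \<partial>sphere_borel \<partial>torus_measure)"
  unfolding phase_def
  by (rule phase_pair.nn_integral_snd[symmetric], measurable) (rule sph.nn_integral_fst[symmetric], measurable)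

lemma nn_integral_phase_translation:
  fixes f :: "(real^'n) \<times> (real^'n) \<Rightarrow> ennreal"
  assumes [measurable]: "f \<in> borel_measurable (borel \<Otimes>\<^sub>M borel)" "v \<in> borel_measurable borel"
    and per: "\<And>w. lattice_periodic (\<lambda>x. f (x, w))"
  shows "(\<integral>\<^sup>+p. f (fst p + v (snd p), snd p) \<partial>phase) = (\<integral>\<^sup>+p. f p \<partial>phase)"
proof -
  have "(\<integral>\<^sup>+p. f (fst p + v (snd p), snd p) \<partial>phase) =
      (\<integral>\<^sup>+w. \<integral>\<^sup>+x. f (x + v w, w) \<partial>torus_measure \<partial>sphere_borel)"
    by (subst nn_integral_phase(1)) auto
  also have "\<dots> = (\<integral>\<^sup>+w. \<integral>\<^sup>+x. f (x, w) \<partial>torus_measure \<partial>sphere_borel)"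
    by (intro nn_integral_cong nn_integral_torus_translation per) measurable
  also have "\<dots> = (\<integral>\<^sup>+p. f p \<partial>phase)" by (rule nn_integral_phase(1)[symmetric]) measurable
  finally show ?thesis .
qed

lemma AE_phase_translation:
  fixes P :: "(real^'n) \<times> (real^'n) \<Rightarrow> bool"
  assumes [measurable]: "Measurable.pred (borel \<Otimes>\<^sub>M borel) P" "v \<in> borel_measurable borel"
    and per: "\<And>w. lattice_periodic (\<lambda>x. P (x, w))" and P: "AE p in phase. P p"
  shows "AE p in phase. P (fst p + v (snd p), snd p)"
proof -
  let ?f = "\<lambda>p. if P p then 0 else 1 :: ennreal"
  have "(\<integral>\<^sup>+p. ?f p \<partial>phase) = 0" by (rule nn_integral_zeroI) (use P in \<open>auto elim: eventually_mono\<close>)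
  moreover have "(\<integral>\<^sup>+p. ?f (fst p + v (snd p), snd p) \<partial>phase) = (\<integral>\<^sup>+p. ?f p \<partial>phase)"
    by (rule nn_integral_phase_translation) (measurable, use per in \<open>auto simp: lattice_periodic_def\<close>)
  ultimately have "AE p in phase. ?f (fst p + v (snd p), snd p) = 0"
    by (intro nn_integral_zeroD) auto
  then show ?thesis by eventually_elim (auto split: if_splits)
qed

text \<open>For each \<open>s\<close> the motion along characteristics translates the torus by a
  vector depending on \<open>w\<close> only, so it preserves \<open>phase\<close>. Estimates of
  Duhamel integrals thereby reduce to the source at fixed times.\<close>

lemma nn_integral_characteristics:
  fixes g :: "real \<times> (real^'n) \<times> (real^'n) \<Rightarrow> ennreal" and \<theta> :: "real \<Rightarrow> ennreal"
  assumes [measurable]: "g \<in> borel_measurable (borel \<Otimes>\<^sub>M (borel \<Otimes>\<^sub>M borel))" "\<theta> \<in> borel_measurable borel"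
    and per: "\<And>s w. lattice_periodic (\<lambda>x. g (s, x, w))"
  shows "(\<integral>\<^sup>+p. \<integral>\<^sup>+s. \<theta> s * g (s, fst p - (\<gamma> * (t - s)) *\<^sub>R snd p, snd p) \<partial>lborel \<partial>phase) =
    (\<integral>\<^sup>+s. \<theta> s * (\<integral>\<^sup>+p. g (s, p) \<partial>phase) \<partial>lborel)"
proof -
  interpret pair_sigma_finite phase "lborel :: real measure" ..
  have "(\<integral>\<^sup>+p. \<integral>\<^sup>+s. \<theta> s * g (s, fst p - (\<gamma> * (t - s)) *\<^sub>R snd p, snd p) \<partial>lborel \<partial>phase) =
      (\<integral>\<^sup>+s. \<integral>\<^sup>+p. \<theta> s * g (s, fst p - (\<gamma> * (t - s)) *\<^sub>R snd p, snd p) \<partial>phase \<partial>lborel)"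
    by (rule Fubini'[symmetric]) measurable
  also have "\<dots> = (\<integral>\<^sup>+s. \<theta> s * (\<integral>\<^sup>+p. g (s, p) \<partial>phase) \<partial>lborel)"
  proof (rule nn_integral_cong)
    fix s
    have "(\<integral>\<^sup>+p. g (s, fst p - (\<gamma> * (t - s)) *\<^sub>R snd p, snd p) \<partial>phase) = (\<integral>\<^sup>+p. g (s, p) \<partial>phase)"
      using nn_integral_phase_translation[of "\<lambda>p. g (s, p)" "\<lambda>w. - (\<gamma> * (t - s)) *\<^sub>R w"] per by simp
    then show "(\<integral>\<^sup>+p. \<theta> s * g (s, fst p - (\<gamma> * (t - s)) *\<^sub>R snd p, snd p) \<partial>phase) = \<theta> s * (\<integral>\<^sup>+p. g (s, p) \<partial>phase)"
      by (subst nn_integral_cmult) auto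
  qed
  finally show ?thesis .
qed

text \<open>The upper limit \<tau> is separate from the time \<open>t\<close> in the exponent
  because the delayed formula stops at \<open>t - h\<close>. As a Borel function on the whole line
  it needs no variable domain of integration, and it vanishes identically for
  \<open>\<tau> < 0\<close>.\<close>

definition duhamel_weight :: "real \<Rightarrow> real \<Rightarrow> real \<Rightarrow> real" where
  "duhamel_weight \<tau> t s = (if 0 \<le> s \<and> s \<le> \<tau> then exp (s - t) else 0)"

lemma duhamel_weight_measurable[measurable]:
  assumes [measurable]: "f \<in> borel_measurable M" "g \<in> borel_measurable M" "h \<in> borel_measurable M"
  shows "(\<lambda>x. duhamel_weight (f x) (g x) (h x)) \<in> borel_measurable M"
  unfolding duhamel_weight_def by measurable

lemma duhamel_weight_nonneg: "0 \<le> duhamel_weight \<tau> t s"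
  by (simp add: duhamel_weight_def)

definition duhamel ::
  "real \<Rightarrow> real \<Rightarrow> (real \<times> (real^'n) \<times> (real^'n) \<Rightarrow> real) \<Rightarrow> real \<times> (real^'n) \<times> (real^'n) \<Rightarrow> real" where
  "duhamel \<gamma> h g q = (\<integral>s. duhamel_weight (fst q - h) (fst q) s *
     g (s, fst (snd q) - (\<gamma> * (fst q - s)) *\<^sub>R snd (snd q), snd (snd q)) \<partial>lborel)"

lemma duhamel_measurable[measurable]:
  assumes [measurable]: "g \<in> borel_measurable (borel \<Otimes>\<^sub>M (borel \<Otimes>\<^sub>M borel))"
  shows "duhamel \<gamma> h g \<in> borel_measurable (borel \<Otimes>\<^sub>M (borel \<Otimes>\<^sub>M borel))"
  unfolding duhamel_def[abs_def] by measurable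

lemma lattice_periodic_shift:
  assumes "lattice_periodic f" shows "lattice_periodic (\<lambda>x. f (x - v))" "lattice_periodic (\<lambda>x. f (x + v))"
  unfolding lattice_periodic_def
proof (safe)
  fix x k :: "real^'a" assume k: "\<forall>i. k $ i \<in> \<int>"
  have "x + k - v = (x - v) + k" "x + k + v = (x + v) + k" by simp_all
  then show "f (x + k - v) = f (x - v)" "f (x + k + v) = f (x + v)"
    using assms k unfolding lattice_periodic_def by metis+
qed

lemma duhamel_periodic:
  assumes "\<And>s w. lattice_periodic (\<lambda>x. g (s, x, w))"
  shows "lattice_periodic (\<lambda>x. duhamel \<gamma> h g (t, x, w))"
  unfolding duhamel_def fst_conv snd_conv lattice_periodic_def
  using lattice_periodic_shift(1)[OF assms, unfolded lattice_periodic_def] by simp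

lemma duhamel_nonneg:
  assumes "\<And>q. 0 \<le> g q" shows "0 \<le> duhamel \<gamma> h g q"
  unfolding duhamel_def using assms duhamel_weight_nonneg by (intro Bochner_Integration.integral_nonneg mult_nonneg_nonneg) auto

lemma ennreal_abs_integral_le:
  fixes f :: "'a \<Rightarrow> real"
  shows "ennreal \<bar>\<integral>x. f x \<partial>M\<bar> \<le> (\<integral>\<^sup>+x. ennreal \<bar>f x\<bar> \<partial>M)"
proof (cases "integrable M f")
  case True
  then show ?thesis using integral_norm_bound_ennreal[OF True] by simp
qed (simp add: not_integrable_integral_eq)

lemma nn_integral_duhamel_le:
  fixes g :: "real \<times> (real^'n) \<times> (real^'n) \<Rightarrow> real"
  assumes [measurable]: "g \<in> borel_measurable (borel \<Otimes>\<^sub>M (borel \<Otimes>\<^sub>M borel))"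
    and per: "\<And>s w. lattice_periodic (\<lambda>x. g (s, x, w))"
  shows "(\<integral>\<^sup>+p. ennreal \<bar>duhamel \<gamma> h g (t, p)\<bar> \<partial>phase) \<le>
    (\<integral>\<^sup>+s. ennreal (duhamel_weight (t - h) t s) * (\<integral>\<^sup>+p. ennreal \<bar>g (s, p)\<bar> \<partial>phase) \<partial>lborel)"
proof -
  have "(\<integral>\<^sup>+p. ennreal \<bar>duhamel \<gamma> h g (t, p)\<bar> \<partial>phase) \<le>
      (\<integral>\<^sup>+p. \<integral>\<^sup>+s. ennreal (duhamel_weight (t - h) t s) *
        ennreal \<bar>g (s, fst p - (\<gamma> * (t - s)) *\<^sub>R snd p, snd p)\<bar> \<partial>lborel \<partial>phase)"
    unfolding duhamel_def fst_conv snd_conv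
    by (intro nn_integral_mono order_trans[OF ennreal_abs_integral_le])
      (simp add: abs_mult duhamel_weight_nonneg ennreal_mult)
  also have "\<dots> = (\<integral>\<^sup>+s. ennreal (duhamel_weight (t - h) t s) * (\<integral>\<^sup>+p. ennreal \<bar>g (s, p)\<bar> \<partial>phase) \<partial>lborel)"
    by (rule nn_integral_characteristics[where g="\<lambda>q. ennreal \<bar>g q\<bar>"])
      (measurable, use per in \<open>auto simp: lattice_periodic_def\<close>)
  finally show ?thesis .
qed

text \<open>The integration is extended to \<open>{0..t}\<close> and done exactly, and a nonpositive
  term is dropped. The case \<open>B = 0\<close> gives the mass bound; the factor
  \<open>1 / (c + 1)\<close> is what closes the entropy induction.\<close>

lemma nn_integral_duhamel_weight_exp:
  assumes "0 \<le> A" "0 \<le> B" "0 \<le> c" "\<tau> \<le> t" "0 \<le> t"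
  shows "(\<integral>\<^sup>+s. ennreal (duhamel_weight \<tau> t s) * ennreal (A + B * exp (c * s)) \<partial>lborel)
    \<le> ennreal (A * (1 - exp (- t)) + B / (c + 1) * exp (c * t))"
proof -
  let ?F = "\<lambda>s. A * exp (s - t) + B / (c + 1) * exp ((c + 1) * s - t)"
  have "(\<integral>\<^sup>+s. ennreal (duhamel_weight \<tau> t s) * ennreal (A + B * exp (c * s)) \<partial>lborel) \<le>
      (\<integral>\<^sup>+s. ennreal (A * exp (s - t) + B * exp ((c + 1) * s - t)) * indicator {0..t} s \<partial>lborel)"
  proof (rule nn_integral_mono)
    fix s
    have "exp (s - t) * (A + B * exp (c * s)) = A * exp (s - t) + B * exp ((c + 1) * s - t)"
      by (simp add: algebra_simps flip: exp_add)
    then show "ennreal (duhamel_weight \<tau> t s) * ennreal (A + B * exp (c * s)) \<le>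
        ennreal (A * exp (s - t) + B * exp ((c + 1) * s - t)) * indicator {0..t} s"
      using assms by (auto simp: duhamel_weight_def ennreal_mult[symmetric] simp del: ennreal_plus split: split_indicator)
  qed
  also have "\<dots> = ennreal (?F t - ?F 0)"
  proof (rule nn_integral_FTC_Icc)
    fix s
    have "c + 1 \<noteq> 0" using assms by simp
    then show "(?F has_real_derivative A * exp (s - t) + B * exp ((c + 1) * s - t)) (at s)"
      by (auto intro!: derivative_eq_intros)
  qed (use assms in auto)
  also have "\<dots> \<le> ennreal (A * (1 - exp (- t)) + B / (c + 1) * exp (c * t))"
    using assms by (intro ennreal_leI) (simp add: algebra_simps)
  finally show ?thesis .
qed

subsection \<open>The gain term\<close>

definition density_of :: "(real \<times> (real^'n) \<times> (real^'n) \<Rightarrow> real) \<Rightarrow> real \<times> (real^'n) \<Rightarrow> real" where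
  "density_of F z = (\<integral>w. F (fst z, snd z, w) \<partial>sphere_borel)"

definition flux_of :: "(real \<times> (real^'n) \<times> (real^'n) \<Rightarrow> real) \<Rightarrow> real \<times> (real^'n) \<Rightarrow> real^'n" where
  "flux_of F z = (\<integral>w. F (fst z, snd z, w) *\<^sub>R w \<partial>sphere_borel)"

definition gain_of :: "(real \<times> (real^'n) \<times> (real^'n) \<Rightarrow> real) \<Rightarrow> real \<times> (real^'n) \<times> (real^'n) \<Rightarrow> real" where
  "gain_of F q = density_of F (fst q, fst (snd q)) * vonMises (flux_of F (fst q, fst (snd q))) (snd (snd q))"

lemma density_of_measurable[measurable]:
  assumes [measurable]: "F \<in> borel_measurable (borel \<Otimes>\<^sub>M (borel \<Otimes>\<^sub>M borel))"
  shows "density_of F \<in> borel_measurable (borel \<Otimes>\<^sub>M borel)"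
  unfolding density_of_def[abs_def] by measurable

lemma flux_of_measurable[measurable]:
  assumes [measurable]: "F \<in> borel_measurable (borel \<Otimes>\<^sub>M (borel \<Otimes>\<^sub>M borel))"
  shows "flux_of F \<in> borel_measurable (borel \<Otimes>\<^sub>M borel)"
  unfolding flux_of_def[abs_def] by measurable

lemma gain_of_measurable[measurable]:
  assumes [measurable]: "F \<in> borel_measurable (borel \<Otimes>\<^sub>M (borel \<Otimes>\<^sub>M borel))"
  shows "gain_of F \<in> borel_measurable (borel \<Otimes>\<^sub>M (borel \<Otimes>\<^sub>M borel))"
  unfolding gain_of_def[abs_def] by measurable

lemma moments_periodic:
  assumes "\<And>w. lattice_periodic (\<lambda>x. F (t, x, w))"
  shows "lattice_periodic (\<lambda>x. density_of F (t, x))" "lattice_periodic (\<lambda>x. flux_of F (t, x))"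
    "lattice_periodic (\<lambda>x. gain_of F (t, x, w))"
  using assms unfolding lattice_periodic_def gain_of_def density_of_def flux_of_def by simp_all

lemma density_of_nonneg: "(\<And>q. 0 \<le> F q) \<Longrightarrow> 0 \<le> density_of F z"
  unfolding density_of_def by simp

lemma gain_of_nonneg: "(\<And>q. 0 \<le> F q) \<Longrightarrow> 0 \<le> gain_of F q"
  unfolding gain_of_def by (intro mult_nonneg_nonneg density_of_nonneg vonMises_nonneg)

lemma gain_of_cong:
  assumes "\<And>x w. F (t, x, w) = G (t, x, w)"
  shows "gain_of F (t, x, w) = gain_of G (t, x, w)"
  unfolding gain_of_def density_of_def flux_of_def by (simp add: assms)

lemma norm_flux_of_le:
  assumes "\<And>q. 0 \<le> F q" "integrable sphere_borel (\<lambda>w. F (fst z, snd z, w))"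
  shows "norm (flux_of F z) \<le> density_of F z"
proof -
  have "norm (flux_of F z) \<le> (\<integral>w. norm (F (fst z, snd z, w) *\<^sub>R w) \<partial>sphere_borel)"
    unfolding flux_of_def by (rule integral_norm_bound)
  also have "\<dots> = density_of F z"
    unfolding density_of_def
  proof (rule integral_cong_AE)
    show "AE w in sphere_borel. norm (F (fst z, snd z, w) *\<^sub>R w) = F (fst z, snd z, w)"
      using AE_sphere_borel_norm by eventually_elim (simp add: assms(1))
  qed (use assms(2) in auto)
  finally show ?thesis .
qed

lemma nn_integral_gain_of:
  assumes "\<And>q. 0 \<le> F q"
  shows "(\<integral>\<^sup>+w. ennreal (gain_of F (t, x, w)) \<partial>sphere_borel) = ennreal (density_of F (t, x))"
proof -
  have "(\<integral>\<^sup>+w. ennreal (gain_of F (t, x, w)) \<partial>sphere_borel) =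
     ennreal (density_of F (t, x)) * (\<integral>\<^sup>+w. ennreal (vonMises (flux_of F (t, x)) w) \<partial>sphere_borel)"
    unfolding gain_of_def fst_conv snd_conv
    by (subst nn_integral_cmult[symmetric]) (auto simp: ennreal_mult density_of_nonneg[OF assms] vonMises_nonneg)
  then show ?thesis by (simp add: nn_integral_vonMises)
qed

lemma nn_integral_density_of:
  assumes "\<And>q. 0 \<le> F q" "integrable sphere_borel (\<lambda>w. F (t, x, w))"
  shows "(\<integral>\<^sup>+w. ennreal (F (t, x, w)) \<partial>sphere_borel) = ennreal (density_of F (t, x))"
  unfolding density_of_def using nn_integral_eq_integral[OF assms(2)] assms(1) by simp

text \<open>The first summand stems from the von Mises constant. The second is the price of trading
  \<open>\<rho> ln (1 + \<rho>)\<close> for the entropy of \<open>F\<close>: the area of the sphere,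
  once for each of the \<open>CARD('n) + 1\<close> powers of \<open>1 + \<rho>\<close>.\<close>

definition gain_log_const :: "'n::finite itself \<Rightarrow> real" where
  "gain_log_const _ = ln (1 + vonMises_const TYPE('n)) +
     (real CARD('n) + 1) * measure (sphere_borel :: (real^'n) measure) UNIV"

lemma gain_log_const_nonneg: "0 \<le> gain_log_const TYPE('n::finite)"
  unfolding gain_log_const_def using vonMises_const_pos[where 'n='n] by (intro add_nonneg_nonneg mult_nonneg_nonneg) auto

text \<open>The pointwise bound by \<open>C (1 + \<rho>)^(d + 1)\<close> makes the logarithm at most
  a quantity independent of \<open>w\<close>, and the gain integrates to \<rho>. What remains,
  \<open>\<rho> ln (1 + \<rho>)\<close>, is controlled by the entropy of \<open>F\<close>.\<close>

lemma nn_integral_entropy_gain_of: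
  fixes F :: "real \<times> (real^'n) \<times> (real^'n) \<Rightarrow> real"
  assumes F[measurable]: "F \<in> borel_measurable (borel \<Otimes>\<^sub>M (borel \<Otimes>\<^sub>M borel))" and F0: "\<And>q. 0 \<le> F q"
    and int: "integrable sphere_borel (\<lambda>w. F (t, x, w))"
  shows "(\<integral>\<^sup>+w. ennreal (entropy_density (gain_of F (t, x, w))) \<partial>sphere_borel) \<le>
     ennreal (real CARD('n) + 1) * (\<integral>\<^sup>+w. ennreal (entropy_density (F (t, x, w))) \<partial>sphere_borel)
     + ennreal (gain_log_const TYPE('n)) * (\<integral>\<^sup>+w. ennreal (F (t, x, w)) \<partial>sphere_borel)"
proof -
  let ?r = "density_of F (t, x)" and ?J = "flux_of F (t, x)" and ?C = "vonMises_const TYPE('n)" and ?d = "CARD('n)"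
  let ?S = "measure (sphere_borel :: (real^'n) measure) UNIV"
  have r: "0 \<le> ?r" by (rule density_of_nonneg[OF F0])
  have J: "norm ?J \<le> ?r" using norm_flux_of_le[of F "(t, x)"] F0 int by simp
  have C: "0 < ?C" by (rule vonMises_const_pos)
  define l where "l = ln (1 + ?C) + (real ?d + 1) * ln (1 + ?r)"
  have l0: "0 \<le> l" unfolding l_def using C r by (intro add_nonneg_nonneg mult_nonneg_nonneg) auto
  have "AE w in sphere_borel. ennreal (entropy_density (gain_of F (t, x, w))) \<le> ennreal (gain_of F (t, x, w)) * ennreal l"
    using AE_sphere_borel_norm
  proof eventually_elim
    case (elim w)
    have g0: "0 \<le> gain_of F (t, x, w)" by (rule gain_of_nonneg[OF F0])
    have "gain_of F (t, x, w) \<le> ?r * (?C * (1 + norm ?J) ^ ?d)"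
      unfolding gain_of_def fst_conv snd_conv using elim r by (intro mult_left_mono vonMises_le) auto
    also have "\<dots> \<le> ?r * (?C * (1 + ?r) ^ ?d)"
      using J r C by (intro mult_left_mono power_mono add_left_mono) auto
    also have "\<dots> \<le> (1 + ?r) * (?C * (1 + ?r) ^ ?d)" using r C by (intro mult_right_mono) auto
    finally have g: "gain_of F (t, x, w) \<le> ?C * (1 + ?r) ^ (?d + 1)" by (simp add: mult_ac)
    have "1 \<le> (1 + ?r) ^ (?d + 1)" using r by (intro one_le_power) auto
    with g have "1 + gain_of F (t, x, w) \<le> (1 + ?C) * (1 + ?r) ^ (?d + 1)" by (simp add: algebra_simps)
    then have "ln (1 + gain_of F (t, x, w)) \<le> ln ((1 + ?C) * (1 + ?r) ^ (?d + 1))"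
      using g0 r C by (subst ln_le_cancel_iff) (auto intro!: mult_pos_pos zero_less_power simp del: power_Suc)
    also have "\<dots> = l" unfolding l_def using r C by (subst ln_mult_pos) (auto simp: ln_realpow simp del: power_Suc)
    finally have "entropy_density (gain_of F (t, x, w)) \<le> gain_of F (t, x, w) * l"
      unfolding entropy_density_def using g0 by (intro mult_left_mono)
    then show ?case using g0 l0 by (simp add: ennreal_mult[symmetric])
  qed
  then have "(\<integral>\<^sup>+w. ennreal (entropy_density (gain_of F (t, x, w))) \<partial>sphere_borel) \<le>
      (\<integral>\<^sup>+w. ennreal (gain_of F (t, x, w)) * ennreal l \<partial>sphere_borel)"
    by (rule nn_integral_mono_AE)
  also have "\<dots> = ennreal ?r * ennreal l"
    by (subst nn_integral_multc) (auto simp: nn_integral_gain_of[OF F0])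
  also have "\<dots> = ennreal (ln (1 + ?C) * ?r) + ennreal (real ?d + 1) * ennreal (?r * ln (1 + ?r))"
    unfolding l_def using r C
    by (simp add: ennreal_mult[symmetric] ennreal_plus[symmetric] algebra_simps del: ennreal_plus)
  \<comment> \<open>\<rho> is the integral of \<open>F\<close> over the sphere, so
    \<open>log_Young\<close> can be used under that integral with \<open>b\<close> equal to \<rho>;
    its second term contributes the area \<open>?S\<close>.\<close>
  also have "ennreal (?r * ln (1 + ?r)) \<le>
      (\<integral>\<^sup>+w. ennreal (entropy_density (F (t, x, w))) \<partial>sphere_borel) + ennreal (?S * ?r)"
  proof -
    have "ennreal (?r * ln (1 + ?r)) = (\<integral>\<^sup>+w. ennreal (F (t, x, w)) * ennreal (ln (1 + ?r)) \<partial>sphere_borel)"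
      using r by (subst nn_integral_multc) (auto simp: nn_integral_density_of[OF F0 int] ennreal_mult)
    also have "\<dots> \<le> (\<integral>\<^sup>+w. ennreal (entropy_density (F (t, x, w))) + ennreal ?r \<partial>sphere_borel)"
    proof (rule nn_integral_mono)
      fix w
      have "F (t, x, w) * ln (1 + ?r) \<le> entropy_density (F (t, x, w)) + ?r" by (rule log_Young[OF F0 r])
      then show "ennreal (F (t, x, w)) * ennreal (ln (1 + ?r)) \<le> ennreal (entropy_density (F (t, x, w))) + ennreal ?r"
        using F0[of "(t, x, w)"] r entropy_density_nonneg[OF F0[of "(t, x, w)"]]
        by (simp add: ennreal_mult[symmetric] ennreal_plus[symmetric] del: ennreal_plus)
    qed
    also have "\<dots> = (\<integral>\<^sup>+w. ennreal (entropy_density (F (t, x, w))) \<partial>sphere_borel) + ennreal (?S * ?r)"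
      using r by (subst nn_integral_add) (auto simp: sph.emeasure_eq_measure ennreal_mult mult.commute)
    finally show ?thesis .
  qed
  finally have "(\<integral>\<^sup>+w. ennreal (entropy_density (gain_of F (t, x, w))) \<partial>sphere_borel) \<le>
      ennreal (ln (1 + ?C) * ?r) + ennreal (real ?d + 1) *
        ((\<integral>\<^sup>+w. ennreal (entropy_density (F (t, x, w))) \<partial>sphere_borel) + ennreal (?S * ?r))"
    by (auto simp: add_left_mono mult_left_mono)
  also have "\<dots> = ennreal (real ?d + 1) * (\<integral>\<^sup>+w. ennreal (entropy_density (F (t, x, w))) \<partial>sphere_borel) +
      (ennreal (ln (1 + ?C) * ?r) + ennreal (real ?d + 1) * ennreal (?S * ?r))"
    by (simp only: distrib_left add_ac)
  also have "ennreal (ln (1 + ?C) * ?r) + ennreal (real ?d + 1) * ennreal (?S * ?r) =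
      ennreal (gain_log_const TYPE('n)) * (\<integral>\<^sup>+w. ennreal (F (t, x, w)) \<partial>sphere_borel)"
    unfolding nn_integral_density_of[OF F0 int] using r C gain_log_const_nonneg[where 'n='n]
    by (simp add: ennreal_mult[symmetric] ennreal_plus[symmetric] gain_log_const_def algebra_simps del: ennreal_plus)
  finally show ?thesis .
qed

subsection \<open>Approximate solutions\<close>

definition free_flow :: "real \<Rightarrow> ((real^'n) \<times> (real^'n) \<Rightarrow> real) \<Rightarrow> real \<times> (real^'n) \<times> (real^'n) \<Rightarrow> real" where
  "free_flow \<gamma> f q = exp (- fst q) * f (fst (snd q) - (\<gamma> * fst q) *\<^sub>R snd (snd q), snd (snd q))"

lemma free_flow_measurable[measurable]:
  assumes [measurable]: "f \<in> borel_measurable (borel \<Otimes>\<^sub>M borel)"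
  shows "free_flow \<gamma> f \<in> borel_measurable (borel \<Otimes>\<^sub>M (borel \<Otimes>\<^sub>M borel))"
  unfolding free_flow_def[abs_def] by measurable

lemma free_flow_periodic:
  assumes "\<And>w. lattice_periodic (\<lambda>x. f (x, w))"
  shows "lattice_periodic (\<lambda>x. free_flow \<gamma> f (t, x, w))"
  unfolding free_flow_def fst_conv snd_conv lattice_periodic_def
  using lattice_periodic_shift(1)[OF assms, unfolded lattice_periodic_def] by simp

lemma nn_integral_free_flow:
  fixes f :: "(real^'n) \<times> (real^'n) \<Rightarrow> real"
  assumes [measurable]: "f \<in> borel_measurable (borel \<Otimes>\<^sub>M borel)" and per: "\<And>w. lattice_periodic (\<lambda>x. f (x, w))"
  shows "(\<integral>\<^sup>+p. ennreal \<bar>free_flow \<gamma> f (t, p)\<bar> \<partial>phase) = ennreal (exp (- t)) * (\<integral>\<^sup>+p. ennreal \<bar>f p\<bar> \<partial>phase)"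
proof -
  have "(\<integral>\<^sup>+p. ennreal \<bar>free_flow \<gamma> f (t, p)\<bar> \<partial>phase) =
      ennreal (exp (- t)) * (\<integral>\<^sup>+p. ennreal \<bar>f (fst p + - (\<gamma> * t) *\<^sub>R snd p, snd p)\<bar> \<partial>phase)"
    unfolding free_flow_def fst_conv snd_conv by (subst nn_integral_cmult[symmetric]) (auto simp: abs_mult ennreal_mult)
  also have "(\<integral>\<^sup>+p. ennreal \<bar>f (fst p + - (\<gamma> * t) *\<^sub>R snd p, snd p)\<bar> \<partial>phase) = (\<integral>\<^sup>+p. ennreal \<bar>f p\<bar> \<partial>phase)"
    by (rule nn_integral_phase_translation[where f="\<lambda>p. ennreal \<bar>f p\<bar>" and v="\<lambda>w. - (\<gamma> * t) *\<^sub>R w"])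
      (measurable, use per in \<open>auto simp: lattice_periodic_def\<close>)
  finally show ?thesis .
qed

locale kinetic =
  fixes \<gamma> :: real and f0 :: "(real^'n) \<times> (real^'n) \<Rightarrow> real"
  assumes dim: "CARD('n) \<ge> 2" and gamma: "\<gamma> > 0"
    and f0_measurable[measurable]: "f0 \<in> borel_measurable (borel \<Otimes>\<^sub>M borel)"
    and f0_nonneg: "\<And>p. 0 \<le> f0 p"
    and f0_periodic: "\<And>w. lattice_periodic (\<lambda>x. f0 (x, w))"
    and f0_integrable: "integrable phase f0"
    and f0_entropy: "(\<integral>\<^sup>+p. ennreal (entropy_density (f0 p)) \<partial>phase) < \<infinity>"
begin

definition mass :: real where "mass = (\<integral>p. f0 p \<partial>phase)"

definition entropy0 :: real where "entropy0 = enn2real (\<integral>\<^sup>+p. ennreal (entropy_density (f0 p)) \<partial>phase)"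

text \<open>The factor by which the gain may multiply the entropy; it becomes the rate of
  exponential growth.\<close>

definition rate :: real where "rate = real CARD('n) + 1"

text \<open>Dictated by the induction in \<open>iter_entropy_le\<close>: divided by
  \<open>rate + 1\<close>, it has to dominate everything except the entropy fed back by the
  gain.\<close>

definition entropy_const :: real where
  "entropy_const = (rate + 1) * (entropy0 + (gain_log_const TYPE('n) + 1) * mass)"

definition delay :: "nat \<Rightarrow> real" where "delay n = 1 / (real n + 1)"

definition cut :: "nat \<Rightarrow> (real^'n) \<times> (real^'n) \<Rightarrow> real" where "cut n p = min (f0 p) (real n)"

text \<open>\<open>n\<close> fixes the truncation level and the delay, \<open>k\<close> counts the
  steps of the iteration. Truncating both the datum and the gain bounds each iterate at every fixed
  time, so its moments are integrals of integrable functions.\<close>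

primrec iter :: "nat \<Rightarrow> nat \<Rightarrow> real \<times> (real^'n) \<times> (real^'n) \<Rightarrow> real" where
  "iter n 0 = free_flow \<gamma> (cut n)"
| "iter n (Suc k) = (\<lambda>q. free_flow \<gamma> (cut n) q + duhamel \<gamma> (delay n) (\<lambda>q. min (gain_of (iter n k) q) (real n)) q)"

lemma mass_nonneg: "0 \<le> mass" unfolding mass_def using f0_nonneg by simp

lemma nn_integral_f0: "(\<integral>\<^sup>+p. ennreal (f0 p) \<partial>phase) = ennreal mass"
  unfolding mass_def by (rule nn_integral_eq_integral[OF f0_integrable]) (simp add: f0_nonneg)

lemma nn_entropy_f0: "(\<integral>\<^sup>+p. ennreal (entropy_density (f0 p)) \<partial>phase) = ennreal entropy0"
  unfolding entropy0_def using f0_entropy by (simp add: less_top)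

lemma entropy0_nonneg: "0 \<le> entropy0" unfolding entropy0_def by simp

lemma rate_pos: "0 < rate" unfolding rate_def by simp

lemma entropy_const_nonneg: "0 \<le> entropy_const"
  unfolding entropy_const_def using entropy0_nonneg mass_nonneg gain_log_const_nonneg[where 'n='n] rate_pos
  by (intro mult_nonneg_nonneg add_nonneg_nonneg) auto

lemma delay_pos: "0 < delay n" unfolding delay_def by simp

lemma cut_measurable[measurable]: "cut n \<in> borel_measurable (borel \<Otimes>\<^sub>M borel)"
  unfolding cut_def[abs_def] by measurable

lemma cut_bounds: "0 \<le> cut n p" "cut n p \<le> f0 p" "cut n p \<le> real n"
  unfolding cut_def using f0_nonneg[of p] by auto

lemma cut_periodic: "lattice_periodic (\<lambda>x. cut n (x, w))"
  using f0_periodic[of w] unfolding cut_def lattice_periodic_def by simp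

lemma iter_measurable[measurable]: "iter n k \<in> borel_measurable (borel \<Otimes>\<^sub>M (borel \<Otimes>\<^sub>M borel))"
  by (induction k) simp_all

lemma free_cut_nonneg: "0 \<le> free_flow \<gamma> (cut n) q"
  unfolding free_flow_def by (simp add: cut_bounds)

lemma iter_nonneg: "0 \<le> iter n k q"
proof (induction k arbitrary: q)
  case 0
  show ?case by (simp add: free_cut_nonneg)
next
  case (Suc k)
  have "0 \<le> duhamel \<gamma> (delay n) (\<lambda>q. min (gain_of (iter n k) q) (real n)) q"
    using gain_of_nonneg[OF Suc] by (intro duhamel_nonneg) auto
  then show ?case using free_cut_nonneg by simp
qed

lemma iter_periodic: "lattice_periodic (\<lambda>x. iter n k (t, x, w))"
proof (induction k arbitrary: t w)
  case 0
  show ?case by (simp add: free_flow_periodic cut_periodic)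
next
  case (Suc k)
  have "lattice_periodic (\<lambda>x. min (gain_of (iter n k) (s, x, w)) (real n))" for s w
    using moments_periodic(3)[of "iter n k" s w, OF Suc] unfolding lattice_periodic_def by simp
  then have "lattice_periodic (\<lambda>x. duhamel \<gamma> (delay n) (\<lambda>q. min (gain_of (iter n k) q) (real n)) (t, x, w))"
    by (rule duhamel_periodic)
  moreover have "lattice_periodic (\<lambda>x. free_flow \<gamma> (cut n) (t, x, w))" by (rule free_flow_periodic[OF cut_periodic])
  ultimately show ?case unfolding lattice_periodic_def by simp
qed

text \<open>The source term of step \<open>Suc k\<close>. It refers to \<open>iter\<close>, so it is
  named only after the recursion; \<open>iter_Suc\<close> restates the recursion with it.\<close>

definition cut_gain :: "nat \<Rightarrow> nat \<Rightarrow> real \<times> (real^'n) \<times> (real^'n) \<Rightarrow> real" where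
  "cut_gain n k q = min (gain_of (iter n k) q) (real n)"

lemma cut_gain_measurable[measurable]: "cut_gain n k \<in> borel_measurable (borel \<Otimes>\<^sub>M (borel \<Otimes>\<^sub>M borel))"
  unfolding cut_gain_def[abs_def] by measurable

lemma cut_gain_bounds: "0 \<le> cut_gain n k q" "cut_gain n k q \<le> gain_of (iter n k) q" "cut_gain n k q \<le> real n"
  unfolding cut_gain_def using gain_of_nonneg[of "iter n k" q, OF iter_nonneg] by auto

lemma cut_gain_periodic: "lattice_periodic (\<lambda>x. cut_gain n k (t, x, w))"
  using moments_periodic(3)[of "iter n k" t w, OF iter_periodic] unfolding cut_gain_def lattice_periodic_def by simp

lemma iter_Suc: "iter n (Suc k) q = free_flow \<gamma> (cut n) q + duhamel \<gamma> (delay n) (cut_gain n k) q"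
  by (simp add: cut_gain_def[abs_def])

text \<open>The kernel has total mass at most \<open>1\<close>. At negative times it vanishes, so
  the bound holds there too.\<close>

lemma duhamel_bounded:
  assumes g: "\<And>q. 0 \<le> g q" "\<And>q. g q \<le> c" and h: "0 \<le> h"
  shows "duhamel \<gamma> h g q \<le> c"
proof (cases "0 \<le> fst q")
  case True
  have c: "0 \<le> c" using g by (meson order_trans)
  have "ennreal \<bar>duhamel \<gamma> h g q\<bar> \<le> (\<integral>\<^sup>+s. ennreal (duhamel_weight (fst q - h) (fst q) s) * ennreal (c + 0 * exp (0 * s)) \<partial>lborel)"
    unfolding duhamel_def
  proof (intro order_trans[OF ennreal_abs_integral_le] nn_integral_mono)
    fix s
    have "\<bar>duhamel_weight (fst q - h) (fst q) s * g (s, fst (snd q) - (\<gamma> * (fst q - s)) *\<^sub>R snd (snd q), snd (snd q))\<bar>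
      \<le> duhamel_weight (fst q - h) (fst q) s * (c + 0 * exp (0 * s))"
      unfolding abs_mult using g c duhamel_weight_nonneg by (intro mult_mono) auto
    then show "ennreal \<bar>duhamel_weight (fst q - h) (fst q) s * g (s, fst (snd q) - (\<gamma> * (fst q - s)) *\<^sub>R snd (snd q), snd (snd q))\<bar>
      \<le> ennreal (duhamel_weight (fst q - h) (fst q) s) * ennreal (c + 0 * exp (0 * s))"
      using c duhamel_weight_nonneg by (subst ennreal_mult[symmetric]) (auto intro: ennreal_leI)
  qed
  also have "\<dots> \<le> ennreal (c * (1 - exp (- fst q)) + 0 / (0 + 1) * exp (0 * fst q))"
    by (rule nn_integral_duhamel_weight_exp) (use c h True in auto)
  also have "\<dots> \<le> ennreal c" using c by (intro ennreal_leI) (simp add: algebra_simps)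
  finally show ?thesis using c by simp
next
  case False
  have c: "0 \<le> c" using g by (meson order_trans)
  have "duhamel_weight (fst q - h) (fst q) s = 0" for s using False h by (simp add: duhamel_weight_def)
  then show ?thesis using c by (simp add: duhamel_def)
qed

lemma iter_bounded: "iter n k (t, x, w) \<le> (exp (- t) + 1) * real n"
proof -
  have f: "free_flow \<gamma> (cut n) (t, x, w) \<le> exp (- t) * real n"
    unfolding free_flow_def by (simp add: cut_bounds)
  show ?thesis
  proof (cases k)
    case 0
    have "exp (- t) * real n \<le> (exp (- t) + 1) * real n" by (intro mult_right_mono) auto
    then show ?thesis using f 0 by simp
  next
    case (Suc j)
    have "duhamel \<gamma> (delay n) (cut_gain n j) (t, x, w) \<le> real n"
      using cut_gain_bounds delay_pos by (intro duhamel_bounded less_imp_le[OF delay_pos])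
    then show ?thesis using f unfolding Suc iter_Suc by (simp add: algebra_simps)
  qed
qed

lemma iter_sphere_integrable: "integrable sphere_borel (\<lambda>w. iter n k (t, x, w))"
  by (rule sph.integrable_const_bound[of _ "(exp (- t) + 1) * real n"])
    (use iter_bounded iter_nonneg in auto)

end

subsection \<open>Uniform bounds\<close>

context kinetic
begin

text \<open>The von Mises distribution has mass \<open>1\<close>, so at each \<open>x\<close> the
  gain redistributes velocities without changing the density.\<close>

lemma nn_integral_gain_iter:
  "(\<integral>\<^sup>+p. ennreal (gain_of (iter n k) (t, p)) \<partial>phase) = (\<integral>\<^sup>+p. ennreal (iter n k (t, p)) \<partial>phase)"
  by (subst (1 2) nn_integral_phase(2))
    (auto simp: nn_integral_gain_of[OF iter_nonneg] nn_integral_density_of[OF iter_nonneg iter_sphere_integrable])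

lemma nn_integral_cut_gain_le:
  "(\<integral>\<^sup>+p. ennreal (cut_gain n k (t, p)) \<partial>phase) \<le> (\<integral>\<^sup>+p. ennreal (iter n k (t, p)) \<partial>phase)"
  unfolding nn_integral_gain_iter[symmetric] by (intro nn_integral_mono ennreal_leI cut_gain_bounds)

lemma nn_integral_free_cut_le:
  "(\<integral>\<^sup>+p. ennreal (free_flow \<gamma> (cut n) (t, p)) \<partial>phase) \<le> ennreal (exp (- t) * mass)"
proof -
  have "(\<integral>\<^sup>+p. ennreal (free_flow \<gamma> (cut n) (t, p)) \<partial>phase) = ennreal (exp (- t)) * (\<integral>\<^sup>+p. ennreal (cut n p) \<partial>phase)"
    using nn_integral_free_flow[of "cut n" \<gamma> t] cut_periodic by (simp add: free_cut_nonneg cut_bounds)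
  also have "\<dots> \<le> ennreal (exp (- t)) * (\<integral>\<^sup>+p. ennreal (f0 p) \<partial>phase)"
    by (intro mult_left_mono nn_integral_mono ennreal_leI cut_bounds) auto
  also have "\<dots> = ennreal (exp (- t) * mass)"
    using mass_nonneg by (simp add: nn_integral_f0 ennreal_mult)
  finally show ?thesis .
qed

lemma nn_integral_duhamel_gain_le:
  "(\<integral>\<^sup>+p. ennreal (duhamel \<gamma> h (cut_gain n k) (t, p)) \<partial>phase) \<le>
    (\<integral>\<^sup>+s. ennreal (duhamel_weight (t - h) t s) * (\<integral>\<^sup>+p. ennreal (cut_gain n k (s, p)) \<partial>phase) \<partial>lborel)"
  using nn_integral_duhamel_le[of "cut_gain n k" \<gamma> h t] cut_gain_periodic
  by (simp add: cut_gain_bounds duhamel_nonneg)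

text \<open>The initial datum contributes at most the fraction \<open>exp (- t)\<close> of
  \<open>mass\<close>, and the source at most the complementary fraction.\<close>

lemma iter_mass_le:
  assumes "0 \<le> t"
  shows "(\<integral>\<^sup>+p. ennreal (iter n k (t, p)) \<partial>phase) \<le> ennreal mass"
  using assms
proof (induction k arbitrary: t)
  case 0
  have "exp (- t) * mass \<le> mass" using 0 mass_nonneg by (intro mult_left_le_one_le) auto
  then show ?case using nn_integral_free_cut_le[of n t] by (auto intro: order_trans ennreal_leI)
next
  case (Suc k)
  have "(\<integral>\<^sup>+p. ennreal (iter n (Suc k) (t, p)) \<partial>phase) =
     (\<integral>\<^sup>+p. ennreal (free_flow \<gamma> (cut n) (t, p)) \<partial>phase) + (\<integral>\<^sup>+p. ennreal (duhamel \<gamma> (delay n) (cut_gain n k) (t, p)) \<partial>phase)"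
    unfolding iter_Suc by (subst nn_integral_add[symmetric]) (auto simp: free_cut_nonneg duhamel_nonneg cut_gain_bounds)
  also have "\<dots> \<le> ennreal (exp (- t) * mass) + ennreal (mass * (1 - exp (- t)) + 0 / (0 + 1) * exp (0 * t))"
  proof (intro add_mono nn_integral_free_cut_le order_trans[OF nn_integral_duhamel_gain_le])
    have "(\<integral>\<^sup>+s. ennreal (duhamel_weight (t - delay n) t s) * (\<integral>\<^sup>+p. ennreal (cut_gain n k (s, p)) \<partial>phase) \<partial>lborel) \<le>
       (\<integral>\<^sup>+s. ennreal (duhamel_weight (t - delay n) t s) * ennreal (mass + 0 * exp (0 * s)) \<partial>lborel)"
    proof (rule nn_integral_mono)
      fix s
      show "ennreal (duhamel_weight (t - delay n) t s) * (\<integral>\<^sup>+p. ennreal (cut_gain n k (s, p)) \<partial>phase) \<le>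
         ennreal (duhamel_weight (t - delay n) t s) * ennreal (mass + 0 * exp (0 * s))"
        using order_trans[OF nn_integral_cut_gain_le Suc.IH, of s]
        by (cases "0 \<le> s") (auto simp: duhamel_weight_def intro!: mult_left_mono)
    qed
    also have "\<dots> \<le> ennreal (mass * (1 - exp (- t)) + 0 / (0 + 1) * exp (0 * t))"
      using Suc.prems mass_nonneg less_imp_le[OF delay_pos[of n]] by (intro nn_integral_duhamel_weight_exp) auto
    finally show "(\<integral>\<^sup>+s. ennreal (duhamel_weight (t - delay n) t s) * (\<integral>\<^sup>+p. ennreal (cut_gain n k (s, p)) \<partial>phase) \<partial>lborel) \<le>
      ennreal (mass * (1 - exp (- t)) + 0 / (0 + 1) * exp (0 * t))" .
  qed
  also have "\<dots> = ennreal mass"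
    using mult_left_le[of "exp (- t)" mass] Suc.prems mass_nonneg
    by (subst ennreal_plus[symmetric]) (auto simp: algebra_simps)
  finally show ?case .
qed

text \<open>Young's inequality for \<open>u ln (1 + u)\<close> replaces Jensen's inequality for the Duhamel average.\<close>

lemma entropy_duhamel_le:
  assumes t: "0 \<le> t" and g: "\<And>q. 0 \<le> g q" "\<And>q. g q \<le> c" and gm[measurable]: "g \<in> borel_measurable (borel \<Otimes>\<^sub>M (borel \<Otimes>\<^sub>M borel))"
    and h: "0 \<le> h" and F: "F = free_flow \<gamma> (cut n) (t, x, w) + duhamel \<gamma> h g (t, x, w)"
  shows "ennreal (entropy_density F) \<le> ennreal (exp (- t)) * ennreal (entropy_density (cut n (x - (\<gamma> * t) *\<^sub>R w, w)))
    + (\<integral>\<^sup>+s. ennreal (duhamel_weight (t - h) t s) * ennreal (entropy_density (g (s, x - (\<gamma> * (t - s)) *\<^sub>R w, w))) \<partial>lborel) + ennreal F"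
proof -
  let ?a = "cut n (x - (\<gamma> * t) *\<^sub>R w, w)" and ?W = "\<lambda>s. duhamel_weight (t - h) t s"
  let ?g = "\<lambda>s. g (s, x - (\<gamma> * (t - s)) *\<^sub>R w, w)"
  have D0: "0 \<le> duhamel \<gamma> h g q" for q using duhamel_nonneg[of g, OF g(1)] .
  have F0: "0 \<le> F" unfolding F using free_cut_nonneg D0 by simp
  have L: "0 \<le> ln (1 + F)" using F0 by simp
  \<comment> \<open>Together with the weight \<open>exp (- t)\<close> of the initial term this adds
    up to at most \<open>1\<close>, so the remainders of Young's inequality amount to a single
    \<open>F\<close>.\<close>
  have Wint: "(\<integral>\<^sup>+s. ennreal (?W s) \<partial>lborel) \<le> ennreal (1 - exp (- t))"
    using nn_integral_duhamel_weight_exp[of 1 0 0 "t - h" t] t h by simp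
  have "ennreal (duhamel \<gamma> h g (t, x, w)) \<le> (\<integral>\<^sup>+s. ennreal (?W s) * ennreal (?g s) \<partial>lborel)"
    using ennreal_abs_integral_le[of lborel "\<lambda>s. ?W s * ?g s"]
    by (simp add: duhamel_def abs_mult duhamel_weight_nonneg g ennreal_mult abs_of_nonneg integral_nonneg_AE)
  then have "ennreal (duhamel \<gamma> h g (t, x, w)) * ennreal (ln (1 + F)) \<le>
      (\<integral>\<^sup>+s. ennreal (?W s) * ennreal (?g s) \<partial>lborel) * ennreal (ln (1 + F))"
    by (rule mult_right_mono) simp
  also have "\<dots> = (\<integral>\<^sup>+s. ennreal (?W s) * ennreal (?g s) * ennreal (ln (1 + F)) \<partial>lborel)"
    by (subst nn_integral_multc) auto
  also have "\<dots> \<le> (\<integral>\<^sup>+s. ennreal (?W s) * ennreal (entropy_density (?g s)) + ennreal (?W s) * ennreal F \<partial>lborel)"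
  proof (rule nn_integral_mono)
    fix s
    have "?W s * (?g s * ln (1 + F)) \<le> ?W s * (entropy_density (?g s) + F)"
      by (intro mult_left_mono log_Young g F0 duhamel_weight_nonneg)
    then show "ennreal (?W s) * ennreal (?g s) * ennreal (ln (1 + F)) \<le>
        ennreal (?W s) * ennreal (entropy_density (?g s)) + ennreal (?W s) * ennreal F"
      using g(1)[of "(s, x - (\<gamma> * (t - s)) *\<^sub>R w, w)"] F0 L duhamel_weight_nonneg[of "t - h" t s] entropy_density_nonneg
      by (simp add: ennreal_mult[symmetric] ennreal_plus[symmetric] algebra_simps del: ennreal_plus)
  qed
  also have "\<dots> = (\<integral>\<^sup>+s. ennreal (?W s) * ennreal (entropy_density (?g s)) \<partial>lborel) + (\<integral>\<^sup>+s. ennreal (?W s) \<partial>lborel) * ennreal F"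
    by (subst nn_integral_add) (auto simp: nn_integral_multc)
  also have "\<dots> \<le> (\<integral>\<^sup>+s. ennreal (?W s) * ennreal (entropy_density (?g s)) \<partial>lborel) + ennreal (1 - exp (- t)) * ennreal F"
    by (intro add_left_mono mult_right_mono Wint) auto
  finally have D: "ennreal (duhamel \<gamma> h g (t, x, w)) * ennreal (ln (1 + F)) \<le> \<dots>" .
  have A: "ennreal (free_flow \<gamma> (cut n) (t, x, w)) * ennreal (ln (1 + F)) \<le>
     ennreal (exp (- t)) * ennreal (entropy_density ?a) + ennreal (exp (- t)) * ennreal F"
  proof -
    have "exp (- t) * (?a * ln (1 + F)) \<le> exp (- t) * (entropy_density ?a + F)"
      by (intro mult_left_mono log_Young cut_bounds F0) auto
    then show ?thesis using cut_bounds(1)[of n] F0 L entropy_density_nonneg[OF cut_bounds(1)[of n]]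
      by (simp add: free_flow_def ennreal_mult[symmetric] ennreal_plus[symmetric] algebra_simps del: ennreal_plus)
  qed
  \<comment> \<open>Only the factor \<open>F\<close> is split into its two parts; the logarithm
    keeps the full \<open>F\<close> as a common factor.\<close>
  have "ennreal (entropy_density F) = ennreal (free_flow \<gamma> (cut n) (t, x, w)) * ennreal (ln (1 + F)) +
      ennreal (duhamel \<gamma> h g (t, x, w)) * ennreal (ln (1 + F))"
    unfolding entropy_density_def using F0 L free_cut_nonneg D0
    by (subst (1) F) (simp add: ennreal_mult[symmetric] ennreal_plus[symmetric] distrib_right del: ennreal_plus)
  also have "\<dots> \<le> (ennreal (exp (- t)) * ennreal (entropy_density ?a) + ennreal (exp (- t)) * ennreal F) +
     ((\<integral>\<^sup>+s. ennreal (?W s) * ennreal (entropy_density (?g s)) \<partial>lborel) + ennreal (1 - exp (- t)) * ennreal F)"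
    by (intro add_mono A D)
  also have "\<dots> = ennreal (exp (- t)) * ennreal (entropy_density ?a) +
     (\<integral>\<^sup>+s. ennreal (?W s) * ennreal (entropy_density (?g s)) \<partial>lborel) +
     (ennreal (exp (- t)) * ennreal F + ennreal (1 - exp (- t)) * ennreal F)"
    by (simp only: add_ac)
  also have "ennreal (exp (- t)) * ennreal F + ennreal (1 - exp (- t)) * ennreal F = ennreal F"
    using t F0 mult_left_le[of "exp (- t)" F]
    by (simp add: ennreal_mult[symmetric] ennreal_plus[symmetric] algebra_simps del: ennreal_plus)
  finally show ?thesis .
qed

lemma nn_integral_entropy_gain_iter:
  "(\<integral>\<^sup>+p. ennreal (entropy_density (cut_gain n k (t, p))) \<partial>phase) \<le>
    ennreal rate * (\<integral>\<^sup>+p. ennreal (entropy_density (iter n k (t, p))) \<partial>phase)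
    + ennreal (gain_log_const TYPE('n)) * (\<integral>\<^sup>+p. ennreal (iter n k (t, p)) \<partial>phase)"
proof -
  have "(\<integral>\<^sup>+p. ennreal (entropy_density (cut_gain n k (t, p))) \<partial>phase) \<le>
      (\<integral>\<^sup>+p. ennreal (entropy_density (gain_of (iter n k) (t, p))) \<partial>phase)"
    by (intro nn_integral_mono ennreal_leI entropy_density_mono cut_gain_bounds)
  also have "\<dots> = (\<integral>\<^sup>+x. \<integral>\<^sup>+w. ennreal (entropy_density (gain_of (iter n k) (t, x, w))) \<partial>sphere_borel \<partial>torus_measure)"
    by (rule nn_integral_phase(2)) measurable
  also have "\<dots> \<le> (\<integral>\<^sup>+x. ennreal rate * (\<integral>\<^sup>+w. ennreal (entropy_density (iter n k (t, x, w))) \<partial>sphere_borel)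
     + ennreal (gain_log_const TYPE('n)) * (\<integral>\<^sup>+w. ennreal (iter n k (t, x, w)) \<partial>sphere_borel) \<partial>torus_measure)"
    unfolding rate_def
    by (intro nn_integral_mono nn_integral_entropy_gain_of iter_measurable iter_nonneg iter_sphere_integrable)
  also have "\<dots> = ennreal rate * (\<integral>\<^sup>+p. ennreal (entropy_density (iter n k (t, p))) \<partial>phase)
    + ennreal (gain_log_const TYPE('n)) * (\<integral>\<^sup>+p. ennreal (iter n k (t, p)) \<partial>phase)"
    by (subst nn_integral_add, measurable, (subst nn_integral_cmult, measurable)+, subst (1 2) nn_integral_phase(2)) measurable
  finally show ?thesis .
qed

lemma gain_entropy_const_nonneg: "0 \<le> gain_log_const TYPE('n) * mass"
  by (intro mult_nonneg_nonneg gain_log_const_nonneg mass_nonneg)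

lemma cut_gain_entropy_le_of_iter:
  assumes "0 \<le> t" and "(\<integral>\<^sup>+p. ennreal (entropy_density (iter n k (t, p))) \<partial>phase) \<le> ennreal (entropy_const * exp (rate * t))"
  shows "(\<integral>\<^sup>+p. ennreal (entropy_density (cut_gain n k (t, p))) \<partial>phase) \<le>
    ennreal (gain_log_const TYPE('n) * mass + (rate * entropy_const) * exp (rate * t))"
proof -
  have "(\<integral>\<^sup>+p. ennreal (entropy_density (cut_gain n k (t, p))) \<partial>phase) \<le>
      ennreal rate * ennreal (entropy_const * exp (rate * t)) + ennreal (gain_log_const TYPE('n)) * ennreal mass"
    by (intro order_trans[OF nn_integral_entropy_gain_iter] add_mono mult_left_mono assms(2) iter_mass_le assms(1)) auto
  also have "\<dots> = ennreal (gain_log_const TYPE('n) * mass + (rate * entropy_const) * exp (rate * t))"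
    using rate_pos entropy_const_nonneg mass_nonneg gain_log_const_nonneg[where 'n='n]
    by (simp add: ennreal_mult[symmetric] ennreal_plus[symmetric] algebra_simps del: ennreal_plus)
  finally show ?thesis .
qed

text \<open>Gronwall's argument as an induction on \<open>k\<close>: the source returns the fraction
  \<open>rate / (rate + 1)\<close> of the claimed bound, and the initial entropy and the mass terms
  fit into the remaining \<open>1 / (rate + 1)\<close>.\<close>

lemma iter_entropy_le:
  assumes "0 \<le> t"
  shows "(\<integral>\<^sup>+p. ennreal (entropy_density (iter n k (t, p))) \<partial>phase) \<le> ennreal (entropy_const * exp (rate * t))"
  using assms
proof (induction k arbitrary: t)
  case 0
  have 1: "entropy_density (iter n 0 (t, p)) \<le> exp (- t) * entropy_density (cut n (fst p + - (\<gamma> * t) *\<^sub>R snd p, snd p))" for p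
  proof -
    let ?a = "cut n (fst p + - (\<gamma> * t) *\<^sub>R snd p, snd p)"
    have "exp (- t) * ?a \<le> ?a" using 0 cut_bounds(1) by (intro mult_left_le_one_le) auto
    then have "exp (- t) * ?a * ln (1 + exp (- t) * ?a) \<le> exp (- t) * ?a * ln (1 + ?a)"
      using cut_bounds(1)[of n] by (intro mult_left_mono) (auto simp: add_pos_nonneg)
    then show ?thesis by (simp add: free_flow_def entropy_density_def mult.assoc)
  qed
  have "(\<integral>\<^sup>+p. ennreal (entropy_density (iter n 0 (t, p))) \<partial>phase) \<le>
     (\<integral>\<^sup>+p. ennreal (entropy_density (cut n (fst p + - (\<gamma> * t) *\<^sub>R snd p, snd p))) \<partial>phase)"
  proof (intro nn_integral_mono ennreal_leI)
    fix p :: "(real^'n) \<times> (real^'n)"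
    have "exp (- t) * entropy_density (cut n (fst p + - (\<gamma> * t) *\<^sub>R snd p, snd p)) \<le> entropy_density (cut n (fst p + - (\<gamma> * t) *\<^sub>R snd p, snd p))"
      using 0 entropy_density_nonneg[OF cut_bounds(1)] by (intro mult_left_le_one_le) auto
    then show "entropy_density (iter n 0 (t, p)) \<le> entropy_density (cut n (fst p + - (\<gamma> * t) *\<^sub>R snd p, snd p))"
      using 1[of p] by simp
  qed
  also have "\<dots> = (\<integral>\<^sup>+p. ennreal (entropy_density (cut n p)) \<partial>phase)"
    by (rule nn_integral_phase_translation[where f="\<lambda>p. ennreal (entropy_density (cut n p))" and v="\<lambda>w. - (\<gamma> * t) *\<^sub>R w"])
      (measurable, use cut_periodic in \<open>auto simp: lattice_periodic_def\<close>)
  also have "\<dots> \<le> (\<integral>\<^sup>+p. ennreal (entropy_density (f0 p)) \<partial>phase)"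
    by (intro nn_integral_mono ennreal_leI entropy_density_mono cut_bounds)
  also have "\<dots> = ennreal entropy0" by (rule nn_entropy_f0)
  also have "\<dots> \<le> ennreal (entropy_const * exp (rate * t))"
  proof (rule ennreal_leI)
    have "entropy0 \<le> 1 * (entropy0 + (gain_log_const TYPE('n) + 1) * mass)"
      using mass_nonneg gain_log_const_nonneg[where 'n='n] by simp
    also have "\<dots> \<le> entropy_const" unfolding entropy_const_def using rate_pos entropy0_nonneg mass_nonneg gain_log_const_nonneg[where 'n='n]
      by (intro mult_right_mono add_nonneg_nonneg mult_nonneg_nonneg) auto
    also have "\<dots> \<le> entropy_const * exp (rate * t)"
      using mult_left_mono[of 1 "exp (rate * t)" entropy_const] entropy_const_nonneg 0 rate_pos by simp
    finally show "entropy0 \<le> entropy_const * exp (rate * t)" .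
  qed
  finally show ?case .
next
  case (Suc k)
  let ?h = "delay n" and ?g = "cut_gain n k"
  have h: "0 \<le> ?h" using delay_pos[of n] by simp
  let ?K = "gain_log_const TYPE('n) * mass"
  have "(\<integral>\<^sup>+p. ennreal (entropy_density (iter n (Suc k) (t, p))) \<partial>phase) \<le>
     (\<integral>\<^sup>+p. (ennreal (exp (- t)) * ennreal (entropy_density (cut n (fst p + - (\<gamma> * t) *\<^sub>R snd p, snd p)))
    + (\<integral>\<^sup>+s. ennreal (duhamel_weight (t - ?h) t s) * ennreal (entropy_density (?g (s, fst p - (\<gamma> * (t - s)) *\<^sub>R snd p, snd p))) \<partial>lborel))
    + ennreal (iter n (Suc k) (t, p)) \<partial>phase)"
  proof (rule nn_integral_mono)
    fix p :: "(real^'n) \<times> (real^'n)"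
    show "ennreal (entropy_density (iter n (Suc k) (t, p))) \<le> (ennreal (exp (- t)) * ennreal (entropy_density (cut n (fst p + - (\<gamma> * t) *\<^sub>R snd p, snd p)))
    + (\<integral>\<^sup>+s. ennreal (duhamel_weight (t - ?h) t s) * ennreal (entropy_density (?g (s, fst p - (\<gamma> * (t - s)) *\<^sub>R snd p, snd p))) \<partial>lborel))
    + ennreal (iter n (Suc k) (t, p))"
      using entropy_duhamel_le[where g="?g" and c="real n" and h="?h" and n=n and x="fst p" and w="snd p",
        OF Suc.prems cut_gain_bounds(1) cut_gain_bounds(3) cut_gain_measurable h iter_Suc] by simp
  qed
  also have "\<dots> = (\<integral>\<^sup>+p. ennreal (exp (- t)) * ennreal (entropy_density (cut n (fst p + - (\<gamma> * t) *\<^sub>R snd p, snd p))) \<partial>phase)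
    + (\<integral>\<^sup>+p. \<integral>\<^sup>+s. ennreal (duhamel_weight (t - ?h) t s) * ennreal (entropy_density (?g (s, fst p - (\<gamma> * (t - s)) *\<^sub>R snd p, snd p))) \<partial>lborel \<partial>phase)
    + (\<integral>\<^sup>+p. ennreal (iter n (Suc k) (t, p)) \<partial>phase)"
    by (subst nn_integral_add, measurable, subst nn_integral_add) measurable
  also have "\<dots> \<le> ennreal (exp (- t) * entropy0) + ennreal (?K * (1 - exp (- t)) + (rate * entropy_const) / (rate + 1) * exp (rate * t)) + ennreal mass"
  proof (intro add_mono iter_mass_le Suc.prems)
    have "(\<integral>\<^sup>+p. ennreal (exp (- t)) * ennreal (entropy_density (cut n (fst p + - (\<gamma> * t) *\<^sub>R snd p, snd p))) \<partial>phase) =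
      ennreal (exp (- t)) * (\<integral>\<^sup>+p. ennreal (entropy_density (cut n (fst p + - (\<gamma> * t) *\<^sub>R snd p, snd p))) \<partial>phase)"
      by (rule nn_integral_cmult) measurable
    also have "(\<integral>\<^sup>+p. ennreal (entropy_density (cut n (fst p + - (\<gamma> * t) *\<^sub>R snd p, snd p))) \<partial>phase) = (\<integral>\<^sup>+p. ennreal (entropy_density (cut n p)) \<partial>phase)"
      by (rule nn_integral_phase_translation[where f="\<lambda>p. ennreal (entropy_density (cut n p))" and v="\<lambda>w. - (\<gamma> * t) *\<^sub>R w"])
        (measurable, use cut_periodic in \<open>auto simp: lattice_periodic_def\<close>)
    also have "\<dots> \<le> (\<integral>\<^sup>+p. ennreal (entropy_density (f0 p)) \<partial>phase)"
      by (intro nn_integral_mono ennreal_leI entropy_density_mono cut_bounds)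
    finally show "(\<integral>\<^sup>+p. ennreal (exp (- t)) * ennreal (entropy_density (cut n (fst p + - (\<gamma> * t) *\<^sub>R snd p, snd p))) \<partial>phase) \<le> ennreal (exp (- t) * entropy0)"
      using entropy0_nonneg by (simp add: nn_entropy_f0 ennreal_mult mult_left_mono)
    have "(\<integral>\<^sup>+p. \<integral>\<^sup>+s. ennreal (duhamel_weight (t - ?h) t s) * ennreal (entropy_density (?g (s, fst p - (\<gamma> * (t - s)) *\<^sub>R snd p, snd p))) \<partial>lborel \<partial>phase) =
      (\<integral>\<^sup>+s. ennreal (duhamel_weight (t - ?h) t s) * (\<integral>\<^sup>+p. ennreal (entropy_density (?g (s, p))) \<partial>phase) \<partial>lborel)"
      by (rule nn_integral_characteristics[where g="\<lambda>q. ennreal (entropy_density (?g q))"])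
        (measurable, use cut_gain_periodic in \<open>auto simp: lattice_periodic_def\<close>)
    also have "\<dots> \<le> (\<integral>\<^sup>+s. ennreal (duhamel_weight (t - ?h) t s) * ennreal (?K + (rate * entropy_const) * exp (rate * s)) \<partial>lborel)"
    proof (rule nn_integral_mono)
      fix s
      show "ennreal (duhamel_weight (t - ?h) t s) * (\<integral>\<^sup>+p. ennreal (entropy_density (?g (s, p))) \<partial>phase) \<le>
        ennreal (duhamel_weight (t - ?h) t s) * ennreal (?K + (rate * entropy_const) * exp (rate * s))"
        using cut_gain_entropy_le_of_iter[OF _ Suc.IH, of s]
        by (cases "0 \<le> s") (auto simp: duhamel_weight_def intro!: mult_left_mono)
    qed
    also have "\<dots> \<le> ennreal (?K * (1 - exp (- t)) + (rate * entropy_const) / (rate + 1) * exp (rate * t))"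
      using Suc.prems h rate_pos entropy_const_nonneg gain_entropy_const_nonneg by (intro nn_integral_duhamel_weight_exp) auto
    finally show "(\<integral>\<^sup>+p. \<integral>\<^sup>+s. ennreal (duhamel_weight (t - ?h) t s) * ennreal (entropy_density (?g (s, fst p - (\<gamma> * (t - s)) *\<^sub>R snd p, snd p))) \<partial>lborel \<partial>phase) \<le> \<dots>" .
  qed
  also have "\<dots> = ennreal (exp (- t) * entropy0 + (?K * (1 - exp (- t)) + (rate * entropy_const) / (rate + 1) * exp (rate * t)) + mass)"
    using Suc.prems entropy0_nonneg gain_entropy_const_nonneg rate_pos entropy_const_nonneg mass_nonneg
    by (simp add: ennreal_plus[symmetric] del: ennreal_plus)
  also have "\<dots> \<le> ennreal (entropy_const * exp (rate * t))"
  proof (rule ennreal_leI)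
    have e: "0 < exp (- t)" "exp (- t) \<le> 1" using Suc.prems by auto
    have "exp (- t) * entropy0 \<le> entropy0" using e entropy0_nonneg by (intro mult_left_le_one_le) auto
    moreover have "?K * (1 - exp (- t)) \<le> ?K" using e gain_entropy_const_nonneg by (intro mult_right_le_one_le) auto
    ultimately have "exp (- t) * entropy0 + ?K * (1 - exp (- t)) + mass \<le> entropy0 + (gain_log_const TYPE('n) + 1) * mass"
      by (simp add: algebra_simps)
    \<comment> \<open>This identity is the reason for the form of
      \<open>entropy_const\<close>.\<close>
    also have "\<dots> = entropy_const / (rate + 1)" unfolding entropy_const_def using rate_pos by simp
    also have "\<dots> \<le> entropy_const / (rate + 1) * exp (rate * t)"
      using mult_left_mono[of 1 "exp (rate * t)" "entropy_const / (rate + 1)"] entropy_const_nonneg rate_pos Suc.prems by simp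
    finally have "exp (- t) * entropy0 + (?K * (1 - exp (- t)) + (rate * entropy_const) / (rate + 1) * exp (rate * t)) + mass
      \<le> entropy_const / (rate + 1) * exp (rate * t) + (rate * entropy_const) / (rate + 1) * exp (rate * t)" by simp
    also have "\<dots> = (entropy_const * (1 + rate) / (rate + 1)) * exp (rate * t)"
      by (simp add: add_divide_distrib distrib_left distrib_right mult.commute)
    also have "\<dots> = entropy_const * exp (rate * t)"
      using rate_pos by (simp only: add.commute[of 1 rate]) simp
    finally show "exp (- t) * entropy0 + (?K * (1 - exp (- t)) + (rate * entropy_const) / (rate + 1) * exp (rate * t)) + mass
      \<le> entropy_const * exp (rate * t)" .
  qed
  finally show ?case .
qed

text \<open>The constant term of the gain bound is absorbed into the exponential, which is at least
  \<open>1\<close> for \<open>t \<ge> 0\<close>.\<close>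

definition gain_entropy_const :: real where
  "gain_entropy_const = gain_log_const TYPE('n) * mass + rate * entropy_const"

lemma gain_entropy_bound_nonneg: "0 \<le> gain_entropy_const"
  unfolding gain_entropy_const_def using gain_entropy_const_nonneg rate_pos entropy_const_nonneg by simp

lemma cut_gain_entropy_le:
  assumes "0 \<le> t"
  shows "(\<integral>\<^sup>+p. ennreal (entropy_density (cut_gain n k (t, p))) \<partial>phase) \<le> ennreal (gain_entropy_const * exp (rate * t))"
proof -
  have "gain_log_const TYPE('n) * mass * 1 \<le> gain_log_const TYPE('n) * mass * exp (rate * t)"
    using assms rate_pos gain_entropy_const_nonneg by (intro mult_left_mono) auto
  then show ?thesis
    using cut_gain_entropy_le_of_iter[OF assms iter_entropy_le[OF assms], of n k]
    by (elim order_trans) (auto simp: gain_entropy_const_def algebra_simps intro!: ennreal_leI)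
qed

subsection \<open>The delay makes the iteration stationary\<close>

text \<open>With a delay \<open>h\<close>, the values up to time \<open>(k + 1) h\<close> depend on
  the preceding iterate only up to time \<open>k h\<close>. For \<open>t \<le> 0\<close> the Duhamel
  term is void, which starts the induction.\<close>

lemma iter_stationary:
  assumes "t \<le> real k * delay n"
  shows "iter n (Suc k) (t, x, w) = iter n k (t, x, w)"
  using assms
proof (induction k arbitrary: t x w)
  case 0
  have "duhamel_weight (t - delay n) t s = 0" for s
    using 0 delay_pos[of n] by (simp add: duhamel_weight_def)
  then show ?case by (simp add: duhamel_def)
next
  case (Suc k)
  have "duhamel \<gamma> (delay n) (cut_gain n (Suc k)) (t, x, w) = duhamel \<gamma> (delay n) (cut_gain n k) (t, x, w)"
    unfolding duhamel_def fst_conv snd_conv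
  proof (intro Bochner_Integration.integral_cong refl)
    fix s
    show "duhamel_weight (t - delay n) t s * cut_gain n (Suc k) (s, x - (\<gamma> * (t - s)) *\<^sub>R w, w) =
       duhamel_weight (t - delay n) t s * cut_gain n k (s, x - (\<gamma> * (t - s)) *\<^sub>R w, w)"
    proof (cases "s \<le> t - delay n")
      case True
      then have "s \<le> real k * delay n" using Suc.prems by (simp add: algebra_simps)
      then show ?thesis unfolding cut_gain_def using gain_of_cong[of "iter n (Suc k)" s "iter n k", OF Suc.IH] by simp
    qed (simp add: duhamel_weight_def)
  qed
  then show ?case by (simp only: iter_Suc)
qed

text \<open>\<open>(n + 1) * n\<close> steps of length \<open>1 / (n + 1)\<close> reach the time
  \<open>n\<close>.\<close>

definition iterations :: "nat \<Rightarrow> nat" where "iterations n = (n + 1) * n"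

text \<open>One step beyond \<open>iterations n\<close>: \<open>source n\<close> is built from the
  preceding iterate, and by stationarity it is the truncated gain of \<open>approx n\<close> itself
  up to time \<open>n\<close>.\<close>

definition approx :: "nat \<Rightarrow> real \<times> (real^'n) \<times> (real^'n) \<Rightarrow> real" where
  "approx n = iter n (Suc (iterations n))"

definition source :: "nat \<Rightarrow> real \<times> (real^'n) \<times> (real^'n) \<Rightarrow> real" where
  "source n = cut_gain n (iterations n)"

lemma approx_eq: "approx n q = free_flow \<gamma> (cut n) q + duhamel \<gamma> (delay n) (source n) q"
  unfolding approx_def source_def by (rule iter_Suc)

lemma source_eq:
  assumes "t \<le> real n"
  shows "source n (t, x, w) = min (gain_of (approx n) (t, x, w)) (real n)"
proof -
  have "real (iterations n) = (real n + 1) * real n" by (simp add: iterations_def algebra_simps)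
  moreover have "real n + 1 \<noteq> 0" by simp
  ultimately have "real (iterations n) * delay n = real n"
    unfolding delay_def by (simp only: times_divide_eq_right mult_1_right nonzero_mult_div_cancel_left not_False_eq_True)
  then have "t \<le> real (iterations n) * delay n" using assms by simp
  from gain_of_cong[of "iter n (Suc (iterations n))" t "iter n (iterations n)", OF iter_stationary[OF this]]
  show ?thesis unfolding source_def cut_gain_def approx_def by simp
qed

end

subsection \<open>Compactness of the moments\<close>

lemma totally_bounded_L1_Cauchy:
  assumes a: "\<And>n. integrable M (a n)"
    and c: "\<And>\<epsilon>. \<epsilon> > 0 \<Longrightarrow> \<exists>N. \<forall>m\<ge>N. \<forall>n\<ge>N. (\<integral>x. \<bar>a m x - a n x\<bar> \<partial>M) < \<epsilon>"
  shows "totally_bounded_L1 M a"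
  unfolding totally_bounded_L1_def
proof (intro conjI allI impI a)
  fix \<epsilon> :: real assume e: "\<epsilon> > 0"
  then obtain N where "\<And>m n. N \<le> m \<Longrightarrow> N \<le> n \<Longrightarrow> (\<integral>x. \<bar>a m x - a n x\<bar> \<partial>M) < \<epsilon>"
    using c by blast
  then show "finitely_colourable (\<lambda>m n. (\<integral>x. \<bar>a m x - a n x\<bar> \<partial>M) < \<epsilon>)"
    using e by (intro finitely_colourable_eventually[of _ N]) auto
qed

lemma AE_time_measure_nonneg: "AE t in time_measure. 0 \<le> t"
  unfolding time_measure_def by (subst AE_density) (auto split: split_indicator)

lemma integral_time_measure:
  fixes f :: "real \<Rightarrow> real"
  assumes [measurable]: "f \<in> borel_measurable borel"
  shows "(\<integral>t. f t \<partial>time_measure) = (\<integral>t. (exp (- t) * indicator {0..} t) * f t \<partial>lborel)"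
proof -
  have *: "time_measure = density lborel (\<lambda>t. ennreal (exp (- t) * indicator {0..} t))"
    unfolding time_measure_def by (intro density_cong) (auto split: split_indicator)
  show ?thesis unfolding * by (subst integral_density) auto
qed

lemma duhamel_weight_integrable:
  assumes [measurable]: "g \<in> borel_measurable borel" and g: "\<And>s. \<bar>g s\<bar> \<le> c" and "\<tau> \<le> t"
  shows "integrable lborel (\<lambda>s. duhamel_weight \<tau> t s * g s)"
proof (rule integrableI_bounded)
  have c: "0 \<le> c" using g by (meson abs_ge_zero order_trans)
  show "(\<integral>\<^sup>+s. ennreal (norm (duhamel_weight \<tau> t s * g s)) \<partial>lborel) < \<infinity>"
  proof (cases "0 \<le> t")
    case True
    have "(\<integral>\<^sup>+s. ennreal (norm (duhamel_weight \<tau> t s * g s)) \<partial>lborel) \<le>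
       (\<integral>\<^sup>+s. ennreal (duhamel_weight \<tau> t s) * ennreal (c + 0 * exp (0 * s)) \<partial>lborel)"
      using c g duhamel_weight_nonneg
      by (intro nn_integral_mono) (auto simp: ennreal_mult[symmetric] abs_mult intro!: ennreal_leI mult_mono)
    also have "\<dots> \<le> ennreal (c * (1 - exp (- t)) + 0 / (0 + 1) * exp (0 * t))"
      by (rule nn_integral_duhamel_weight_exp) (use c assms True in auto)
    also have "\<dots> < \<infinity>" by simp
    finally show ?thesis .
  next
    case False
    then have "duhamel_weight \<tau> t s = 0" for s using assms(3) by (simp add: duhamel_weight_def)
    then show ?thesis by simp
  qed
qed measurable

context kinetic
begin

text \<open>The damping by \<open>exp (- (rate * t))\<close> offsets the growth of the entropy
  bound, so that truncation errors are small in the mean over all times together.\<close>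

definition weighted_moment :: "((real^'n) \<Rightarrow> real) \<Rightarrow> (real \<times> (real^'n) \<times> (real^'n) \<Rightarrow> real) \<Rightarrow> real \<times> (real^'n) \<Rightarrow> real" where
  "weighted_moment \<psi> F z = exp (- (rate * fst z)) * (\<integral>w. \<psi> w * F (fst z, snd z, w) \<partial>sphere_borel)"

lemma weighted_moment_measurable[measurable]:
  assumes [measurable]: "F \<in> borel_measurable (borel \<Otimes>\<^sub>M (borel \<Otimes>\<^sub>M borel))" "\<psi> \<in> borel_measurable borel"
  shows "weighted_moment \<psi> F \<in> borel_measurable (borel \<Otimes>\<^sub>M borel)"
  unfolding weighted_moment_def[abs_def] by measurable

lemma weighted_moment_L1:
  assumes [measurable]: "F \<in> borel_measurable (borel \<Otimes>\<^sub>M (borel \<Otimes>\<^sub>M borel))" "\<psi> \<in> borel_measurable borel"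
    and \<psi>: "\<And>w. \<bar>\<psi> w\<bar> \<le> 1" and K: "0 \<le> K"
    and F: "\<And>t. 0 \<le> t \<Longrightarrow> (\<integral>\<^sup>+p. ennreal \<bar>F (t, p)\<bar> \<partial>phase) \<le> ennreal (K * exp (rate * t))"
  shows "integrable space_time (weighted_moment \<psi> F)"
    and "(\<integral>z. \<bar>weighted_moment \<psi> F z\<bar> \<partial>space_time) \<le> K * measure time_measure UNIV"
proof -
  have "(\<integral>\<^sup>+z. ennreal \<bar>weighted_moment \<psi> F z\<bar> \<partial>space_time) =
      (\<integral>\<^sup>+t. \<integral>\<^sup>+x. ennreal \<bar>weighted_moment \<psi> F (t, x)\<bar> \<partial>torus_measure \<partial>time_measure)"
    by (rule torus.nn_integral_fst[symmetric]) measurable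
  also have "\<dots> \<le> (\<integral>\<^sup>+t. ennreal K \<partial>time_measure)"
  proof (rule nn_integral_mono_AE)
    show "AE t in time_measure. (\<integral>\<^sup>+x. ennreal \<bar>weighted_moment \<psi> F (t, x)\<bar> \<partial>torus_measure) \<le> ennreal K"
      using AE_time_measure_nonneg
    proof eventually_elim
      case (elim t)
      have "(\<integral>\<^sup>+x. ennreal \<bar>weighted_moment \<psi> F (t, x)\<bar> \<partial>torus_measure) \<le>
         (\<integral>\<^sup>+x. ennreal (exp (- (rate * t))) * (\<integral>\<^sup>+w. ennreal \<bar>F (t, x, w)\<bar> \<partial>sphere_borel) \<partial>torus_measure)"
      proof (rule nn_integral_mono)
        fix x
        have "ennreal \<bar>\<integral>w. \<psi> w * F (t, x, w) \<partial>sphere_borel\<bar> \<le> (\<integral>\<^sup>+w. ennreal \<bar>\<psi> w * F (t, x, w)\<bar> \<partial>sphere_borel)"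
          by (rule ennreal_abs_integral_le)
        also have "\<dots> \<le> (\<integral>\<^sup>+w. ennreal \<bar>F (t, x, w)\<bar> \<partial>sphere_borel)"
          using \<psi> by (intro nn_integral_mono ennreal_leI) (simp add: abs_mult mult_left_le_one_le)
        finally show "ennreal \<bar>weighted_moment \<psi> F (t, x)\<bar> \<le> ennreal (exp (- (rate * t))) * (\<integral>\<^sup>+w. ennreal \<bar>F (t, x, w)\<bar> \<partial>sphere_borel)"
          by (simp add: weighted_moment_def abs_mult ennreal_mult mult_left_mono)
      qed
      also have "\<dots> = ennreal (exp (- (rate * t))) * (\<integral>\<^sup>+p. ennreal \<bar>F (t, p)\<bar> \<partial>phase)"
        by (subst nn_integral_cmult, measurable, subst nn_integral_phase(2)) measurable
      also have "\<dots> \<le> ennreal (exp (- (rate * t))) * ennreal (K * exp (rate * t))"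
        by (intro mult_left_mono F elim) auto
      also have "\<dots> = ennreal K" using K by (simp add: ennreal_mult[symmetric] exp_minus field_simps)
      finally show ?case .
    qed
  qed
  also have "\<dots> = ennreal (K * measure time_measure UNIV)"
    using K by (simp add: time.emeasure_eq_measure ennreal_mult)
  finally have N: "(\<integral>\<^sup>+z. ennreal \<bar>weighted_moment \<psi> F z\<bar> \<partial>space_time) \<le> ennreal (K * measure time_measure UNIV)" .
  show i: "integrable space_time (weighted_moment \<psi> F)"
    using order.strict_trans1[OF N ennreal_less_top] by (intro integrableI_bounded) auto
  have "ennreal (\<integral>z. \<bar>weighted_moment \<psi> F z\<bar> \<partial>space_time) = (\<integral>\<^sup>+z. ennreal \<bar>weighted_moment \<psi> F z\<bar> \<partial>space_time)"
    using i by (intro nn_integral_eq_integral[symmetric]) auto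
  then show "(\<integral>z. \<bar>weighted_moment \<psi> F z\<bar> \<partial>space_time) \<le> K * measure time_measure UNIV"
    using N K by (metis ennreal_le_iff measure_nonneg mult_nonneg_nonneg)
qed

lemma weighted_moment_diff:
  assumes [measurable]: "\<psi> \<in> borel_measurable borel" and \<psi>: "\<And>w. \<bar>\<psi> w\<bar> \<le> 1"
    and F: "\<And>t x. integrable sphere_borel (\<lambda>w. F (t, x, w))" and G: "\<And>t x. integrable sphere_borel (\<lambda>w. G (t, x, w))"
  shows "weighted_moment \<psi> F z - weighted_moment \<psi> G z = weighted_moment \<psi> (\<lambda>q. F q - G q) z"
    and "weighted_moment \<psi> F z + weighted_moment \<psi> G z = weighted_moment \<psi> (\<lambda>q. F q + G q) z"
proof -
  have i: "integrable sphere_borel (\<lambda>w. \<psi> w * h w)" if "integrable sphere_borel h" for h :: "real^'n \<Rightarrow> real"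
    by (rule Bochner_Integration.integrable_bound[OF that])
      (use that \<psi> in \<open>auto simp: abs_mult mult_left_le_one_le\<close>)
  have "(\<integral>w. \<psi> w * (F (fst z, snd z, w) - G (fst z, snd z, w)) \<partial>sphere_borel) =
      (\<integral>w. \<psi> w * F (fst z, snd z, w) \<partial>sphere_borel) - (\<integral>w. \<psi> w * G (fst z, snd z, w) \<partial>sphere_borel)"
    using Bochner_Integration.integral_diff[OF i[OF F] i[OF G]] by (simp add: right_diff_distrib)
  then show "weighted_moment \<psi> F z - weighted_moment \<psi> G z = weighted_moment \<psi> (\<lambda>q. F q - G q) z"
    unfolding weighted_moment_def by (simp only: right_diff_distrib)
  have "(\<integral>w. \<psi> w * (F (fst z, snd z, w) + G (fst z, snd z, w)) \<partial>sphere_borel) =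
      (\<integral>w. \<psi> w * F (fst z, snd z, w) \<partial>sphere_borel) + (\<integral>w. \<psi> w * G (fst z, snd z, w) \<partial>sphere_borel)"
    using Bochner_Integration.integral_add[OF i[OF F] i[OF G]] by (simp add: distrib_left)
  then show "weighted_moment \<psi> F z + weighted_moment \<psi> G z = weighted_moment \<psi> (\<lambda>q. F q + G q) z"
    unfolding weighted_moment_def by (simp only: distrib_left)
qed

lemma source_measurable[measurable]: "source n \<in> borel_measurable (borel \<Otimes>\<^sub>M (borel \<Otimes>\<^sub>M borel))"
  unfolding source_def by measurable

lemma source_bounds: "0 \<le> source n q" "source n q \<le> real n"
  unfolding source_def by (rule cut_gain_bounds)+

lemma source_periodic: "lattice_periodic (\<lambda>x. source n (t, x, w))"
  unfolding source_def by (rule cut_gain_periodic)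

lemma source_mass_le: "0 \<le> t \<Longrightarrow> (\<integral>\<^sup>+p. ennreal (source n (t, p)) \<partial>phase) \<le> ennreal mass"
  unfolding source_def using order_trans[OF nn_integral_cut_gain_le iter_mass_le] .

lemma free_cut_sphere_integrable: "integrable sphere_borel (\<lambda>w. free_flow \<gamma> (cut n) (t, x, w))"
proof (rule sph.integrable_const_bound[of _ "exp (- t) * real n"])
  have "free_flow \<gamma> (cut n) (t, x, w) \<le> exp (- t) * real n" for w
    unfolding free_flow_def by (simp add: cut_bounds)
  then show "AE w in sphere_borel. norm (free_flow \<gamma> (cut n) (t, x, w)) \<le> exp (- t) * real n"
    using free_cut_nonneg by (intro AE_I2) (simp add: abs_of_nonneg)
qed measurable

lemma duhamel_sphere_integrable:
  assumes [measurable]: "g \<in> borel_measurable (borel \<Otimes>\<^sub>M (borel \<Otimes>\<^sub>M borel))" and g: "\<And>q. 0 \<le> g q" "\<And>q. g q \<le> c" and h: "0 \<le> h"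
  shows "integrable sphere_borel (\<lambda>w. duhamel \<gamma> h g (t, x, w))"
  by (rule sph.integrable_const_bound[of _ c])
    (use duhamel_bounded[of g c h, OF g h] duhamel_nonneg[of g, OF g(1)] in auto)

lemma duhamel_diff:
  assumes g: "g \<in> borel_measurable (borel \<Otimes>\<^sub>M (borel \<Otimes>\<^sub>M borel))" "\<And>q. 0 \<le> g q" "\<And>q. g q \<le> c"
    and g': "g' \<in> borel_measurable (borel \<Otimes>\<^sub>M (borel \<Otimes>\<^sub>M borel))" "\<And>q. 0 \<le> g' q" "\<And>q. g' q \<le> c" and h: "0 \<le> h"
  shows "duhamel \<gamma> h g q - duhamel \<gamma> h g' q = duhamel \<gamma> h (\<lambda>q. g q - g' q) q"
proof -
  have i: "integrable lborel (\<lambda>s. duhamel_weight (fst q - h) (fst q) s *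
     g (s, fst (snd q) - (\<gamma> * (fst q - s)) *\<^sub>R snd (snd q), snd (snd q)))"
    if [measurable]: "g \<in> borel_measurable (borel \<Otimes>\<^sub>M (borel \<Otimes>\<^sub>M borel))" and "\<And>q. 0 \<le> g q" "\<And>q. g q \<le> c" for g
    using that h by (intro duhamel_weight_integrable[of _ c]) auto
  from Bochner_Integration.integral_diff[OF i[OF g] i[OF g']] show ?thesis
    unfolding duhamel_def by (simp only: right_diff_distrib)
qed

text \<open>The two weights differ only between \<open>t - h\<close> and \<open>t\<close>, by at
  most \<open>1\<close>. The mass bound is asked for almost every \<open>s\<close> only, because for
  the limit gain it will be known just at good times.\<close>

lemma nn_integral_lag_le:
  assumes t: "0 \<le> t" and [measurable]: "g \<in> borel_measurable (borel \<Otimes>\<^sub>M (borel \<Otimes>\<^sub>M borel))" and g: "\<And>q. 0 \<le> g q"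
    and per: "\<And>s w. lattice_periodic (\<lambda>x. g (s, x, w))"
    and m: "AE s in lborel. 0 \<le> s \<longrightarrow> (\<integral>\<^sup>+p. ennreal (g (s, p)) \<partial>phase) \<le> ennreal mass" and h: "0 \<le> h"
  shows "(\<integral>\<^sup>+p. \<integral>\<^sup>+s. ennreal (duhamel_weight t t s - duhamel_weight (t - h) t s) *
    ennreal (g (s, fst p - (\<gamma> * (t - s)) *\<^sub>R snd p, snd p)) \<partial>lborel \<partial>phase) \<le> ennreal (h * mass)"
proof -
  have "(\<integral>\<^sup>+p. \<integral>\<^sup>+s. ennreal (duhamel_weight t t s - duhamel_weight (t - h) t s) *
    ennreal (g (s, fst p - (\<gamma> * (t - s)) *\<^sub>R snd p, snd p)) \<partial>lborel \<partial>phase) =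
    (\<integral>\<^sup>+s. ennreal (duhamel_weight t t s - duhamel_weight (t - h) t s) * (\<integral>\<^sup>+p. ennreal (g (s, p)) \<partial>phase) \<partial>lborel)"
    by (rule nn_integral_characteristics[where g="\<lambda>q. ennreal (g q)"])
      (measurable, use per in \<open>auto simp: lattice_periodic_def\<close>)
  also have "\<dots> \<le> (\<integral>\<^sup>+s. ennreal mass * indicator {t - h..t} s \<partial>lborel)"
  proof (rule nn_integral_mono_AE)
    from m show "AE s in lborel. ennreal (duhamel_weight t t s - duhamel_weight (t - h) t s) * (\<integral>\<^sup>+p. ennreal (g (s, p)) \<partial>phase)
       \<le> ennreal mass * indicator {t - h..t} s"
    proof eventually_elim
      case (elim s)
      show ?case
      proof (cases "0 \<le> s \<and> t - h < s \<and> s \<le> t")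
        case True
        have "ennreal (duhamel_weight t t s - duhamel_weight (t - h) t s) * (\<integral>\<^sup>+p. ennreal (g (s, p)) \<partial>phase) \<le> 1 * ennreal mass"
          using True elim h by (intro mult_mono) (auto simp: duhamel_weight_def)
        then show ?thesis using True by simp
      next
        case False
        then have "duhamel_weight t t s - duhamel_weight (t - h) t s = 0" using h by (auto simp: duhamel_weight_def)
        then show ?thesis by simp
      qed
    qed
  qed
  also have "\<dots> = ennreal (h * mass)"
    using h mass_nonneg by (subst nn_integral_cmult_indicator) (auto simp: ennreal_mult[symmetric] mult.commute)
  finally show ?thesis .
qed

lemma nn_integral_source_lag_le:
  assumes t: "0 \<le> t"
  shows "(\<integral>\<^sup>+p. ennreal \<bar>duhamel \<gamma> 0 (source n) (t, p) - duhamel \<gamma> (delay n) (source n) (t, p)\<bar> \<partial>phase) \<le> ennreal (delay n * mass)"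
proof -
  have h: "0 \<le> delay n" using delay_pos[of n] by simp
  have "(\<integral>\<^sup>+p. ennreal \<bar>duhamel \<gamma> 0 (source n) (t, p) - duhamel \<gamma> (delay n) (source n) (t, p)\<bar> \<partial>phase) \<le>
    (\<integral>\<^sup>+p. \<integral>\<^sup>+s. ennreal (duhamel_weight t t s - duhamel_weight (t - delay n) t s) *
    ennreal (source n (s, fst p - (\<gamma> * (t - s)) *\<^sub>R snd p, snd p)) \<partial>lborel \<partial>phase)"
  proof (rule nn_integral_mono)
    fix p :: "(real^'n) \<times> (real^'n)"
    let ?g = "\<lambda>s. source n (s, fst p - (\<gamma> * (t - s)) *\<^sub>R snd p, snd p)"
    have i: "integrable lborel (\<lambda>s. duhamel_weight \<tau> t s * ?g s)" if "\<tau> \<le> t" for \<tau>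
    proof (rule duhamel_weight_integrable[OF _ _ that])
      show "\<bar>?g s\<bar> \<le> real n" for s
        using source_bounds(1)[of n "(s, fst p - (\<gamma> * (t - s)) *\<^sub>R snd p, snd p)"]
          source_bounds(2)[of n "(s, fst p - (\<gamma> * (t - s)) *\<^sub>R snd p, snd p)"] by linarith
    qed measurable
    have eq: "duhamel \<gamma> 0 (source n) (t, p) - duhamel \<gamma> (delay n) (source n) (t, p) =
        (\<integral>s. (duhamel_weight t t s - duhamel_weight (t - delay n) t s) * ?g s \<partial>lborel)"
      using Bochner_Integration.integral_diff[OF i[of t] i[of "t - delay n"]] h
      by (simp only: duhamel_def left_diff_distrib fst_conv snd_conv diff_0_right)
    have "ennreal \<bar>duhamel \<gamma> 0 (source n) (t, p) - duhamel \<gamma> (delay n) (source n) (t, p)\<bar> \<le>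
        (\<integral>\<^sup>+s. ennreal \<bar>(duhamel_weight t t s - duhamel_weight (t - delay n) t s) * ?g s\<bar> \<partial>lborel)"
      unfolding eq by (rule ennreal_abs_integral_le)
    also have "\<dots> = (\<integral>\<^sup>+s. ennreal (duhamel_weight t t s - duhamel_weight (t - delay n) t s) * ennreal (?g s) \<partial>lborel)"
    proof (rule nn_integral_cong)
      fix s
      have W: "0 \<le> duhamel_weight t t s - duhamel_weight (t - delay n) t s"
        unfolding duhamel_weight_def using h by simp
      show "ennreal \<bar>(duhamel_weight t t s - duhamel_weight (t - delay n) t s) * ?g s\<bar> =
         ennreal (duhamel_weight t t s - duhamel_weight (t - delay n) t s) * ennreal (?g s)"
        unfolding abs_of_nonneg[OF mult_nonneg_nonneg[OF W source_bounds(1)]]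
        by (rule ennreal_mult[OF W source_bounds(1)])
    qed
    finally show "ennreal \<bar>duhamel \<gamma> 0 (source n) (t, p) - duhamel \<gamma> (delay n) (source n) (t, p)\<bar> \<le>
      (\<integral>\<^sup>+s. ennreal (duhamel_weight t t s - duhamel_weight (t - delay n) t s) *
        ennreal (source n (s, fst p - (\<gamma> * (t - s)) *\<^sub>R snd p, snd p)) \<partial>lborel)" .
  qed
  also have "\<dots> \<le> ennreal (delay n * mass)"
    using source_mass_le by (intro nn_integral_lag_le[OF t source_measurable source_bounds(1) source_periodic _ h] AE_I2 impI)
  finally show ?thesis .
qed

lemma rate_ge_1: "1 \<le> rate" unfolding rate_def by simp

lemma exp_rate_ge_1: "0 \<le> t \<Longrightarrow> 1 \<le> exp (rate * t)" using rate_pos by simp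

text \<open>After truncation the moment is \<open>R\<close> times a velocity average of functions
  bounded by \<open>1\<close>, uniformly in \<open>n\<close>.\<close>

lemma totally_bounded_truncated:
  assumes \<psi>m[measurable]: "\<psi> \<in> borel_measurable borel" and \<psi>: "\<And>w. \<bar>\<psi> w\<bar> \<le> 1" and R: "0 < R"
  shows "totally_bounded_L1 space_time (\<lambda>n. weighted_moment \<psi> (duhamel \<gamma> 0 (\<lambda>q. min (source n q) R)))"
proof -
  \<comment> \<open>The exponents are distributed so that \<open>k\<close> and \<open>H\<close> are
    bounded by \<open>1\<close>, while for \<open>0 \<le> s \<le> t\<close> their product with the
    density \<open>exp (- s)\<close> of \<open>time_measure\<close> is
    \<open>exp (- (rate * t)) * exp (s - t)\<close>. The absolute value in \<open>H\<close> keeps it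
    bounded at negative times.\<close>
  define k where "k p = (if 0 \<le> snd p \<and> snd p \<le> fst p then exp (- ((rate + 1) * (fst p - snd p))) else 0)" for p :: "real \<times> real"
  define H where "H n p = \<psi> (snd (fst p)) * (min (source n (fst (fst p), snd p, snd (fst p))) R / R) * exp (- ((rate - 1) * \<bar>fst (fst p)\<bar>))"
    for n and p :: "(real \<times> (real^'n)) \<times> (real^'n)"
  have k[measurable]: "k \<in> borel_measurable (borel \<Otimes>\<^sub>M borel)" unfolding k_def by measurable
  have kb: "0 \<le> k p" "k p \<le> 1" for p unfolding k_def using rate_pos by (auto intro!: mult_nonneg_nonneg)
  have H[measurable]: "H n \<in> borel_measurable ((borel \<Otimes>\<^sub>M borel) \<Otimes>\<^sub>M borel)" for n unfolding H_def by measurable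
  have Hb: "\<bar>H n p\<bar> \<le> 1" for n p
  proof -
    let ?s = "source n (fst (fst p), snd p, snd (fst p))"
    have "0 \<le> min ?s R / R" "min ?s R / R \<le> 1" using R source_bounds(1)[of n] by simp_all
    then have 1: "\<bar>min ?s R / R\<bar> \<le> 1" by linarith
    have 2: "\<bar>exp (- ((rate - 1) * \<bar>fst (fst p)\<bar>))\<bar> \<le> 1" using rate_ge_1 by simp
    have "\<bar>H n p\<bar> \<le> 1 * 1 * 1"
      unfolding H_def abs_mult by (rule mult_mono[OF mult_mono[OF \<psi> 1] 2]) simp_all
    then show ?thesis by simp
  qed
  have Hper: "lattice_periodic (\<lambda>x. H n (b, x))" for n b
    using source_periodic[of n "fst b" "snd b"] unfolding H_def lattice_periodic_def by simp
  have eq: "weighted_moment \<psi> (duhamel \<gamma> 0 (\<lambda>q. min (source n q) R)) z = R * velocity_average k \<gamma> (H n) z" for n z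
  proof -
    obtain t x where z: "z = (t, x)" by (cases z)
    let ?f = "\<lambda>s w. k (t, s) * H n ((s, w), x + - (\<gamma> * (t - s)) *\<^sub>R w)"
    have fb: "\<bar>?f s w\<bar> \<le> 1 * 1" for s w unfolding abs_mult using kb by (intro mult_mono Hb) auto
    let ?F = "\<lambda>b. k (t, fst b) * H n (b, x + - (\<gamma> * (t - fst b)) *\<^sub>R snd b)"
    have Fb: "\<bar>?F b\<bar> \<le> 1 * 1" for b using fb[of "fst b" "snd b"] by simp
    have "(\<integral>s. \<integral>w. ?F (s, w) \<partial>sphere_borel \<partial>time_measure) = (\<integral>b. ?F b \<partial>velocity_time)"
      by (rule integral_pair_bounded[OF finite_measure_time_measure finite_measure_sphere_borel _ Fb]) measurable
    then have "velocity_average k \<gamma> (H n) z = (\<integral>s. \<integral>w. ?f s w \<partial>sphere_borel \<partial>time_measure)"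
      unfolding velocity_average_def z fst_conv snd_conv by (rule sym)
    also have "\<dots> = (\<integral>w. \<integral>s. ?f s w \<partial>time_measure \<partial>sphere_borel)"
      by (rule Fubini_bounded[OF finite_measure_time_measure finite_measure_sphere_borel _ fb]) measurable
    also have "\<dots> = (\<integral>w. \<integral>s. (exp (- s) * indicator {0..} s) * ?f s w \<partial>lborel \<partial>sphere_borel)"
      by (intro Bochner_Integration.integral_cong[OF refl] integral_time_measure) measurable
    also have "\<dots> = (\<integral>w. \<integral>s. (exp (- (rate * t)) / R) * (\<psi> w * (duhamel_weight t t s * min (source n (s, x - (\<gamma> * (t - s)) *\<^sub>R w, w)) R)) \<partial>lborel \<partial>sphere_borel)"
    proof (intro Bochner_Integration.integral_cong[OF refl])
      fix w s
      show "(exp (- s) * indicator {0..} s) * ?f s w =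
        (exp (- (rate * t)) / R) * (\<psi> w * (duhamel_weight t t s * min (source n (s, x - (\<gamma> * (t - s)) *\<^sub>R w, w)) R))"
      proof (cases "0 \<le> s \<and> s \<le> t")
        case True
        have e: "exp (- s) * (exp (- ((rate + 1) * (t - s))) * exp (- ((rate - 1) * s))) = exp (- (rate * t)) * exp (s - t)"
          unfolding exp_add[symmetric] by (rule arg_cong[of _ _ exp]) (simp add: algebra_simps)
        have "(exp (- s) * indicator {0..} s) * ?f s w =
          (exp (- s) * (exp (- ((rate + 1) * (t - s))) * exp (- ((rate - 1) * s)))) * (\<psi> w * (min (source n (s, x - (\<gamma> * (t - s)) *\<^sub>R w, w)) R / R))"
          using True by (simp add: k_def H_def)
        also have "\<dots> = (exp (- (rate * t)) / R) * (\<psi> w * (duhamel_weight t t s * min (source n (s, x - (\<gamma> * (t - s)) *\<^sub>R w, w)) R))"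
          unfolding e using True by (simp add: duhamel_weight_def)
        finally show ?thesis .
      qed (auto simp: k_def duhamel_weight_def)
    qed
    also have "\<dots> = weighted_moment \<psi> (duhamel \<gamma> 0 (\<lambda>q. min (source n q) R)) z / R"
      by (simp add: weighted_moment_def duhamel_def z)
    finally show ?thesis using R by simp
  qed
  have "totally_bounded_L1 space_time (\<lambda>n. velocity_average k \<gamma> (H n))"
    unfolding totally_bounded_L1_def
  proof (intro conjI allI impI)
    show "integrable space_time (velocity_average k \<gamma> (H n))" for n
    proof (rule integrable_bounded_finite[OF finite_measure_space_time])
      have k': "\<bar>k p\<bar> \<le> 1" for p using kb[of p] by linarith
      show "\<bar>velocity_average k \<gamma> (H n) p\<bar> \<le> 1 * measure (velocity_time :: (real \<times> (real^'n)) measure) (space velocity_time)" for p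
        by (rule velocity_average_bound[OF k' Hb])
    qed measurable
    show "finitely_colourable (\<lambda>m n. (\<integral>x. \<bar>velocity_average k \<gamma> (H m) x - velocity_average k \<gamma> (H n) x\<bar> \<partial>space_time) < \<epsilon>)"
      if "0 < \<epsilon>" for \<epsilon>
      using gamma by (intro velocity_average_compact[OF dim _ k kb H Hb Hper that]) auto
  qed
  then have "totally_bounded_L1 space_time (\<lambda>n z. R * velocity_average k \<gamma> (H n) z)"
    by (rule totally_bounded_L1_scale)
  moreover have "(\<lambda>n z. R * velocity_average k \<gamma> (H n) z) =
      (\<lambda>n. weighted_moment \<psi> (duhamel \<gamma> 0 (\<lambda>q. min (source n q) R)))"
    by (intro ext) (simp add: eq)
  ultimately show ?thesis by simp
qed

end

context kinetic
begin

lemma cut_tendsto: "(\<lambda>n. \<integral>p. f0 p - cut n p \<partial>phase) \<longlonglongrightarrow> 0"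
proof -
  have "(\<lambda>n. \<integral>p. f0 p - cut n p \<partial>phase) \<longlonglongrightarrow> (\<integral>p. 0 \<partial>(phase :: ((real^'n) \<times> (real^'n)) measure))"
  proof (rule integral_dominated_convergence[OF _ _ f0_integrable])
    show "AE p in phase. (\<lambda>n. f0 p - cut n p) \<longlonglongrightarrow> 0"
    proof (rule AE_I2)
      fix p
      have "\<forall>\<^sub>F n in sequentially. f0 p - cut n p = 0"
        using eventually_ge_at_top[of "nat \<lceil>f0 p\<rceil>"]
      proof eventually_elim
        case (elim n)
        then have "f0 p \<le> real n" using real_nat_ceiling_ge[of "f0 p"] by linarith
        then show ?case by (simp add: cut_def)
      qed
      then show "(\<lambda>n. f0 p - cut n p) \<longlonglongrightarrow> 0" by (rule tendsto_eventually)
    qed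
    show "AE p in phase. norm (f0 p - cut n p) \<le> f0 p" for n
      using cut_bounds(1,2) by (intro AE_I2) (simp add: abs_of_nonneg)
  qed auto
  then show ?thesis by simp
qed

lemma cut_mono: "m \<le> n \<Longrightarrow> cut m p \<le> cut n p"
  unfolding cut_def by (auto intro: min.mono)

lemma cut_integrable: "integrable phase (cut n)"
  by (rule Bochner_Integration.integrable_bound[OF f0_integrable]) (use cut_bounds(1,2) in \<open>auto simp: abs_of_nonneg f0_nonneg\<close>)

text \<open>Both truncations lie between \<open>cut N\<close> and \<open>f0\<close>, and free flow
  shrinks distances in the mean by \<open>exp (- t)\<close>.\<close>

lemma nn_integral_free_cut_diff_le:
  assumes t: "0 \<le> t" and N: "N \<le> m" "N \<le> n"
  shows "(\<integral>\<^sup>+p. ennreal \<bar>free_flow \<gamma> (cut m) (t, p) - free_flow \<gamma> (cut n) (t, p)\<bar> \<partial>phase) \<le> ennreal (\<integral>p. f0 p - cut N p \<partial>phase)"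
proof -
  have "(\<integral>\<^sup>+p. ennreal \<bar>free_flow \<gamma> (cut m) (t, p) - free_flow \<gamma> (cut n) (t, p)\<bar> \<partial>phase) =
      (\<integral>\<^sup>+p. ennreal \<bar>free_flow \<gamma> (\<lambda>p. cut m p - cut n p) (t, p)\<bar> \<partial>phase)"
    by (simp add: free_flow_def right_diff_distrib)
  also have "\<dots> = ennreal (exp (- t)) * (\<integral>\<^sup>+p. ennreal \<bar>cut m p - cut n p\<bar> \<partial>phase)"
    by (rule nn_integral_free_flow) (measurable, use cut_periodic in \<open>simp add: lattice_periodic_def\<close>)
  also have "\<dots> \<le> 1 * (\<integral>\<^sup>+p. ennreal (f0 p - cut N p) \<partial>phase)"
  proof (intro mult_mono nn_integral_mono ennreal_leI)
    fix p
    show "\<bar>cut m p - cut n p\<bar> \<le> f0 p - cut N p"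
      using cut_mono[OF N(1), of p] cut_mono[OF N(2), of p] cut_bounds(2)[of m p] cut_bounds(2)[of n p] by linarith
  qed (use t in auto)
  also have "\<dots> = ennreal (\<integral>p. f0 p - cut N p \<partial>phase)"
    using f0_integrable cut_integrable[of N] cut_bounds(2) by (subst nn_integral_eq_integral) auto
  finally show ?thesis .
qed

lemma nn_integral_duhamel_source_le:
  assumes t: "0 \<le> t"
  shows "(\<integral>\<^sup>+p. ennreal \<bar>duhamel \<gamma> 0 (source n) (t, p)\<bar> \<partial>phase) \<le> ennreal mass"
proof -
  have "(\<integral>\<^sup>+p. ennreal \<bar>duhamel \<gamma> 0 (source n) (t, p)\<bar> \<partial>phase) \<le>
      (\<integral>\<^sup>+s. ennreal (duhamel_weight (t - 0) t s) * (\<integral>\<^sup>+p. ennreal \<bar>source n (s, p)\<bar> \<partial>phase) \<partial>lborel)"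
    by (rule nn_integral_duhamel_le[OF source_measurable source_periodic])
  also have "\<dots> \<le> (\<integral>\<^sup>+s. ennreal (duhamel_weight t t s) * ennreal (mass + 0 * exp (0 * s)) \<partial>lborel)"
  proof (rule nn_integral_mono)
    fix s
    show "ennreal (duhamel_weight (t - 0) t s) * (\<integral>\<^sup>+p. ennreal \<bar>source n (s, p)\<bar> \<partial>phase) \<le> ennreal (duhamel_weight t t s) * ennreal (mass + 0 * exp (0 * s))"
      using source_mass_le[of s n] by (cases "0 \<le> s") (auto simp: duhamel_weight_def abs_of_nonneg[OF source_bounds(1)] intro!: mult_left_mono)
  qed
  also have "\<dots> \<le> ennreal (mass * (1 - exp (- t)) + 0 / (0 + 1) * exp (0 * t))"
    by (rule nn_integral_duhamel_weight_exp) (use t mass_nonneg in auto)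
  also have "\<dots> \<le> ennreal mass" using mass_nonneg by (intro ennreal_leI) (simp add: algebra_simps)
  finally show ?thesis .
qed

lemma nn_integral_source_tail_le:
  assumes "0 \<le> s" "0 < R"
  shows "(\<integral>\<^sup>+p. ennreal (source n (s, p) - min (source n (s, p)) R) \<partial>phase) \<le> ennreal (gain_entropy_const / ln (1 + R) * exp (rate * s))"
proof -
  have L: "0 < ln (1 + R)" using assms by simp
  have "(\<integral>\<^sup>+p. ennreal (source n (s, p) - min (source n (s, p)) R) \<partial>phase) \<le>
     (\<integral>\<^sup>+p. ennreal (1 / ln (1 + R)) * ennreal (entropy_density (source n (s, p))) \<partial>phase)"
  proof (rule nn_integral_mono)
    fix p
    show "ennreal (source n (s, p) - min (source n (s, p)) R) \<le> ennreal (1 / ln (1 + R)) * ennreal (entropy_density (source n (s, p)))"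
      using tail_le_entropy_density[OF source_bounds(1) assms(2), of n "(s, p)"] L entropy_density_nonneg[OF source_bounds(1)[of n "(s, p)"]]
      by (simp add: ennreal_mult[symmetric] ennreal_leI)
  qed
  also have "\<dots> = ennreal (1 / ln (1 + R)) * (\<integral>\<^sup>+p. ennreal (entropy_density (source n (s, p))) \<partial>phase)"
    by (rule nn_integral_cmult) measurable
  also have "\<dots> \<le> ennreal (1 / ln (1 + R)) * ennreal (gain_entropy_const * exp (rate * s))"
    unfolding source_def by (intro mult_left_mono cut_gain_entropy_le assms) auto
  also have "\<dots> = ennreal (gain_entropy_const / ln (1 + R) * exp (rate * s))"
    using L gain_entropy_bound_nonneg by (simp add: ennreal_mult[symmetric])
  finally show ?thesis .
qed

text \<open>Three pieces: the free part is Cauchy, the Duhamel part without delay is approximated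
  uniformly in \<open>n\<close> by its truncations, and the error caused by the delay tends to
  zero.\<close>

lemma totally_bounded_moment:
  assumes \<psi>m[measurable]: "\<psi> \<in> borel_measurable borel" and \<psi>: "\<And>w. \<bar>\<psi> w\<bar> \<le> 1"
  shows "totally_bounded_L1 space_time (\<lambda>n. weighted_moment \<psi> (approx n))"
proof -
  let ?\<tau> = "measure time_measure UNIV"
  let ?b = "\<lambda>n. weighted_moment \<psi> (free_flow \<gamma> (cut n))"
  let ?c = "\<lambda>n. weighted_moment \<psi> (duhamel \<gamma> 0 (source n))"
  let ?d = "\<lambda>n. weighted_moment \<psi> (\<lambda>q. duhamel \<gamma> 0 (source n) q - duhamel \<gamma> (delay n) (source n) q)"
  have grow: "ennreal K \<le> ennreal (K * exp (rate * t))" if "0 \<le> K" "0 \<le> t" for K t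
    using mult_left_mono[OF exp_rate_ge_1[OF that(2)] that(1)] by (intro ennreal_leI) simp
  have \<tau>: "0 \<le> ?\<tau>" by simp
  have ci: "integrable space_time (?c n)" for n
    by (rule weighted_moment_L1(1)[OF _ \<psi>m \<psi> mass_nonneg])
      (measurable, rule order_trans[OF nn_integral_duhamel_source_le grow[OF mass_nonneg]])
  have c: "totally_bounded_L1 space_time ?c"
  proof (rule totally_bounded_L1_approx[OF ci])
    fix \<epsilon> :: real assume e: "0 < \<epsilon>"
    \<comment> \<open>\<open>L\<close> is so large that the tail bound
      \<open>gain_entropy_const / L\<close>, times the mass of \<open>time_measure\<close>, is below
      \<epsilon>; \<open>R\<close> then solves \<open>ln (1 + R) = L\<close>.\<close>
    define L where "L = gain_entropy_const * ?\<tau> / \<epsilon> + 1"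
    define R where "R = exp L - 1"
    have L: "0 < L" unfolding L_def using e gain_entropy_bound_nonneg \<tau> by (intro add_nonneg_pos) auto
    have R: "0 < R" "ln (1 + R) = L" unfolding R_def using L by auto
    let ?K = "gain_entropy_const / L"
    have K: "0 \<le> ?K" using L gain_entropy_bound_nonneg by simp
    have diff: "?c n z - weighted_moment \<psi> (duhamel \<gamma> 0 (\<lambda>q. min (source n q) R)) z =
        weighted_moment \<psi> (duhamel \<gamma> 0 (\<lambda>q. source n q - min (source n q) R)) z" for n z
    proof -
      have mb: "0 \<le> min (source n q) R" "min (source n q) R \<le> real n" for q
        using source_bounds(1)[of n q] source_bounds(2)[of n q] R by auto
      have "?c n z - weighted_moment \<psi> (duhamel \<gamma> 0 (\<lambda>q. min (source n q) R)) z =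
        weighted_moment \<psi> (\<lambda>q. duhamel \<gamma> 0 (source n) q - duhamel \<gamma> 0 (\<lambda>q. min (source n q) R) q) z"
        by (intro weighted_moment_diff(1)[OF \<psi>m \<psi>] duhamel_sphere_integrable[where c="real n"] source_bounds mb) auto
      also have "(\<lambda>q. duhamel \<gamma> 0 (source n) q - duhamel \<gamma> 0 (\<lambda>q. min (source n q) R) q) =
        duhamel \<gamma> 0 (\<lambda>q. source n q - min (source n q) R)"
        by (intro ext duhamel_diff[where c="real n"] source_bounds mb) auto
      finally show ?thesis .
    qed
    have "(\<integral>z. \<bar>?c n z - weighted_moment \<psi> (duhamel \<gamma> 0 (\<lambda>q. min (source n q) R)) z\<bar> \<partial>space_time) \<le> ?K * ?\<tau>" for n
      unfolding diff
    proof (rule weighted_moment_L1(2)[OF _ \<psi>m \<psi> K])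
      fix t :: real assume t: "0 \<le> t"
      have "(\<integral>\<^sup>+p. ennreal \<bar>duhamel \<gamma> 0 (\<lambda>q. source n q - min (source n q) R) (t, p)\<bar> \<partial>phase) \<le>
        (\<integral>\<^sup>+s. ennreal (duhamel_weight (t - 0) t s) * (\<integral>\<^sup>+p. ennreal \<bar>source n (s, p) - min (source n (s, p)) R\<bar> \<partial>phase) \<partial>lborel)"
        using source_periodic[of n] by (intro nn_integral_duhamel_le) (measurable, simp add: lattice_periodic_def)
      also have "\<dots> \<le> (\<integral>\<^sup>+s. ennreal (duhamel_weight t t s) * ennreal (0 + ?K * exp (rate * s)) \<partial>lborel)"
      proof (rule nn_integral_mono)
        fix s
        have "\<bar>u - min u R\<bar> = u - min u R" for u :: real by simp
        then show "ennreal (duhamel_weight (t - 0) t s) * (\<integral>\<^sup>+p. ennreal \<bar>source n (s, p) - min (source n (s, p)) R\<bar> \<partial>phase) \<le>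
           ennreal (duhamel_weight t t s) * ennreal (0 + ?K * exp (rate * s))"
          using nn_integral_source_tail_le[of s R n] R by (cases "0 \<le> s") (auto simp: duhamel_weight_def intro!: mult_left_mono)
      qed
      also have "\<dots> \<le> ennreal (0 * (1 - exp (- t)) + ?K / (rate + 1) * exp (rate * t))"
        by (rule nn_integral_duhamel_weight_exp) (use t K rate_pos in auto)
      also have "\<dots> \<le> ennreal (?K * exp (rate * t))"
      proof (rule ennreal_leI)
        have "?K / (rate + 1) \<le> ?K / 1" using K rate_pos by (intro divide_left_mono) auto
        then have "?K / (rate + 1) * exp (rate * t) \<le> ?K * exp (rate * t)" by (intro mult_right_mono) auto
        then show "0 * (1 - exp (- t)) + ?K / (rate + 1) * exp (rate * t) \<le> ?K * exp (rate * t)" by simp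
      qed
      finally show "(\<integral>\<^sup>+p. ennreal \<bar>duhamel \<gamma> 0 (\<lambda>q. source n q - min (source n q) R) (t, p)\<bar> \<partial>phase) \<le> ennreal (?K * exp (rate * t))" .
    qed measurable
    moreover have "?K * ?\<tau> < \<epsilon>"
    proof -
      have "gain_entropy_const * ?\<tau> < \<epsilon> * L" unfolding L_def using e by (simp add: distrib_left)
      then show ?thesis using L by (simp add: pos_divide_less_eq)
    qed
    ultimately have "\<forall>n. (\<integral>z. \<bar>?c n z - weighted_moment \<psi> (duhamel \<gamma> 0 (\<lambda>q. min (source n q) R)) z\<bar> \<partial>space_time) < \<epsilon>"
      by (meson order.strict_trans1)
    then show "\<exists>b. totally_bounded_L1 space_time b \<and> (\<forall>n. (\<integral>z. \<bar>?c n z - b n z\<bar> \<partial>space_time) < \<epsilon>)"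
      using totally_bounded_truncated[OF \<psi>m \<psi> R(1)]
      by (intro exI[of _ "\<lambda>n. weighted_moment \<psi> (duhamel \<gamma> 0 (\<lambda>q. min (source n q) R))"]) auto
  qed
  have b: "totally_bounded_L1 space_time ?b"
  proof (rule totally_bounded_L1_Cauchy)
    show "integrable space_time (?b n)" for n
    proof (rule weighted_moment_L1(1)[OF _ \<psi>m \<psi> mass_nonneg])
      fix t :: real assume t: "0 \<le> t"
      have "exp (- t) * mass \<le> mass" using t mass_nonneg by (intro mult_left_le_one_le) auto
      then show "(\<integral>\<^sup>+p. ennreal \<bar>free_flow \<gamma> (cut n) (t, p)\<bar> \<partial>phase) \<le> ennreal (mass * exp (rate * t))"
        using order_trans[OF order_trans[OF nn_integral_free_cut_le[of n t] ennreal_leI] grow[OF mass_nonneg t]]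
        by (simp add: free_cut_nonneg)
    qed measurable
    fix \<epsilon> :: real assume e: "0 < \<epsilon>"
    have "(\<lambda>n. (\<integral>p. f0 p - cut n p \<partial>phase) * ?\<tau>) \<longlonglongrightarrow> 0" using tendsto_mult_left_zero[OF cut_tendsto] .
    then have "\<forall>\<^sub>F n in sequentially. (\<integral>p. f0 p - cut n p \<partial>phase) * ?\<tau> < \<epsilon>" using e by (rule order_tendstoD(2))
    then obtain N where N: "(\<integral>p. f0 p - cut N p \<partial>phase) * ?\<tau> < \<epsilon>" by (auto simp: eventually_sequentially)
    have K: "0 \<le> (\<integral>p. f0 p - cut N p \<partial>phase)" using cut_bounds(2) by (intro Bochner_Integration.integral_nonneg) auto
    have "(\<integral>z. \<bar>?b m z - ?b n z\<bar> \<partial>space_time) < \<epsilon>" if mn: "N \<le> m" "N \<le> n" for m n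
    proof -
      have "(\<integral>z. \<bar>?b m z - ?b n z\<bar> \<partial>space_time) \<le> (\<integral>p. f0 p - cut N p \<partial>phase) * ?\<tau>"
        unfolding weighted_moment_diff(1)[OF \<psi>m \<psi> free_cut_sphere_integrable free_cut_sphere_integrable]
        by (rule weighted_moment_L1(2)[OF _ \<psi>m \<psi> K])
          (measurable, rule order_trans[OF nn_integral_free_cut_diff_le[OF _ mn] grow[OF K]])
      then show ?thesis using N by simp
    qed
    then show "\<exists>N. \<forall>m\<ge>N. \<forall>n\<ge>N. (\<integral>z. \<bar>?b m z - ?b n z\<bar> \<partial>space_time) < \<epsilon>" by blast
  qed
  have dm: "0 \<le> delay n * mass" for n using delay_pos[of n] mass_nonneg by simp
  have di: "integrable space_time (?d n)" for n
    by (rule weighted_moment_L1(1)[OF _ \<psi>m \<psi> dm], measurable, rule order_trans[OF nn_integral_source_lag_le grow[OF dm]])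
  have dl: "(\<integral>z. \<bar>?d n z\<bar> \<partial>space_time) \<le> delay n * mass * ?\<tau>" for n
    by (rule weighted_moment_L1(2)[OF _ \<psi>m \<psi> dm], measurable, rule order_trans[OF nn_integral_source_lag_le grow[OF dm]])
  have d: "totally_bounded_L1 space_time ?d"
  proof (rule totally_bounded_L1_Cauchy[OF di])
    fix \<epsilon> :: real assume e: "0 < \<epsilon>"
    have "(\<lambda>n. delay n) \<longlonglongrightarrow> 0" unfolding delay_def using LIMSEQ_inverse_real_of_nat by (simp add: inverse_eq_divide add.commute)
    then have "(\<lambda>n. delay n * (mass * ?\<tau>)) \<longlonglongrightarrow> 0" by (rule tendsto_mult_left_zero)
    then obtain N where N: "\<And>n. N \<le> n \<Longrightarrow> delay n * (mass * ?\<tau>) < \<epsilon> / 2"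
      using order_tendstoD(2)[of _ 0 sequentially "\<epsilon> / 2"] e by (auto simp: eventually_sequentially)
    have "(\<integral>z. \<bar>?d m z - ?d n z\<bar> \<partial>space_time) < \<epsilon>" if "N \<le> m" "N \<le> n" for m n
    proof -
      have "(\<integral>z. \<bar>?d m z - ?d n z\<bar> \<partial>space_time) \<le> (\<integral>z. \<bar>?d m z\<bar> \<partial>space_time) + (\<integral>z. \<bar>?d n z\<bar> \<partial>space_time)"
        using integral_abs_triangle[OF di[of m] _ di[of n], of "\<lambda>_. 0"] by simp
      then show ?thesis using N[OF that(1)] N[OF that(2)] dl[of m] dl[of n] by (simp add: mult.assoc)
    qed
    then show "\<exists>N. \<forall>m\<ge>N. \<forall>n\<ge>N. (\<integral>z. \<bar>?d m z - ?d n z\<bar> \<partial>space_time) < \<epsilon>" by blast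
  qed
  have eq: "(\<lambda>n z. (?b n z + ?c n z) + (-1) * ?d n z) = (\<lambda>n. weighted_moment \<psi> (approx n))"
  proof (intro ext)
    fix n z
    have h: "0 \<le> delay n" using delay_pos[of n] by simp
    have i0: "integrable sphere_borel (\<lambda>w. duhamel \<gamma> 0 (source n) (t, x, w))"
      and ih: "integrable sphere_borel (\<lambda>w. duhamel \<gamma> (delay n) (source n) (t, x, w))" for t x
      using h by (intro duhamel_sphere_integrable[where c="real n"] source_bounds; simp)+
    have "?b n z + ?c n z - ?d n z = ?b n z + weighted_moment \<psi> (duhamel \<gamma> (delay n) (source n)) z"
      unfolding weighted_moment_diff(1)[OF \<psi>m \<psi> i0 ih, symmetric] by simp
    also have "\<dots> = weighted_moment \<psi> (approx n) z"
      unfolding weighted_moment_diff(2)[OF \<psi>m \<psi> free_cut_sphere_integrable ih] approx_eq[abs_def] by simp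
    finally show "(?b n z + ?c n z) + (-1) * ?d n z = weighted_moment \<psi> (approx n) z" by simp
  qed
  have "totally_bounded_L1 space_time (\<lambda>n z. (?b n z + ?c n z) + (-1) * ?d n z)"
    by (intro totally_bounded_L1_add[OF totally_bounded_L1_add[OF b c] totally_bounded_L1_scale[OF d]])
  then show ?thesis unfolding eq .
qed

lemma approx_measurable[measurable]: "approx n \<in> borel_measurable (borel \<Otimes>\<^sub>M (borel \<Otimes>\<^sub>M borel))"
  unfolding approx_def by measurable

lemma approx_nonneg: "0 \<le> approx n q"
  unfolding approx_def by (rule iter_nonneg)

lemma approx_periodic: "lattice_periodic (\<lambda>x. approx n (t, x, w))"
  unfolding approx_def by (rule iter_periodic)

lemma approx_sphere_integrable: "integrable sphere_borel (\<lambda>w. approx n (t, x, w))"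
  unfolding approx_def by (rule iter_sphere_integrable)

text \<open>\<open>None\<close> selects the density and \<open>Some j\<close> the
  \<open>j\<close>-th component of the flux. The coordinate is clamped because a bound by
  \<open>1\<close> is required on all of \<open>real ^ 'n\<close>; on the sphere the clamp changes
  nothing.\<close>

definition test_weight :: "'n option \<Rightarrow> real^'n \<Rightarrow> real" where
  "test_weight i w = (case i of None \<Rightarrow> 1 | Some j \<Rightarrow> max (-1) (min 1 (w $ j)))"

lemma test_weight_measurable[measurable]: "test_weight i \<in> borel_measurable borel"
  unfolding test_weight_def[abs_def] by (cases i) simp_all

lemma test_weight_le: "\<bar>test_weight i w\<bar> \<le> 1"
  unfolding test_weight_def by (cases i) auto

lemma flux_of_component:
  assumes "integrable sphere_borel (\<lambda>w. F (t, x, w))"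
  shows "flux_of F (t, x) $ j = (\<integral>w. test_weight (Some j) w * F (t, x, w) \<partial>sphere_borel)"
proof -
  have i: "integrable sphere_borel (\<lambda>w. F (t, x, w) *\<^sub>R w)"
  proof (rule Bochner_Integration.integrable_bound[OF assms])
    show "AE w in sphere_borel. norm (F (t, x, w) *\<^sub>R w) \<le> norm (F (t, x, w))"
      using AE_sphere_borel_norm by eventually_elim simp
  qed (use assms in auto)
  have "flux_of F (t, x) $ j = (\<integral>w. (F (t, x, w) *\<^sub>R w) $ j \<partial>sphere_borel)"
    unfolding flux_of_def fst_conv snd_conv
    using integral_bounded_linear[OF bounded_linear_vec_nth[of j] i] by simp
  also have "\<dots> = (\<integral>w. test_weight (Some j) w * F (t, x, w) \<partial>sphere_borel)"
  proof (rule integral_cong_AE)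
    show "AE w in sphere_borel. (F (t, x, w) *\<^sub>R w) $ j = test_weight (Some j) w * F (t, x, w)"
      using AE_sphere_borel_norm
    proof eventually_elim
      case (elim w)
      have "\<bar>w $ j\<bar> \<le> 1" using component_le_norm_cart[of w j] elim by simp
      then show ?case by (simp add: test_weight_def abs_le_iff max_def min_def)
    qed
  qed (use assms in auto)
  finally show ?thesis .
qed

text \<open>The density and the finitely many flux components become Cauchy in the mean along one
  subsequence. Bundled into a single vector, they need only one further subsequence to converge
  almost everywhere.\<close>

lemma moments_subsequence:
  "\<exists>r::nat \<Rightarrow> nat. strict_mono r \<and>
    (AE z in space_time. convergent (\<lambda>n. density_of (approx (r n)) z) \<and> convergent (\<lambda>n. flux_of (approx (r n)) z))"
proof -
  let ?a = "\<lambda>i n. weighted_moment (test_weight i) (approx n)"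
  have tb: "totally_bounded_L1 space_time (?a i)" for i
    by (rule totally_bounded_moment[OF test_weight_measurable test_weight_le])
  then have ai: "integrable space_time (?a i n)" for i n by (simp add: totally_bounded_L1_def)
  have "finitely_colourable (\<lambda>m n. \<forall>i\<in>UNIV. (\<integral>z. \<bar>?a i m z - ?a i n z\<bar> \<partial>space_time) < 1 / (real k + 1))" for k
    using tb by (intro finitely_colourable_ball) (auto simp: totally_bounded_L1_def add_nonneg_pos)
  from finitely_colourable_subseq[of "\<lambda>k m n. \<forall>i\<in>UNIV. (\<integral>z. \<bar>?a i m z - ?a i n z\<bar> \<partial>space_time) < 1 / (real k + 1)", OF this]
  obtain r :: "nat \<Rightarrow> nat" where r: "strict_mono r"
    and rc: "\<And>k m n i. k \<le> m \<Longrightarrow> k \<le> n \<Longrightarrow> (\<integral>z. \<bar>?a i (r m) z - ?a i (r n) z\<bar> \<partial>space_time) < 1 / (real k + 1)"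
    by blast
  define s where "s n z = (\<chi> i. ?a i (r n) z)" for n z
  have s_eq: "s n = (\<lambda>z. \<Sum>i\<in>UNIV. ?a i (r n) z *\<^sub>R axis i 1)" for n
    by (simp add: fun_eq_iff s_def vec_eq_iff axis_def if_distrib sum.delta cong: if_cong)
  have si: "integrable space_time (s n)" for n
    unfolding s_eq by (intro Bochner_Integration.integrable_sum integrable_scaleR_left ai)
  let ?N = "real CARD('n option)"
  have sc: "(\<integral>z. norm (s m z - s n z) \<partial>space_time) \<le> ?N * (1 / (real k + 1))" if "k \<le> m" "k \<le> n" for k m n
  proof -
    have "(\<integral>z. norm (s m z - s n z) \<partial>space_time) \<le> (\<integral>z. (\<Sum>i\<in>UNIV. \<bar>?a i (r m) z - ?a i (r n) z\<bar>) \<partial>space_time)"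
    proof (rule integral_mono)
      show "norm (s m z - s n z) \<le> (\<Sum>i\<in>UNIV. \<bar>?a i (r m) z - ?a i (r n) z\<bar>)" for z
        using norm_le_l1_cart[of "s m z - s n z"] by (simp add: s_def)
    qed (use si ai in auto)
    also have "\<dots> = (\<Sum>i\<in>UNIV. (\<integral>z. \<bar>?a i (r m) z - ?a i (r n) z\<bar> \<partial>space_time))"
      by (rule Bochner_Integration.integral_sum) (use ai in auto)
    also have "\<dots> \<le> (\<Sum>i\<in>(UNIV :: 'n option set). 1 / (real k + 1))"
      by (intro sum_mono less_imp_le rc that)
    finally show ?thesis by simp
  qed
  have "\<exists>N. \<forall>i\<ge>N. \<forall>j\<ge>N. (\<integral>z. norm (s i z - s j z) \<partial>space_time) < e" if e: "0 < e" for e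
  proof -
    obtain k :: nat where k: "?N / e < real k" using reals_Archimedean2 by blast
    then have "?N < e * (real k + 1)" using e by (simp add: pos_divide_less_eq algebra_simps)
    then have "?N * (1 / (real k + 1)) < e" by (simp add: pos_divide_less_eq add_nonneg_pos)
    then show ?thesis using sc by (meson order.strict_trans1)
  qed
  then obtain r' :: "nat \<Rightarrow> nat" where r': "strict_mono r'" "AE z in space_time. Cauchy (\<lambda>i. s (r' i) z)"
    using cauchy_L1_AE_cauchy_subseq[of space_time s, OF si] by blast
  have "AE z in space_time. convergent (\<lambda>n. density_of (approx ((r \<circ> r') n)) z) \<and> convergent (\<lambda>n. flux_of (approx ((r \<circ> r') n)) z)"
    using r'(2)
  proof eventually_elim
    case (elim z)
    obtain t x where z: "z = (t, x)" by (cases z)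
    from elim obtain l where l: "(\<lambda>n. s (r' n) z) \<longlonglongrightarrow> l" using Cauchy_convergent convergent_def by blast
    have "(\<lambda>n. s (r' n) z $ i) \<longlonglongrightarrow> l $ i" for i by (rule tendsto_vec_nth[OF l])
    then have "(\<lambda>n. exp (rate * t) * (?a i (r (r' n)) z)) \<longlonglongrightarrow> exp (rate * t) * l $ i" for i
      by (intro tendsto_mult_left) (simp add: s_def)
    \<comment> \<open>The damping factor depends on \<open>t\<close> only, so it is undone point by
      point.\<close>
    moreover have "exp (rate * t) * ?a i n z = (\<integral>w. test_weight i w * approx n (t, x, w) \<partial>sphere_borel)" for i n
      unfolding weighted_moment_def z fst_conv snd_conv by (simp add: mult.assoc[symmetric] flip: exp_add)
    ultimately have lim: "(\<lambda>n. \<integral>w. test_weight i w * approx (r (r' n)) (t, x, w) \<partial>sphere_borel) \<longlonglongrightarrow> exp (rate * t) * l $ i" for i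
      by simp
    have "(\<lambda>n. density_of (approx (r (r' n))) z) \<longlonglongrightarrow> exp (rate * t) * l $ None"
      using lim[of None] by (simp add: density_of_def z test_weight_def)
    moreover have "(\<lambda>n. flux_of (approx (r (r' n))) z) \<longlonglongrightarrow> (\<chi> j. exp (rate * t) * l $ Some j)"
      using lim[of "Some _"] by (intro vec_tendstoI) (simp add: z flux_of_component[OF approx_sphere_integrable])
    ultimately show ?case by (auto simp: convergent_def)
  qed
  then show ?thesis using strict_mono_o[OF r r'(1)] by blast
qed

end

subsection \<open>Passage to the limit\<close>

lemma nn_integral_Fatou_le:
  fixes u :: "nat \<Rightarrow> 'a \<Rightarrow> ennreal"
  assumes [measurable]: "\<And>n. u n \<in> borel_measurable M" "f \<in> borel_measurable M"
    and lim: "AE x in M. (\<lambda>n. u n x) \<longlonglongrightarrow> f x" and le: "\<And>n. (\<integral>\<^sup>+x. u n x \<partial>M) \<le> b n" and b: "b \<longlonglongrightarrow> c"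
  shows "(\<integral>\<^sup>+x. f x \<partial>M) \<le> c"
proof -
  have "(\<integral>\<^sup>+x. f x \<partial>M) = (\<integral>\<^sup>+x. liminf (\<lambda>n. u n x) \<partial>M)"
    using lim by (intro nn_integral_cong_AE) (auto elim!: eventually_mono simp: lim_imp_Liminf)
  also have "\<dots> \<le> liminf (\<lambda>n. \<integral>\<^sup>+x. u n x \<partial>M)" by (rule nn_integral_liminf) measurable
  also have "\<dots> \<le> liminf b" by (rule Liminf_mono) (simp add: le)
  also have "\<dots> = c" using b by (simp add: lim_imp_Liminf)
  finally show ?thesis .
qed

lemma AE_phase_fst:
  fixes P :: "real^'n \<Rightarrow> bool"
  assumes "AE x in torus_measure. P x" shows "AE p in phase. P (fst p)"
proof -
  from assms obtain N where N: "N \<in> null_sets torus_measure" "{x. \<not> P x} \<subseteq> N"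
    by (auto simp: eventually_ae_filter)
  have "N \<times> UNIV \<in> null_sets (torus_measure \<Otimes>\<^sub>M (sphere_borel :: (real^'n) measure))"
    using null_setsD1[OF N(1)] null_setsD2[OF N(1)] sph.emeasure_pair_measure_Times[of N torus_measure UNIV]
    by (intro null_setsI) auto
  then show ?thesis unfolding phase_def using N(2) by (intro AE_I'[of "N \<times> UNIV"]) auto
qed

text \<open>The sequence is eventually below its limit plus \<open>1\<close>, and the truncation
  level exceeds that value.\<close>

lemma tendsto_min_unbounded:
  fixes a :: "nat \<Rightarrow> real"
  assumes a: "a \<longlonglongrightarrow> l" and r: "strict_mono (r :: nat \<Rightarrow> nat)"
  shows "(\<lambda>n. min (a n) (real (r n))) \<longlonglongrightarrow> l"
proof (rule Lim_transform_eventually[OF a])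
  have "\<forall>\<^sub>F n in sequentially. a n < l + 1" using order_tendstoD(2)[OF a, of "l + 1"] by simp
  moreover have "\<forall>\<^sub>F n in sequentially. nat \<lceil>l + 1\<rceil> \<le> n" by (rule eventually_ge_at_top)
  ultimately show "\<forall>\<^sub>F n in sequentially. a n = min (a n) (real (r n))"
  proof eventually_elim
    case (elim n)
    have "l + 1 \<le> real n" using elim(2) real_nat_ceiling_ge[of "l + 1"] by linarith
    also have "\<dots> \<le> real (r n)" using seq_suble[OF r, of n] by simp
    finally show ?case using elim(1) by simp
  qed
qed

lemma tendsto_0_if_eventually_less:
  fixes f :: "nat \<Rightarrow> ennreal"
  assumes "\<And>\<epsilon>. 0 < \<epsilon> \<Longrightarrow> \<forall>\<^sub>F n in sequentially. f n < ennreal \<epsilon>"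
  shows "f \<longlonglongrightarrow> 0"
proof (rule order_tendstoI)
  fix a :: ennreal assume "0 < a"
  then obtain e where "0 < e" "e < a" using dense by blast
  then obtain x where x: "e = ennreal x" "0 \<le> x" by (cases e) auto
  then have "0 < x" using \<open>0 < e\<close> by simp
  from assms[OF this] show "\<forall>\<^sub>F n in sequentially. f n < a"
    by eventually_elim (use x \<open>e < a\<close> in auto)
qed simp

locale kinetic_limit = kinetic \<gamma> f0 for \<gamma> :: real and f0 :: "(real^'n) \<times> (real^'n) \<Rightarrow> real" +
  fixes r :: "nat \<Rightarrow> nat"
  assumes r_mono: "strict_mono r"
    and r_conv: "AE z in space_time. convergent (\<lambda>n. density_of (approx (r n)) z) \<and> convergent (\<lambda>n. flux_of (approx (r n)) z)"
begin

text \<open>Where the sequence diverges, \<open>lim\<close> is an unspecified value; the absolute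
  value makes the result nonnegative everywhere and changes nothing at points of
  convergence.\<close>

definition lim_density :: "real \<times> (real^'n) \<Rightarrow> real" where
  "lim_density z = \<bar>lim (\<lambda>n. density_of (approx (r n)) z)\<bar>"

definition lim_flux :: "real \<times> (real^'n) \<Rightarrow> real^'n" where
  "lim_flux z = lim (\<lambda>n. flux_of (approx (r n)) z)"

definition lim_gain :: "real \<times> (real^'n) \<times> (real^'n) \<Rightarrow> real" where
  "lim_gain q = lim_density (fst q, fst (snd q)) * vonMises (lim_flux (fst q, fst (snd q))) (snd (snd q))"

text \<open>Defined from \<open>lim_gain\<close> by the Duhamel formula, not as a limit in the mean:
  it is then Borel, nonnegative and periodic at every time and point, and \<open>lim_gain\<close>
  has to be identified as its gain.\<close>

definition solution :: "real \<times> (real^'n) \<times> (real^'n) \<Rightarrow> real" where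
  "solution q = free_flow \<gamma> f0 q + duhamel \<gamma> 0 lim_gain q"

lemma lim_density_measurable[measurable]: "lim_density \<in> borel_measurable (borel \<Otimes>\<^sub>M borel)"
  unfolding lim_density_def[abs_def] by (intro borel_measurable_abs borel_measurable_lim_metric) measurable

lemma lim_flux_measurable[measurable]: "lim_flux \<in> borel_measurable (borel \<Otimes>\<^sub>M borel)"
  unfolding lim_flux_def[abs_def] by (intro borel_measurable_lim_metric) measurable

lemma lim_gain_measurable[measurable]: "lim_gain \<in> borel_measurable (borel \<Otimes>\<^sub>M (borel \<Otimes>\<^sub>M borel))"
  unfolding lim_gain_def[abs_def] by measurable

lemma solution_measurable[measurable]: "solution \<in> borel_measurable (borel \<Otimes>\<^sub>M (borel \<Otimes>\<^sub>M borel))"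
  unfolding solution_def[abs_def] by measurable

lemma lim_gain_nonneg: "0 \<le> lim_gain q"
  unfolding lim_gain_def lim_density_def by (intro mult_nonneg_nonneg vonMises_nonneg) simp

lemma free_f0_nonneg: "0 \<le> free_flow \<gamma> f0 q"
  unfolding free_flow_def by (simp add: f0_nonneg)

lemma solution_nonneg: "0 \<le> solution q"
  unfolding solution_def using free_f0_nonneg duhamel_nonneg[of lim_gain, OF lim_gain_nonneg] by simp

text \<open>The moments of the approximations are periodic at every point, so \<open>lim\<close> is
  applied to the same sequence at \<open>x\<close> and at its lattice translates, whether it
  converges or not.\<close>

lemma lim_gain_periodic: "lattice_periodic (\<lambda>x. lim_gain (t, x, w))"
  using moments_periodic(1,2)[of "approx (r n)" t for n, OF approx_periodic]
  unfolding lattice_periodic_def lim_gain_def lim_density_def lim_flux_def by simp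

lemma solution_periodic: "lattice_periodic (\<lambda>x. solution (t, x, w))"
  using free_flow_periodic[of f0 \<gamma> t w, OF f0_periodic] duhamel_periodic[of lim_gain \<gamma> 0 t w, OF lim_gain_periodic]
  unfolding solution_def lattice_periodic_def by simp

text \<open>Fubini yields convergence of the moments only for almost every time. The exceptional
  times disappear inside the time integral of the Duhamel formula.\<close>

definition good_time :: "real \<Rightarrow> bool" where
  "good_time t \<longleftrightarrow> 0 \<le> t \<and> (AE x in torus_measure.
     (\<lambda>n. density_of (approx (r n)) (t, x)) \<longlonglongrightarrow> lim_density (t, x) \<and>
     (\<lambda>n. flux_of (approx (r n)) (t, x)) \<longlonglongrightarrow> lim_flux (t, x))"

lemma AE_good_time: "AE t in lborel. 0 \<le> t \<longrightarrow> good_time t"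
proof -
  interpret tx: pair_sigma_finite time_measure "torus_measure :: (real^'n) measure" ..
  have "AE z in space_time. (\<lambda>n. density_of (approx (r n)) z) \<longlonglongrightarrow> lim_density z \<and>
     (\<lambda>n. flux_of (approx (r n)) z) \<longlonglongrightarrow> lim_flux z"
    using r_conv
  proof eventually_elim
    case (elim z)
    have l: "(\<lambda>n. density_of (approx (r n)) z) \<longlonglongrightarrow> lim (\<lambda>n. density_of (approx (r n)) z)"
      using elim convergent_LIMSEQ_iff by blast
    have "0 \<le> lim (\<lambda>n. density_of (approx (r n)) z)"
      by (rule LIMSEQ_le_const[OF l]) (use density_of_nonneg[of "approx (r n)" z for n, OF approx_nonneg] in auto)
    then show ?case using l elim unfolding lim_density_def lim_flux_def by (simp add: convergent_LIMSEQ_iff)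
  qed
  then have "AE t in time_measure. AE x in torus_measure. (\<lambda>n. density_of (approx (r n)) (t, x)) \<longlonglongrightarrow> lim_density (t, x) \<and>
     (\<lambda>n. flux_of (approx (r n)) (t, x)) \<longlonglongrightarrow> lim_flux (t, x)"
    by (rule tx.AE_pair)
  then show ?thesis unfolding time_measure_def
    by (subst (asm) AE_density) (auto simp: good_time_def elim!: eventually_mono split: split_indicator_asm)
qed

text \<open>At a fixed time the horizon and the truncation level are eventually inactive, and the
  gain depends continuously on the moments.\<close>

lemma source_tendsto:
  assumes "good_time t"
  shows "AE p in phase. (\<lambda>n. source (r n) (t, p)) \<longlonglongrightarrow> lim_gain (t, p)"
proof -
  have "AE x in torus_measure. \<forall>w. (\<lambda>n. source (r n) (t, x, w)) \<longlonglongrightarrow> lim_gain (t, x, w)"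
    using conjunct2[OF assms[unfolded good_time_def]]
  proof (eventually_elim, intro allI)
    fix x w
    assume l: "(\<lambda>n. density_of (approx (r n)) (t, x)) \<longlonglongrightarrow> lim_density (t, x) \<and>
     (\<lambda>n. flux_of (approx (r n)) (t, x)) \<longlonglongrightarrow> lim_flux (t, x)"
    have "(\<lambda>n. gain_of (approx (r n)) (t, x, w)) \<longlonglongrightarrow> lim_gain (t, x, w)"
      unfolding gain_of_def lim_gain_def fst_conv snd_conv using l by (intro tendsto_mult tendsto_vonMises) auto
    then have "(\<lambda>n. min (gain_of (approx (r n)) (t, x, w)) (real (r n))) \<longlonglongrightarrow> lim_gain (t, x, w)"
      by (rule tendsto_min_unbounded[OF _ r_mono])
    moreover have "\<forall>\<^sub>F n in sequentially. min (gain_of (approx (r n)) (t, x, w)) (real (r n)) = source (r n) (t, x, w)"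
      using eventually_ge_at_top[of "nat \<lceil>t\<rceil>"]
    proof eventually_elim
      case (elim n)
      have "t \<le> real n" using elim real_nat_ceiling_ge[of t] by linarith
      also have "\<dots> \<le> real (r n)" using seq_suble[OF r_mono, of n] by simp
      finally show ?case by (simp add: source_eq)
    qed
    ultimately show "(\<lambda>n. source (r n) (t, x, w)) \<longlonglongrightarrow> lim_gain (t, x, w)" by (rule Lim_transform_eventually)
  qed
  from AE_phase_fst[OF this] show ?thesis by eventually_elim (metis prod.collapse)
qed

lemma lim_gain_mass_le:
  assumes "good_time t"
  shows "(\<integral>\<^sup>+p. ennreal (lim_gain (t, p)) \<partial>phase) \<le> ennreal mass"
proof (rule nn_integral_Fatou_le[where u="\<lambda>n p. ennreal (source (r n) (t, p))" and b="\<lambda>_. ennreal mass"])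
  show "AE p in phase. (\<lambda>n. ennreal (source (r n) (t, p))) \<longlonglongrightarrow> ennreal (lim_gain (t, p))"
    using source_tendsto[OF assms] by eventually_elim (rule tendsto_ennrealI)
  show "(\<integral>\<^sup>+p. ennreal (source (r n) (t, p)) \<partial>phase) \<le> ennreal mass" for n
    using assms by (intro source_mass_le) (simp add: good_time_def)
qed auto

lemma tendsto_entropy_density:
  assumes "u \<longlonglongrightarrow> l" "0 \<le> l" shows "(\<lambda>n. entropy_density (u n)) \<longlonglongrightarrow> entropy_density l"
  unfolding entropy_density_def using assms by (intro tendsto_intros) auto

lemma lim_gain_entropy_le:
  assumes "good_time t"
  shows "(\<integral>\<^sup>+p. ennreal (entropy_density (lim_gain (t, p))) \<partial>phase) \<le> ennreal (gain_entropy_const * exp (rate * t))"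
proof (rule nn_integral_Fatou_le[where u="\<lambda>n p. ennreal (entropy_density (source (r n) (t, p)))" and b="\<lambda>_. ennreal (gain_entropy_const * exp (rate * t))"])
  show "AE p in phase. (\<lambda>n. ennreal (entropy_density (source (r n) (t, p)))) \<longlonglongrightarrow> ennreal (entropy_density (lim_gain (t, p)))"
    using source_tendsto[OF assms] by eventually_elim (intro tendsto_ennrealI tendsto_entropy_density lim_gain_nonneg)
  show "(\<integral>\<^sup>+p. ennreal (entropy_density (source (r n) (t, p))) \<partial>phase) \<le> ennreal (gain_entropy_const * exp (rate * t))" for n
    unfolding source_def using assms by (intro cut_gain_entropy_le) (simp add: good_time_def)
qed auto

lemma tail_of_entropy_le:
  assumes [measurable]: "u \<in> borel_measurable (borel \<Otimes>\<^sub>M borel)" and u: "\<And>p. 0 \<le> u p" and R: "0 < R" and E: "0 \<le> E"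
    and e: "(\<integral>\<^sup>+p. ennreal (entropy_density (u p)) \<partial>phase) \<le> ennreal E"
  shows "(\<integral>\<^sup>+p. ennreal (u p - min (u p) R) \<partial>(phase :: ((real^'n) \<times> (real^'n)) measure)) \<le> ennreal (E / ln (1 + R))"
proof -
  have L: "0 < ln (1 + R)" using R by simp
  have "(\<integral>\<^sup>+p. ennreal (u p - min (u p) R) \<partial>phase) \<le> (\<integral>\<^sup>+p. ennreal (1 / ln (1 + R)) * ennreal (entropy_density (u p)) \<partial>phase)"
  proof (rule nn_integral_mono)
    fix p
    show "ennreal (u p - min (u p) R) \<le> ennreal (1 / ln (1 + R)) * ennreal (entropy_density (u p))"
      using tail_le_entropy_density[OF u R, of p] L entropy_density_nonneg[OF u[of p]]
      by (simp add: ennreal_mult[symmetric] ennreal_leI)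
  qed
  also have "\<dots> = ennreal (1 / ln (1 + R)) * (\<integral>\<^sup>+p. ennreal (entropy_density (u p)) \<partial>phase)"
    by (rule nn_integral_cmult) measurable
  also have "\<dots> \<le> ennreal (1 / ln (1 + R)) * ennreal E" by (intro mult_left_mono e) auto
  also have "\<dots> = ennreal (E / ln (1 + R))" using L E by (simp add: ennreal_mult[symmetric])
  finally show ?thesis .
qed

text \<open>The entropy bound makes the sources uniformly integrable at each time, so that almost
  everywhere convergence improves to convergence in the mean.\<close>

lemma source_L1_tendsto:
  assumes g: "good_time t"
  shows "(\<lambda>n. \<integral>\<^sup>+p. ennreal \<bar>source (r n) (t, p) - lim_gain (t, p)\<bar> \<partial>phase) \<longlonglongrightarrow> 0"
proof (rule tendsto_0_if_eventually_less)
  fix \<epsilon> :: real assume e: "0 < \<epsilon>"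
  have t: "0 \<le> t" using g by (simp add: good_time_def)
  define E where "E = gain_entropy_const * exp (rate * t)"
  have E: "0 \<le> E" unfolding E_def using gain_entropy_bound_nonneg by simp
  \<comment> \<open>Chosen so that the entropy tail \<open>E / L\<close> is below a quarter of
    \<epsilon>: two tails and the truncated difference then stay below \<epsilon>.\<close>
  define L where "L = 4 * E / \<epsilon> + 1"
  define R where "R = exp L - 1"
  have L: "0 < L" unfolding L_def using e E by (intro add_nonneg_pos) auto
  have R: "0 < R" "ln (1 + R) = L" unfolding R_def using L by auto
  have EL: "E / L < \<epsilon> / 4"
  proof -
    have "4 * E < \<epsilon> * L" unfolding L_def using e by (simp add: distrib_left)
    then show ?thesis using L by (simp add: pos_divide_less_eq)
  qed
  \<comment> \<open>Truncated at \<open>R\<close>, the functions are bounded on a finite measure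
    space, so dominated convergence applies.\<close>
  have bnd: "(\<lambda>n. \<integral>\<^sup>+p. ennreal \<bar>min (source (r n) (t, p)) R - min (lim_gain (t, p)) R\<bar> \<partial>phase) \<longlonglongrightarrow> (\<integral>\<^sup>+p. 0 \<partial>(phase :: ((real^'n) \<times> (real^'n)) measure))"
  proof (rule nn_integral_dominated_convergence[where w="\<lambda>_. ennreal R"])
    show "AE p in phase. ennreal \<bar>min (source (r n) (t, p)) R - min (lim_gain (t, p)) R\<bar> \<le> ennreal R" for n
    proof (intro AE_I2 ennreal_leI)
      fix p
      show "\<bar>min (source (r n) (t, p)) R - min (lim_gain (t, p)) R\<bar> \<le> R"
        using source_bounds(1)[of "r n" "(t, p)"] lim_gain_nonneg[of "(t, p)"] R(1) by (auto simp: min_def abs_le_iff)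
    qed
    show "(\<integral>\<^sup>+p. ennreal R \<partial>(phase :: ((real^'n) \<times> (real^'n)) measure)) < \<infinity>"
      by (simp add: phase.emeasure_eq_measure ennreal_mult_less_top)
    show "AE p in phase. (\<lambda>n. ennreal \<bar>min (source (r n) (t, p)) R - min (lim_gain (t, p)) R\<bar>) \<longlonglongrightarrow> 0"
      using source_tendsto[OF g]
    proof eventually_elim
      case (elim p)
      have "(\<lambda>n. \<bar>min (source (r n) (t, p)) R - min (lim_gain (t, p)) R\<bar>) \<longlonglongrightarrow> \<bar>min (lim_gain (t, p)) R - min (lim_gain (t, p)) R\<bar>"
        by (intro tendsto_intros elim)
      then show ?case using tendsto_ennrealI by fastforce
    qed
  qed auto
  then have "\<forall>\<^sub>F n in sequentially. (\<integral>\<^sup>+p. ennreal \<bar>min (source (r n) (t, p)) R - min (lim_gain (t, p)) R\<bar> \<partial>phase) < ennreal (\<epsilon> / 4)"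
    using e by (intro order_tendstoD(2)) auto
  then show "\<forall>\<^sub>F n in sequentially. (\<integral>\<^sup>+p. ennreal \<bar>source (r n) (t, p) - lim_gain (t, p)\<bar> \<partial>phase) < ennreal \<epsilon>"
  proof eventually_elim
    case (elim n)
    have "(\<integral>\<^sup>+p. ennreal \<bar>source (r n) (t, p) - lim_gain (t, p)\<bar> \<partial>phase) \<le>
       (\<integral>\<^sup>+p. ennreal \<bar>min (source (r n) (t, p)) R - min (lim_gain (t, p)) R\<bar> +
         (ennreal (source (r n) (t, p) - min (source (r n) (t, p)) R) + ennreal (lim_gain (t, p) - min (lim_gain (t, p)) R)) \<partial>phase)"
    proof (rule nn_integral_mono)
      fix p
      let ?a = "source (r n) (t, p)" and ?b = "lim_gain (t, p)"
      have "\<bar>?a - ?b\<bar> \<le> \<bar>min ?a R - min ?b R\<bar> + ((?a - min ?a R) + (?b - min ?b R))" by (auto simp: min_def)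
      then show "ennreal \<bar>?a - ?b\<bar> \<le> ennreal \<bar>min ?a R - min ?b R\<bar> + (ennreal (?a - min ?a R) + ennreal (?b - min ?b R))"
        by (simp add: ennreal_plus[symmetric] ennreal_leI del: ennreal_plus)
    qed
    also have "\<dots> = (\<integral>\<^sup>+p. ennreal \<bar>min (source (r n) (t, p)) R - min (lim_gain (t, p)) R\<bar> \<partial>phase) +
         ((\<integral>\<^sup>+p. ennreal (source (r n) (t, p) - min (source (r n) (t, p)) R) \<partial>phase) + (\<integral>\<^sup>+p. ennreal (lim_gain (t, p) - min (lim_gain (t, p)) R) \<partial>phase))"
      by (subst nn_integral_add, measurable, subst nn_integral_add) measurable
    also have "\<dots> \<le> ennreal (\<epsilon> / 4) + (ennreal (E / ln (1 + R)) + ennreal (E / ln (1 + R)))"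
    proof (intro add_mono tail_of_entropy_le source_bounds lim_gain_nonneg R E)
      show "(\<integral>\<^sup>+p. ennreal (entropy_density (source (r n) (t, p))) \<partial>phase) \<le> ennreal E"
        unfolding E_def source_def by (rule cut_gain_entropy_le[OF t])
      show "(\<integral>\<^sup>+p. ennreal (entropy_density (lim_gain (t, p))) \<partial>phase) \<le> ennreal E"
        unfolding E_def by (rule lim_gain_entropy_le[OF g])
    qed (use elim in auto)
    also have "\<dots> = ennreal (\<epsilon> / 4 + (E / L + E / L))" using e E L R by (simp add: ennreal_plus[symmetric] del: ennreal_plus)
    also have "\<dots> < ennreal \<epsilon>" using EL e E L by (intro ennreal_lessI) auto
    finally show ?case .
  qed
qed

end

section \<open>Convergence in the mean and almost everywhere subsequences\<close>

lemma fast_subsequence: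
  fixes a b :: "nat \<Rightarrow> ennreal"
  assumes a: "a \<longlonglongrightarrow> 0" and b: "\<And>n. 0 < b n"
  shows "\<exists>r. strict_mono (r :: nat \<Rightarrow> nat) \<and> (\<forall>n. a (r n) < b n)"
proof -
  have "\<forall>n. \<exists>m. \<forall>k\<ge>m. a k < b n"
    using order_tendstoD(2)[OF a b] by (simp add: eventually_sequentially)
  then obtain m where m: "\<And>n k. m n \<le> k \<Longrightarrow> a k < b n" using choice[of "\<lambda>n m. \<forall>k\<ge>m. a k < b n"] by blast
  define r where "r = rec_nat (m 0) (\<lambda>n a. max (Suc a) (m (Suc n)))"
  have r0: "r 0 = m 0" and rS: "r (Suc n) = max (Suc (r n)) (m (Suc n))" for n by (simp_all add: r_def)
  have "strict_mono r" unfolding strict_mono_Suc_iff rS by (simp add: less_max_iff_disj)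
  moreover have "m n \<le> r n" for n by (cases n) (simp_all only: r0 rS order_refl max.cobounded2)
  ultimately show ?thesis using m by (intro exI[of _ r]) simp
qed

text \<open>Along a subsequence whose means lie below a geometric series the sum of the absolute
  values is integrable, hence finite almost everywhere, and its terms tend to zero.\<close>

lemma L1_null_sequence_AE_subsequence:
  fixes u :: "nat \<Rightarrow> 'a \<Rightarrow> real"
  assumes u[measurable]: "\<And>n. u n \<in> borel_measurable M"
    and lim: "(\<lambda>n. \<integral>\<^sup>+x. ennreal \<bar>u n x\<bar> \<partial>M) \<longlonglongrightarrow> 0"
  shows "\<exists>r. strict_mono (r :: nat \<Rightarrow> nat) \<and> (AE x in M. (\<lambda>n. u (r n) x) \<longlonglongrightarrow> 0)"
proof -
  have pos: "0 < ennreal ((1/2) ^ Suc n)" for n by simp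
  obtain r :: "nat \<Rightarrow> nat"
    where r: "strict_mono r" and small: "\<And>n. (\<integral>\<^sup>+x. ennreal \<bar>u (r n) x\<bar> \<partial>M) < ennreal ((1/2) ^ Suc n)"
    using fast_subsequence[OF lim, of "\<lambda>n. ennreal ((1/2) ^ Suc n)", OF pos] by metis
  have "(\<integral>\<^sup>+x. (\<Sum>n. ennreal \<bar>u (r n) x\<bar>) \<partial>M) = (\<Sum>n. \<integral>\<^sup>+x. ennreal \<bar>u (r n) x\<bar> \<partial>M)"
    by (rule nn_integral_suminf) measurable
  also have "\<dots> \<le> (\<Sum>n. ennreal ((1/2) ^ Suc n))"
    by (rule suminf_le[OF less_imp_le[OF small] summableI summableI])
  also have "\<dots> = ennreal 1" by (rule suminf_ennreal_eq[OF _ power_half_series]) simp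
  finally have "(\<integral>\<^sup>+x. (\<Sum>n. ennreal \<bar>u (r n) x\<bar>) \<partial>M) \<le> ennreal 1" .
  then have "(\<integral>\<^sup>+x. (\<Sum>n. ennreal \<bar>u (r n) x\<bar>) \<partial>M) < top" by (rule le_less_trans) simp
  then have "(\<integral>\<^sup>+x. (\<Sum>n. ennreal \<bar>u (r n) x\<bar>) \<partial>M) \<noteq> \<infinity>" by simp
  then have "AE x in M. (\<Sum>n. ennreal \<bar>u (r n) x\<bar>) \<noteq> \<infinity>" by (rule nn_integral_noteq_infinite[rotated]) measurable
  then have "AE x in M. (\<lambda>n. u (r n) x) \<longlonglongrightarrow> 0"
  proof eventually_elim
    case (elim x)
    then have "(\<Sum>n. ennreal \<bar>u (r n) x\<bar>) \<noteq> top" by simp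
    then have "summable (\<lambda>n. \<bar>u (r n) x\<bar>)"
      by (rule summable_suminf_not_top[rotated]) (rule abs_ge_zero)
    then show ?case by (rule tendsto_rabs_zero_cancel[OF summable_LIMSEQ_zero])
  qed
  with r show ?thesis by blast
qed

context kinetic_limit
begin

definition source_error :: "nat \<Rightarrow> real \<Rightarrow> ennreal" where
  "source_error n s = (\<integral>\<^sup>+p. ennreal \<bar>source (r n) (s, p) - lim_gain (s, p)\<bar> \<partial>phase)"

lemma source_error_measurable[measurable]: "source_error n \<in> borel_measurable borel"
  unfolding source_error_def[abs_def] by measurable

text \<open>The total over all characteristics is finite by
  \<open>nn_integral_characteristics\<close>. The arrival time \<tau> is kept apart from the upper
  limit \<open>t\<close> so that \<open>solution_drift_le\<close> can compare two end times on the
  same line.\<close>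

lemma AE_lim_gain_integrable_along:
  assumes t: "0 \<le> t"
  shows "AE p in phase. integrable lborel (\<lambda>s. duhamel_weight t t s * lim_gain (s, fst p - (\<gamma> * (\<tau> - s)) *\<^sub>R snd p, snd p))"
proof -
  have "(\<integral>\<^sup>+p. \<integral>\<^sup>+s. ennreal (duhamel_weight t t s) * ennreal (lim_gain (s, fst p - (\<gamma> * (\<tau> - s)) *\<^sub>R snd p, snd p)) \<partial>lborel \<partial>phase) =
     (\<integral>\<^sup>+s. ennreal (duhamel_weight t t s) * (\<integral>\<^sup>+p. ennreal (lim_gain (s, p)) \<partial>phase) \<partial>lborel)"
    by (rule nn_integral_characteristics[where g="\<lambda>q. ennreal (lim_gain q)"])
      (measurable, use lim_gain_periodic in \<open>simp add: lattice_periodic_def\<close>)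
  also have "\<dots> \<le> (\<integral>\<^sup>+s. ennreal (duhamel_weight t t s) * ennreal (mass + 0 * exp (0 * s)) \<partial>lborel)"
  proof (rule nn_integral_mono_AE)
    from AE_good_time show "AE s in lborel. ennreal (duhamel_weight t t s) * (\<integral>\<^sup>+p. ennreal (lim_gain (s, p)) \<partial>phase) \<le>
        ennreal (duhamel_weight t t s) * ennreal (mass + 0 * exp (0 * s))"
    proof eventually_elim
      case (elim s)
      then show ?case using lim_gain_mass_le[of s] by (cases "0 \<le> s") (auto simp: duhamel_weight_def intro!: mult_left_mono)
    qed
  qed
  also have "\<dots> \<le> ennreal (mass * (1 - exp (- t)) + 0 / (0 + 1) * exp (0 * t))"
    by (rule nn_integral_duhamel_weight_exp) (use t mass_nonneg in auto)
  also have "\<dots> < \<infinity>" by simp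
  finally have "AE p in phase. (\<integral>\<^sup>+s. ennreal (duhamel_weight t t s) * ennreal (lim_gain (s, fst p - (\<gamma> * (\<tau> - s)) *\<^sub>R snd p, snd p)) \<partial>lborel) \<noteq> \<infinity>"
    by (intro nn_integral_noteq_infinite) auto
  then show ?thesis
  proof eventually_elim
    case (elim p)
    have "(\<integral>\<^sup>+s. ennreal (norm (duhamel_weight t t s * lim_gain (s, fst p - (\<gamma> * (\<tau> - s)) *\<^sub>R snd p, snd p))) \<partial>lborel) =
      (\<integral>\<^sup>+s. ennreal (duhamel_weight t t s) * ennreal (lim_gain (s, fst p - (\<gamma> * (\<tau> - s)) *\<^sub>R snd p, snd p)) \<partial>lborel)"
      by (simp add: abs_mult lim_gain_nonneg duhamel_weight_nonneg ennreal_mult)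
    with elim show ?case by (intro integrableI_bounded) (auto simp: less_top[symmetric])
  qed
qed

lemmas AE_lim_gain_integrable = AE_lim_gain_integrable_along[of t t for t]

text \<open>Three errors: the truncation of the initial datum, the distance of the sources, and the
  delay. The integrals are split only where \<open>lim_gain\<close> is integrable along the
  characteristic, that is for almost every \<open>p\<close>.\<close>

lemma approx_solution_error_le:
  assumes t: "0 \<le> t"
  shows "(\<integral>\<^sup>+p. ennreal \<bar>approx (r n) (t, p) - solution (t, p)\<bar> \<partial>phase) \<le>
    ennreal (\<integral>p. f0 p - cut (r n) p \<partial>phase) +
    ((\<integral>\<^sup>+s. ennreal (duhamel_weight t t s) * source_error n s \<partial>lborel) + ennreal (delay (r n) * mass))"
proof -
  let ?h = "delay (r n)"
  have h: "0 \<le> ?h" using delay_pos[of "r n"] by simp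
  let ?W = "\<lambda>s. duhamel_weight t t s" and ?Wh = "\<lambda>s. duhamel_weight (t - ?h) t s"
  have W: "0 \<le> ?Wh s" "?Wh s \<le> ?W s" for s unfolding duhamel_weight_def using h by auto
  let ?S = "\<lambda>p s. source (r n) (s, fst p - (\<gamma> * (t - s)) *\<^sub>R snd p, snd p)"
  let ?G = "\<lambda>p s. lim_gain (s, fst p - (\<gamma> * (t - s)) *\<^sub>R snd p, snd p)"
  let ?E = "\<lambda>p. (\<integral>\<^sup>+s. ennreal (?W s) * ennreal \<bar>?S p s - ?G p s\<bar> \<partial>lborel)"
  let ?D = "\<lambda>p. (\<integral>\<^sup>+s. ennreal (?W s - ?Wh s) * ennreal (?G p s) \<partial>lborel)"
  have "(\<integral>\<^sup>+p. ennreal \<bar>approx (r n) (t, p) - solution (t, p)\<bar> \<partial>phase) \<le>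
     (\<integral>\<^sup>+p. ennreal \<bar>free_flow \<gamma> (\<lambda>p. f0 p - cut (r n) p) (t, p)\<bar> + (?E p + ?D p) \<partial>phase)"
  proof (rule nn_integral_mono_AE)
    from AE_lim_gain_integrable[OF t]
    show "AE p in phase. ennreal \<bar>approx (r n) (t, p) - solution (t, p)\<bar> \<le>
       ennreal \<bar>free_flow \<gamma> (\<lambda>p. f0 p - cut (r n) p) (t, p)\<bar> + (?E p + ?D p)"
    proof eventually_elim
      case (elim p)
      note iG = elim
      have iGh: "integrable lborel (\<lambda>s. ?Wh s * ?G p s)"
      proof (rule Bochner_Integration.integrable_bound[OF iG])
        have "\<bar>?Wh s * ?G p s\<bar> \<le> \<bar>?W s * ?G p s\<bar>" for s
          unfolding abs_mult using W[of s] by (intro mult_right_mono) auto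
        then show "AE s in lborel. norm (?Wh s * ?G p s) \<le> norm (?W s * ?G p s)" by simp
      qed measurable
      have iS: "integrable lborel (\<lambda>s. ?Wh s * ?S p s)"
      proof (rule duhamel_weight_integrable)
        show "\<bar>?S p s\<bar> \<le> real (r n)" for s
          using source_bounds(1)[of "r n" "(s, fst p - (\<gamma> * (t - s)) *\<^sub>R snd p, snd p)"]
            source_bounds(2)[of "r n" "(s, fst p - (\<gamma> * (t - s)) *\<^sub>R snd p, snd p)"] by linarith
      qed (use h in auto)
      have 1: "approx (r n) (t, p) - solution (t, p) = - free_flow \<gamma> (\<lambda>p. f0 p - cut (r n) p) (t, p)
         + (\<integral>s. ?Wh s * ?S p s \<partial>lborel) - (\<integral>s. ?W s * ?G p s \<partial>lborel)"
        unfolding approx_eq solution_def duhamel_def free_flow_def by (simp add: right_diff_distrib)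
      have 2: "(\<integral>s. ?Wh s * ?S p s \<partial>lborel) - (\<integral>s. ?Wh s * ?G p s \<partial>lborel) = (\<integral>s. ?Wh s * (?S p s - ?G p s) \<partial>lborel)"
        using Bochner_Integration.integral_diff[OF iS iGh] by (simp only: right_diff_distrib)
      have 3: "(\<integral>s. ?W s * ?G p s \<partial>lborel) - (\<integral>s. ?Wh s * ?G p s \<partial>lborel) = (\<integral>s. (?W s - ?Wh s) * ?G p s \<partial>lborel)"
        using Bochner_Integration.integral_diff[OF iG iGh] by (simp only: left_diff_distrib)
      have "\<bar>approx (r n) (t, p) - solution (t, p)\<bar> \<le> \<bar>free_flow \<gamma> (\<lambda>p. f0 p - cut (r n) p) (t, p)\<bar> +
         (\<bar>\<integral>s. ?Wh s * (?S p s - ?G p s) \<partial>lborel\<bar> + \<bar>\<integral>s. (?W s - ?Wh s) * ?G p s \<partial>lborel\<bar>)"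
        unfolding 1 2[symmetric] 3[symmetric] by linarith
      then have "ennreal \<bar>approx (r n) (t, p) - solution (t, p)\<bar> \<le> ennreal \<bar>free_flow \<gamma> (\<lambda>p. f0 p - cut (r n) p) (t, p)\<bar> +
         (ennreal \<bar>\<integral>s. ?Wh s * (?S p s - ?G p s) \<partial>lborel\<bar> + ennreal \<bar>\<integral>s. (?W s - ?Wh s) * ?G p s \<partial>lborel\<bar>)"
        by (simp add: ennreal_plus[symmetric] ennreal_leI del: ennreal_plus)
      also have "\<dots> \<le> ennreal \<bar>free_flow \<gamma> (\<lambda>p. f0 p - cut (r n) p) (t, p)\<bar> + (?E p + ?D p)"
      proof (intro add_mono order_refl)
        show "ennreal \<bar>\<integral>s. ?Wh s * (?S p s - ?G p s) \<partial>lborel\<bar> \<le> ?E p"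
        proof (intro order_trans[OF ennreal_abs_integral_le] nn_integral_mono)
          fix s
          have "\<bar>?Wh s * (?S p s - ?G p s)\<bar> \<le> ?W s * \<bar>?S p s - ?G p s\<bar>"
            using mult_right_mono[OF W(2) abs_ge_zero] W(1) by (simp add: abs_mult)
          then show "ennreal \<bar>?Wh s * (?S p s - ?G p s)\<bar> \<le> ennreal (?W s) * ennreal \<bar>?S p s - ?G p s\<bar>"
            by (subst ennreal_mult[symmetric]) (auto simp: duhamel_weight_nonneg intro: ennreal_leI)
        qed
        show "ennreal \<bar>\<integral>s. (?W s - ?Wh s) * ?G p s \<partial>lborel\<bar> \<le> ?D p"
        proof (intro order_trans[OF ennreal_abs_integral_le] nn_integral_mono)
          fix s
          have WW: "0 \<le> ?W s - ?Wh s" using W(2)[of s] by linarith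
          show "ennreal \<bar>(?W s - ?Wh s) * ?G p s\<bar> \<le> ennreal (?W s - ?Wh s) * ennreal (?G p s)"
            unfolding abs_of_nonneg[OF mult_nonneg_nonneg[OF WW lim_gain_nonneg]]
            by (simp only: ennreal_mult[OF WW lim_gain_nonneg])
        qed
      qed
      finally show ?case .
    qed
  qed
  also have "\<dots> = (\<integral>\<^sup>+p. ennreal \<bar>free_flow \<gamma> (\<lambda>p. f0 p - cut (r n) p) (t, p)\<bar> \<partial>phase) + ((\<integral>\<^sup>+p. ?E p \<partial>phase) + (\<integral>\<^sup>+p. ?D p \<partial>phase))"
    by (subst nn_integral_add, measurable, subst nn_integral_add) measurable
  also have "\<dots> \<le> ennreal (\<integral>p. f0 p - cut (r n) p \<partial>phase) +
    ((\<integral>\<^sup>+s. ennreal (?W s) * source_error n s \<partial>lborel) + ennreal (?h * mass))"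
  proof (intro add_mono)
    have "(\<integral>\<^sup>+p. ennreal \<bar>free_flow \<gamma> (\<lambda>p. f0 p - cut (r n) p) (t, p)\<bar> \<partial>phase) = ennreal (exp (- t)) * (\<integral>\<^sup>+p. ennreal \<bar>f0 p - cut (r n) p\<bar> \<partial>phase)"
      by (rule nn_integral_free_flow) (measurable, use cut_periodic f0_periodic in \<open>simp add: lattice_periodic_def\<close>)
    also have "\<dots> \<le> 1 * (\<integral>\<^sup>+p. ennreal (f0 p - cut (r n) p) \<partial>phase)"
      using t cut_bounds(2) by (intro mult_mono nn_integral_mono) auto
    also have "\<dots> = ennreal (\<integral>p. f0 p - cut (r n) p \<partial>phase)"
      using f0_integrable cut_integrable[of "r n"] cut_bounds(2) by (subst nn_integral_eq_integral) auto
    finally show "(\<integral>\<^sup>+p. ennreal \<bar>free_flow \<gamma> (\<lambda>p. f0 p - cut (r n) p) (t, p)\<bar> \<partial>phase) \<le> ennreal (\<integral>p. f0 p - cut (r n) p \<partial>phase)" .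
    show "(\<integral>\<^sup>+p. ?E p \<partial>phase) \<le> (\<integral>\<^sup>+s. ennreal (?W s) * source_error n s \<partial>lborel)"
      unfolding source_error_def
      by (rule eq_refl, rule nn_integral_characteristics[where g="\<lambda>q. ennreal \<bar>source (r n) q - lim_gain q\<bar>"])
        (measurable, use source_periodic lim_gain_periodic in \<open>simp add: lattice_periodic_def\<close>)
    show "(\<integral>\<^sup>+p. ?D p \<partial>phase) \<le> ennreal (?h * mass)"
      using AE_good_time by (intro nn_integral_lag_le[OF t lim_gain_measurable lim_gain_nonneg lim_gain_periodic _ h])
        (auto elim!: eventually_mono intro: lim_gain_mass_le)
  qed
  finally show ?thesis .
qed

lemma r_tendsto: "f \<longlonglongrightarrow> l \<Longrightarrow> (\<lambda>n. f (r n)) \<longlonglongrightarrow> l"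
  using LIMSEQ_subseq_LIMSEQ[OF _ r_mono] by (simp add: o_def)

text \<open>The source error tends to zero at almost every time and is at most
  \<open>2 * mass\<close>, so dominated convergence in \<open>s\<close> applies. Integration over
  \<open>s\<close> is what gives the conclusion at every \<open>t\<close>, beyond the good
  times.\<close>

lemma approx_tendsto_solution:
  assumes t: "0 \<le> t"
  shows "(\<lambda>n. \<integral>\<^sup>+p. ennreal \<bar>approx (r n) (t, p) - solution (t, p)\<bar> \<partial>phase) \<longlonglongrightarrow> 0"
proof (rule tendsto_sandwich[OF _ _ tendsto_const])
  show "\<forall>\<^sub>F n in sequentially. (\<integral>\<^sup>+p. ennreal \<bar>approx (r n) (t, p) - solution (t, p)\<bar> \<partial>phase) \<le>
    ennreal (\<integral>p. f0 p - cut (r n) p \<partial>phase) +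
    ((\<integral>\<^sup>+s. ennreal (duhamel_weight t t s) * source_error n s \<partial>lborel) + ennreal (delay (r n) * mass))"
    using approx_solution_error_le[OF t] by simp
  have 1: "(\<lambda>n. ennreal (\<integral>p. f0 p - cut (r n) p \<partial>phase)) \<longlonglongrightarrow> ennreal 0"
    by (intro tendsto_ennrealI r_tendsto[OF cut_tendsto])
  have "(\<lambda>n. delay n) \<longlonglongrightarrow> 0"
    unfolding delay_def using LIMSEQ_inverse_real_of_nat by (simp add: inverse_eq_divide add.commute)
  from tendsto_mult_left_zero[OF r_tendsto[OF this], of mass]
  have 3: "(\<lambda>n. ennreal (delay (r n) * mass)) \<longlonglongrightarrow> ennreal 0" by (rule tendsto_ennrealI)
  have 2: "(\<lambda>n. \<integral>\<^sup>+s. ennreal (duhamel_weight t t s) * source_error n s \<partial>lborel) \<longlonglongrightarrow> (\<integral>\<^sup>+s. 0 \<partial>(lborel :: real measure))"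
  proof (rule nn_integral_dominated_convergence[where w="\<lambda>s. ennreal (duhamel_weight t t s) * ennreal (2 * mass + 0 * exp (0 * s))"])
    have "(\<integral>\<^sup>+s. ennreal (duhamel_weight t t s) * ennreal (2 * mass + 0 * exp (0 * s)) \<partial>lborel) \<le> ennreal (2 * mass * (1 - exp (- t)) + 0 / (0 + 1) * exp (0 * t))"
      by (rule nn_integral_duhamel_weight_exp) (use t mass_nonneg in auto)
    also have "\<dots> < \<infinity>" by simp
    finally show "(\<integral>\<^sup>+s. ennreal (duhamel_weight t t s) * ennreal (2 * mass + 0 * exp (0 * s)) \<partial>lborel) < \<infinity>" .
    show "AE s in lborel. ennreal (duhamel_weight t t s) * source_error n s \<le> ennreal (duhamel_weight t t s) * ennreal (2 * mass + 0 * exp (0 * s))" for n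
      using AE_good_time
    proof eventually_elim
      case (elim s)
      have "source_error n s \<le> ennreal (2 * mass)" if s: "0 \<le> s"
      proof -
        have "source_error n s \<le> (\<integral>\<^sup>+p. ennreal (source (r n) (s, p)) + ennreal (lim_gain (s, p)) \<partial>phase)"
          unfolding source_error_def
        proof (rule nn_integral_mono)
          fix p
          have "\<bar>source (r n) (s, p) - lim_gain (s, p)\<bar> \<le> source (r n) (s, p) + lim_gain (s, p)"
            using source_bounds(1)[of "r n" "(s, p)"] lim_gain_nonneg[of "(s, p)"] by linarith
          then show "ennreal \<bar>source (r n) (s, p) - lim_gain (s, p)\<bar> \<le> ennreal (source (r n) (s, p)) + ennreal (lim_gain (s, p))"
            unfolding ennreal_plus[OF source_bounds(1) lim_gain_nonneg, symmetric] by (rule ennreal_leI)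
        qed
        also have "\<dots> = (\<integral>\<^sup>+p. ennreal (source (r n) (s, p)) \<partial>phase) + (\<integral>\<^sup>+p. ennreal (lim_gain (s, p)) \<partial>phase)"
          by (rule nn_integral_add) measurable
        also have "\<dots> \<le> ennreal mass + ennreal mass"
          using elim s by (intro add_mono source_mass_le lim_gain_mass_le) auto
        also have "\<dots> = ennreal (2 * mass)" using mass_nonneg by (simp add: ennreal_plus[symmetric] del: ennreal_plus)
        finally show ?thesis .
      qed
      then show ?case by (cases "0 \<le> s") (auto simp: duhamel_weight_def intro!: mult_left_mono)
    qed
    show "AE s in lborel. (\<lambda>n. ennreal (duhamel_weight t t s) * source_error n s) \<longlonglongrightarrow> 0"
      using AE_good_time
    proof eventually_elim
      case (elim s)
      show ?case
      proof (cases "0 \<le> s")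
        case True
        have "(\<lambda>n. source_error n s) \<longlonglongrightarrow> 0" unfolding source_error_def using elim True source_L1_tendsto by blast
        then have "(\<lambda>n. ennreal (duhamel_weight t t s) * source_error n s) \<longlonglongrightarrow> ennreal (duhamel_weight t t s) * 0"
          by (intro tendsto_mult_ennreal tendsto_const) auto
        then show ?thesis by simp
      qed (simp add: duhamel_weight_def)
    qed
  qed auto
  show "(\<lambda>n. ennreal (\<integral>p. f0 p - cut (r n) p \<partial>phase) +
    ((\<integral>\<^sup>+s. ennreal (duhamel_weight t t s) * source_error n s \<partial>lborel) + ennreal (delay (r n) * mass))) \<longlonglongrightarrow> 0"
    using tendsto_add[OF 1 tendsto_add[OF 2 3]] by simp
qed simp

lemma approx_AE_subsequence:
  assumes t: "0 \<le> t"
  shows "\<exists>r'. strict_mono (r' :: nat \<Rightarrow> nat) \<and> (AE p in phase. (\<lambda>n. approx (r (r' n)) (t, p)) \<longlonglongrightarrow> solution (t, p))"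
proof -
  have "\<exists>r'. strict_mono (r' :: nat \<Rightarrow> nat) \<and> (AE p in phase. (\<lambda>n. approx (r (r' n)) (t, p) - solution (t, p)) \<longlonglongrightarrow> 0)"
    by (rule L1_null_sequence_AE_subsequence[OF _ approx_tendsto_solution[OF t]]) measurable
  then show ?thesis by (simp only: LIM_zero_iff)
qed

lemma solution_entropy_le:
  assumes t: "0 \<le> t"
  shows "(\<integral>\<^sup>+p. ennreal (entropy_density (solution (t, p))) \<partial>phase) \<le> ennreal (entropy_const * exp (rate * t))"
proof -
  obtain r' :: "nat \<Rightarrow> nat" where r': "AE p in phase. (\<lambda>n. approx (r (r' n)) (t, p)) \<longlonglongrightarrow> solution (t, p)"
    using approx_AE_subsequence[OF t] by blast
  show ?thesis
  proof (rule nn_integral_Fatou_le[where u="\<lambda>n p. ennreal (entropy_density (approx (r (r' n)) (t, p)))" and b="\<lambda>_. ennreal (entropy_const * exp (rate * t))"])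
    show "AE p in phase. (\<lambda>n. ennreal (entropy_density (approx (r (r' n)) (t, p)))) \<longlonglongrightarrow> ennreal (entropy_density (solution (t, p)))"
      using r' by eventually_elim (intro tendsto_ennrealI tendsto_entropy_density solution_nonneg)
    show "(\<integral>\<^sup>+p. ennreal (entropy_density (approx (r (r' n)) (t, p))) \<partial>phase) \<le> ennreal (entropy_const * exp (rate * t))" for n
      unfolding approx_def by (rule iter_entropy_le[OF t])
  qed auto
qed

lemma solution_mass_le:
  assumes t: "0 \<le> t"
  shows "(\<integral>\<^sup>+p. ennreal (solution (t, p)) \<partial>phase) \<le> ennreal mass"
proof -
  obtain r' :: "nat \<Rightarrow> nat" where r': "AE p in phase. (\<lambda>n. approx (r (r' n)) (t, p)) \<longlonglongrightarrow> solution (t, p)"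
    using approx_AE_subsequence[OF t] by blast
  show ?thesis
  proof (rule nn_integral_Fatou_le[where u="\<lambda>n p. ennreal (approx (r (r' n)) (t, p))" and b="\<lambda>_. ennreal mass"])
    show "AE p in phase. (\<lambda>n. ennreal (approx (r (r' n)) (t, p))) \<longlonglongrightarrow> ennreal (solution (t, p))"
      using r' by eventually_elim (intro tendsto_ennrealI)
    show "(\<integral>\<^sup>+p. ennreal (approx (r (r' n)) (t, p)) \<partial>phase) \<le> ennreal mass" for n
      unfolding approx_def by (rule iter_mass_le[OF t])
  qed auto
qed

lemma solution_integrable:
  assumes t: "0 \<le> t" shows "integrable phase (\<lambda>p. solution (t, p))"
  using order.strict_trans1[OF solution_mass_le[OF t] ennreal_less_top]
  by (intro integrableI_bounded) (auto simp: solution_nonneg)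

lemma AE_solution_sphere_integrable:
  assumes t: "0 \<le> t" shows "AE x in torus_measure. integrable sphere_borel (\<lambda>w. solution (t, x, w))"
  using phase_pair.AE_integrable_fst'[OF solution_integrable[OF t, unfolded phase_def]] by simp

text \<open>The moments of the approximations converge in two ways: in the mean to those of
  \<open>solution\<close>, since taking moments does not increase distances in the mean, and almost
  everywhere to \<open>lim_density\<close> and \<open>lim_flux\<close>. Fatou's lemma forces the
  limits to agree.\<close>

lemma solution_moments:
  assumes g: "good_time t"
  shows "AE x in torus_measure. density_of solution (t, x) = lim_density (t, x) \<and> flux_of solution (t, x) = lim_flux (t, x)"
proof -
  have t: "0 \<le> t" using g by (simp add: good_time_def)
  let ?e = "\<lambda>n x. \<integral>\<^sup>+w. ennreal \<bar>approx (r n) (t, x, w) - solution (t, x, w)\<bar> \<partial>sphere_borel"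
  have e: "(\<integral>\<^sup>+x. ?e n x \<partial>torus_measure) = (\<integral>\<^sup>+p. ennreal \<bar>approx (r n) (t, p) - solution (t, p)\<bar> \<partial>phase)" for n
    by (rule nn_integral_phase(2)[symmetric]) measurable
  have mom: "AE x in torus_measure. \<forall>n. ennreal \<bar>density_of (approx (r n)) (t, x) - density_of solution (t, x)\<bar> \<le> ?e n x \<and>
     ennreal (norm (flux_of (approx (r n)) (t, x) - flux_of solution (t, x))) \<le> ?e n x"
    using AE_solution_sphere_integrable[OF t]
  proof (eventually_elim, intro allI conjI)
    fix x n
    assume i: "integrable sphere_borel (\<lambda>w. solution (t, x, w))"
    have ia: "integrable sphere_borel (\<lambda>w. approx (r n) (t, x, w))" by (rule approx_sphere_integrable)
    have v: "integrable sphere_borel (\<lambda>w. f w *\<^sub>R w)" if "integrable sphere_borel f" for f :: "real^'n \<Rightarrow> real"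
    proof (rule Bochner_Integration.integrable_bound[OF that])
      show "AE w in sphere_borel. norm (f w *\<^sub>R w) \<le> norm (f w)"
        using AE_sphere_borel_norm by eventually_elim simp
    qed (use that in auto)
    have "density_of (approx (r n)) (t, x) - density_of solution (t, x) = (\<integral>w. approx (r n) (t, x, w) - solution (t, x, w) \<partial>sphere_borel)"
      unfolding density_of_def using ia i by simp
    then show "ennreal \<bar>density_of (approx (r n)) (t, x) - density_of solution (t, x)\<bar> \<le> ?e n x"
      using ennreal_abs_integral_le by simp
    have d: "integrable sphere_borel (\<lambda>w. (approx (r n) (t, x, w) - solution (t, x, w)) *\<^sub>R w)" using ia i by (intro v) auto
    have "flux_of (approx (r n)) (t, x) - flux_of solution (t, x) = (\<integral>w. (approx (r n) (t, x, w) - solution (t, x, w)) *\<^sub>R w \<partial>sphere_borel)"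
      unfolding flux_of_def using v[OF ia] v[OF i] by (simp add: scaleR_diff_left)
    then have "ennreal (norm (flux_of (approx (r n)) (t, x) - flux_of solution (t, x))) \<le>
        (\<integral>\<^sup>+w. ennreal (norm ((approx (r n) (t, x, w) - solution (t, x, w)) *\<^sub>R w)) \<partial>sphere_borel)"
      using integral_norm_bound_ennreal[OF d] by simp
    also have "\<dots> = ?e n x"
      by (rule nn_integral_cong_AE) (use AE_sphere_borel_norm in \<open>auto elim!: eventually_mono\<close>)
    finally show "ennreal (norm (flux_of (approx (r n)) (t, x) - flux_of solution (t, x))) \<le> ?e n x" .
  qed
  have lims: "AE x in torus_measure. (\<lambda>n. density_of (approx (r n)) (t, x)) \<longlonglongrightarrow> lim_density (t, x) \<and>
     (\<lambda>n. flux_of (approx (r n)) (t, x)) \<longlonglongrightarrow> lim_flux (t, x)"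
    using g by (simp add: good_time_def)
  have "(\<integral>\<^sup>+x. ennreal \<bar>lim_density (t, x) - density_of solution (t, x)\<bar> \<partial>torus_measure) \<le> 0"
  proof (rule nn_integral_Fatou_le[where u="\<lambda>n x. ennreal \<bar>density_of (approx (r n)) (t, x) - density_of solution (t, x)\<bar>", OF _ _ _ _ approx_tendsto_solution[OF t]])
    show "AE x in torus_measure. (\<lambda>n. ennreal \<bar>density_of (approx (r n)) (t, x) - density_of solution (t, x)\<bar>) \<longlonglongrightarrow> ennreal \<bar>lim_density (t, x) - density_of solution (t, x)\<bar>"
      using lims by eventually_elim (intro tendsto_ennrealI tendsto_intros; simp)
    show "(\<integral>\<^sup>+x. ennreal \<bar>density_of (approx (r n)) (t, x) - density_of solution (t, x)\<bar> \<partial>torus_measure) \<le>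
       (\<integral>\<^sup>+p. ennreal \<bar>approx (r n) (t, p) - solution (t, p)\<bar> \<partial>phase)" for n
      unfolding e[symmetric] by (rule nn_integral_mono_AE) (use mom in \<open>auto elim!: eventually_mono\<close>)
  qed auto
  then have 1: "AE x in torus_measure. ennreal \<bar>lim_density (t, x) - density_of solution (t, x)\<bar> = 0"
    by (intro nn_integral_zeroD) auto
  have "(\<integral>\<^sup>+x. ennreal (norm (lim_flux (t, x) - flux_of solution (t, x))) \<partial>torus_measure) \<le> 0"
  proof (rule nn_integral_Fatou_le[where u="\<lambda>n x. ennreal (norm (flux_of (approx (r n)) (t, x) - flux_of solution (t, x)))", OF _ _ _ _ approx_tendsto_solution[OF t]])
    show "AE x in torus_measure. (\<lambda>n. ennreal (norm (flux_of (approx (r n)) (t, x) - flux_of solution (t, x)))) \<longlonglongrightarrow> ennreal (norm (lim_flux (t, x) - flux_of solution (t, x)))"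
      using lims by eventually_elim (intro tendsto_ennrealI tendsto_intros; simp)
    show "(\<integral>\<^sup>+x. ennreal (norm (flux_of (approx (r n)) (t, x) - flux_of solution (t, x))) \<partial>torus_measure) \<le>
       (\<integral>\<^sup>+p. ennreal \<bar>approx (r n) (t, p) - solution (t, p)\<bar> \<partial>phase)" for n
      unfolding e[symmetric] by (rule nn_integral_mono_AE) (use mom in \<open>auto elim!: eventually_mono\<close>)
  qed auto
  then have "AE x in torus_measure. ennreal (norm (lim_flux (t, x) - flux_of solution (t, x))) = 0"
    by (intro nn_integral_zeroD) auto
  with 1 show ?thesis by eventually_elim (simp add: ennreal_eq_0_iff)
qed

lemma gain_of_solution:
  assumes "good_time t"
  shows "AE p in phase. gain_of solution (t, p) = lim_gain (t, p)"
proof -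
  have "AE x in torus_measure. \<forall>w. gain_of solution (t, x, w) = lim_gain (t, x, w)"
    using solution_moments[OF assms] by eventually_elim (simp add: gain_of_def lim_gain_def)
  from AE_phase_fst[OF this] show ?thesis by eventually_elim (metis prod.collapse)
qed

end

subsection \<open>Continuity of translations in the mean\<close>

text \<open>\<open>fracv\<close> is discontinuous only where some coordinate is an integer, a null
  set that is independent of the approaching sequence.\<close>

lemma AE_torus_tendsto_fracv:
  fixes y :: "nat \<Rightarrow> real^'n"
  shows "AE x in torus_measure. \<forall>y::nat \<Rightarrow> real^'n. y \<longlonglongrightarrow> x \<longrightarrow> (\<lambda>n. fracv (y n)) \<longlonglongrightarrow> fracv x"
proof -
  have "AE x::real^'n in lborel. x $ i \<noteq> of_int k" for i :: 'n and k
  proof -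
    have "negligible {x::real^'n. x $ i = of_int k}"
      using negligible_standard_hyperplane[of "axis i (1::real)" "of_int k"]
      by (simp add: cart_eq_inner_axis axis_in_Basis_iff)
    from AE_lborel_notin_null[OF this] show ?thesis by simp
  qed
  then have "AE x::real^'n in lborel. \<forall>i k. x $ i \<noteq> of_int k" by (simp add: AE_all_countable)
  then have "AE x::real^'n in torus_measure. \<forall>i k. x $ i \<noteq> of_int k"
    unfolding torus_measure_def
    by (subst AE_distr_iff) (auto simp: measurable_restrict_space1 AE_restrict_space_iff elim!: eventually_mono)
  then show ?thesis
  proof (eventually_elim, intro allI impI)
    fix x :: "real^'n" and y :: "nat \<Rightarrow> real^'n"
    assume x: "\<forall>i k. x $ i \<noteq> of_int k" and y: "y \<longlonglongrightarrow> x"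
    show "(\<lambda>n. fracv (y n)) \<longlonglongrightarrow> fracv x"
    proof (rule vec_tendstoI)
      fix i
      have yi: "(\<lambda>n. y n $ i) \<longlonglongrightarrow> x $ i" by (rule tendsto_vec_nth[OF y])
      have "x $ i \<notin> \<int>" using x by (auto elim: Ints_cases)
      then have "\<forall>\<^sub>F n in sequentially. \<lfloor>y n $ i\<rfloor> = \<lfloor>x $ i\<rfloor>" by (rule eventually_floor_eq[OF yi])
      then have "\<forall>\<^sub>F n in sequentially. y n $ i - of_int \<lfloor>x $ i\<rfloor> = fracv (y n) $ i"
        by eventually_elim (simp add: fracv_def frac_def)
      moreover have "(\<lambda>n. y n $ i - of_int \<lfloor>x $ i\<rfloor>) \<longlonglongrightarrow> fracv x $ i"
        unfolding fracv_def frac_def vec_lambda_beta by (intro tendsto_intros yi)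
      ultimately show "(\<lambda>n. fracv (y n) $ i) \<longlonglongrightarrow> fracv x $ i" by (rule Lim_transform_eventually[rotated])
    qed
  qed
qed

lemma distr_phase_fracv:
  fixes v :: "real^'n \<Rightarrow> real^'n"
  assumes [measurable]: "v \<in> borel_measurable borel"
  shows "distr phase (borel \<Otimes>\<^sub>M borel) (\<lambda>p. (fracv (fst p + v (snd p)), snd p)) = phase"
proof (rule measure_eqI)
  fix A assume "A \<in> sets (distr phase (borel \<Otimes>\<^sub>M borel) (\<lambda>p. (fracv (fst p + v (snd p)), snd p)))"
  then have A[measurable]: "A \<in> sets (borel \<Otimes>\<^sub>M borel)" by simp
  have "emeasure (distr phase (borel \<Otimes>\<^sub>M borel) (\<lambda>p. (fracv (fst p + v (snd p)), snd p))) A =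
      (\<integral>\<^sup>+p. indicator A (fracv (fst p + v (snd p)), snd p) \<partial>phase)"
    by (subst nn_integral_indicator[symmetric], simp, subst nn_integral_distr) auto
  also have "\<dots> = (\<integral>\<^sup>+w. \<integral>\<^sup>+x. indicator A (fracv (x + v w), w) \<partial>torus_measure \<partial>sphere_borel)"
    by (subst nn_integral_phase(1)) auto
  also have "\<dots> = (\<integral>\<^sup>+w. \<integral>\<^sup>+x. indicator A (x, w) \<partial>torus_measure \<partial>sphere_borel)"
  proof (rule nn_integral_cong)
    fix w
    have "(\<integral>\<^sup>+x. indicator A (x, w) \<partial>torus_measure) = (\<integral>\<^sup>+x. indicator A (x, w) \<partial>distr torus_measure borel (\<lambda>x. fracv (x + v w)))"
      by (simp only: distr_torus_translation)
    also have "\<dots> = (\<integral>\<^sup>+x. indicator A (fracv (x + v w), w) \<partial>torus_measure)"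
      by (rule nn_integral_distr) measurable
    finally show "(\<integral>\<^sup>+x. indicator A (fracv (x + v w), w) \<partial>torus_measure) = (\<integral>\<^sup>+x. indicator A (x, w) \<partial>torus_measure :: ennreal)" by simp
  qed
  also have "\<dots> = (\<integral>\<^sup>+p. indicator A p \<partial>phase)" by (rule nn_integral_phase(1)[symmetric]) measurable
  also have "\<dots> = emeasure phase A" by simp
  finally show "emeasure (distr phase (borel \<Otimes>\<^sub>M borel) (\<lambda>p. (fracv (fst p + v (snd p)), snd p))) A = emeasure phase A" .
qed simp

text \<open>For an open set the translated indicators are eventually at least the original one, while
  their integrals agree; a Dynkin argument extends the convergence to all Borel sets.\<close>

lemma translation_L1_continuous:
  fixes f :: "(real^'n) \<times> (real^'n) \<Rightarrow> real" and v :: "nat \<Rightarrow> real^'n \<Rightarrow> real^'n"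
  assumes vm[measurable]: "\<And>n. v n \<in> borel_measurable borel" and v: "\<And>w. (\<lambda>n. v n w) \<longlonglongrightarrow> 0"
    and f: "integrable phase f"
  shows "(\<lambda>n. \<integral>p. \<bar>f (fracv (fst p + v n (snd p)), snd p) - f (fracv (fst p), snd p)\<bar> \<partial>phase) \<longlonglongrightarrow> 0"
proof -
  define T where "T n p = (fracv (fst p + v n (snd p)), snd p)" for n and p :: "(real^'n) \<times> (real^'n)"
  define T0 where "T0 p = (fracv (fst p), snd p)" for p :: "(real^'n) \<times> (real^'n)"
  have Tm[measurable]: "T n \<in> measurable (borel \<Otimes>\<^sub>M borel) (borel \<Otimes>\<^sub>M borel)" for n unfolding T_def by measurable
  have T0m[measurable]: "T0 \<in> measurable (borel \<Otimes>\<^sub>M borel) (borel \<Otimes>\<^sub>M borel)" unfolding T0_def by measurable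
  have Td: "distr phase (borel \<Otimes>\<^sub>M borel) (T n) = phase" for n
    using distr_phase_fracv[OF vm[of n]] by (simp add: T_def[abs_def])
  have T0d: "distr phase (borel \<Otimes>\<^sub>M borel) T0 = phase"
    using distr_phase_fracv[of "\<lambda>_. 0"] by (simp add: T0_def[abs_def])
  have tr: "integrable phase (\<lambda>p. g (S p))" "(\<integral>p. g (S p) \<partial>phase) = (\<integral>p. g p \<partial>phase)"
    if S[measurable]: "S \<in> measurable (borel \<Otimes>\<^sub>M borel) (borel \<Otimes>\<^sub>M borel)" and Sd: "distr phase (borel \<Otimes>\<^sub>M borel) S = phase"
      and g: "integrable phase g" for S and g :: "(real^'n) \<times> (real^'n) \<Rightarrow> real"
  proof -
    have gm[measurable]: "g \<in> borel_measurable (borel \<Otimes>\<^sub>M borel)" using borel_measurable_integrable[OF g] by simp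
    have Sp: "S \<in> measurable phase (borel \<Otimes>\<^sub>M borel)" by measurable
    have "integrable (distr phase (borel \<Otimes>\<^sub>M borel) S) g" using g by (simp only: Sd)
    then show "integrable phase (\<lambda>p. g (S p))" by (simp add: integrable_distr_eq[OF Sp gm])
    have "(\<integral>p. g p \<partial>phase) = (\<integral>p. g p \<partial>distr phase (borel \<Otimes>\<^sub>M borel) S)" by (simp only: Sd)
    also have "\<dots> = (\<integral>p. g (S p) \<partial>phase)" by (rule integral_distr[OF Sp gm])
    finally show "(\<integral>p. g (S p) \<partial>phase) = (\<integral>p. g p \<partial>phase)" by simp
  qed
  note trn = tr[OF Tm Td] and tr0 = tr[OF T0m T0d]
  define Q where "Q g \<longleftrightarrow> ((\<lambda>n. \<integral>p. \<bar>g (T n p) - g (T0 p)\<bar> \<partial>phase) \<longlonglongrightarrow> 0)" for g :: "(real^'n) \<times> (real^'n) \<Rightarrow> real"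
  have int: "integrable phase (\<lambda>p. \<bar>g (T n p) - g (T0 p)\<bar>)" if "integrable phase g" for g :: "(real^'n) \<times> (real^'n) \<Rightarrow> real" and n
    using trn(1)[OF that] tr0(1)[OF that] by auto
  have Q_add: "Q (\<lambda>p. g p + h p)" if g: "integrable phase g" "Q g" and h: "integrable phase h" "Q h" for g h :: "(real^'n) \<times> (real^'n) \<Rightarrow> real"
    unfolding Q_def
  proof (rule tendsto_sandwich[OF _ _ tendsto_const])
    show "\<forall>\<^sub>F n in sequentially. (\<integral>p. \<bar>g (T n p) + h (T n p) - (g (T0 p) + h (T0 p))\<bar> \<partial>phase) \<le>
        (\<integral>p. \<bar>g (T n p) - g (T0 p)\<bar> \<partial>phase) + (\<integral>p. \<bar>h (T n p) - h (T0 p)\<bar> \<partial>phase)"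
    proof (rule always_eventually, rule allI)
      fix n
      have "(\<integral>p. \<bar>g (T n p) + h (T n p) - (g (T0 p) + h (T0 p))\<bar> \<partial>phase) \<le> (\<integral>p. \<bar>g (T n p) - g (T0 p)\<bar> + \<bar>h (T n p) - h (T0 p)\<bar> \<partial>phase)"
        using trn(1)[OF g(1)] tr0(1)[OF g(1)] trn(1)[OF h(1)] tr0(1)[OF h(1)] by (intro integral_mono) auto
      also have "\<dots> = (\<integral>p. \<bar>g (T n p) - g (T0 p)\<bar> \<partial>phase) + (\<integral>p. \<bar>h (T n p) - h (T0 p)\<bar> \<partial>phase)"
        by (rule Bochner_Integration.integral_add[OF int[OF g(1)] int[OF h(1)]])
      finally show "(\<integral>p. \<bar>g (T n p) + h (T n p) - (g (T0 p) + h (T0 p))\<bar> \<partial>phase) \<le>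
        (\<integral>p. \<bar>g (T n p) - g (T0 p)\<bar> \<partial>phase) + (\<integral>p. \<bar>h (T n p) - h (T0 p)\<bar> \<partial>phase)" .
    qed
    show "(\<lambda>n. (\<integral>p. \<bar>g (T n p) - g (T0 p)\<bar> \<partial>phase) + (\<integral>p. \<bar>h (T n p) - h (T0 p)\<bar> \<partial>phase)) \<longlonglongrightarrow> 0"
      using tendsto_add[OF g(2)[unfolded Q_def] h(2)[unfolded Q_def]] by simp
  qed simp
  have Q_scale: "Q (\<lambda>p. c * g p)" if "Q g" for g c
  proof -
    have "(\<integral>p. \<bar>c * g (T n p) - c * g (T0 p)\<bar> \<partial>phase) = \<bar>c\<bar> * (\<integral>p. \<bar>g (T n p) - g (T0 p)\<bar> \<partial>phase)" for n
      by (simp add: abs_mult flip: right_diff_distrib)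
    then show ?thesis using tendsto_mult_right_zero[OF that[unfolded Q_def], of "\<bar>c\<bar>"] by (simp add: Q_def)
  qed
  have Q_lim: "Q g"
    if g: "integrable phase g" and s: "\<And>i. integrable phase (s i)" "\<And>i. Q (s i)"
      and lim: "(\<lambda>i. \<integral>p. \<bar>s i p - g p\<bar> \<partial>phase) \<longlonglongrightarrow> 0" for g and s :: "nat \<Rightarrow> _"
    unfolding Q_def
  proof (rule LIMSEQ_I)
    fix e :: real assume e: "0 < e"
    obtain i where i: "(\<integral>p. \<bar>s i p - g p\<bar> \<partial>phase) < e / 3"
      using order_tendstoD(2)[OF lim, of "e / 3"] e by (auto simp: eventually_sequentially)
    obtain N where N: "\<And>n. N \<le> n \<Longrightarrow> (\<integral>p. \<bar>s i (T n p) - s i (T0 p)\<bar> \<partial>phase) < e / 3"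
      using order_tendstoD(2)[OF s(2)[of i, unfolded Q_def], of "e / 3"] e by (auto simp: eventually_sequentially)
    have d: "integrable phase (\<lambda>p. \<bar>s i p - g p\<bar>)" using g s(1)[of i] by auto
    have "(\<integral>p. \<bar>g (T n p) - g (T0 p)\<bar> \<partial>phase) < e" if "N \<le> n" for n
    proof -
      have "(\<integral>p. \<bar>g (T n p) - g (T0 p)\<bar> \<partial>phase) \<le>
          (\<integral>p. \<bar>s i (T n p) - g (T n p)\<bar> + (\<bar>s i (T n p) - s i (T0 p)\<bar> + \<bar>s i (T0 p) - g (T0 p)\<bar>) \<partial>phase)"
        using trn(1)[OF g] tr0(1)[OF g] trn(1)[OF s(1)[of i]] tr0(1)[OF s(1)[of i]] by (intro integral_mono) auto
      also have "\<dots> = (\<integral>p. \<bar>s i (T n p) - g (T n p)\<bar> \<partial>phase) + ((\<integral>p. \<bar>s i (T n p) - s i (T0 p)\<bar> \<partial>phase) + (\<integral>p. \<bar>s i (T0 p) - g (T0 p)\<bar> \<partial>phase))"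
        using trn(1)[OF g] tr0(1)[OF g] trn(1)[OF s(1)[of i]] tr0(1)[OF s(1)[of i]] by simp
      \<comment> \<open>\<open>T n\<close> and \<open>T0\<close> preserve \<open>phase\<close>, so
        the first and the last error both equal the distance of \<open>s i\<close> to
        \<open>g\<close>.\<close>
      also have "\<dots> < e" using i N[OF that] trn(2)[OF d, of n] tr0(2)[OF d] by linarith
      finally show ?thesis .
    qed
    then show "\<exists>N. \<forall>n\<ge>N. norm ((\<integral>p. \<bar>g (T n p) - g (T0 p)\<bar> \<partial>phase) - 0) < e" by auto
  qed
  have ind_int: "integrable phase (indicator A :: _ \<Rightarrow> real)" if "A \<in> sets (borel \<Otimes>\<^sub>M borel)" for A :: "((real^'n) \<times> (real^'n)) set"
    using that by (simp add: phase.emeasure_eq_measure)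
  have Q_open: "Q (indicator E)" if E: "open E" for E :: "((real^'n) \<times> (real^'n)) set"
  proof -
    have Em[measurable]: "E \<in> sets (borel \<Otimes>\<^sub>M borel)" by (subst borel_prod) (rule borel_open[OF E])
    have i: "integrable phase (\<lambda>p. (indicator E (T n p) :: real))" "integrable phase (\<lambda>p. (indicator E (T0 p) :: real))" for n using trn(1)[OF ind_int[OF Em]] tr0(1)[OF ind_int[OF Em]] by auto
    have ip: "integrable phase (\<lambda>p. (indicator E (T n p) :: real) * (indicator E (T0 p) :: real))" for n
      by (rule Bochner_Integration.integrable_bound[OF i(2)]) (auto split: split_indicator)
    have "AE p in phase. \<forall>y::nat \<Rightarrow> real^'n. y \<longlonglongrightarrow> fst p \<longrightarrow> (\<lambda>n. fracv (y n)) \<longlonglongrightarrow> fracv (fst p)"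
      by (rule AE_phase_fst[OF AE_torus_tendsto_fracv])
    \<comment> \<open>Multiplication by the original indicator leaves only points that end up in
      \<open>E\<close>, where openness yields the convergence.\<close>
    then have "AE p in phase. (\<lambda>n. (indicator E (T n p) :: real) * (indicator E (T0 p) :: real)) \<longlonglongrightarrow> (indicator E (T0 p) :: real)"
    proof eventually_elim
      case (elim p)
      have "(\<lambda>n. fst p + v n (snd p)) \<longlonglongrightarrow> fst p" using tendsto_add[OF tendsto_const v, of "fst p" "snd p"] by simp
      then have "(\<lambda>n. T n p) \<longlonglongrightarrow> T0 p" unfolding T_def T0_def using elim by (intro tendsto_Pair tendsto_const) auto
      show ?case
      proof (cases "T0 p \<in> E")
        case True
        then have "\<forall>\<^sub>F n in sequentially. T n p \<in> E" using topological_tendstoD[OF \<open>(\<lambda>n. T n p) \<longlonglongrightarrow> T0 p\<close> E] by simp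
        then have "\<forall>\<^sub>F n in sequentially. (indicator E (T n p) :: real) * (indicator E (T0 p) :: real) = (indicator E (T0 p) :: real)" by eventually_elim (simp add: True)
        then show ?thesis by (rule tendsto_eventually)
      qed simp
    qed
    then have "(\<lambda>n. \<integral>p. (indicator E (T n p) :: real) * (indicator E (T0 p) :: real) \<partial>phase) \<longlonglongrightarrow> (\<integral>p. (indicator E (T0 p) :: real) \<partial>phase)"
      using i ip by (intro integral_dominated_convergence[where w="\<lambda>_. 1"]) (auto split: split_indicator)
    then have "(\<lambda>n. 2 * (\<integral>p. (indicator E (T0 p) :: real) \<partial>phase) - 2 * (\<integral>p. (indicator E (T n p) :: real) * (indicator E (T0 p) :: real) \<partial>phase)) \<longlonglongrightarrow> 2 * (\<integral>p. (indicator E (T0 p) :: real) \<partial>phase) - 2 * (\<integral>p. (indicator E (T0 p) :: real) \<partial>phase)"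
      by (intro tendsto_intros)
    \<comment> \<open>For indicators \<open>\<bar>a - b\<bar> = a + b - 2 * a * b\<close>, and here
      \<open>a\<close> and \<open>b\<close> have the same integral.\<close>
    moreover have "(\<integral>p. \<bar>(indicator E (T n p) :: real) - (indicator E (T0 p) :: real)\<bar> \<partial>phase) = 2 * (\<integral>p. (indicator E (T0 p) :: real) \<partial>phase) - 2 * (\<integral>p. (indicator E (T n p) :: real) * (indicator E (T0 p) :: real) \<partial>phase)" for n
    proof -
      have "(\<integral>p. \<bar>(indicator E (T n p) :: real) - (indicator E (T0 p) :: real)\<bar> \<partial>phase) = (\<integral>p. (indicator E (T n p) :: real) + (indicator E (T0 p) :: real) - 2 * ((indicator E (T n p) :: real) * (indicator E (T0 p) :: real)) \<partial>phase)"
        by (intro Bochner_Integration.integral_cong) (auto split: split_indicator)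
      also have "\<dots> = (\<integral>p. (indicator E (T n p) :: real) \<partial>phase) + (\<integral>p. (indicator E (T0 p) :: real) \<partial>phase) - 2 * (\<integral>p. (indicator E (T n p) :: real) * (indicator E (T0 p) :: real) \<partial>phase)"
        using i(1)[of n] i(2) ip[of n] by simp
      finally show ?thesis using trn(2)[OF ind_int[OF Em], of n] tr0(2)[OF ind_int[OF Em]] by simp
    qed
    ultimately show ?thesis unfolding Q_def by simp
  qed
  have dom: "(\<lambda>i. \<integral>p. \<bar>s i p - g p\<bar> \<partial>phase) \<longlonglongrightarrow> 0"
    if g: "integrable phase g" and s: "\<And>i. integrable phase (s i)"
      and lim: "\<And>p. (\<lambda>i. s i p) \<longlonglongrightarrow> g p" and bd: "\<And>i p. \<bar>s i p\<bar> \<le> 2 * \<bar>g p\<bar>"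
    for g and s :: "nat \<Rightarrow> (real^'n) \<times> (real^'n) \<Rightarrow> real"
  proof -
    have "(\<lambda>i. \<integral>p. \<bar>s i p - g p\<bar> \<partial>phase) \<longlonglongrightarrow> (\<integral>p. 0 \<partial>(phase :: ((real^'n) \<times> (real^'n)) measure))"
    proof (rule integral_dominated_convergence[where w="\<lambda>p. 3 * \<bar>g p\<bar>"])
      show "AE p in phase. (\<lambda>i. \<bar>s i p - g p\<bar>) \<longlonglongrightarrow> 0"
        using lim by (intro AE_I2 tendsto_rabs_zero) (simp add: LIM_zero_iff)
      show "AE p in phase. norm \<bar>s i p - g p\<bar> \<le> 3 * \<bar>g p\<bar>" for i
      proof (rule AE_I2)
        fix p show "norm \<bar>s i p - g p\<bar> \<le> 3 * \<bar>g p\<bar>" using bd[of i p] by (simp add: abs_le_iff) linarith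
      qed
    qed (use g s in auto)
    then show ?thesis by simp
  qed
  have Q_ind: "Q (indicator A)" if A: "A \<in> sets (borel \<Otimes>\<^sub>M borel)" for A :: "((real^'n) \<times> (real^'n)) set"
  proof -
    have sb: "sets (borel \<Otimes>\<^sub>M borel :: ((real^'n) \<times> (real^'n)) measure) = sigma_sets UNIV {S. open S}"
      by (subst borel_prod, subst borel_def, rule sets_measure_of) auto
    have "Int_stable {S::((real^'n) \<times> (real^'n)) set. open S}" "{S::((real^'n) \<times> (real^'n)) set. open S} \<subseteq> Pow UNIV" "A \<in> sigma_sets UNIV {S. open S}"
      using A sb by (auto simp: Int_stable_def)
    then show ?thesis
    proof (induction A rule: sigma_sets_induct_disjoint)
      case (basic A) then show ?case using Q_open by simp
    next
      case empty show ?case using Q_open[of "{}"] by (simp only: open_empty)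
    next
      case (compl A)
      then have A: "A \<in> sets (borel \<Otimes>\<^sub>M borel)" using sb by simp
      have "Q (\<lambda>p. indicator UNIV p + (-1) * indicator A p)"
        using compl Q_open[of UNIV] ind_int[OF A] ind_int[of UNIV] by (intro Q_add Q_scale) auto
      moreover have "(\<lambda>p. indicator UNIV p + (-1) * indicator A p) = (indicator (UNIV - A) :: _ \<Rightarrow> real)"
        by (auto simp: fun_eq_iff split: split_indicator)
      ultimately show ?case by simp
    next
      case (union A)
      then have A: "A i \<in> sets (borel \<Otimes>\<^sub>M borel)" for i using sb by auto
      have An: "(\<Union>i<n. A i) \<in> sets (borel \<Otimes>\<^sub>M borel)" "(\<Union> (range A)) \<in> sets (borel \<Otimes>\<^sub>M borel)" for n
        using A by auto
      have Qn: "Q (indicator (\<Union>i<n. A i))" for n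
      proof (induction n)
        case 0 show ?case using Q_open[of "{}"] by (simp only: open_empty lessThan_0 UN_empty)
      next
        case (Suc n)
        have "Q (\<lambda>p. indicator (\<Union>i<n. A i) p + indicator (A n) p)"
          using Suc union ind_int[OF An(1)] ind_int[OF A] by (intro Q_add) auto
        moreover have "(\<lambda>p. indicator (\<Union>i<n. A i) p + indicator (A n) p) = (indicator (\<Union>i<Suc n. A i) :: _ \<Rightarrow> real)"
          using union(1) by (auto simp: fun_eq_iff disjoint_family_on_def lessThan_Suc split: split_indicator) (metis IntI empty_iff nat_neq_iff)
        ultimately show ?case by simp
      qed
      show ?case
      proof (rule Q_lim[of _ "\<lambda>n. indicator (\<Union>i<n. A i)"])
        show "(\<lambda>n. \<integral>p. \<bar>(indicator (\<Union>i<n. A i) p :: real) - indicator (\<Union> (range A)) p\<bar> \<partial>phase) \<longlonglongrightarrow> 0"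
        proof (rule dom[OF ind_int[OF An(2)] ind_int[OF An(1)]])
          show "(\<lambda>n. indicator (\<Union>i<n. A i) p :: real) \<longlonglongrightarrow> indicator (\<Union> (range A)) p" for p
            using LIMSEQ_indicator_UN[of A p] by simp
        qed (auto split: split_indicator)
      qed (use Qn ind_int[OF An(1)] ind_int[OF An(2)] in auto)
    qed
  qed
  have "Q f" using f
  proof (induction f rule: integrable_induct)
    case (base A c)
    then show ?case using Q_scale[OF Q_ind, of A c] by (simp add: mult.commute)
  next
    case (add f g) then show ?case by (intro Q_add)
  next
    case (lim f s) then show ?case by (intro Q_lim[of f s] dom) auto
  qed
  then show ?thesis unfolding Q_def T_def T0_def .
qed

lemma nn_integral_duhamel_weight:
  assumes "0 \<le> t"
  shows "(\<integral>\<^sup>+s. ennreal (duhamel_weight t t s) \<partial>lborel) = ennreal (1 - exp (- t))"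
proof -
  have "(\<integral>\<^sup>+s. ennreal (duhamel_weight t t s) \<partial>lborel) = (\<integral>\<^sup>+s. ennreal (exp (s - t)) * indicator {0..t} s \<partial>lborel)"
    by (intro nn_integral_cong) (auto simp: duhamel_weight_def split: split_indicator)
  also have "\<dots> = ennreal (exp (t - t) - exp (0 - t))"
  proof (rule nn_integral_FTC_Icc)
    fix s
    show "((\<lambda>s. exp (s - t)) has_real_derivative exp (s - t)) (at s)"
      by (auto intro!: derivative_eq_intros)
  qed (use assms in auto)
  finally show ?thesis by simp
qed

text \<open>The weights converge pointwise except possibly at \<open>s = t\<close>, and all of them
  live on a common bounded interval.\<close>

lemma duhamel_weight_diff_tendsto:
  fixes X :: "nat \<Rightarrow> real"
  assumes X: "X \<longlonglongrightarrow> t" "\<And>n. 0 \<le> X n" and t: "0 \<le> t"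
  shows "(\<lambda>n. \<integral>\<^sup>+s. ennreal \<bar>duhamel_weight (X n) (X n) s - duhamel_weight t t s\<bar> \<partial>lborel) \<longlonglongrightarrow> 0"
proof -
  obtain B where "0 < B" and "\<forall>n. norm (X n) \<le> B"
    using Bseq_def convergent_imp_Bseq convergentI[OF X(1)] by metis
  then have B: "X n \<le> B" for n by (simp add: abs_le_iff)
  then have tB: "t \<le> B" by (intro LIMSEQ_le_const2[OF X(1)]) auto
  have "(\<lambda>n. \<integral>\<^sup>+s. ennreal \<bar>duhamel_weight (X n) (X n) s - duhamel_weight t t s\<bar> \<partial>lborel) \<longlonglongrightarrow> (\<integral>\<^sup>+s. 0 \<partial>(lborel :: real measure))"
  proof (rule nn_integral_dominated_convergence[where w="indicator {0..B}"])
    have "ennreal \<bar>duhamel_weight (X n) (X n) s - duhamel_weight t t s\<bar> \<le> indicator {0..B} s" for n s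
    proof (cases "s \<in> {0..B}")
      case True
      have "0 \<le> duhamel_weight u u s" "duhamel_weight u u s \<le> 1" for u by (auto simp: duhamel_weight_def)
      from this(1)[of t] this(2)[of t] this(1)[of "X n"] this(2)[of "X n"]
      have "\<bar>duhamel_weight (X n) (X n) s - duhamel_weight t t s\<bar> \<le> 1" by linarith
      then show ?thesis using True by simp
    next
      case False
      then have "duhamel_weight (X n) (X n) s = 0" "duhamel_weight t t s = 0"
        using B[of n] tB by (auto simp: duhamel_weight_def)
      then show ?thesis by simp
    qed
    then show "AE s in lborel. ennreal \<bar>duhamel_weight (X n) (X n) s - duhamel_weight t t s\<bar> \<le> indicator {0..B} s" for n
      by simp
    have lim: "(\<lambda>n. duhamel_weight (X n) (X n) s) \<longlonglongrightarrow> duhamel_weight t t s" if s: "s \<noteq> t" for s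
    proof (cases "0 \<le> s \<and> s < t")
      case True
      have "\<forall>\<^sub>F n in sequentially. s < X n" using order_tendstoD(1)[OF X(1)] True by simp
      then have "\<forall>\<^sub>F n in sequentially. exp (s - X n) = duhamel_weight (X n) (X n) s"
        by eventually_elim (use True in \<open>simp add: duhamel_weight_def\<close>)
      moreover have "(\<lambda>n. exp (s - X n)) \<longlonglongrightarrow> exp (s - t)" by (intro tendsto_intros X(1))
      ultimately show ?thesis using True by (simp add: duhamel_weight_def[of t] Lim_transform_eventually)
    next
      case False
      have "\<forall>\<^sub>F n in sequentially. s < 0 \<or> X n < s"
      proof (cases "s < 0")
        case f: False
        then have "t < s" using False s by auto
        from order_tendstoD(2)[OF X(1) this] show ?thesis by eventually_elim simp
      qed simp
      then have "\<forall>\<^sub>F n in sequentially. duhamel_weight (X n) (X n) s = duhamel_weight t t s"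
        by eventually_elim (use False s in \<open>auto simp: duhamel_weight_def\<close>)
      then show ?thesis by (rule tendsto_eventually)
    qed
    have *: "(\<lambda>n. ennreal \<bar>duhamel_weight (X n) (X n) s - duhamel_weight t t s\<bar>) \<longlonglongrightarrow> 0" if "s \<noteq> t" for s
    proof -
      have "(\<lambda>n. ennreal \<bar>duhamel_weight (X n) (X n) s - duhamel_weight t t s\<bar>) \<longlonglongrightarrow> ennreal 0"
        by (intro tendsto_ennrealI tendsto_rabs_zero LIM_zero lim that)
      then show ?thesis by simp
    qed
    show "AE s in lborel. (\<lambda>n. ennreal \<bar>duhamel_weight (X n) (X n) s - duhamel_weight t t s\<bar>) \<longlonglongrightarrow> 0"
      using AE_lborel_singleton[of t] by eventually_elim (rule *)
    show "(\<integral>\<^sup>+s. indicator {0..B} s \<partial>lborel) < (\<infinity> :: ennreal)" using \<open>0 < B\<close> by simp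
  qed measurable
  then show ?thesis by simp
qed

section \<open>Conservation of mass and continuity in time\<close>

context kinetic_limit
begin

lemma nn_integral_lim_gain_characteristics:
  assumes [measurable]: "\<theta> \<in> borel_measurable borel"
  shows "(\<integral>\<^sup>+p. \<integral>\<^sup>+s. \<theta> s * ennreal (lim_gain (s, fst p - (\<gamma> * (t - s)) *\<^sub>R snd p, snd p)) \<partial>lborel \<partial>phase) =
    (\<integral>\<^sup>+s. \<theta> s * (\<integral>\<^sup>+p. ennreal (lim_gain (s, p)) \<partial>phase) \<partial>lborel)"
  by (rule nn_integral_characteristics[where g="\<lambda>q. ennreal (lim_gain q)"])
    (use lim_gain_periodic in \<open>auto simp: lattice_periodic_def\<close>)

text \<open>All terms of the Duhamel formula are nonnegative, so it integrates to an equality. This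
  supplies the lower bound on the mass that Fatou's lemma cannot give.\<close>

lemma nn_integral_solution:
  assumes t: "0 \<le> t"
  shows "(\<integral>\<^sup>+p. ennreal (solution (t, p)) \<partial>phase) = ennreal (exp (- t)) * ennreal mass +
    (\<integral>\<^sup>+s. ennreal (duhamel_weight t t s) * (\<integral>\<^sup>+p. ennreal (lim_gain (s, p)) \<partial>phase) \<partial>lborel)"
proof -
  let ?G = "\<lambda>p s. lim_gain (s, fst p - (\<gamma> * (t - s)) *\<^sub>R snd p, snd p)"
  have "(\<integral>\<^sup>+p. ennreal (solution (t, p)) \<partial>phase) = (\<integral>\<^sup>+p. ennreal \<bar>free_flow \<gamma> f0 (t, p)\<bar> +
      (\<integral>\<^sup>+s. ennreal (duhamel_weight t t s) * ennreal (?G p s) \<partial>lborel) \<partial>phase)"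
  proof (rule nn_integral_cong_AE)
    from AE_lim_gain_integrable[OF t] show "AE p in phase. ennreal (solution (t, p)) = ennreal \<bar>free_flow \<gamma> f0 (t, p)\<bar> +
      (\<integral>\<^sup>+s. ennreal (duhamel_weight t t s) * ennreal (?G p s) \<partial>lborel)"
    proof eventually_elim
      case (elim p)
      have "ennreal (solution (t, p)) = ennreal (free_flow \<gamma> f0 (t, p)) + ennreal (duhamel \<gamma> 0 lim_gain (t, p))"
        unfolding solution_def by (rule ennreal_plus[OF free_f0_nonneg duhamel_nonneg[of lim_gain, OF lim_gain_nonneg]])
      also have "duhamel \<gamma> 0 lim_gain (t, p) = (\<integral>s. duhamel_weight t t s * ?G p s \<partial>lborel)"
        by (simp add: duhamel_def)
      also have "ennreal \<dots> = (\<integral>\<^sup>+s. ennreal (duhamel_weight t t s * ?G p s) \<partial>lborel)"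
        by (rule nn_integral_eq_integral[symmetric, OF elim]) (simp add: duhamel_weight_nonneg lim_gain_nonneg)
      finally show ?case by (simp add: free_f0_nonneg duhamel_weight_nonneg lim_gain_nonneg ennreal_mult)
    qed
  qed
  also have "\<dots> = (\<integral>\<^sup>+p. ennreal \<bar>free_flow \<gamma> f0 (t, p)\<bar> \<partial>phase) +
      (\<integral>\<^sup>+p. \<integral>\<^sup>+s. ennreal (duhamel_weight t t s) * ennreal (?G p s) \<partial>lborel \<partial>phase)"
    by (rule nn_integral_add) measurable
  also have "(\<integral>\<^sup>+p. \<integral>\<^sup>+s. ennreal (duhamel_weight t t s) * ennreal (?G p s) \<partial>lborel \<partial>phase) =
      (\<integral>\<^sup>+s. ennreal (duhamel_weight t t s) * (\<integral>\<^sup>+p. ennreal (lim_gain (s, p)) \<partial>phase) \<partial>lborel)"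
    by (rule nn_integral_lim_gain_characteristics) measurable
  also have "(\<integral>\<^sup>+p. ennreal \<bar>free_flow \<gamma> f0 (t, p)\<bar> \<partial>phase) = ennreal (exp (- t)) * ennreal mass"
    using nn_integral_free_flow[OF f0_measurable f0_periodic, of \<gamma> t] nn_integral_f0 by (simp add: f0_nonneg)
  finally show ?thesis .
qed

text \<open>Integrability of \<open>solution\<close> gives integrability over the sphere for almost
  every \<open>x\<close>, where the gain has the same density; this holds at every time, good or
  not.\<close>

lemma nn_integral_gain_of_solution:
  assumes t: "0 \<le> t"
  shows "(\<integral>\<^sup>+p. ennreal (gain_of solution (t, p)) \<partial>phase) = (\<integral>\<^sup>+p. ennreal (solution (t, p)) \<partial>phase)"
proof -
  have "(\<integral>\<^sup>+p. ennreal (gain_of solution (t, p)) \<partial>phase) = (\<integral>\<^sup>+x. ennreal (density_of solution (t, x)) \<partial>torus_measure)"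
    by (subst nn_integral_phase(2)) (auto simp: nn_integral_gain_of[OF solution_nonneg])
  also have "\<dots> = (\<integral>\<^sup>+x. \<integral>\<^sup>+w. ennreal (solution (t, x, w)) \<partial>sphere_borel \<partial>torus_measure)"
  proof (rule nn_integral_cong_AE)
    from AE_solution_sphere_integrable[OF t]
    show "AE x in torus_measure. ennreal (density_of solution (t, x)) = (\<integral>\<^sup>+w. ennreal (solution (t, x, w)) \<partial>sphere_borel)"
      by eventually_elim (rule nn_integral_density_of[OF solution_nonneg, symmetric])
  qed
  also have "\<dots> = (\<integral>\<^sup>+p. ennreal (solution (t, p)) \<partial>phase)"
    by (rule nn_integral_phase(2)[symmetric]) measurable
  finally show ?thesis .
qed

text \<open>If \<open>l\<close> is the infimum of the mass over \<open>[0, T]\<close>, the Duhamel formula bounds the mass from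
  below there by \<open>l + exp (- T) * (mass - l)\<close>, so \<open>mass \<le> l\<close>.\<close>

lemma nn_integral_solution_eq_mass:
  assumes T: "0 \<le> T"
  shows "(\<integral>\<^sup>+p. ennreal (solution (T, p)) \<partial>phase) = ennreal mass"
proof -
  define m where "m t = (\<integral>\<^sup>+p. ennreal (solution (t, p)) \<partial>phase)" for t
  define L where "L = (INF t\<in>{0..T}. m t)"
  have Lle: "L \<le> m t" if "t \<in> {0..T}" for t unfolding L_def by (rule INF_lower[OF that])
  have mm: "m t \<le> ennreal mass" if "0 \<le> t" for t unfolding m_def by (rule solution_mass_le[OF that])
  have "L \<le> ennreal mass" using Lle[of T] mm[OF T] T by simp
  then obtain l where l: "L = ennreal l" "0 \<le> l" by (cases L) (auto simp: top_unique)
  have lm: "l \<le> mass" using \<open>L \<le> ennreal mass\<close> l mass_nonneg by simp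
  have "ennreal (l + exp (- T) * (mass - l)) \<le> m t" if t: "t \<in> {0..T}" for t
  proof -
    have t0: "0 \<le> t" using t by simp
    \<comment> \<open>\<open>mass - l\<close> is nonnegative and \<open>exp (- t)\<close> is
      smallest at \<open>t = T\<close>, so the bound becomes uniform over the interval.\<close>
    have "exp (- T) * (mass - l) \<le> exp (- t) * (mass - l)" using t lm by (intro mult_right_mono) auto
    then have "ennreal (l + exp (- T) * (mass - l)) \<le> ennreal (exp (- t) * mass + (1 - exp (- t)) * l)"
      by (intro ennreal_leI) (simp add: algebra_simps)
    also have "\<dots> = ennreal (exp (- t)) * ennreal mass + ennreal (1 - exp (- t)) * L"
      using t0 l mass_nonneg by (simp add: ennreal_mult l ennreal_plus)
    also have "ennreal (1 - exp (- t)) * L = (\<integral>\<^sup>+s. ennreal (duhamel_weight t t s) * L \<partial>lborel)"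
      by (subst nn_integral_multc) (auto simp: nn_integral_duhamel_weight[OF t0])
    also have "\<dots> \<le> (\<integral>\<^sup>+s. ennreal (duhamel_weight t t s) * (\<integral>\<^sup>+p. ennreal (lim_gain (s, p)) \<partial>phase) \<partial>lborel)"
    proof (rule nn_integral_mono_AE)
      from AE_good_time show "AE s in lborel. ennreal (duhamel_weight t t s) * L \<le> ennreal (duhamel_weight t t s) * (\<integral>\<^sup>+p. ennreal (lim_gain (s, p)) \<partial>phase)"
      proof eventually_elim
        case (elim s)
        show ?case
        proof (cases "0 \<le> s \<and> s \<le> t")
          case True
          \<comment> \<open>At a good time the source has the mass of \<open>solution\<close>, hence
            at least the infimum \<open>L\<close>.\<close>
          then have g: "good_time s" and s: "0 \<le> s" "s \<in> {0..T}" using elim t by auto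
          have "L \<le> m s" by (rule Lle[OF s(2)])
          also have "m s = (\<integral>\<^sup>+p. ennreal (gain_of solution (s, p)) \<partial>phase)"
            unfolding m_def by (rule nn_integral_gain_of_solution[OF s(1), symmetric])
          also have "\<dots> = (\<integral>\<^sup>+p. ennreal (lim_gain (s, p)) \<partial>phase)"
            by (rule nn_integral_cong_AE) (use gain_of_solution[OF g] in \<open>eventually_elim, simp\<close>)
          finally show ?thesis by (rule mult_left_mono) simp
        next
          case False then show ?thesis by (auto simp: duhamel_weight_def)
        qed
      qed
    qed
    also have "ennreal (exp (- t)) * ennreal mass + \<dots> = m t" unfolding m_def by (rule nn_integral_solution[OF t0, symmetric])
    finally show ?thesis by (simp add: add_left_mono)
  qed
  then have "ennreal (l + exp (- T) * (mass - l)) \<le> L" unfolding L_def by (intro INF_greatest)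
  then have "exp (- T) * (mass - l) \<le> 0" using l by simp
  then have "mass \<le> l" by (simp add: mult_le_0_iff)
  then have "ennreal mass \<le> m T" using Lle[of T] T l by (simp add: order_trans[OF ennreal_leI])
  then show ?thesis using mm[OF T] by (simp add: m_def antisym)
qed

text \<open>The two values lie on the same characteristic: they involve the same initial value and
  the same values of \<open>lim_gain\<close>, so only the scalar weights differ.\<close>

lemma solution_drift_le:
  assumes t: "0 \<le> t" and u: "0 \<le> u"
  shows "(\<integral>\<^sup>+p. ennreal \<bar>solution (t, p) - solution (u, fst p + - (\<gamma> * (t - u)) *\<^sub>R snd p, snd p)\<bar> \<partial>phase) \<le>
    ennreal \<bar>exp (- t) - exp (- u)\<bar> * ennreal mass +
    (\<integral>\<^sup>+s. ennreal \<bar>duhamel_weight t t s - duhamel_weight u u s\<bar> \<partial>lborel) * ennreal mass"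
proof -
  let ?G = "\<lambda>p s. lim_gain (s, fst p - (\<gamma> * (t - s)) *\<^sub>R snd p, snd p)"
  let ?f = "\<lambda>p. f0 (fst p + - (\<gamma> * t) *\<^sub>R snd p, snd p)"
  let ?D = "\<lambda>s. duhamel_weight t t s - duhamel_weight u u s"
  \<comment> \<open>One exceptional null set serves both times: integrability up to the later time
    gives it up to the earlier one, since by \<open>WT\<close> the weights are comparable.\<close>
  define T where "T = max t u"
  have T: "0 \<le> T" using t by (simp add: T_def)
  have WT: "duhamel_weight a a s \<le> exp (T - a) * duhamel_weight T T s" if "a \<le> T" for a s
    using that by (auto simp: duhamel_weight_def simp flip: exp_add)
  have "AE p in phase. ennreal \<bar>solution (t, p) - solution (u, fst p + - (\<gamma> * (t - u)) *\<^sub>R snd p, snd p)\<bar> \<le>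
      ennreal \<bar>exp (- t) - exp (- u)\<bar> * ennreal (?f p) + (\<integral>\<^sup>+s. ennreal \<bar>?D s\<bar> * ennreal (?G p s) \<partial>lborel)"
    using AE_lim_gain_integrable_along[OF T, of t]
  proof eventually_elim
    case (elim p)
    have int: "integrable lborel (\<lambda>s. duhamel_weight a a s * ?G p s)" if a: "a \<le> T" for a
    proof (rule Bochner_Integration.integrable_bound)
      show "integrable lborel (\<lambda>s. exp (T - a) * (duhamel_weight T T s * ?G p s))" using elim by simp
      have "duhamel_weight a a s * ?G p s \<le> exp (T - a) * (duhamel_weight T T s * ?G p s)" for s
        using mult_right_mono[OF WT[OF a, of s] lim_gain_nonneg] by (simp add: mult.assoc)
      then show "AE s in lborel. norm (duhamel_weight a a s * ?G p s) \<le> norm (exp (T - a) * (duhamel_weight T T s * ?G p s))"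
        by (simp add: duhamel_weight_nonneg lim_gain_nonneg)
    qed measurable
    have it: "integrable lborel (\<lambda>s. duhamel_weight t t s * ?G p s)" and iu: "integrable lborel (\<lambda>s. duhamel_weight u u s * ?G p s)"
      by (rule int, simp add: T_def)+
    have shift: "fst p + - (\<gamma> * (t - u)) *\<^sub>R snd p - (\<gamma> * (u - s)) *\<^sub>R snd p = fst p - (\<gamma> * (t - s)) *\<^sub>R snd p" for s
      by (simp add: algebra_simps)
    have shift0: "fst p + - (\<gamma> * (t - u)) *\<^sub>R snd p - (\<gamma> * u) *\<^sub>R snd p = fst p + - (\<gamma> * t) *\<^sub>R snd p"
      by (simp add: algebra_simps)
    have s1: "solution (t, p) = exp (- t) * ?f p + (\<integral>s. duhamel_weight t t s * ?G p s \<partial>lborel)"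
      by (simp add: solution_def free_flow_def duhamel_def)
    have s2: "solution (u, fst p + - (\<gamma> * (t - u)) *\<^sub>R snd p, snd p) = exp (- u) * ?f p + (\<integral>s. duhamel_weight u u s * ?G p s \<partial>lborel)"
      unfolding solution_def free_flow_def duhamel_def fst_conv snd_conv shift shift0 by simp
    have "solution (t, p) - solution (u, fst p + - (\<gamma> * (t - u)) *\<^sub>R snd p, snd p) =
        (exp (- t) - exp (- u)) * ?f p + (\<integral>s. duhamel_weight t t s * ?G p s - duhamel_weight u u s * ?G p s \<partial>lborel)"
      unfolding s1 s2 Bochner_Integration.integral_diff[OF it iu] by (simp add: algebra_simps)
    also have "(\<integral>s. duhamel_weight t t s * ?G p s - duhamel_weight u u s * ?G p s \<partial>lborel) = (\<integral>s. ?D s * ?G p s \<partial>lborel)"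
      by (simp add: left_diff_distrib)
    finally have e: "solution (t, p) - solution (u, fst p + - (\<gamma> * (t - u)) *\<^sub>R snd p, snd p) =
        (exp (- t) - exp (- u)) * ?f p + (\<integral>s. ?D s * ?G p s \<partial>lborel)" .
    have "\<bar>(exp (- t) - exp (- u)) * ?f p + (\<integral>s. ?D s * ?G p s \<partial>lborel)\<bar> \<le> \<bar>exp (- t) - exp (- u)\<bar> * ?f p + \<bar>\<integral>s. ?D s * ?G p s \<partial>lborel\<bar>"
      using abs_triangle_ineq[of "(exp (- t) - exp (- u)) * ?f p" "\<integral>s. ?D s * ?G p s \<partial>lborel"] f0_nonneg
      by (simp add: abs_mult)
    then have "ennreal \<bar>solution (t, p) - solution (u, fst p + - (\<gamma> * (t - u)) *\<^sub>R snd p, snd p)\<bar> \<le>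
        ennreal (\<bar>exp (- t) - exp (- u)\<bar> * ?f p + \<bar>\<integral>s. ?D s * ?G p s \<partial>lborel\<bar>)"
      unfolding e by (rule ennreal_leI)
    also have "ennreal (\<bar>exp (- t) - exp (- u)\<bar> * ?f p + \<bar>\<integral>s. ?D s * ?G p s \<partial>lborel\<bar>) =
        ennreal \<bar>exp (- t) - exp (- u)\<bar> * ennreal (?f p) + ennreal \<bar>\<integral>s. ?D s * ?G p s \<partial>lborel\<bar>"
      by (subst ennreal_plus) (auto simp: f0_nonneg ennreal_mult)
    also have "ennreal \<bar>\<integral>s. ?D s * ?G p s \<partial>lborel\<bar> \<le> (\<integral>\<^sup>+s. ennreal \<bar>?D s * ?G p s\<bar> \<partial>lborel)"
      by (rule ennreal_abs_integral_le)
    also have "(\<integral>\<^sup>+s. ennreal \<bar>?D s * ?G p s\<bar> \<partial>lborel) = (\<integral>\<^sup>+s. ennreal \<bar>?D s\<bar> * ennreal (?G p s) \<partial>lborel)"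
      by (simp add: abs_mult ennreal_mult lim_gain_nonneg)
    finally show ?case by (simp add: add_left_mono)
  qed
  then have "(\<integral>\<^sup>+p. ennreal \<bar>solution (t, p) - solution (u, fst p + - (\<gamma> * (t - u)) *\<^sub>R snd p, snd p)\<bar> \<partial>phase) \<le>
      (\<integral>\<^sup>+p. ennreal \<bar>exp (- t) - exp (- u)\<bar> * ennreal (?f p) + (\<integral>\<^sup>+s. ennreal \<bar>?D s\<bar> * ennreal (?G p s) \<partial>lborel) \<partial>phase)"
    by (rule nn_integral_mono_AE)
  also have "\<dots> = (\<integral>\<^sup>+p. ennreal \<bar>exp (- t) - exp (- u)\<bar> * ennreal (?f p) \<partial>phase) + (\<integral>\<^sup>+p. \<integral>\<^sup>+s. ennreal \<bar>?D s\<bar> * ennreal (?G p s) \<partial>lborel \<partial>phase)"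
    by (rule nn_integral_add) measurable
  also have "(\<integral>\<^sup>+p. ennreal \<bar>exp (- t) - exp (- u)\<bar> * ennreal (?f p) \<partial>phase) = ennreal \<bar>exp (- t) - exp (- u)\<bar> * (\<integral>\<^sup>+p. ennreal (?f p) \<partial>phase)"
    by (rule nn_integral_cmult) measurable
  also have "(\<integral>\<^sup>+p. ennreal (?f p) \<partial>phase) = (\<integral>\<^sup>+p. ennreal (f0 p) \<partial>phase)"
    by (rule nn_integral_phase_translation[where f="\<lambda>p. ennreal (f0 p)" and v="\<lambda>w. - (\<gamma> * t) *\<^sub>R w"])
      (measurable, use f0_periodic in \<open>auto simp: lattice_periodic_def\<close>)
  also have "(\<integral>\<^sup>+p. \<integral>\<^sup>+s. ennreal \<bar>?D s\<bar> * ennreal (?G p s) \<partial>lborel \<partial>phase) = (\<integral>\<^sup>+s. ennreal \<bar>?D s\<bar> * (\<integral>\<^sup>+p. ennreal (lim_gain (s, p)) \<partial>phase) \<partial>lborel)"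
    by (rule nn_integral_lim_gain_characteristics) measurable
  also have "\<dots> \<le> (\<integral>\<^sup>+s. ennreal \<bar>?D s\<bar> * ennreal mass \<partial>lborel)"
  proof (rule nn_integral_mono_AE)
    from AE_good_time show "AE s in lborel. ennreal \<bar>?D s\<bar> * (\<integral>\<^sup>+p. ennreal (lim_gain (s, p)) \<partial>phase) \<le> ennreal \<bar>?D s\<bar> * ennreal mass"
    proof eventually_elim
      case (elim s)
      then show ?case using lim_gain_mass_le[of s] by (cases "0 \<le> s") (auto simp: duhamel_weight_def intro!: mult_left_mono)
    qed
  qed
  also have "\<dots> = (\<integral>\<^sup>+s. ennreal \<bar>?D s\<bar> \<partial>lborel) * ennreal mass"
    by (rule nn_integral_multc) measurable
  finally show ?thesis by (simp add: nn_integral_f0 add_left_mono)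
qed

lemma solution_translate_integrable:
  assumes t: "0 \<le> t" and [measurable]: "v \<in> borel_measurable borel"
  shows "integrable phase (\<lambda>p. solution (t, fst p + v (snd p), snd p))"
proof (rule integrableI_bounded)
  have "(\<integral>\<^sup>+p. ennreal (solution (t, fst p + v (snd p), snd p)) \<partial>phase) = (\<integral>\<^sup>+p. ennreal (solution (t, p)) \<partial>phase)"
    by (rule nn_integral_phase_translation[where f="\<lambda>p. ennreal (solution (t, p))"])
      (use solution_periodic in \<open>auto simp: lattice_periodic_def\<close>)
  then show "(\<integral>\<^sup>+p. ennreal (norm (solution (t, fst p + v (snd p), snd p))) \<partial>phase) < \<infinity>"
    using nn_integral_solution_eq_mass[OF t] by (simp add: solution_nonneg)
qed measurable

text \<open>The change from \<open>t\<close> to \<open>X n\<close> is a drift along characteristics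
  followed by a translation of the fixed function at time \<open>t\<close>, with a displacement
  proportional to \<open>X n - t\<close>.\<close>

lemma solution_L1_continuous:
  fixes X :: "nat \<Rightarrow> real"
  assumes X: "X \<longlonglongrightarrow> t" "\<And>n. 0 \<le> X n" and t: "0 \<le> t"
  shows "(\<lambda>n. \<integral>p. \<bar>solution (X n, p) - solution (t, p)\<bar> \<partial>phase) \<longlonglongrightarrow> 0"
proof -
  define v where "v = (\<lambda>n (w :: real^'n). - (\<gamma> * (X n - t)) *\<^sub>R w)"
  have vm[measurable]: "v n \<in> borel_measurable borel" for n unfolding v_def by measurable
  have "(\<lambda>n. - (\<gamma> * (X n - t)) *\<^sub>R w) \<longlonglongrightarrow> - (\<gamma> * (t - t)) *\<^sub>R w" for w :: "real^'n"
    by (intro tendsto_intros X(1))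
  then have v: "(\<lambda>n. v n w) \<longlonglongrightarrow> 0" for w by (simp add: v_def)
  define a where "a = (\<lambda>n. \<integral>p. \<bar>solution (t, fst p + v n (snd p), snd p) - solution (t, p)\<bar> \<partial>phase)"
  have "(\<lambda>n. \<integral>p. \<bar>solution (t, fracv (fst p + v n (snd p)), snd p) - solution (t, fracv (fst p), snd p)\<bar> \<partial>phase) \<longlonglongrightarrow> 0"
    using translation_L1_continuous[where f="\<lambda>p. solution (t, p)", OF vm v solution_integrable[OF t]] by simp
  then have a: "a \<longlonglongrightarrow> 0" by (simp add: a_def lattice_periodic_fracv[OF solution_periodic])
  define b where "b = (\<lambda>n. (ennreal \<bar>exp (- X n) - exp (- t)\<bar> * ennreal mass +
    (\<integral>\<^sup>+s. ennreal \<bar>duhamel_weight (X n) (X n) s - duhamel_weight t t s\<bar> \<partial>lborel) * ennreal mass) + ennreal (a n))"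
  have "(\<lambda>n. exp (- X n)) \<longlonglongrightarrow> exp (- t)" by (intro tendsto_intros X(1))
  then have e0: "(\<lambda>n. ennreal \<bar>exp (- X n) - exp (- t)\<bar>) \<longlonglongrightarrow> ennreal 0"
    by (intro tendsto_ennrealI tendsto_rabs_zero LIM_zero)
  then have e1: "(\<lambda>n. ennreal \<bar>exp (- X n) - exp (- t)\<bar> * ennreal mass) \<longlonglongrightarrow> ennreal 0 * ennreal mass"
    by (subst (1 2) mult.commute) (rule ennreal_tendsto_cmult[OF _ e0], simp)
  have e2: "(\<lambda>n. (\<integral>\<^sup>+s. ennreal \<bar>duhamel_weight (X n) (X n) s - duhamel_weight t t s\<bar> \<partial>lborel) * ennreal mass) \<longlonglongrightarrow> 0 * ennreal mass"
    by (subst (1 2) mult.commute) (rule ennreal_tendsto_cmult[OF _ duhamel_weight_diff_tendsto[OF X t]], simp)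
  have b: "b \<longlonglongrightarrow> 0"
    using tendsto_add[OF tendsto_add[OF e1 e2] tendsto_ennrealI[OF a]] by (simp add: b_def)
  have int: "integrable phase (\<lambda>p. \<bar>solution (X n, p) - solution (t, p)\<bar>)" for n
    using solution_integrable[OF X(2)[of n]] solution_integrable[OF t] by auto
  have "ennreal (\<integral>p. \<bar>solution (X n, p) - solution (t, p)\<bar> \<partial>phase) \<le> b n" for n
  proof -
    have "ennreal (\<integral>p. \<bar>solution (X n, p) - solution (t, p)\<bar> \<partial>phase) = (\<integral>\<^sup>+p. ennreal \<bar>solution (X n, p) - solution (t, p)\<bar> \<partial>phase)"
      by (rule nn_integral_eq_integral[symmetric, OF int]) simp
    also have "\<dots> \<le> (\<integral>\<^sup>+p. ennreal \<bar>solution (X n, p) - solution (t, fst p + v n (snd p), snd p)\<bar> +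
        ennreal \<bar>solution (t, fst p + v n (snd p), snd p) - solution (t, p)\<bar> \<partial>phase)"
      by (intro nn_integral_mono) (simp add: ennreal_plus[symmetric] ennreal_leI del: ennreal_plus)
    also have "\<dots> = (\<integral>\<^sup>+p. ennreal \<bar>solution (X n, p) - solution (t, fst p + v n (snd p), snd p)\<bar> \<partial>phase) +
        (\<integral>\<^sup>+p. ennreal \<bar>solution (t, fst p + v n (snd p), snd p) - solution (t, p)\<bar> \<partial>phase)"
      by (rule nn_integral_add) measurable
    also have "(\<integral>\<^sup>+p. ennreal \<bar>solution (t, fst p + v n (snd p), snd p) - solution (t, p)\<bar> \<partial>phase) = ennreal (a n)"
      unfolding a_def
    proof (rule nn_integral_eq_integral)
      show "integrable phase (\<lambda>p. \<bar>solution (t, fst p + v n (snd p), snd p) - solution (t, p)\<bar>)"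
        using solution_translate_integrable[OF t vm[of n]] solution_integrable[OF t] by auto
    qed simp
    finally show ?thesis
      using add_right_mono[OF solution_drift_le[OF X(2)[of n] t], of "ennreal (a n)"]
      unfolding b_def v_def by (rule order_trans)
  qed
  then have "(\<lambda>n. ennreal (\<integral>p. \<bar>solution (X n, p) - solution (t, p)\<bar> \<partial>phase)) \<longlonglongrightarrow> 0"
    by (intro tendsto_sandwich[OF _ _ tendsto_const b]) auto
  then have "(\<lambda>n. ennreal (\<integral>p. \<bar>solution (X n, p) - solution (t, p)\<bar> \<partial>phase)) \<longlonglongrightarrow> ennreal 0" by simp
  then show ?thesis by (rule tendsto_ennrealD) simp_all
qed

end

section \<open>Return to the measures and the initial datum of the statement\<close>

lemma AE_phase_measure:
  assumes [measurable]: "Measurable.pred (borel \<Otimes>\<^sub>M borel) P"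
  shows "(AE p in phase_measure. P p) \<longleftrightarrow> (AE p in phase. P p)"
  unfolding phase_eq_distr by (rule AE_distr_iff[OF id_measurable_phase_measure, symmetric]) measurable

lemma AE_phase_measureI: "AE p in phase. P p \<Longrightarrow> AE p in phase_measure. P p"
  unfolding phase_eq_distr by (rule AE_distrD[OF id_measurable_phase_measure])

lemma nn_integral_phase_measure:
  assumes "f \<in> borel_measurable (borel \<Otimes>\<^sub>M borel)"
  shows "(\<integral>\<^sup>+p. f p \<partial>phase_measure) = (\<integral>\<^sup>+p. f p \<partial>phase)"
  unfolding phase_eq_distr by (subst nn_integral_distr[OF id_measurable_phase_measure]) (use assms in auto)

lemma integrable_phase_measure:
  fixes f :: "(real^'n) \<times> (real^'n) \<Rightarrow> real"
  assumes "f \<in> borel_measurable (borel \<Otimes>\<^sub>M borel)"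
  shows "integrable phase_measure f \<longleftrightarrow> integrable phase f"
  unfolding phase_eq_distr by (rule integrable_distr_eq[OF id_measurable_phase_measure assms, symmetric])

lemma integral_phase_measure:
  fixes f :: "(real^'n) \<times> (real^'n) \<Rightarrow> real"
  assumes "f \<in> borel_measurable (borel \<Otimes>\<^sub>M borel)"
  shows "(\<integral>p. f p \<partial>phase_measure) = (\<integral>p. f p \<partial>phase)"
  unfolding phase_eq_distr by (rule integral_distr[OF id_measurable_phase_measure assms, symmetric])

lemma gain_eq_gain_of:
  assumes [measurable]: "F \<in> borel_measurable (borel \<Otimes>\<^sub>M (borel \<Otimes>\<^sub>M borel))"
  shows "gain (\<lambda>t x w. F (t, x, w)) t x w = gain_of F (t, x, w)"
proof -
  have "(\<integral>w. F (t, x, w) \<partial>sphere_measure) = (\<integral>w. F (t, x, w) \<partial>sphere_borel)"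
    by (rule integral_sphere_measure) measurable
  moreover have "(\<integral>w. F (t, x, w) *\<^sub>R w \<partial>sphere_measure) = (\<integral>w. F (t, x, w) *\<^sub>R w \<partial>sphere_borel)"
    by (rule integral_sphere_measure) measurable
  ultimately show ?thesis by (simp add: gain_def rho_def Jf_def gain_of_def density_of_def flux_of_def)
qed

text \<open>\<open>F0\<close> is measurable only on the cube times the sphere, while the Duhamel
  formula evaluates it at translated positions. Composition with \<open>fracv\<close> extends it,
  values off the sphere are set to zero, and \<open>max 0\<close> removes the negative values.
  Agreement is stated after every translation by a function of the velocity because the feet of the
  characteristics leave the cube.\<close>

lemma borel_periodic_representative:
  fixes F0 :: "real^'n \<Rightarrow> real^'n \<Rightarrow> real"
  assumes per: "\<And>w. lattice_periodic (\<lambda>x. F0 x w)"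
    and nonneg: "AE p in phase_measure. 0 \<le> F0 (fst p) (snd p)"
    and meas: "(\<lambda>p. F0 (fst p) (snd p)) \<in> borel_measurable phase_measure"
  shows "\<exists>f0. f0 \<in> borel_measurable (borel \<Otimes>\<^sub>M borel) \<and> (\<forall>p. 0 \<le> f0 p) \<and> (\<forall>w. lattice_periodic (\<lambda>x. f0 (x, w))) \<and>
    (\<forall>v \<in> borel_measurable borel. AE p in phase_measure. f0 (fst p + v (snd p), snd p) = F0 (fst p + v (snd p)) (snd p))"
proof -
  define S where "S = {p :: (real^'n) \<times> (real^'n). norm (snd p) = 1}"
  define h where "h p = indicator S p *\<^sub>R F0 (fracv (fst p)) (snd p)" for p
  have S[measurable]: "S \<in> sets (borel \<Otimes>\<^sub>M borel)"
  proof -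
    have "{p \<in> space (borel \<Otimes>\<^sub>M borel). norm (snd p :: real^'n) = 1} \<in> sets (borel \<Otimes>\<^sub>M borel :: ((real^'n) \<times> (real^'n)) measure)"
      by measurable
    then show ?thesis by (simp add: S_def space_pair_measure)
  qed
  have "(\<lambda>p. (fracv (fst p), snd p)) \<in> measurable (restrict_space (borel \<Otimes>\<^sub>M borel) S) phase_measure"
    unfolding phase_measure_def
  proof (rule measurable_Pair)
    show "(\<lambda>p. fracv (fst p)) \<in> measurable (restrict_space (borel \<Otimes>\<^sub>M borel) S) (restrict_space lborel (unit_cube :: (real^'n) set))"
      by (rule measurable_restrict_space2) (auto simp: fracv_mem intro!: measurable_restrict_space1)
    have "snd \<in> measurable (restrict_space (borel \<Otimes>\<^sub>M borel) S) (restrict_space borel (sphere (0 :: real^'n) 1))"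
      by (rule measurable_restrict_space2) (auto simp: S_def space_restrict_space intro!: measurable_restrict_space1)
    then show "snd \<in> measurable (restrict_space (borel \<Otimes>\<^sub>M borel) S) (sphere_measure :: (real^'n) measure)"
      by (simp cong: measurable_cong_sets add: sets_sphere_measure)
  qed
  from measurable_compose[OF this meas]
  have "(\<lambda>p. F0 (fracv (fst p)) (snd p)) \<in> borel_measurable (restrict_space (borel \<Otimes>\<^sub>M borel) S)" by simp
  then have hm[measurable]: "h \<in> borel_measurable (borel \<Otimes>\<^sub>M borel)"
    by (subst (asm) borel_measurable_restrict_space_iff) (auto simp: h_def[abs_def])
  \<comment> \<open>By periodicity this holds at every point over the sphere, so only the sign is an
    almost everywhere matter.\<close>
  have h: "h (x, w) = F0 x w" if "norm w = 1" for x w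
    using that lattice_periodic_fracv[OF per[of w]] by (simp add: h_def S_def)
  have hper: "lattice_periodic (\<lambda>x. h (x, w))" for w
    using lattice_periodic_compose_fracv[of "\<lambda>x. F0 x w"] by (simp add: lattice_periodic_def h_def S_def indicator_def)
  have sp: "norm (snd p) = 1" if "p \<in> space phase_measure" for p :: "(real^'n) \<times> (real^'n)"
    using that by (auto simp: phase_measure_def space_pair_measure space_sphere_measure)
  have "AE p in phase_measure. 0 \<le> h p"
    using nonneg AE_space
  proof eventually_elim
    case (elim p) then show ?case using h[OF sp[of p], of "fst p"] by simp
  qed
  then have hn: "AE p in phase. 0 \<le> h p" by (subst (asm) AE_phase_measure) measurable
  have "AE p in phase_measure. max 0 (h (fst p + v (snd p), snd p)) = F0 (fst p + v (snd p)) (snd p)"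
    if [measurable]: "v \<in> borel_measurable borel" for v
  proof -
    \<comment> \<open>Translation preserves null sets of the torus, so the nonnegativity of the
      periodic \<open>h\<close> persists along it.\<close>
    have "AE p in phase. 0 \<le> h (fst p + v (snd p), snd p)"
      by (rule AE_phase_translation[OF _ that _ hn]) (measurable, use hper in \<open>simp add: lattice_periodic_def\<close>)
    from AE_phase_measureI[OF this] AE_space show ?thesis
    proof eventually_elim
      case (elim p) then show ?case using h[OF sp[of p], of "fst p + v (snd p)"] by simp
    qed
  qed
  moreover have "lattice_periodic (\<lambda>x. max 0 (h (x, w)))" for w using hper[of w] by (simp add: lattice_periodic_def)
  ultimately show ?thesis by (intro exI[of _ "\<lambda>p. max 0 (h p)"]) (auto intro!: borel_measurable_max hm)
qed

context kinetic_limit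
begin

text \<open>The indicator of disagreement has integral zero at every good time, so by
  \<open>nn_integral_characteristics\<close> almost every characteristic meets the disagreement in a
  null set of times.\<close>

lemma gain_of_solution_characteristics:
  "AE p in phase. AE s in lborel. 0 \<le> s \<longrightarrow>
    gain_of solution (s, fst p - (\<gamma> * (t - s)) *\<^sub>R snd p, snd p) = lim_gain (s, fst p - (\<gamma> * (t - s)) *\<^sub>R snd p, snd p)"
proof -
  define g :: "real \<times> (real^'n) \<times> (real^'n) \<Rightarrow> ennreal" where "g = (\<lambda>q. if gain_of solution q = lim_gain q then 0 else 1)"
  have gm[measurable]: "g \<in> borel_measurable (borel \<Otimes>\<^sub>M (borel \<Otimes>\<^sub>M borel))" unfolding g_def by measurable
  have "(\<integral>\<^sup>+p. \<integral>\<^sup>+s. indicator {0..} s * g (s, fst p - (\<gamma> * (t - s)) *\<^sub>R snd p, snd p) \<partial>lborel \<partial>phase) =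
      (\<integral>\<^sup>+s. indicator {0..} s * (\<integral>\<^sup>+p. g (s, p) \<partial>phase) \<partial>lborel)"
  proof (rule nn_integral_characteristics)
    show "lattice_periodic (\<lambda>x. g (s, x, w))" for s w
      using moments_periodic(3)[of solution s w, OF solution_periodic] lim_gain_periodic[of s w]
      by (simp add: lattice_periodic_def g_def)
  qed measurable
  also have "\<dots> = 0"
  proof (rule nn_integral_zeroI)
    from AE_good_time show "AE s in lborel. indicator {0..} s * (\<integral>\<^sup>+p. g (s, p) \<partial>phase) = 0"
    proof eventually_elim
      case (elim s)
      show ?case
      proof (cases "0 \<le> s")
        case True
        with elim have "good_time s" by simp
        from gain_of_solution[OF this] have "AE p in phase. g (s, p) = 0" by eventually_elim (simp add: g_def)
        then have "(\<integral>\<^sup>+p. g (s, p) \<partial>phase) = 0" by (rule nn_integral_zeroI)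
        then show ?thesis by simp
      qed simp
    qed
  qed
  finally have "AE p in phase. (\<integral>\<^sup>+s. indicator {0..} s * g (s, fst p - (\<gamma> * (t - s)) *\<^sub>R snd p, snd p) \<partial>lborel) = 0"
    by (subst (asm) nn_integral_0_iff_AE) measurable
  then show ?thesis
  proof eventually_elim
    case (elim p)
    then have "AE s in lborel. indicator {0..} s * g (s, fst p - (\<gamma> * (t - s)) *\<^sub>R snd p, snd p) = 0"
      by (subst (asm) nn_integral_0_iff_AE) measurable
    then show ?case by eventually_elim (auto simp: g_def split: if_splits)
  qed
qed

lemma solution_duhamel:
  assumes t: "0 \<le> t"
  shows "AE p in phase.
    integrable lborel (\<lambda>s. duhamel_weight t t s * gain_of solution (s, fst p - (\<gamma> * (t - s)) *\<^sub>R snd p, snd p)) \<and>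
    solution (t, p) = free_flow \<gamma> f0 (t, p) +
      (\<integral>s. duhamel_weight t t s * gain_of solution (s, fst p - (\<gamma> * (t - s)) *\<^sub>R snd p, snd p) \<partial>lborel)"
  using AE_lim_gain_integrable[OF t] gain_of_solution_characteristics[of t]
proof eventually_elim
  case (elim p)
  let ?G = "\<lambda>s. gain_of solution (s, fst p - (\<gamma> * (t - s)) *\<^sub>R snd p, snd p)"
  let ?L = "\<lambda>s. lim_gain (s, fst p - (\<gamma> * (t - s)) *\<^sub>R snd p, snd p)"
  have ae: "AE s in lborel. duhamel_weight t t s * ?L s = duhamel_weight t t s * ?G s"
    using elim(2) by eventually_elim (simp add: duhamel_weight_def)
  have Lm: "(\<lambda>s. duhamel_weight t t s * ?L s) \<in> borel_measurable lborel" by measurable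
  have Gm: "(\<lambda>s. duhamel_weight t t s * ?G s) \<in> borel_measurable lborel" by measurable
  have "solution (t, p) = free_flow \<gamma> f0 (t, p) + (\<integral>s. duhamel_weight t t s * ?L s \<partial>lborel)"
    by (simp add: solution_def duhamel_def)
  then show ?case
    using elim(1) integrable_cong_AE[OF Lm Gm ae] integral_cong_AE[OF Lm Gm ae] by simp
qed

lemma gain_of_solution_integrable:
  assumes t: "0 \<le> t"
  shows "integrable phase (\<lambda>p. gain_of solution (t, p))" "(\<integral>p. gain_of solution (t, p) \<partial>phase) = mass"
proof -
  have nn: "0 \<le> gain_of solution q" for q by (rule gain_of_nonneg[of solution, OF solution_nonneg])
  have e: "(\<integral>\<^sup>+p. ennreal (gain_of solution (t, p)) \<partial>phase) = ennreal mass"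
    using nn_integral_gain_of_solution[OF t] nn_integral_solution_eq_mass[OF t] by simp
  show i: "integrable phase (\<lambda>p. gain_of solution (t, p))"
    by (intro integrableI_bounded) (auto simp: nn e)
  show "(\<integral>p. gain_of solution (t, p) \<partial>phase) = mass"
    using nn_integral_eq_integral[OF i] e nn mass_nonneg by (simp add: integral_nonneg_AE)
qed

text \<open>The assumption on \<open>F0\<close> is used with
  \<open>v w = - (\<gamma> * t) *\<^sub>R w\<close>, which exchanges \<open>f0\<close> for
  \<open>F0\<close> at the foot of the characteristic. The conserved mass serves as the bound
  \<open>B\<close> on every interval.\<close>

lemma solution_mild:
  assumes F0: "\<And>v. v \<in> borel_measurable borel \<Longrightarrow>
    AE p in phase_measure. f0 (fst p + v (snd p), snd p) = F0 (fst p + v (snd p)) (snd p)"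
  shows "mild_solution \<gamma> F0 (\<lambda>t x w. solution (t, x, w))"
  unfolding mild_solution_def gain_eq_gain_of[OF solution_measurable] split_beta'
proof (intro conjI allI impI)
  show "lattice_periodic (\<lambda>x. solution (t, x, w))" for t w by (rule solution_periodic)
  have "(\<lambda>q. (fst q, snd q)) \<in> measurable (restrict_space lborel {0..} \<Otimes>\<^sub>M phase_measure) (borel \<Otimes>\<^sub>M (borel \<Otimes>\<^sub>M borel))"
    by (intro measurable_Pair measurable_compose[OF measurable_fst] measurable_compose[OF measurable_snd]
      id_measurable_phase_measure measurable_restrict_space1) simp
  from measurable_compose[OF this gain_of_measurable[OF solution_measurable]]
  show "(\<lambda>q. gain_of solution (fst q, fst (snd q), snd (snd q))) \<in> borel_measurable (restrict_space lborel {0..} \<Otimes>\<^sub>M phase_measure)"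
    by simp
  have gm: "(\<lambda>p. gain_of solution (t, p)) \<in> borel_measurable (borel \<Otimes>\<^sub>M borel)" for t by measurable
  fix t :: real assume t: "0 \<le> t"
  show "integrable phase_measure (\<lambda>p. gain_of solution (t, fst p, snd p))"
    using gain_of_solution_integrable(1)[OF t] by (simp add: integrable_phase_measure[OF gm])
  have "(\<integral>p. \<bar>gain_of solution (s, fst p, snd p)\<bar> \<partial>phase_measure) \<le> mass" if "s \<in> {0..t}" for s
    using gain_of_solution_integrable(2)[of s] that gain_of_nonneg[of solution, OF solution_nonneg]
    by (simp add: integral_phase_measure[OF gm])
  then show "\<exists>B. \<forall>s\<in>{0..t}. (\<integral>p. \<bar>gain_of solution (s, fst p, snd p)\<bar> \<partial>phase_measure) \<le> B" by blast
  have "(\<lambda>w. - (\<gamma> * t) *\<^sub>R w) \<in> borel_measurable (borel :: (real^'n) measure)" by measurable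
  from F0[OF this] AE_phase_measureI[OF solution_duhamel[OF t]]
  show "AE p in phase_measure.
      set_integrable lborel {0..t} (\<lambda>s. exp (s - t) * gain_of solution (s, fst p - (\<gamma> * (t - s)) *\<^sub>R snd p, snd p)) \<and>
      solution (t, fst p, snd p) = exp (- t) * F0 (fst p - (\<gamma> * t) *\<^sub>R snd p) (snd p)
        + (LINT s:{0..t}|lborel. exp (s - t) * gain_of solution (s, fst p - (\<gamma> * (t - s)) *\<^sub>R snd p, snd p))"
  proof eventually_elim
    case (elim p)
    have "(\<lambda>s. indicator {0..t} s *\<^sub>R (exp (s - t) * gain_of solution (s, fst p - (\<gamma> * (t - s)) *\<^sub>R snd p, snd p))) =
        (\<lambda>s. duhamel_weight t t s * gain_of solution (s, fst p - (\<gamma> * (t - s)) *\<^sub>R snd p, snd p))"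
      by (auto simp: fun_eq_iff duhamel_weight_def indicator_def)
    then show ?case
      using elim by (simp add: set_integrable_def set_lebesgue_integral_def free_flow_def)
  qed
qed

text \<open>Returning to \<open>u * \<bar>ln u\<bar>\<close> costs \<open>1\<close> per unit of
  phase volume, hence the measure of the phase space in the constant; its \<open>+ 1\<close> makes
  the constant positive.\<close>

lemma solution_entropy_bound:
  assumes t: "0 \<le> t"
  shows "(\<integral>\<^sup>+p. ennreal (solution (t, p) * \<bar>ln (solution (t, p))\<bar>) \<partial>phase) \<le>
    ennreal ((entropy_const + measure (phase :: ((real^'n) \<times> (real^'n)) measure) UNIV + 1) * (1 + exp (rate * t)))"
proof -
  let ?V = "measure (phase :: ((real^'n) \<times> (real^'n)) measure) UNIV"
  have "(\<integral>\<^sup>+p. ennreal (solution (t, p) * \<bar>ln (solution (t, p))\<bar>) \<partial>phase) \<le> (\<integral>\<^sup>+p. ennreal (entropy_density (solution (t, p))) + 1 \<partial>phase)"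
  proof (rule nn_integral_mono)
    fix p
    have "ennreal (solution (t, p) * \<bar>ln (solution (t, p))\<bar>) \<le> ennreal (entropy_density (solution (t, p)) + 1)"
      by (rule ennreal_leI[OF abs_ln_le_entropy_density[OF solution_nonneg]])
    also have "\<dots> = ennreal (entropy_density (solution (t, p))) + 1"
      by (subst ennreal_plus) (auto simp: entropy_density_nonneg solution_nonneg)
    finally show "ennreal (solution (t, p) * \<bar>ln (solution (t, p))\<bar>) \<le> ennreal (entropy_density (solution (t, p))) + 1" .
  qed
  also have "\<dots> = (\<integral>\<^sup>+p. ennreal (entropy_density (solution (t, p))) \<partial>phase) + ennreal ?V"
    by (subst nn_integral_add) (auto simp: phase.emeasure_eq_measure)
  also have "\<dots> \<le> ennreal (entropy_const * exp (rate * t)) + ennreal ?V"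
    by (intro add_right_mono solution_entropy_le[OF t])
  also have "\<dots> = ennreal (entropy_const * exp (rate * t) + ?V)"
    using entropy_const_nonneg by simp
  also have "\<dots> \<le> ennreal ((entropy_const + ?V + 1) * (1 + exp (rate * t)))"
  proof (rule ennreal_leI)
    have "0 \<le> ?V * exp (rate * t)" "0 \<le> entropy_const" "0 \<le> exp (rate * t)" using entropy_const_nonneg by auto
    then show "entropy_const * exp (rate * t) + ?V \<le> (entropy_const + ?V + 1) * (1 + exp (rate * t))"
      by (simp add: algebra_simps)
  qed
  finally show ?thesis .
qed

lemma integral_solution:
  assumes t: "0 \<le> t" shows "(\<integral>p. solution (t, p) \<partial>phase) = mass"
  using nn_integral_eq_integral[OF solution_integrable[OF t]] nn_integral_solution_eq_mass[OF t] solution_nonneg mass_nonneg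
  by (simp add: integral_nonneg_AE)

end

theorem theorem3:
  fixes \<gamma> :: real and F0 :: "real ^ 'n \<Rightarrow> real ^ 'n \<Rightarrow> real"
  assumes "CARD('n) \<ge> 2"
    and "\<gamma> > 0"
    and "\<forall>w. lattice_periodic (\<lambda>x. F0 x w)"
    and "AE (x, w) in phase_measure. F0 x w \<ge> 0"
    and "integrable phase_measure (\<lambda>(x, w). F0 x w)"
    and "(\<integral>\<^sup>+ (x, w). ennreal (F0 x w * \<bar>ln (F0 x w)\<bar>) \<partial>phase_measure) < \<infinity>"
  shows "\<exists>F :: real \<Rightarrow> real ^ 'n \<Rightarrow> real ^ 'n \<Rightarrow> real.
           mild_solution \<gamma> F0 F \<and>
           (\<forall>t\<ge>0. AE (x, w) in phase_measure. F t x w \<ge> 0) \<and>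
           (\<forall>t\<ge>0. integrable phase_measure (\<lambda>(x, w). F t x w)) \<and>
           (\<forall>t0\<ge>0. ((\<lambda>t. \<integral>(x, w). \<bar>F t x w - F t0 x w\<bar> \<partial>phase_measure) \<longlongrightarrow> 0)
                       (at t0 within {0..})) \<and>
           (\<forall>t\<ge>0. (\<integral>(x, w). F t x w \<partial>phase_measure) = (\<integral>(x, w). F0 x w \<partial>phase_measure)) \<and>
           (\<exists>c C. c > 0 \<and> C > 0 \<and> (\<forall>t\<ge>0.
              (\<integral>\<^sup>+ (x, w). ennreal (F t x w * \<bar>ln (F t x w)\<bar>) \<partial>phase_measure)
                \<le> ennreal (C * (1 + exp (c * t)))))"
proof -
  have F0m: "(\<lambda>p. F0 (fst p) (snd p)) \<in> borel_measurable phase_measure"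
    and F0i: "integrable phase_measure (\<lambda>p. F0 (fst p) (snd p))"
    using assms(5) borel_measurable_integrable[OF assms(5)] by (simp_all add: split_beta')
  have F0n: "AE p in phase_measure. 0 \<le> F0 (fst p) (snd p)" using assms(4) by (simp add: split_beta')
  obtain f0 where f0m[measurable]: "f0 \<in> borel_measurable (borel \<Otimes>\<^sub>M borel)" and f0n: "\<And>p. 0 \<le> f0 p"
    and f0p: "\<And>w. lattice_periodic (\<lambda>x. f0 (x, w))"
    and f0: "\<And>v. v \<in> borel_measurable borel \<Longrightarrow>
      AE p in phase_measure. f0 (fst p + v (snd p), snd p) = F0 (fst p + v (snd p)) (snd p)"
    using borel_periodic_representative[of F0, OF _ F0n F0m] assms(3) by blast
  \<comment> \<open>The zero translation gives the plain almost everywhere identity.\<close>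
  have eq: "AE p in phase_measure. f0 p = F0 (fst p) (snd p)" using f0[of "\<lambda>_. 0"] by simp
  have f0m': "f0 \<in> borel_measurable phase_measure"
    using measurable_compose[OF id_measurable_phase_measure f0m] by simp
  have "integrable phase_measure f0" using F0i by (subst integrable_cong_AE[OF f0m' F0m eq])
  then have f0i: "integrable phase f0" by (simp add: integrable_phase_measure)
  have "(\<integral>\<^sup>+p. ennreal (entropy_density (f0 p)) \<partial>phase) \<le> (\<integral>\<^sup>+p. ennreal (f0 p * \<bar>ln (f0 p)\<bar>) + ennreal (f0 p) \<partial>phase)"
    using entropy_density_le_abs_ln[OF f0n] f0n
    by (intro nn_integral_mono) (simp add: ennreal_leI flip: ennreal_plus)
  also have "\<dots> = (\<integral>\<^sup>+p. ennreal (f0 p * \<bar>ln (f0 p)\<bar>) \<partial>phase) + (\<integral>\<^sup>+p. ennreal (f0 p) \<partial>phase)"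
    by (rule nn_integral_add) measurable
  also have "(\<integral>\<^sup>+p. ennreal (f0 p * \<bar>ln (f0 p)\<bar>) \<partial>phase) = (\<integral>\<^sup>+p. ennreal (f0 p * \<bar>ln (f0 p)\<bar>) \<partial>phase_measure)"
    by (rule nn_integral_phase_measure[symmetric]) measurable
  also have "\<dots> = (\<integral>\<^sup>+p. ennreal (F0 (fst p) (snd p) * \<bar>ln (F0 (fst p) (snd p))\<bar>) \<partial>phase_measure)"
    by (rule nn_integral_cong_AE) (use eq in \<open>eventually_elim, simp\<close>)
  also have "(\<integral>\<^sup>+p. ennreal (f0 p) \<partial>phase) = ennreal (\<integral>p. f0 p \<partial>phase)"
    by (rule nn_integral_eq_integral[OF f0i]) (simp add: f0n)
  also have "(\<integral>\<^sup>+p. ennreal (F0 (fst p) (snd p) * \<bar>ln (F0 (fst p) (snd p))\<bar>) \<partial>phase_measure) + ennreal (\<integral>p. f0 p \<partial>phase) < \<infinity>"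
    using assms(6) by (simp add: split_beta')
  finally have f0e: "(\<integral>\<^sup>+p. ennreal (entropy_density (f0 p)) \<partial>phase) < \<infinity>" .
  interpret kinetic \<gamma> f0
    using assms(1,2) f0m f0n f0p f0i f0e by unfold_locales
  obtain r :: "nat \<Rightarrow> nat" where "strict_mono r"
    and "AE z in space_time. convergent (\<lambda>n. density_of (approx (r n)) z) \<and> convergent (\<lambda>n. flux_of (approx (r n)) z)"
    using moments_subsequence by blast
  then interpret kinetic_limit \<gamma> f0 r by unfold_locales
  have mass_F0: "mass = (\<integral>p. F0 (fst p) (snd p) \<partial>phase_measure)"
    unfolding mass_def integral_phase_measure[OF f0m, symmetric] by (rule integral_cong_AE[OF f0m' F0m eq])
  have sm: "(\<lambda>p. solution (t, p)) \<in> borel_measurable (borel \<Otimes>\<^sub>M borel)" for t by measurable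
  have cont: "((\<lambda>t. \<integral>p. \<bar>solution (t, p) - solution (u, p)\<bar> \<partial>phase_measure) \<longlongrightarrow> 0) (at u within {0..})" if u: "0 \<le> u" for u
    unfolding tendsto_at_iff_sequentially
  proof (intro allI impI)
    fix X :: "nat \<Rightarrow> real"
    assume X: "\<forall>n. X n \<in> {0..} - {u}" "X \<longlonglongrightarrow> u"
    have "(\<integral>p. \<bar>solution (t, p) - solution (u, p)\<bar> \<partial>phase_measure) = (\<integral>p. \<bar>solution (t, p) - solution (u, p)\<bar> \<partial>phase)" for t
      by (rule integral_phase_measure) measurable
    then show "((\<lambda>t. \<integral>p. \<bar>solution (t, p) - solution (u, p)\<bar> \<partial>phase_measure) \<circ> X) \<longlonglongrightarrow> 0"
      using solution_L1_continuous[OF X(2) _ u] X(1) by (simp add: comp_def)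
  qed
  have int: "integrable phase_measure (\<lambda>p. solution (t, p))" "(\<integral>p. solution (t, p) \<partial>phase_measure) = mass" if "0 \<le> t" for t
    using solution_integrable[OF that] integral_solution[OF that]
    by (simp_all add: integrable_phase_measure[OF sm] integral_phase_measure[OF sm])
  define C where "C = entropy_const + measure (phase :: ((real^'n) \<times> (real^'n)) measure) UNIV + 1"
  have C: "0 < C" using entropy_const_nonneg by (simp add: C_def add_nonneg_pos)
  have ent: "(\<integral>\<^sup>+p. ennreal (solution (t, p) * \<bar>ln (solution (t, p))\<bar>) \<partial>phase_measure) \<le> ennreal (C * (1 + exp (rate * t)))"
    if "0 \<le> t" for t
    using solution_entropy_bound[OF that] unfolding C_def by (subst nn_integral_phase_measure) auto
  show ?thesis
    unfolding split_beta'
  proof (intro exI[of _ "\<lambda>t x w. solution (t, x, w)"] conjI)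
    show "mild_solution \<gamma> F0 (\<lambda>t x w. solution (t, x, w))" by (rule solution_mild[OF f0])
    show "\<exists>c C. 0 < c \<and> 0 < C \<and> (\<forall>t\<ge>0.
        (\<integral>\<^sup>+p. ennreal (solution (t, fst p, snd p) * \<bar>ln (solution (t, fst p, snd p))\<bar>) \<partial>phase_measure) \<le> ennreal (C * (1 + exp (c * t))))"
      using C rate_pos ent by (intro exI[of _ rate] exI[of _ C]) simp
  qed (use int mass_F0 cont solution_nonneg in auto)
qed

end
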